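(* Let $N\ge2$, let $q\in(1,\infty)$, $q'=q/(q-1)$, and let $\rho=\rho_+\mathbf{1}_{\mathbb{R}_+^N}+\rho_-\mathbf{1}_{\mathbb{R}_-^N}$ for positive constants $\rho_\pm$. (1) Existence. Let $\mathbf{f}\in L_q(\mathbb{R}^N\setminus\mathbb{R}_0^N)^N$. Then there is $u\in\widehat H_q^1(\mathbb{R}^N)$ such that $$(\rho^{-1}\nabla u,\nabla\varphi)_{\mathbb{R}^N\setminus\mathbb{R}_0^N}=(\mathbf{f},\nabla\varphi)_{\mathbb{R}^N\setminus\mathbb{R}_0^N}\quad\text{for any }\varphi\in\widehat H_{q'}^1(\mathbb{R}^N),$$ satisfying $$\|\nabla u\|_{L_q(\mathbb{R}^N)}\le2C_2(\rho_++\rho_-)\|\mathbf{f}\|_{L_q(\mathbb{R}^N\setminus\mathbb{R}_0^N)},$$ where $C_2=C_2(N,q,\rho_+,\rho_-)$ is the constant specified in the context. (2) Uniqueness. If $u\in\widehat H_q^1(\mathbb{R}^N)$ satisfies $$(\rho^{-1}\nabla u,\nabla\varphi)_{\mathbb{R}^N\setminus\mathbb{R}_0^N}=0\quad\text{for any }\varphi\in\widehat H_{q'}^1(\mathbb{R}^N),$$ then $u=c$ for some constant $c$.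
   Context: $\mathbb{R}_\pm^N=\{x=(x',x_N):x'\in\mathbb{R}^{N-1},\ \pm x_N>0\}$, $\mathbb{R}_0^N=\{x_N=0\}$. For an open set $G\subset\mathbb{R}^N$: $\widehat H_q^1(G)=\{f\in L_{q,\mathrm{loc}}(\overline G):\nabla f\in L_q(G)^N\}$, $\widehat H_q^2(G)=\{f\in L_{1,\mathrm{loc}}(G):\nabla f\in\widehat H_q^1(G)^N\}$. $(\mathbf{u},\mathbf{v})_G=\int_G\mathbf{u}\cdot\mathbf{v}\,dx$. $\mathbf{1}_A$ is the indicator function of $A$. $E_q(D)=\{\mathbf{f}\in L_q(D)^N:\operatorname{div}\mathbf{f}\in L_q(D)\}$ and $F_q(\mathbb{R}_\pm^N)=\{\mathbf{f}_\pm\in E_q(\mathbb{R}_\pm^N):f_{\pm N}\in H_q^1(\mathbb{R}_\pm^N)\}$. The constant $C_2=C_2(N,q,\rho_+,\rho_-)>0$ is one for which the following holds: for any $\mathbf{f}_\pm\in F_q(\mathbb{R}_\pm^N)$ the problem $\Delta v_\pm=\operatorname{div}\mathbf{f}_\pm$ in $\mathbb{R}_\pm^N$, $\rho_+v_+=\rho_-v_-$ on $\mathbb{R}_0^N$, $\partial_Nv_+-\partial_Nv_-=f_{+N}-f_{-N}$ on $\mathbb{R}_0^N$ admits solutions $v_\pm\in\widehat H_q^1(\mathbb{R}_\pm^N)\cap\widehat H_q^2(\mathbb{R}_\pm^N)$ with $\sum_{\mathfrak{s}\in\{+,-\}}\|\nabla^2v_{\mathfrak{s}}\|_{L_q(\mathbb{R}_{\mathfrak{s}}^N)}\le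 C_2\sum_{\mathfrak{s}\in\{+,-\}}\|(\operatorname{div}\mathbf{f}_{\mathfrak{s}},\nabla f_{\mathfrak{s}N})\|_{L_q(\mathbb{R}_{\mathfrak{s}}^N)}$ and $\sum_{\mathfrak{s}\in\{+,-\}}\|\nabla v_{\mathfrak{s}}\|_{L_q(\mathbb{R}_{\mathfrak{s}}^N)}\le C_2\sum_{\mathfrak{s}\in\{+,-\}}\|\mathbf{f}_{\mathfrak{s}}\|_{L_q(\mathbb{R}_{\mathfrak{s}}^N)}$, and, if $f_{+N}-f_{-N}=0$ on $\mathbb{R}_0^N$, also $\sum_{\mathfrak{s}}\|\nabla^2v_{\mathfrak{s}}\|_{L_q(\mathbb{R}_{\mathfrak{s}}^N)}\le C_2\sum_{\mathfrak{s}}\|\operatorname{div}\mathbf{f}_{\mathfrak{s}}\|_{L_q(\mathbb{R}_{\mathfrak{s}}^N)}$. (Such a constant exists.) *)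

theory Defs
  imports "HOL-Analysis.Analysis"
begin

text \<open>
  Points of \<open>\<real>\<^sup>N\<close> are vectors in \<^typ>\<open>real ^ 'n\<close>, with \<open>N = CARD('n)\<close>. The index \<open>d :: 'n\<close> is that
  of the distinguished coordinate \<open>x\<^sub>N\<close>. Functions on an open set \<open>G\<close> are total functions
  whose values outside \<open>G\<close> are irrelevant. All functions are real valued.
\<close>

definition upper_half :: "'n \<Rightarrow> (real ^ 'n) set" where
  "upper_half d = {x. x $ d > 0}"

definition lower_half :: "'n \<Rightarrow> (real ^ 'n) set" where
  "lower_half d = {x. x $ d < 0}"

definition plane :: "'n \<Rightarrow> (real ^ 'n) set" where
  "plane d = {x. x $ d = 0}"

definition two_phase_density :: "'n \<Rightarrow> real \<Rightarrow> real \<Rightarrow> real ^ 'n \<Rightarrow> real" where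
  "two_phase_density d \<rho>p \<rho>m x = \<rho>p * indicator (upper_half d) x + \<rho>m * indicator (lower_half d) x"

abbreviation lborel_on :: "'a::euclidean_space set \<Rightarrow> 'a measure" where
  "lborel_on G \<equiv> restrict_space lborel G"

text \<open>\<open>(N - 1)\<close>-dimensional Lebesgue measure on the hyperplane, as a measure on \<open>\<real>\<^sup>N\<close>.\<close>

definition plane_measure :: "'n::finite \<Rightarrow> (real ^ 'n) measure" where
  "plane_measure d =
     distr (Pi\<^sub>M (UNIV - {d}) (\<lambda>_. lborel)) borel (\<lambda>y. \<chi> i. if i = d then 0 else y i)"


section \<open>Lebesgue spaces\<close>

text \<open>
  Elements of \<open>L\<^sub>q\<close> are functions, not classes of functions; over Lebesgue measure they are
  Borel measurable, as every class has such a representative. Vectors, matrices and pairs carry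
  their Euclidean norm, so the norm of a tuple is taken pointwise before integrating.
  The value of \<open>Lp_norm\<close> is meaningful only for members of \<open>Lp\<close>.
\<close>

definition Lp :: "real \<Rightarrow> 'a measure \<Rightarrow> ('a \<Rightarrow> 'b::euclidean_space) set" where
  "Lp q M = {f \<in> borel_measurable M. integrable M (\<lambda>x. norm (f x) powr q)}"

definition Lp_norm :: "real \<Rightarrow> 'a measure \<Rightarrow> ('a \<Rightarrow> 'b::euclidean_space) \<Rightarrow> real" where
  "Lp_norm q M f = (\<integral>x. norm (f x) powr q \<partial>M) powr (1 / q)"

abbreviation Lq_norm :: "real \<Rightarrow> (real ^ 'n) set \<Rightarrow> (real ^ 'n \<Rightarrow> 'b::euclidean_space) \<Rightarrow> real" where
  "Lq_norm q G \<equiv> Lp_norm q (lborel_on G)"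

definition Lp_tendsto ::
  "real \<Rightarrow> 'a measure \<Rightarrow> (nat \<Rightarrow> 'a \<Rightarrow> 'b::euclidean_space) \<Rightarrow> ('a \<Rightarrow> 'b) \<Rightarrow> bool" where
  "Lp_tendsto q M w f \<longleftrightarrow>
     f \<in> Lp q M \<and> (\<forall>n. w n \<in> Lp q M) \<and> (\<lambda>n. Lp_norm q M (\<lambda>x. w n x - f x)) \<longlonglongrightarrow> 0"

definition Lp_loc :: "real \<Rightarrow> (real ^ 'n) set \<Rightarrow> (real ^ 'n \<Rightarrow> 'b::euclidean_space) set" where
  "Lp_loc q G = {f. \<forall>K. compact K \<and> K \<subseteq> G \<longrightarrow> f \<in> Lp q (lborel_on K)}"

text \<open>The space \<open>L\<^sub>q\<^sub>,\<^sub>l\<^sub>o\<^sub>c\<close> of the closure of \<open>G\<close>: integrability up to the boundary of \<open>G\<close>.\<close>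

definition Lp_loc_closure ::
  "real \<Rightarrow> (real ^ 'n) set \<Rightarrow> (real ^ 'n \<Rightarrow> 'b::euclidean_space) set" where
  "Lp_loc_closure q G =
     {f. \<forall>K. compact K \<and> K \<subseteq> closure G \<longrightarrow> f \<in> Lp q (lborel_on (K \<inter> G))}"


section \<open>Weak derivatives\<close>

definition partial_deriv :: "'n \<Rightarrow> (real ^ 'n \<Rightarrow> real) \<Rightarrow> real ^ 'n \<Rightarrow> real" where
  "partial_deriv i f x = frechet_derivative f (at x) (axis i 1)"

definition grad :: "(real ^ 'n \<Rightarrow> real) \<Rightarrow> real ^ 'n \<Rightarrow> real ^ 'n" where
  "grad f x = (\<chi> i. partial_deriv i f x)"

primrec C_times :: "nat \<Rightarrow> (real ^ 'n \<Rightarrow> real) \<Rightarrow> bool" where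
  "C_times 0 f \<longleftrightarrow> continuous_on UNIV f"
| "C_times (Suc k) f \<longleftrightarrow>
     (\<forall>x. f differentiable at x) \<and> (\<forall>i. C_times k (partial_deriv i f))"

definition smooth :: "(real ^ 'n \<Rightarrow> real) \<Rightarrow> bool" where
  "smooth f \<longleftrightarrow> (\<forall>k. C_times k f)"

definition test_functions :: "(real ^ 'n) set \<Rightarrow> (real ^ 'n \<Rightarrow> real) set" where
  "test_functions G =
     {\<phi>. smooth \<phi> \<and> compact (closure {x. \<phi> x \<noteq> 0}) \<and> closure {x. \<phi> x \<noteq> 0} \<subseteq> G}"

definition is_weak_grad ::
  "(real ^ 'n) set \<Rightarrow> (real ^ 'n \<Rightarrow> real) \<Rightarrow> (real ^ 'n \<Rightarrow> real ^ 'n) \<Rightarrow> bool" where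
  "is_weak_grad G f g \<longleftrightarrow> f \<in> Lp_loc 1 G \<and> g \<in> Lp_loc 1 G \<and>
     (\<forall>\<phi> \<in> test_functions G. \<forall>i.
        (\<integral>x. f x * partial_deriv i \<phi> x \<partial>lborel_on G) = - (\<integral>x. g x $ i * \<phi> x \<partial>lborel_on G))"

definition is_weak_div ::
  "(real ^ 'n) set \<Rightarrow> (real ^ 'n \<Rightarrow> real ^ 'n) \<Rightarrow> (real ^ 'n \<Rightarrow> real) \<Rightarrow> bool" where
  "is_weak_div G f g \<longleftrightarrow> f \<in> Lp_loc 1 G \<and> g \<in> Lp_loc 1 G \<and>
     (\<forall>\<phi> \<in> test_functions G.
        (\<integral>x. f x \<bullet> grad \<phi> x \<partial>lborel_on G) = - (\<integral>x. g x * \<phi> x \<partial>lborel_on G))"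

text \<open>
  Weak derivatives are unique up to null sets; the operators below select a representative
  and are meaningful only where one exists.
\<close>

definition weak_grad :: "(real ^ 'n) set \<Rightarrow> (real ^ 'n \<Rightarrow> real) \<Rightarrow> real ^ 'n \<Rightarrow> real ^ 'n" where
  "weak_grad G f = (SOME g. is_weak_grad G f g)"

definition weak_div :: "(real ^ 'n) set \<Rightarrow> (real ^ 'n \<Rightarrow> real ^ 'n) \<Rightarrow> real ^ 'n \<Rightarrow> real" where
  "weak_div G f = (SOME g. is_weak_div G f g)"

definition weak_hess :: "(real ^ 'n) set \<Rightarrow> (real ^ 'n \<Rightarrow> real) \<Rightarrow> real ^ 'n \<Rightarrow> real ^ 'n ^ 'n" where
  "weak_hess G f x = (\<chi> i. weak_grad G (\<lambda>y. weak_grad G f y $ i) x)"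

definition weak_laplace :: "(real ^ 'n) set \<Rightarrow> (real ^ 'n \<Rightarrow> real) \<Rightarrow> real ^ 'n \<Rightarrow> real" where
  "weak_laplace G f x = (\<Sum>i\<in>UNIV. weak_hess G f x $ i $ i)"


section \<open>Function spaces\<close>

definition H1 :: "real \<Rightarrow> (real ^ 'n) set \<Rightarrow> (real ^ 'n \<Rightarrow> real) set" where
  "H1 q G = {f \<in> Lp q (lborel_on G). \<exists>g. is_weak_grad G f g \<and> g \<in> Lp q (lborel_on G)}"

definition hat_H1 :: "real \<Rightarrow> (real ^ 'n) set \<Rightarrow> (real ^ 'n \<Rightarrow> real) set" where
  "hat_H1 q G = {f \<in> Lp_loc_closure q G. \<exists>g. is_weak_grad G f g \<and> g \<in> Lp q (lborel_on G)}"

definition hat_H2 :: "real \<Rightarrow> (real ^ 'n) set \<Rightarrow> (real ^ 'n \<Rightarrow> real) set" where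
  "hat_H2 q G =
     {f \<in> Lp_loc 1 G. \<exists>g. is_weak_grad G f g \<and> (\<forall>i. (\<lambda>x. g x $ i) \<in> hat_H1 q G)}"

definition E_space :: "real \<Rightarrow> (real ^ 'n) set \<Rightarrow> (real ^ 'n \<Rightarrow> real ^ 'n) set" where
  "E_space q G = {f \<in> Lp q (lborel_on G). \<exists>g. is_weak_div G f g \<and> g \<in> Lp q (lborel_on G)}"

definition F_space :: "real \<Rightarrow> 'n \<Rightarrow> (real ^ 'n) set \<Rightarrow> (real ^ 'n \<Rightarrow> real ^ 'n) set" where
  "F_space q d G = {f \<in> E_space q G. (\<lambda>x. f x $ d) \<in> H1 q G}"

text \<open>
  \<open>has_trace q d G v b\<close>, for \<open>G\<close> one of the two half spaces: \<open>b\<close> is the trace on the hyperplane of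
  \<open>v\<close>, a function that is \<open>W\<^sup>1\<^sub>q\<close> on bounded parts of \<open>G\<close>. The trace is the continuous extension of
  the restriction map from functions that are smooth up to the boundary; since \<open>v\<close> need not
  decay, convergence is required on every ball.
\<close>

definition has_trace ::
  "real \<Rightarrow> 'n \<Rightarrow> (real ^ 'n) set \<Rightarrow> (real ^ 'n \<Rightarrow> real) \<Rightarrow> (real ^ 'n \<Rightarrow> real) \<Rightarrow> bool" where
  "has_trace q d G v b \<longleftrightarrow>
     (\<exists>g w. is_weak_grad G v g \<and> (\<forall>n. smooth (w n)) \<and>
        (\<forall>R>0. Lp_tendsto q (lborel_on (G \<inter> ball 0 R)) w v \<and>
               Lp_tendsto q (lborel_on (G \<inter> ball 0 R)) (\<lambda>n. grad (w n)) g \<and>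
               Lp_tendsto q (restrict_space (plane_measure d) (ball 0 R)) w b))"


section \<open>The strong transmission problem\<close>

definition transmission_solution ::
  "real \<Rightarrow> 'n \<Rightarrow> real \<Rightarrow> real \<Rightarrow> (real ^ 'n \<Rightarrow> real ^ 'n) \<Rightarrow> (real ^ 'n \<Rightarrow> real ^ 'n) \<Rightarrow>
   (real ^ 'n \<Rightarrow> real) \<Rightarrow> (real ^ 'n \<Rightarrow> real) \<Rightarrow> bool" where
  "transmission_solution q d \<rho>p \<rho>m fp fm vp vm \<longleftrightarrow>
     vp \<in> hat_H1 q (upper_half d) \<inter> hat_H2 q (upper_half d) \<and>
     vm \<in> hat_H1 q (lower_half d) \<inter> hat_H2 q (lower_half d) \<and>
     (AE x in lborel_on (upper_half d).
        weak_laplace (upper_half d) vp x = weak_div (upper_half d) fp x) \<and>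
     (AE x in lborel_on (lower_half d).
        weak_laplace (lower_half d) vm x = weak_div (lower_half d) fm x) \<and>
     (\<exists>bp bm. has_trace q d (upper_half d) vp bp \<and> has_trace q d (lower_half d) vm bm \<and>
        (AE x in plane_measure d. \<rho>p * bp x = \<rho>m * bm x)) \<and>
     (\<exists>ap am cp cm.
        has_trace q d (upper_half d) (\<lambda>x. weak_grad (upper_half d) vp x $ d) ap \<and>
        has_trace q d (lower_half d) (\<lambda>x. weak_grad (lower_half d) vm x $ d) am \<and>
        has_trace q d (upper_half d) (\<lambda>x. fp x $ d) cp \<and>
        has_trace q d (lower_half d) (\<lambda>x. fm x $ d) cm \<and>
        (AE x in plane_measure d. ap x - am x = cp x - cm x))"

text \<open>
  \<open>C\<close> is an admissible constant in the \<open>L\<^sub>q\<close> estimates for the strong problem. The three bounds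
  are for one and the same solution; the third is required only if the normal components of
  the data have equal traces.
\<close>

definition transmission_constant :: "real \<Rightarrow> 'n::finite \<Rightarrow> real \<Rightarrow> real \<Rightarrow> real \<Rightarrow> bool" where
  "transmission_constant q d \<rho>p \<rho>m C \<longleftrightarrow> C > 0 \<and>
     (\<forall>fp \<in> F_space q d (upper_half d). \<forall>fm \<in> F_space q d (lower_half d).
        \<exists>vp vm. transmission_solution q d \<rho>p \<rho>m fp fm vp vm \<and>
          Lq_norm q (upper_half d) (weak_hess (upper_half d) vp) +
          Lq_norm q (lower_half d) (weak_hess (lower_half d) vm)
          \<le> C * (Lq_norm q (upper_half d)
                  (\<lambda>x. (weak_div (upper_half d) fp x, weak_grad (upper_half d) (\<lambda>y. fp y $ d) x)) +
                 Lq_norm q (lower_half d)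
                  (\<lambda>x. (weak_div (lower_half d) fm x, weak_grad (lower_half d) (\<lambda>y. fm y $ d) x))) \<and>
          Lq_norm q (upper_half d) (weak_grad (upper_half d) vp) +
          Lq_norm q (lower_half d) (weak_grad (lower_half d) vm)
          \<le> C * (Lq_norm q (upper_half d) fp + Lq_norm q (lower_half d) fm) \<and>
          ((\<exists>cp cm. has_trace q d (upper_half d) (\<lambda>x. fp x $ d) cp \<and>
                    has_trace q d (lower_half d) (\<lambda>x. fm x $ d) cm \<and>
                    (AE x in plane_measure d. cp x - cm x = 0)) \<longrightarrow>
           Lq_norm q (upper_half d) (weak_hess (upper_half d) vp) +
           Lq_norm q (lower_half d) (weak_hess (lower_half d) vm)
           \<le> C * (Lq_norm q (upper_half d) (weak_div (upper_half d) fp) +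
                  Lq_norm q (lower_half d) (weak_div (lower_half d) fm))))"

end

theory Submission
  imports Defs
begin

text \<open>
  Test functions are dense among the gradients of \<open>\<hat>H\<^sup>1\<close> (cutoffs and the Poincare inequality), so it
  suffices to test the weak equation with smooth compactly supported functions. Uniqueness: reflection in the
  plane turns a solution \<open>u\<close> of the homogeneous problem into two weakly harmonic functions, the odd part of
  \<open>u\<close> and the even part of \<open>\<rho>\<inverse> u\<close>, whose gradients lie in \<open>L\<^sub>q\<close> and therefore vanish; together they
  determine \<open>\<nabla>u\<close>. Existence: for data that are smooth and vanish near the plane, \<open>u = \<rho> v\<close> with the solution
  \<open>v\<close> of the strong transmission problem; the condition \<open>\<rho>\<^sub>+ v\<^sub>+ = \<rho>\<^sub>- v\<^sub>-\<close> makes \<open>u\<close> weakly differentiable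
  across the plane and the jump condition cancels the boundary terms. Such data are dense in \<open>L\<^sub>q\<close>, and by
  uniqueness the solutions for a convergent sequence of data have gradients that form a Cauchy sequence.
\<close>

section \<open>Smooth functions and test functions\<close>

text \<open>The strong problem only promises that some solution obeys its bounds, so a chosen
  solution need not depend linearly on the data, and nothing is known about differences of chosen
  solutions; this is why uniqueness has to precede existence. In uniqueness the obstacle is the jump
  of the coefficient: \<open>u / \<rho>\<close> need not be weakly differentiable across the plane.
  Its even part is, because both sides have the same boundary values, and the odd part of
  \<open>u\<close> only has to be tested with odd functions, which vanish on the plane and may
  therefore be multiplied by the discontinuous \<rho>. Liouville's theorem is obtained without
  Weyl's lemma: the pairing of a weakly harmonic gradient with a radial kernel does not change when
  the kernel is rescaled, and by Hoelder's inequality it tends to 0 as the kernel spreads out.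
  Smoothing by convolution is avoided: pairings with translates are continuous in the shift, and
  averages over the shift are handled by Fubini.\<close>

lemma smooth_differentiable: "smooth f \<Longrightarrow> f differentiable at x"
  unfolding smooth_def by (metis C_times.simps(2))

lemma smooth_partial_deriv: "smooth f \<Longrightarrow> smooth (partial_deriv i f)"
  unfolding smooth_def by (metis C_times.simps(2))

lemma smooth_continuous_on: "smooth f \<Longrightarrow> continuous_on S f"
  unfolding smooth_def using C_times.simps(1) continuous_on_subset by blast

lemma smooth_borel_measurable [measurable_dest]: "smooth f \<Longrightarrow> f \<in> borel_measurable borel"
  by (simp add: borel_measurable_continuous_onI smooth_continuous_on)

lemma partial_deriv_eqI:
  "(f has_derivative f') (at x) \<Longrightarrow> partial_deriv i f x = f' (axis i 1)"
  by (metis frechet_derivative_at partial_deriv_def)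

lemma has_derivative_grad:
  fixes f :: "real ^ 'n::finite \<Rightarrow> real"
  assumes "f differentiable at x"
  shows "(f has_derivative (\<lambda>h. grad f x \<bullet> h)) (at x)"
proof -
  obtain f' where f': "(f has_derivative f') (at x)"
    using assms differentiable_def by blast
  interpret bounded_linear f' using f' by (rule has_derivative_bounded_linear)
  have "f' h = grad f x \<bullet> h" for h
  proof -
    have "f' h = f' (\<Sum>i\<in>UNIV. (h $ i) *\<^sub>R axis i 1)"
      using basis_expansion[of h] by (simp add: scalar_mult_eq_scaleR)
    also have "\<dots> = (\<Sum>i\<in>UNIV. h $ i * f' (axis i 1))"
      by (simp add: sum scaleR)
    also have "\<dots> = grad f x \<bullet> h"
      by (simp add: inner_vec_def grad_def partial_deriv_eqI[OF f'] mult.commute)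
    finally show ?thesis .
  qed
  then have "f' = (\<lambda>h. grad f x \<bullet> h)" by auto
  with f' show ?thesis by simp
qed

text \<open>That the order may be lowered is not built into \<open>C_times\<close>; the product rule
  needs it, since each of its summands contains a factor that is not differentiated.\<close>

lemma C_times_Suc_imp: "C_times (Suc k) f \<Longrightarrow> C_times k f"
proof (induction k arbitrary: f)
  case 0
  then show ?case
    by (auto intro!: differentiable_imp_continuous_on
        simp: differentiable_on_def differentiable_at_imp_differentiable_on)
next
  case (Suc k)
  then show ?case by simp
qed

lemma partial_deriv_const: "partial_deriv i (\<lambda>x. c) = (\<lambda>x. 0)"
  by (rule ext) (rule partial_deriv_eqI, rule has_derivative_const)

lemma partial_deriv_coord: "partial_deriv i (\<lambda>x. x $ j) = (\<lambda>x. if i = j then 1 else 0)"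
proof
  fix x :: "real ^ 'a"
  have "((\<lambda>x. x $ j) has_derivative (\<lambda>h. h $ j)) (at x)"
    by (rule bounded_linear_imp_has_derivative) (rule bounded_linear_vec_nth)
  then show "partial_deriv i (\<lambda>x. x $ j) x = (if i = j then 1 else 0)"
    by (auto simp: partial_deriv_eqI axis_def)
qed

lemma partial_deriv_add:
  assumes "\<And>x. f differentiable at x" "\<And>x. g differentiable at x"
  shows "partial_deriv i (\<lambda>x. f x + g x) = (\<lambda>x. partial_deriv i f x + partial_deriv i g x)"
proof
  fix x
  have "((\<lambda>x. f x + g x) has_derivative
      (\<lambda>h. frechet_derivative f (at x) h + frechet_derivative g (at x) h)) (at x)"
    by (intro has_derivative_add frechet_derivative_works[THEN iffD1] assms)
  then show "partial_deriv i (\<lambda>x. f x + g x) x = partial_deriv i f x + partial_deriv i g x"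
    unfolding partial_deriv_def[of i f] partial_deriv_def[of i g] by (rule partial_deriv_eqI)
qed

lemma partial_deriv_mult:
  assumes "\<And>x. f differentiable at x" "\<And>x. g differentiable at x"
  shows "partial_deriv i (\<lambda>x. f x * g x) = (\<lambda>x. f x * partial_deriv i g x + partial_deriv i f x * g x)"
proof
  fix x
  have "((\<lambda>x. f x * g x) has_derivative
      (\<lambda>h. f x * frechet_derivative g (at x) h + frechet_derivative f (at x) h * g x)) (at x)"
    by (intro has_derivative_mult frechet_derivative_works[THEN iffD1] assms)
  then show "partial_deriv i (\<lambda>x. f x * g x) x = f x * partial_deriv i g x + partial_deriv i f x * g x"
    unfolding partial_deriv_def[of i f] partial_deriv_def[of i g] by (rule partial_deriv_eqI)
qed

lemma C_times_const: "C_times k (\<lambda>x. c)"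
  by (induction k arbitrary: c) (auto simp: partial_deriv_const)

lemma C_times_add: "C_times k f \<Longrightarrow> C_times k g \<Longrightarrow> C_times k (\<lambda>x. f x + g x)"
proof (induction k arbitrary: f g)
  case (Suc k)
  then show ?case by (simp add: partial_deriv_add)
qed (auto intro: continuous_intros)

lemma C_times_mult: "C_times k f \<Longrightarrow> C_times k g \<Longrightarrow> C_times k (\<lambda>x. f x * g x)"
proof (induction k arbitrary: f g)
  case (Suc k)
  have "C_times k f" "C_times k g" using Suc.prems by (auto intro: C_times_Suc_imp simp del: C_times.simps)
  then show ?case using Suc by (simp add: partial_deriv_mult C_times_add)
qed (auto intro: continuous_intros)

lemma C_times_diff: "C_times k f \<Longrightarrow> C_times k g \<Longrightarrow> C_times k (\<lambda>x. f x - g x)"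
  using C_times_add[OF _ C_times_mult[OF C_times_const], of k f g "-1"] by simp

lemma smooth_const: "smooth (\<lambda>x. c)"
  by (simp add: smooth_def C_times_const)

lemma smooth_coord: "smooth (\<lambda>x. x $ j)"
  unfolding smooth_def
proof
  fix k show "C_times k (\<lambda>x. x $ j)"
  proof (cases k)
    case (Suc m)
    have "(\<lambda>x. x $ j) differentiable at x" for x :: "real ^ 'a"
      by (rule bounded_linear_imp_differentiable) (rule bounded_linear_vec_nth)
    then show ?thesis by (simp add: Suc partial_deriv_coord C_times_const)
  qed (auto intro: continuous_intros)
qed

lemma smooth_add: "smooth f \<Longrightarrow> smooth g \<Longrightarrow> smooth (\<lambda>x. f x + g x)"
  by (simp add: smooth_def C_times_add)

lemma smooth_mult: "smooth f \<Longrightarrow> smooth g \<Longrightarrow> smooth (\<lambda>x. f x * g x)"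
  by (simp add: smooth_def C_times_mult)

lemma smooth_cmult: "smooth f \<Longrightarrow> smooth (\<lambda>x. c * f x)"
  by (intro smooth_mult smooth_const)

lemma smooth_minus: "smooth f \<Longrightarrow> smooth (\<lambda>x. - f x)"
  using smooth_cmult[of f "-1"] by simp

lemma smooth_diff: "smooth f \<Longrightarrow> smooth g \<Longrightarrow> smooth (\<lambda>x. f x - g x)"
  using smooth_add[OF _ smooth_minus] by auto

lemma smooth_sum: "(\<And>i. i \<in> I \<Longrightarrow> smooth (f i)) \<Longrightarrow> smooth (\<lambda>x. \<Sum>i\<in>I. f i x)"
  by (induction I rule: infinite_finite_induct) (auto simp: smooth_const smooth_add)

lemma smooth_prod: "(\<And>i. i \<in> I \<Longrightarrow> smooth (f i)) \<Longrightarrow> smooth (\<lambda>x. \<Prod>i\<in>I. f i x)"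
  by (induction I rule: infinite_finite_induct) (auto simp: smooth_const smooth_mult)

lemma partial_deriv_cmult:
  assumes "\<And>x. f differentiable at x"
  shows "partial_deriv i (\<lambda>x. c * f x) = (\<lambda>x. c * partial_deriv i f x)"
  using partial_deriv_mult[of "\<lambda>x. c" f i] assms by (simp add: partial_deriv_const)

lemma smooth_partial_add: "smooth f \<Longrightarrow> smooth g \<Longrightarrow>
    partial_deriv i (\<lambda>x. f x + g x) = (\<lambda>x. partial_deriv i f x + partial_deriv i g x)"
  by (simp add: partial_deriv_add smooth_differentiable)

lemma smooth_partial_mult: "smooth f \<Longrightarrow> smooth g \<Longrightarrow>
    partial_deriv i (\<lambda>x. f x * g x) = (\<lambda>x. f x * partial_deriv i g x + partial_deriv i f x * g x)"
  by (simp add: partial_deriv_mult smooth_differentiable)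

lemma smooth_partial_cmult: "smooth f \<Longrightarrow>
    partial_deriv i (\<lambda>x. c * f x) = (\<lambda>x. c * partial_deriv i f x)"
  by (simp add: partial_deriv_cmult smooth_differentiable)

lemma smooth_partial_diff: "smooth f \<Longrightarrow> smooth g \<Longrightarrow>
    partial_deriv i (\<lambda>x. f x - g x) = (\<lambda>x. partial_deriv i f x - partial_deriv i g x)"
  using smooth_partial_add[OF _ smooth_cmult, of f g i "-1"] smooth_partial_cmult[of g i "-1"]
  by simp

subsection \<open>Composition with diagonal affine maps\<close>

text \<open>One family for the changes of variables below: translations (\<open>c = 1\<close>),
  point reflections \<open>x - y\<close> (\<open>c = - 1\<close>) and the reflection in the plane (a
  single entry \<open>- 1\<close>). All of these preserve Lebesgue measure.\<close>

definition diag_affine :: "real ^ 'n \<Rightarrow> real ^ 'n \<Rightarrow> real ^ 'n \<Rightarrow> real ^ 'n" where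
  "diag_affine a c x = (\<chi> j. a $ j + c $ j * x $ j)"

lemma diag_affine_nth [simp]: "diag_affine a c x $ j = a $ j + c $ j * x $ j"
  by (simp add: diag_affine_def)

lemma has_derivative_diag_affine:
  "(diag_affine a c has_derivative (\<lambda>h::real^'n::finite. \<chi> j. c $ j * h $ j)) (at x)"
  by (rule has_derivative_componentwise_within[THEN iffD2])
    (auto simp: Basis_vec_def inner_axis diag_affine_def intro!: derivative_eq_intros
      bounded_linear.has_derivative[OF bounded_linear_vec_nth])

lemma continuous_on_diag_affine: "continuous_on S (diag_affine a c :: real^'n::finite \<Rightarrow> _)"
  unfolding diag_affine_def by (intro continuous_intros)

lemma partial_deriv_diag_affine:
  fixes f :: "real ^ 'n::finite \<Rightarrow> real"
  assumes "\<And>x. f differentiable at x"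
  shows "partial_deriv i (\<lambda>x. f (diag_affine a c x)) = (\<lambda>x. c $ i * partial_deriv i f (diag_affine a c x))"
proof
  fix x
  let ?y = "diag_affine a c x"
  have "((f \<circ> diag_affine a c) has_derivative ((\<lambda>h. grad f ?y \<bullet> h) \<circ> (\<lambda>h. \<chi> j. c $ j * h $ j))) (at x)"
    by (intro diff_chain_at has_derivative_diag_affine has_derivative_grad assms)
  from partial_deriv_eqI[OF this, of i]
  have "partial_deriv i (\<lambda>x. f (diag_affine a c x)) x = grad f ?y \<bullet> (\<chi> j. c $ j * axis i 1 $ j)"
    by (simp add: o_def)
  also have "(\<chi> j. c $ j * axis i (1::real) $ j) = c $ i *\<^sub>R axis i 1"
    by (simp add: vec_eq_iff axis_def)
  also have "grad f ?y \<bullet> \<dots> = c $ i * partial_deriv i f ?y"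
    by (simp add: inner_axis grad_def)
  finally show "partial_deriv i (\<lambda>x. f (diag_affine a c x)) x = c $ i * partial_deriv i f ?y" .
qed

lemma C_times_diag_affine:
  fixes f :: "real ^ 'n::finite \<Rightarrow> real"
  shows "C_times k f \<Longrightarrow> C_times k (\<lambda>x. f (diag_affine a c x))"
proof (induction k arbitrary: f)
  case 0
  then show ?case
    by (auto intro!: continuous_on_compose2[where f="diag_affine a c"] continuous_on_diag_affine)
next
  case (Suc k)
  have "(\<lambda>x. f (diag_affine a c x)) differentiable at x" for x
    using differentiable_chain_at[of "diag_affine a c" x f] Suc.prems
      differentiableI[OF has_derivative_diag_affine]
    by (auto simp: o_def)
  then show ?case using Suc
    by (simp add: partial_deriv_diag_affine C_times_mult C_times_const)
qed

lemma smooth_diag_affine: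
  fixes f :: "real ^ 'n::finite \<Rightarrow> real"
  shows "smooth f \<Longrightarrow> smooth (\<lambda>x. f (diag_affine a c x))"
  by (simp add: smooth_def C_times_diag_affine)

subsection \<open>The functions \<open>s \<mapsto> exp (- 1 / s) / s ^ m\<close>\<close>

text \<open>\<open>flat 0\<close> is the standard smooth function that vanishes to infinite order at
  0. The powers in the denominator make the span of the family closed under differentiation, so that
  smoothness follows by one induction with \<open>m\<close> arbitrary.\<close>

definition flat :: "nat \<Rightarrow> real \<Rightarrow> real" where
  "flat m s = (if s > 0 then exp (- 1 / s) / s ^ m else 0)"

lemma flat_nonneg: "flat m s \<ge> 0"
  by (simp add: flat_def)

lemma flat_pos: "s > 0 \<Longrightarrow> flat m s > 0"
  by (simp add: flat_def)

lemma flat_eq_0: "s \<le> 0 \<Longrightarrow> flat m s = 0"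
  by (simp add: flat_def)

text \<open>With \<open>t = 1 / s\<close> the claim from the right says that the exponential
  outgrows every power; from the left the function is 0.\<close>

lemma flat_tendsto_0: "((\<lambda>s. flat m s) \<longlongrightarrow> 0) (at 0)"
proof -
  have "((\<lambda>t::real. t ^ m / exp t) \<longlongrightarrow> 0) at_top"
    by (rule tendsto_power_div_exp_0)
  then have "((\<lambda>s::real. (inverse s) ^ m / exp (inverse s)) \<longlongrightarrow> 0) (at_right 0)"
    by (rule filterlim_compose[OF _ filterlim_inverse_at_top_right])
  moreover have "inverse s ^ m / exp (inverse s) = flat m s" if "s > 0" for s :: real
    using that exp_minus[of "1 / s"]
    by (simp add: flat_def inverse_eq_divide power_one_over)
  ultimately have "((\<lambda>s. flat m s) \<longlongrightarrow> 0) (at_right 0)"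
    by (elim Lim_transform_eventually) (simp add: eventually_at_filter)
  moreover have "((\<lambda>s. flat m s) \<longlongrightarrow> 0) (at_left 0)"
    by (rule Lim_transform_eventually[OF tendsto_const]) (auto simp: eventually_at_filter flat_def)
  ultimately show ?thesis by (simp add: filterlim_split_at)
qed

lemma DERIV_flat: "(flat m has_real_derivative (flat (m + 2) s - m * flat (m + 1) s)) (at s)"
proof -
  consider "s > 0" | "s < 0" | "s = 0" by linarith
  then show ?thesis
  proof cases
    case 1
    have "((\<lambda>s. exp (- 1 / s) / s ^ m) has_real_derivative (flat (m + 2) s - m * flat (m + 1) s)) (at s)"
      using 1 apply (cases m)
       apply (auto intro!: derivative_eq_intros simp: flat_def field_simps power2_eq_square)
      subgoal for k by (cases k) auto
      done
    then show ?thesis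
      by (rule has_field_derivative_transform_within_open[where S="{0<..}"])
        (use 1 in \<open>auto simp: flat_def\<close>)
  next
    case 2
    have "((\<lambda>s. 0) has_real_derivative (flat (m + 2) s - m * flat (m + 1) s)) (at s)"
      using 2 by (simp add: flat_def)
    then show ?thesis
      by (rule has_field_derivative_transform_within_open[where S="{..<0}"])
        (use 2 in \<open>auto simp: flat_def\<close>)
  next
    case 3
    have "((\<lambda>h. flat (m + 1) h) \<longlongrightarrow> 0) (at 0)" by (rule flat_tendsto_0)
    \<comment> \<open>The difference quotient of \<open>flat m\<close> at 0 is
      \<open>flat (m + 1)\<close>, so differentiability at 0 is the limit just recalled.\<close>
    then have "((\<lambda>h. (flat m (0 + h) - flat m 0) / h) \<longlongrightarrow> 0) (at 0)"
      by (rule Lim_transform_eventually) (auto simp: eventually_at_filter flat_def)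
    then show ?thesis using 3 by (simp add: DERIV_def flat_eq_0)
  qed
qed

lemma continuous_on_flat: "continuous_on S (flat m)"
  by (meson DERIV_flat DERIV_isCont continuous_at_imp_continuous_on)

lemma borel_measurable_flat [measurable]: "flat m \<in> borel_measurable borel"
  by (simp add: borel_measurable_continuous_onI continuous_on_flat)

lemma partial_deriv_flat:
  assumes "\<And>x. p differentiable at x"
  shows "partial_deriv i (\<lambda>x. flat m (p x)) =
    (\<lambda>x. (flat (m + 2) (p x) - real m * flat (m + 1) (p x)) * partial_deriv i p x)"
proof
  fix x
  have "((\<lambda>x. flat m (p x)) has_derivative (\<lambda>h. frechet_derivative p (at x) h *
        (flat (m + 2) (p x) - m * flat (m + 1) (p x)))) (at x)"
    using has_derivative_compose[OF frechet_derivative_works[THEN iffD1, OF assms]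
        DERIV_flat[unfolded has_field_derivative_def]] by (simp add: mult.commute)
  from partial_deriv_eqI[OF this, of i]
  show "partial_deriv i (\<lambda>x. flat m (p x)) x =
      (flat (m + 2) (p x) - real m * flat (m + 1) (p x)) * partial_deriv i p x"
    by (simp add: partial_deriv_def)
qed

lemma C_times_flat:
  assumes "smooth p"
  shows "C_times k (\<lambda>x. flat m (p x))"
proof (induction k arbitrary: m)
  case 0
  show ?case
    using continuous_on_compose2[OF continuous_on_flat[of UNIV m] smooth_continuous_on[OF assms]] by auto
next
  case (Suc k)
  have "(\<lambda>x. flat m (p x)) differentiable at x" for x
    using has_derivative_compose[OF frechet_derivative_works[THEN iffD1, OF smooth_differentiable[OF assms]]
        DERIV_flat[unfolded has_field_derivative_def]] unfolding differentiable_def by blast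
  moreover have "C_times k (partial_deriv i p)" for i
    using assms smooth_partial_deriv smooth_def by blast
  ultimately show ?case
    by (auto simp: partial_deriv_flat smooth_differentiable[OF assms]
        intro!: C_times_mult C_times_diff C_times_const Suc.IH)
qed

lemma smooth_flat: "smooth p \<Longrightarrow> smooth (\<lambda>x. flat m (p x))"
  by (simp add: smooth_def C_times_flat)

subsection \<open>Test functions\<close>

text \<open>Supports are handled through any compact set outside of which the function vanishes; the
  closure in the definition never has to be computed.\<close>

lemma test_functionsI:
  assumes "smooth \<phi>" "compact K" "K \<subseteq> G" "\<And>x. x \<notin> K \<Longrightarrow> \<phi> x = 0"
  shows "\<phi> \<in> test_functions G"
proof -
  have "closure {x. \<phi> x \<noteq> 0} \<subseteq> K"
    using assms by (intro closure_minimal) (auto intro: compact_imp_closed)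
  moreover from this have "compact (closure {x. \<phi> x \<noteq> 0})"
    using assms(2) by (metis closed_Int_compact closed_closure inf.absorb1)
  ultimately show ?thesis
    using assms(1,3) unfolding test_functions_def by blast
qed

lemma test_functionsD:
  assumes "\<phi> \<in> test_functions G"
  shows "\<exists>K. smooth \<phi> \<and> compact K \<and> K \<subseteq> G \<and> (\<forall>x. x \<notin> K \<longrightarrow> \<phi> x = 0)"
  using assms closure_subset[of "{x. \<phi> x \<noteq> 0}"] unfolding test_functions_def by blast

lemma test_functions_smooth: "\<phi> \<in> test_functions G \<Longrightarrow> smooth \<phi>"
  by (simp add: test_functions_def)

lemma test_functions_mono: "\<phi> \<in> test_functions G \<Longrightarrow> G \<subseteq> G' \<Longrightarrow> \<phi> \<in> test_functions G'"
  by (auto simp: test_functions_def)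

lemma test_functions_ball:
  assumes "\<phi> \<in> test_functions G"
  obtains R where "R > 0" "\<And>x. x \<notin> ball 0 R \<Longrightarrow> \<phi> x = 0"
proof -
  obtain K where K: "compact K" "\<And>x. x \<notin> K \<Longrightarrow> \<phi> x = 0"
    using test_functionsD[OF assms] by blast
  obtain R where "R > 0" "K \<subseteq> ball 0 R"
    using K(1) bounded_subset_ballD compact_imp_bounded by blast
  with K that show ?thesis by blast
qed

lemma test_functions_add:
  assumes "\<phi> \<in> test_functions G" "\<psi> \<in> test_functions G"
  shows "(\<lambda>x. \<phi> x + \<psi> x) \<in> test_functions G"
proof -
  obtain K where K: "smooth \<phi>" "compact K" "K \<subseteq> G" "\<And>x. x \<notin> K \<Longrightarrow> \<phi> x = 0"
    using test_functionsD[OF assms(1)] by blast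
  obtain L where L: "smooth \<psi>" "compact L" "L \<subseteq> G" "\<And>x. x \<notin> L \<Longrightarrow> \<psi> x = 0"
    using test_functionsD[OF assms(2)] by blast
  show ?thesis
    by (rule test_functionsI[of _ "K \<union> L"]) (use K L in \<open>auto intro: smooth_add\<close>)
qed

lemma test_functions_mult:
  assumes "\<phi> \<in> test_functions G" "smooth \<psi>"
  shows "(\<lambda>x. \<phi> x * \<psi> x) \<in> test_functions G"
proof -
  obtain K where K: "smooth \<phi>" "compact K" "K \<subseteq> G" "\<And>x. x \<notin> K \<Longrightarrow> \<phi> x = 0"
    using test_functionsD[OF assms(1)] by blast
  show ?thesis
    by (rule test_functionsI[of _ K]) (use K assms in \<open>auto intro: smooth_mult\<close>)
qed

lemma test_functions_cmult:
  "\<phi> \<in> test_functions G \<Longrightarrow> (\<lambda>x. c * \<phi> x) \<in> test_functions G"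
  using test_functions_mult[OF _ smooth_const, of \<phi> G c] by (simp add: mult.commute)

lemma test_functions_diff:
  assumes "\<phi> \<in> test_functions G" "\<psi> \<in> test_functions G"
  shows "(\<lambda>x. \<phi> x - \<psi> x) \<in> test_functions G"
  using test_functions_add[OF assms(1) test_functions_cmult[OF assms(2), of "-1"]] by simp

lemma test_functions_zero: "(\<lambda>x. 0) \<in> test_functions G"
  by (rule test_functionsI[of _ "{}"]) (auto simp: smooth_const)

lemma partial_deriv_eq_0:
  assumes "closed K" "\<And>x. x \<notin> K \<Longrightarrow> \<phi> x = 0" "x \<notin> K"
  shows "partial_deriv i \<phi> x = 0"
proof -
  have "(\<phi> has_derivative (\<lambda>h. 0)) (at x)"
    by (rule has_derivative_transform_within_open[where f="\<lambda>x. 0" and s="- K"])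
      (use assms in auto)
  then show ?thesis by (rule partial_deriv_eqI)
qed

lemma test_functions_partial_deriv:
  assumes "\<phi> \<in> test_functions G"
  shows "partial_deriv i \<phi> \<in> test_functions G"
proof -
  obtain K where K: "smooth \<phi>" "compact K" "K \<subseteq> G" "\<And>x. x \<notin> K \<Longrightarrow> \<phi> x = 0"
    using test_functionsD[OF assms(1)] by blast
  show ?thesis
    by (rule test_functionsI[of _ K])
      (use K in \<open>auto intro: smooth_partial_deriv partial_deriv_eq_0 compact_imp_closed\<close>)
qed

lemma diag_affine_inverse:
  assumes "\<And>j. c $ j \<noteq> 0"
  shows "diag_affine a c (diag_affine (\<chi> j. - a $ j / c $ j) (\<chi> j. 1 / c $ j) y) = y"
    "diag_affine (\<chi> j. - a $ j / c $ j) (\<chi> j. 1 / c $ j) (diag_affine a c y) = y"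
  using assms by (auto simp: vec_eq_iff field_simps)

lemma test_functions_diag_affine:
  fixes \<phi> :: "real ^ 'n::finite \<Rightarrow> real"
  assumes "\<phi> \<in> test_functions UNIV" "\<And>j. c $ j \<noteq> 0"
  shows "(\<lambda>x. \<phi> (diag_affine a c x)) \<in> test_functions UNIV"
proof -
  obtain K where K: "smooth \<phi>" "compact K" "\<And>x. x \<notin> K \<Longrightarrow> \<phi> x = 0"
    using test_functionsD[OF assms(1)] by blast
  let ?S = "diag_affine (\<chi> j. - a $ j / c $ j) (\<chi> j. 1 / c $ j)"
  show ?thesis
  proof (rule test_functionsI[of _ "?S ` K"])
    show "compact (?S ` K)" by (intro compact_continuous_image continuous_on_diag_affine K)
    show "\<phi> (diag_affine a c x) = 0" if "x \<notin> ?S ` K" for x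
    proof (rule K(3), rule notI)
      assume "diag_affine a c x \<in> K"
      then have "?S (diag_affine a c x) \<in> ?S ` K" by (rule imageI)
      with that show False unfolding diag_affine_inverse(2)[OF assms(2)] by blast
    qed
  qed (use K smooth_diag_affine in auto)
qed

lemma test_functions_bounded:
  assumes "\<phi> \<in> test_functions G"
  obtains M where "M > 0" "\<And>x. \<bar>\<phi> x\<bar> \<le> M"
proof -
  obtain K where K: "smooth \<phi>" "compact K" "\<And>x. x \<notin> K \<Longrightarrow> \<phi> x = 0"
    using test_functionsD[OF assms(1)] by blast
  have "compact (\<phi> ` K)" using K by (intro compact_continuous_image smooth_continuous_on)
  then obtain M where "\<forall>y\<in>\<phi> ` K. \<bar>y\<bar> \<le> M" using compact_imp_bounded bounded_real by blast
  then have "\<bar>\<phi> x\<bar> \<le> max M 1" for x using K(3)[of x] by (cases "x \<in> K") auto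
  then show ?thesis by (rule that[rotated]) simp
qed

lemma grad_nth: "grad \<phi> x $ i = partial_deriv i \<phi> x"
  by (simp add: grad_def)

lemma grad_const: "grad (\<lambda>x. c) = (\<lambda>x. 0)"
  by (auto simp: vec_eq_iff grad_nth partial_deriv_const)

lemma grad_eq_0:
  fixes \<psi> :: "real ^ 'n::finite \<Rightarrow> real"
  assumes "closed K" "\<And>x. x \<notin> K \<Longrightarrow> \<psi> x = 0" "x \<notin> K"
  shows "grad \<psi> x = 0"
  using partial_deriv_eq_0[OF assms] by (simp add: vec_eq_iff grad_nth)

lemma grad_bounded:
  fixes \<psi> :: "real ^ 'n::finite \<Rightarrow> real"
  assumes \<psi>: "\<psi> \<in> test_functions G"
  obtains B where "\<And>x. norm (grad \<psi> x) \<le> B"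
proof -
  have "\<exists>B. \<forall>x. \<bar>partial_deriv i \<psi> x\<bar> \<le> B" for i
    using test_functions_bounded[OF test_functions_partial_deriv[OF \<psi>]] by metis
  then obtain B where B: "\<And>i x. \<bar>partial_deriv i \<psi> x\<bar> \<le> B i" by metis
  have "norm (grad \<psi> x) \<le> (\<Sum>i\<in>UNIV. B i)" for x
    by (rule order_trans[OF norm_le_l1_cart]) (auto simp: grad_nth intro!: sum_mono B)
  then show ?thesis by (rule that)
qed

section \<open>Lebesgue spaces\<close>

lemma borel_measurable_vec_component [measurable (raw)]:
  fixes f :: "'a \<Rightarrow> real ^ 'n::finite"
  shows "f \<in> borel_measurable M \<Longrightarrow> (\<lambda>x. f x $ i) \<in> borel_measurable M"
  by (rule measurable_compose[OF _ borel_measurable_nth])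

lemma LpI: "f \<in> borel_measurable M \<Longrightarrow> integrable M (\<lambda>x. norm (f x) powr q) \<Longrightarrow> f \<in> Lp q M"
  by (simp add: Lp_def)

lemma Lp_measurable [measurable_dest]: "f \<in> Lp q M \<Longrightarrow> f \<in> borel_measurable M"
  by (simp add: Lp_def)

lemma Lp_integrable: "f \<in> Lp q M \<Longrightarrow> integrable M (\<lambda>x. norm (f x) powr q)"
  by (simp add: Lp_def)

lemma Lp_mono:
  assumes "g \<in> Lp q M" "f \<in> borel_measurable M" "AE x in M. norm (f x) \<le> C * norm (g x)" "q \<ge> 0" "C \<ge> 0"
  shows "f \<in> Lp q M"
proof (rule LpI[OF assms(2)])
  show "integrable M (\<lambda>x. norm (f x) powr q)"
  proof (rule Bochner_Integration.integrable_bound)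
    show "integrable M (\<lambda>x. C powr q * norm (g x) powr q)"
      using Lp_integrable[OF assms(1)] by simp
    show "AE x in M. norm (norm (f x) powr q) \<le> norm (C powr q * norm (g x) powr q)"
      using assms(3)
    proof eventually_elim
      case (elim x)
      then have "norm (f x) powr q \<le> (C * norm (g x)) powr q" using assms by (intro powr_mono2) auto
      then show ?case using assms by (simp add: powr_mult)
    qed
  qed (use assms(2) in measurable)
qed

lemma Lp_norm_mono:
  assumes "g \<in> Lp q M" "f \<in> borel_measurable M" "AE x in M. norm (f x) \<le> norm (g x)" "q > 0"
  shows "Lp_norm q M f \<le> Lp_norm q M g"
  unfolding Lp_norm_def
proof (rule powr_mono2)
  have "f \<in> Lp q M" using Lp_mono[of g q M f 1] assms by auto
  then show "(\<integral>x. norm (f x) powr q \<partial>M) \<le> (\<integral>x. norm (g x) powr q \<partial>M)"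
    using assms by (intro integral_mono_AE Lp_integrable)
      (auto elim!: eventually_mono intro: powr_mono2)
qed (use assms in auto)

lemma Lp_cong_AE:
  assumes "g \<in> Lp q M" "f \<in> borel_measurable M" "AE x in M. f x = g x"
  shows "f \<in> Lp q M"
proof (rule LpI[OF assms(2)])
  show "integrable M (\<lambda>x. norm (f x) powr q)"
    by (rule integrable_cong_AE_imp[OF Lp_integrable[OF assms(1)]]) (use assms in auto)
qed

lemma Lp_norm_cong_AE:
  assumes "g \<in> borel_measurable M" "f \<in> borel_measurable M" "AE x in M. f x = g x"
  shows "Lp_norm q M f = Lp_norm q M g"
  unfolding Lp_norm_def
  by (intro arg_cong[where f="\<lambda>x. x powr (1 / q)"] integral_cong_AE) (use assms in auto)

text \<open>The crude constant suffices for closure of \<open>Lp\<close> under sums, which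
  Minkowski's inequality presupposes when it integrates the power of \<open>f + g\<close>.\<close>

lemma norm_add_powr_le:
  fixes a b :: "'a::real_normed_vector"
  assumes "q \<ge> 0"
  shows "norm (a + b) powr q \<le> 2 powr q * (norm a powr q + norm b powr q)"
proof -
  have "norm (a + b) \<le> 2 * max (norm a) (norm b)" using norm_triangle_ineq[of a b] by linarith
  then have "norm (a + b) powr q \<le> (2 * max (norm a) (norm b)) powr q"
    using assms by (intro powr_mono2) auto
  also have "\<dots> = 2 powr q * max (norm a) (norm b) powr q" by (simp add: powr_mult)
  also have "\<dots> \<le> 2 powr q * (norm a powr q + norm b powr q)"
    by (intro mult_left_mono) (auto simp: max_def)
  finally show ?thesis .
qed

lemma Lp_add:
  assumes "f \<in> Lp q M" "g \<in> Lp q M" "q \<ge> 0"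
  shows "(\<lambda>x. f x + g x) \<in> Lp q M"
proof (rule LpI)
  show "integrable M (\<lambda>x. norm (f x + g x) powr q)"
  proof (rule Bochner_Integration.integrable_bound)
    show "integrable M (\<lambda>x. 2 powr q * (norm (f x) powr q + norm (g x) powr q))"
      using Lp_integrable assms by (intro integrable_mult_right Bochner_Integration.integrable_add)
    show "AE x in M. norm (norm (f x + g x) powr q) \<le>
        norm (2 powr q * (norm (f x) powr q + norm (g x) powr q))"
      using norm_add_powr_le[OF assms(3)] by auto
  qed (use assms in measurable)
qed (use assms in measurable)

lemma Lp_scaleR_bounded:
  fixes f :: "'a \<Rightarrow> 'b::euclidean_space"
  assumes "f \<in> Lp q M" "c \<in> borel_measurable M" "\<And>x. \<bar>c x\<bar> \<le> C" "q \<ge> 0"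
  shows "(\<lambda>x. c x *\<^sub>R f x) \<in> Lp q M"
proof (rule Lp_mono[OF assms(1)])
  show "AE x in M. norm (c x *\<^sub>R f x) \<le> \<bar>C\<bar> * norm (f x)"
    using order_trans[OF assms(3) abs_ge_self] by (auto intro!: mult_right_mono)
qed (use assms in measurable)

lemma Lp_scaleR: "f \<in> Lp q M \<Longrightarrow> q \<ge> 0 \<Longrightarrow> (\<lambda>x. c *\<^sub>R f x) \<in> Lp q M"
  by (rule Lp_scaleR_bounded[where C="\<bar>c\<bar>"]) auto

lemma Lp_diff:
  assumes "f \<in> Lp q M" "g \<in> Lp q M" "q \<ge> 0"
  shows "(\<lambda>x. f x - g x) \<in> Lp q M"
  using Lp_add[OF assms(1) Lp_scaleR[OF assms(2), of "-1"]] assms(3) by simp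

lemma Lp_zero: "(\<lambda>x. 0) \<in> Lp q M"
  by (simp add: Lp_def)

lemma Lp_sum:
  "(\<And>i. i \<in> I \<Longrightarrow> f i \<in> Lp q M) \<Longrightarrow> q \<ge> 0 \<Longrightarrow> (\<lambda>x. \<Sum>i\<in>I. f i x) \<in> Lp q M"
  by (induction I rule: infinite_finite_induct) (auto simp: Lp_zero Lp_add)

lemma Lp_norm_fun: "f \<in> Lp q M \<Longrightarrow> (\<lambda>x. norm (f x)) \<in> Lp q M"
  unfolding Lp_def by auto

lemma Lp_component:
  fixes g :: "'a \<Rightarrow> real ^ 'n::finite"
  shows "g \<in> Lp q M \<Longrightarrow> q \<ge> 0 \<Longrightarrow> (\<lambda>x. g x $ i) \<in> Lp q M"
  by (rule Lp_mono[where C=1 and g=g])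
    (auto simp: component_le_norm_cart)

lemma Lp_componentI:
  fixes g :: "'a \<Rightarrow> real ^ 'n::finite"
  assumes "\<And>i. (\<lambda>x. g x $ i) \<in> Lp q M" "q \<ge> 0"
  shows "g \<in> Lp q M"
proof -
  have m: "(\<lambda>x. g x $ i) \<in> borel_measurable M" for i using assms(1) by (rule Lp_measurable)
  have "g = (\<lambda>x. \<Sum>i\<in>UNIV. (g x $ i) *\<^sub>R axis i 1)"
    using basis_expansion[of "g _"] by (auto simp: scalar_mult_eq_scaleR)
  also have "\<dots> \<in> Lp q M"
    by (intro Lp_sum Lp_mono[OF assms(1), where C=1])
      (use m assms(2) in \<open>auto intro!: borel_measurable_scaleR simp: norm_axis_1\<close>)
  finally show ?thesis .
qed

lemma Lp_norm_nonneg: "Lp_norm q M f \<ge> 0"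
  by (simp add: Lp_norm_def)

lemma Lp_norm_powr: "q > 0 \<Longrightarrow> Lp_norm q M f powr q = (\<integral>x. norm (f x) powr q \<partial>M)"
  by (simp add: Lp_norm_def powr_powr)

lemma Lp_norm_le:
  assumes "q > 0" "C \<ge> 0" "(\<integral>x. norm (f x) powr q \<partial>M) \<le> C powr q"
  shows "Lp_norm q M f \<le> C"
proof -
  have "Lp_norm q M f \<le> (C powr q) powr (1 / q)"
    unfolding Lp_norm_def using assms by (intro powr_mono2) auto
  then show ?thesis using assms by (simp add: powr_powr)
qed

lemma Lp_norm_scaleR:
  assumes "q > 0"
  shows "Lp_norm q M (\<lambda>x. c *\<^sub>R f x) = \<bar>c\<bar> * Lp_norm q M f"
  using assms by (simp add: Lp_norm_def powr_mult powr_powr)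

lemma Lp_norm_minus_commute: "Lp_norm q M (\<lambda>x. f x - g x) = Lp_norm q M (\<lambda>x. g x - f x)"
  by (simp add: Lp_norm_def norm_minus_commute)

lemma Lp_norm_eq_0_AE:
  assumes "f \<in> Lp q M" "q > 0" "Lp_norm q M f = 0"
  shows "AE x in M. f x = 0"
proof -
  have "(\<integral>x. norm (f x) powr q \<partial>M) = 0" using assms Lp_norm_powr[of q M f] by simp
  then have "AE x in M. norm (f x) powr q = 0"
    using integral_nonneg_eq_0_iff_AE[OF Lp_integrable[OF assms(1)]] by auto
  then show ?thesis by eventually_elim simp
qed

section \<open>The inequalities of Hoelder and Minkowski\<close>

lemma Holder:
  fixes f :: "'a \<Rightarrow> 'b::euclidean_space" and g :: "'a \<Rightarrow> 'c::euclidean_space"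
  assumes q: "q > 1" and f: "f \<in> Lp q M" and g: "g \<in> Lp (q / (q - 1)) M"
  shows "integrable M (\<lambda>x. norm (f x) * norm (g x))"
    and "(\<integral>x. norm (f x) * norm (g x) \<partial>M) \<le> Lp_norm q M f * Lp_norm (q / (q - 1)) M g"
proof -
  define p where "p = q / (q - 1)"
  have p: "p > 1" "1 / q + 1 / p = 1" using q by (auto simp: p_def field_simps)
  have g: "g \<in> Lp p M" using g by (simp add: p_def)
  have [measurable]: "f \<in> borel_measurable M" "g \<in> borel_measurable M" using f g by auto
  note If = Lp_integrable[OF f] and Ig = Lp_integrable[OF g]
  \<comment> \<open>Applied to the raw factors, Young's inequality gives integrability only; the
    sharp bound follows once both factors are divided by their norms.\<close>
  have young: "norm (f x) * norm (g x) \<le> norm (f x) powr q / q + norm (g x) powr p / p" for x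
    using q p by (intro Youngs_inequality) auto
  show int: "integrable M (\<lambda>x. norm (f x) * norm (g x))"
    by (rule Bochner_Integration.integrable_bound[of _ "\<lambda>x. norm (f x) powr q / q + norm (g x) powr p / p"])
      (use If Ig young in \<open>auto intro!: Bochner_Integration.integrable_add
         simp: abs_of_nonneg q p order_trans[OF young]\<close>)
  let ?A = "Lp_norm q M f" and ?B = "Lp_norm p M g"
  show "(\<integral>x. norm (f x) * norm (g x) \<partial>M) \<le> ?A * Lp_norm (q / (q - 1)) M g"
    unfolding p_def[symmetric]
  \<comment> \<open>Division by a vanishing norm is impossible, but then one factor is 0 almost
    everywhere.\<close>
  proof (cases "?A = 0 \<or> ?B = 0")
    case True
    then have "AE x in M. norm (f x) * norm (g x) = 0"
    proof
      assume "?A = 0"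
      from Lp_norm_eq_0_AE[OF f _ this] q show ?thesis by auto
    next
      assume "?B = 0"
      from Lp_norm_eq_0_AE[OF g _ this] p show ?thesis by auto
    qed
    then have "(\<integral>x. norm (f x) * norm (g x) \<partial>M) = 0" by (rule integral_eq_zero_AE)
    then show "(\<integral>x. norm (f x) * norm (g x) \<partial>M) \<le> ?A * ?B" by (simp add: Lp_norm_nonneg)
  next
    case False
    then have AB: "?A > 0" "?B > 0" using Lp_norm_nonneg by (metis less_eq_real_def)+
    have "norm (f x) * norm (g x) \<le>
        ?A * ?B * (norm (f x) powr q / (q * ?A powr q) + norm (g x) powr p / (p * ?B powr p))" for x
    proof -
      have "norm (f x) / ?A * (norm (g x) / ?B) \<le> (norm (f x) / ?A) powr q / q + (norm (g x) / ?B) powr p / p"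
        using q p AB by (intro Youngs_inequality) auto
      then have "?A * ?B * (norm (f x) / ?A * (norm (g x) / ?B)) \<le>
          ?A * ?B * ((norm (f x) / ?A) powr q / q + (norm (g x) / ?B) powr p / p)"
        using AB by (intro mult_left_mono) auto
      then show ?thesis using AB by (simp add: powr_divide field_simps)
    qed
    then have "(\<integral>x. norm (f x) * norm (g x) \<partial>M) \<le> (\<integral>x. ?A * ?B *
        (norm (f x) powr q / (q * ?A powr q) + norm (g x) powr p / (p * ?B powr p)) \<partial>M)"
      using If Ig by (intro integral_mono int) auto
    also have "\<dots> = ?A * ?B * ((\<integral>x. norm (f x) powr q \<partial>M) / (q * ?A powr q) +
        (\<integral>x. norm (g x) powr p \<partial>M) / (p * ?B powr p))"
      using If Ig by simp
    also have "\<dots> = ?A * ?B * (1 / q + 1 / p)"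
      using Lp_norm_powr[of q M f, symmetric] Lp_norm_powr[of p M g, symmetric] AB q p by simp
    finally show "(\<integral>x. norm (f x) * norm (g x) \<partial>M) \<le> ?A * ?B" using p by simp
  qed
qed

lemma Holder_inner:
  fixes f g :: "'a \<Rightarrow> 'b::euclidean_space"
  assumes q: "q > 1" and f: "f \<in> Lp q M" and g: "g \<in> Lp (q / (q - 1)) M"
  shows "integrable M (\<lambda>x. f x \<bullet> g x)"
    and "\<bar>\<integral>x. f x \<bullet> g x \<partial>M\<bar> \<le> Lp_norm q M f * Lp_norm (q / (q - 1)) M g"
proof -
  note H = Holder[OF assms]
  have [measurable]: "f \<in> borel_measurable M" "g \<in> borel_measurable M" using f g by auto
  show i: "integrable M (\<lambda>x. f x \<bullet> g x)"
    by (rule Bochner_Integration.integrable_bound[OF H(1)]) (auto intro!: Cauchy_Schwarz_ineq2)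
  have "\<bar>\<integral>x. f x \<bullet> g x \<partial>M\<bar> \<le> (\<integral>x. \<bar>f x \<bullet> g x\<bar> \<partial>M)" by (rule integral_abs_bound)
  also have "\<dots> \<le> (\<integral>x. norm (f x) * norm (g x) \<partial>M)"
    using i H(1) by (intro integral_mono Cauchy_Schwarz_ineq2) auto
  finally show "\<bar>\<integral>x. f x \<bullet> g x \<partial>M\<bar> \<le> Lp_norm q M f * Lp_norm (q / (q - 1)) M g" using H(2) by simp
qed

text \<open>Convexity on the open half line is extended to zero arguments, where it reduces to
  \<open>t powr q \<le> t\<close> on the unit interval.\<close>

lemma convex_on_powr:
  fixes q :: real
  assumes "q \<ge> 1" "a \<ge> 0" "b \<ge> 0" "0 \<le> t" "t \<le> 1"
  shows "((1 - t) * a + t * b) powr q \<le> (1 - t) * a powr q + t * b powr q"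
proof (cases "a > 0 \<and> b > 0")
  case True
  have "convex_on {0<..} (\<lambda>x::real. x powr q)"
    by (rule powr_convex) (use assms in auto)
  with True assms show ?thesis by (auto simp: convex_on_def)
next
  case False
  have le: "t powr q \<le> t" if "t \<ge> 0" "t \<le> 1" for t :: real
    using powr_mono'[of 1 q t] that assms(1) by (cases "t = 0") auto
  consider "a = 0" | "b = 0" using False assms by linarith
  then show ?thesis
  proof cases
    case 1
    then show ?thesis using le[of t] assms by (auto simp: powr_mult intro!: mult_right_mono)
  next
    case 2
    then show ?thesis using le[of "1 - t"] assms by (auto simp: powr_mult intro!: mult_right_mono)
  qed
qed

lemma Minkowski:
  fixes f g :: "'a \<Rightarrow> 'b::euclidean_space"
  assumes q: "q \<ge> 1" and f: "f \<in> Lp q M" and g: "g \<in> Lp q M"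
  shows "Lp_norm q M (\<lambda>x. f x + g x) \<le> Lp_norm q M f + Lp_norm q M g"
proof -
  let ?A = "Lp_norm q M f" and ?B = "Lp_norm q M g"
  have [measurable]: "f \<in> borel_measurable M" "g \<in> borel_measurable M" using f g by auto
  consider "?A = 0" | "?B = 0" | "?A > 0" "?B > 0"
    using Lp_norm_nonneg by (metis less_eq_real_def)
  then show ?thesis
  proof cases
    case 1
    then have "AE x in M. f x = 0" using Lp_norm_eq_0_AE[OF f] q by auto
    then have "Lp_norm q M (\<lambda>x. f x + g x) = ?B"
      by (intro Lp_norm_cong_AE) auto
    then show ?thesis using 1 by simp
  next
    case 2
    then have "AE x in M. g x = 0" using Lp_norm_eq_0_AE[OF g] q by auto
    then have "Lp_norm q M (\<lambda>x. f x + g x) = ?A"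
      by (intro Lp_norm_cong_AE) auto
    then show ?thesis using 2 by simp
  next
    case AB: 3
    \<comment> \<open>With weights proportional to the norms, convexity is applied to
      \<open>f\<close> and \<open>g\<close> divided by their norms; both normalised integrals are 1
      and the weights add up to 1.\<close>
    define t where "t = ?B / (?A + ?B)"
    have t: "0 \<le> t" "t \<le> 1" "1 - t = ?A / (?A + ?B)" using AB by (auto simp: t_def field_simps)
    have t': "(?A + ?B) * (1 - t) = ?A" "(?A + ?B) * t = ?B" using AB by (auto simp: t(3)) (auto simp: t_def)
    have pt: "norm (f x + g x) powr q \<le> (?A + ?B) powr q *
        ((1 - t) * (norm (f x) powr q / ?A powr q) + t * (norm (g x) powr q / ?B powr q))" for x
    proof -
      have "norm (f x + g x) \<le> norm (f x) + norm (g x)" by (rule norm_triangle_ineq)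
      also have "\<dots> = (?A + ?B) * ((1 - t) * (norm (f x) / ?A) + t * (norm (g x) / ?B))"
        using AB t' by (simp add: distrib_left mult.assoc[symmetric])
      finally have "norm (f x + g x) powr q \<le> \<dots> powr q" using q by (intro powr_mono2) auto
      also have "\<dots> = (?A + ?B) powr q * ((1 - t) * (norm (f x) / ?A) + t * (norm (g x) / ?B)) powr q"
        using AB t by (subst powr_mult) auto
      also have "\<dots> \<le> (?A + ?B) powr q * ((1 - t) * (norm (f x) / ?A) powr q + t * (norm (g x) / ?B) powr q)"
        using AB t q by (intro mult_left_mono convex_on_powr) auto
      finally show ?thesis using AB by (simp add: powr_divide)
    qed
    show ?thesis
    proof (rule Lp_norm_le)
      have "(\<integral>x. norm (f x + g x) powr q \<partial>M) \<le> (\<integral>x. (?A + ?B) powr q *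
        ((1 - t) * (norm (f x) powr q / ?A powr q) + t * (norm (g x) powr q / ?B powr q)) \<partial>M)"
        using Lp_integrable[OF f] Lp_integrable[OF g] Lp_integrable[OF Lp_add[OF f g]] pt q
        by (intro integral_mono) auto
      also have "\<dots> = (?A + ?B) powr q * ((1 - t) * (?A powr q / ?A powr q) + t * (?B powr q / ?B powr q))"
        using Lp_integrable[OF f] Lp_integrable[OF g] q by (simp add: Lp_norm_powr)
      also have "\<dots> = (?A + ?B) powr q" using AB by simp
      finally show "(\<integral>x. norm (f x + g x) powr q \<partial>M) \<le> (?A + ?B) powr q" .
    qed (use q AB in auto)
  qed
qed

lemma Lp_norm_triangle_diff:
  fixes f g :: "'a \<Rightarrow> 'b::euclidean_space"
  assumes "q \<ge> 1" "f \<in> Lp q M" "g \<in> Lp q M" "h \<in> Lp q M"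
  shows "Lp_norm q M (\<lambda>x. f x - h x) \<le> Lp_norm q M (\<lambda>x. f x - g x) + Lp_norm q M (\<lambda>x. g x - h x)"
  using Minkowski[OF assms(1) Lp_diff[OF assms(2,3)] Lp_diff[OF assms(3,4)]] assms(1) by simp

lemma Lp_norm_triangle_diff':
  fixes f g :: "'a \<Rightarrow> 'b::euclidean_space"
  assumes "q \<ge> 1" "f \<in> Lp q M" "g \<in> Lp q M"
  shows "\<bar>Lp_norm q M f - Lp_norm q M g\<bar> \<le> Lp_norm q M (\<lambda>x. f x - g x)"
  using Lp_norm_triangle_diff[OF assms(1,2,3) Lp_zero] Lp_norm_triangle_diff[OF assms(1,3,2) Lp_zero]
    Lp_norm_minus_commute[of q M f g] by simp

lemma Lp_norm_sum_le:
  fixes f :: "'i \<Rightarrow> 'a \<Rightarrow> 'b::euclidean_space"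
  assumes "q \<ge> 1" "\<And>i. i \<in> I \<Longrightarrow> f i \<in> Lp q M"
  shows "Lp_norm q M (\<lambda>x. \<Sum>i\<in>I. f i x) \<le> (\<Sum>i\<in>I. Lp_norm q M (f i))"
  using assms(2)
proof (induction I rule: infinite_finite_induct)
  case (insert i I)
  have "Lp_norm q M (\<lambda>x. f i x + (\<Sum>i\<in>I. f i x)) \<le> Lp_norm q M (f i) + Lp_norm q M (\<lambda>x. \<Sum>i\<in>I. f i x)"
    using insert assms(1) by (intro Minkowski Lp_sum) auto
  with insert show ?case by simp
qed (auto simp: Lp_norm_def)

section \<open>Convergence and completeness in \<open>Lp\<close>\<close>

lemma Lp_norm_tendsto:
  fixes f :: "nat \<Rightarrow> 'a \<Rightarrow> 'b::euclidean_space"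
  assumes "q \<ge> 1" "\<And>n. f n \<in> Lp q M" "F \<in> Lp q M" "(\<lambda>n. Lp_norm q M (\<lambda>x. f n x - F x)) \<longlonglongrightarrow> 0"
  shows "(\<lambda>n. Lp_norm q M (f n)) \<longlonglongrightarrow> Lp_norm q M F"
proof (rule LIM_zero_cancel, rule Lim_null_comparison[OF _ assms(4)])
  show "\<forall>\<^sub>F n in sequentially. norm (Lp_norm q M (f n) - Lp_norm q M F) \<le> Lp_norm q M (\<lambda>x. f n x - F x)"
    using Lp_norm_triangle_diff'[OF assms(1) assms(2) assms(3)] by auto
qed

lemma Lp_inner_tendsto:
  fixes f :: "nat \<Rightarrow> 'a \<Rightarrow> 'b::euclidean_space"
  assumes q: "q > 1" and f: "\<And>n. f n \<in> Lp q M" and F: "F \<in> Lp q M"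
    and lim: "(\<lambda>n. Lp_norm q M (\<lambda>x. f n x - F x)) \<longlonglongrightarrow> 0" and g: "g \<in> Lp (q / (q - 1)) M"
  shows "(\<lambda>n. \<integral>x. f n x \<bullet> g x \<partial>M) \<longlonglongrightarrow> (\<integral>x. F x \<bullet> g x \<partial>M)"
proof (rule LIM_zero_cancel, rule Lim_null_comparison)
  show "(\<lambda>n. Lp_norm q M (\<lambda>x. f n x - F x) * Lp_norm (q / (q - 1)) M g) \<longlonglongrightarrow> 0"
    using lim by (rule tendsto_mult_left_zero)
  have "(\<integral>x. f n x \<bullet> g x \<partial>M) - (\<integral>x. F x \<bullet> g x \<partial>M) = (\<integral>x. (f n x - F x) \<bullet> g x \<partial>M)" for n
    using Holder_inner(1)[OF q f g] Holder_inner(1)[OF q F g] by (simp add: inner_diff_left)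
  then show "\<forall>\<^sub>F n in sequentially. norm ((\<integral>x. f n x \<bullet> g x \<partial>M) - (\<integral>x. F x \<bullet> g x \<partial>M))
      \<le> Lp_norm q M (\<lambda>x. f n x - F x) * Lp_norm (q / (q - 1)) M g"
    using Holder_inner(2)[OF q Lp_diff[OF f F] g] q by auto
qed

text \<open>The bound \<open>y \<le> 1 + y powr q\<close> replaces an embedding of Lebesgue spaces
  on a set of finite measure.\<close>

lemma Lp_imp_set_integrable:
  fixes f :: "'a \<Rightarrow> 'b::euclidean_space"
  assumes "f \<in> Lp q M" "q \<ge> 1" "A \<in> sets M" "emeasure M A < \<infinity>"
  shows "integrable M (\<lambda>x. indicator A x *\<^sub>R f x)"
proof (rule Bochner_Integration.integrable_bound)
  have [measurable]: "f \<in> borel_measurable M" "A \<in> sets M" using assms by auto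
  show "integrable M (\<lambda>x. indicator A x + norm (f x) powr q)"
    using assms by (intro Bochner_Integration.integrable_add Lp_integrable) auto
  show "(\<lambda>x. indicator A x *\<^sub>R f x) \<in> borel_measurable M" by measurable
  have "y \<le> 1 + y powr q" if "y \<ge> 0" for y :: real
    using powr_mono[of 1 q y] that assms(2) by (cases "y \<le> 1") (auto intro: order_trans[of _ 1])
  then show "AE x in M. norm (indicator A x *\<^sub>R f x) \<le> norm (indicator A x + norm (f x) powr q)"
    by (auto simp: indicator_def)
qed

text \<open>The fast rate makes the increments summable in \<open>L\<^sub>q\<close>, hence almost everywhere.\<close>

lemma Lp_complete_fast:
  fixes f :: "nat \<Rightarrow> 'a \<Rightarrow> 'b::euclidean_space"
  assumes q: "q \<ge> 1" and f: "\<And>n. f n \<in> Lp q M"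
    and fast: "\<And>n. Lp_norm q M (\<lambda>x. f (Suc n) x - f n x) \<le> C * (1 / 2) ^ n"
  shows "\<exists>F. F \<in> Lp q M \<and> (AE x in M. (\<lambda>n. f n x) \<longlonglongrightarrow> F x) \<and>
    (\<lambda>n. Lp_norm q M (\<lambda>x. f n x - F x)) \<longlonglongrightarrow> 0"
proof -
  have [measurable]: "f n \<in> borel_measurable M" for n using f by auto
  define d where "d n x = norm (f (Suc n) x - f n x)" for n x
  define S where "S m x = (\<Sum>n<m. d n x)" for m x
  have d: "d n \<in> Lp q M" for n
    unfolding d_def using f q by (intro Lp_norm_fun Lp_diff) auto
  have [measurable]: "d n \<in> borel_measurable M" for n using d by auto
  have S: "S m \<in> Lp q M" for m unfolding S_def using d q by (intro Lp_sum) auto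
  have [measurable]: "S n \<in> borel_measurable M" for n using S by auto
  have d0: "d n x \<ge> 0" for n x by (simp add: d_def)
  have S0: "S n x \<ge> 0" for n x by (simp add: S_def d0 sum_nonneg)
  have S_mono: "S m x \<le> S n x" if "m \<le> n" for m n x
    unfolding S_def using that d0 by (intro sum_mono2) auto
  have C: "C \<ge> 0" using order_trans[OF Lp_norm_nonneg fast[of 0]] by simp
  have "Lp_norm q M (S m) \<le> 2 * C" for m
  proof -
    have "Lp_norm q M (S m) \<le> (\<Sum>n<m. Lp_norm q M (d n))"
      unfolding S_def using d q by (intro Lp_norm_sum_le) auto
    also have "\<dots> \<le> (\<Sum>n<m. C * (1 / 2) ^ n)"
      using fast by (intro sum_mono) (simp add: d_def Lp_norm_def)
    also have "\<dots> \<le> C * 2"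
      unfolding sum_distrib_left[symmetric] using C sum_le_suminf[of "\<lambda>n. (1 / 2 :: real) ^ n" "{..<m}"]
        suminf_geometric[of "1 / 2 :: real"]
      by (intro mult_left_mono) (auto simp: summable_geometric)
    finally show ?thesis by simp
  qed
  then have "Lp_norm q M (S m) powr q \<le> (2 * C) powr q" for m
    using q by (intro powr_mono2) (auto simp: Lp_norm_nonneg)
  then have bound: "(\<integral>x. S m x powr q \<partial>M) \<le> (2 * C) powr q" for m
    using q S0 by (simp add: Lp_norm_powr)
  have Sint: "integrable M (\<lambda>x. S m x powr q)" for m using Lp_integrable[OF S[of m]] S0 by simp
  have "AE x in M. summable (\<lambda>n. d n x)"
  proof -
    have "(\<integral>\<^sup>+x. (SUP m. ennreal (S m x powr q)) \<partial>M) = (SUP m. \<integral>\<^sup>+x. ennreal (S m x powr q) \<partial>M)"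
      using q S0 by (intro nn_integral_monotone_convergence_SUP)
        (auto simp: incseq_def le_fun_def intro!: ennreal_leI powr_mono2 S_mono)
    also have "\<dots> \<le> ennreal ((2 * C) powr q)"
      using bound by (intro SUP_least) (auto simp: nn_integral_eq_integral[OF Sint] intro!: ennreal_leI)
    finally have "(\<integral>\<^sup>+x. (SUP m. ennreal (S m x powr q)) \<partial>M) \<noteq> \<infinity>"
      by (metis ennreal_less_top infinity_ennreal_def leD)
    then have "AE x in M. (SUP m. ennreal (S m x powr q)) \<noteq> \<infinity>"
      by (intro nn_integral_PInf_AE) auto
    then show ?thesis
    proof eventually_elim
      case (elim x)
      then obtain B where B: "(SUP m. ennreal (S m x powr q)) = ennreal B" "B \<ge> 0"
        by (metis ennreal_cases infinity_ennreal_def)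
      have "S m x \<le> B powr (1 / q)" for m
      proof -
        have "ennreal (S m x powr q) \<le> ennreal B" unfolding B(1)[symmetric] by (rule SUP_upper) simp
        then have "S m x powr q \<le> B" using B by simp
        then have "(S m x powr q) powr (1 / q) \<le> B powr (1 / q)" using q by (intro powr_mono2) auto
        then show ?thesis using q S0 by (simp add: powr_powr)
      qed
      then show ?case
        by (intro summableI_nonneg_bounded[where x="B powr (1 / q)"]) (auto simp: d0 S_def)
    qed
  qed note summ = this
  define s where "s x = (\<Sum>n. d n x)" for x
  have [measurable]: "s \<in> borel_measurable M" unfolding s_def by measurable
  have S_lim: "AE x in M. (\<lambda>m. S m x) \<longlonglongrightarrow> s x"
    using summ by eventually_elim (auto simp: S_def s_def summable_LIMSEQ)
  have S_le: "AE x in M. \<forall>m. S m x \<le> s x"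
    using summ by eventually_elim (auto simp: S_def s_def d0 intro: sum_le_suminf)
  have s: "s \<in> Lp q M"
  proof (rule LpI)
    have "incseq (\<lambda>m. \<integral>x. S m x powr q \<partial>M)"
      using Sint q S0 by (intro incseq_SucI integral_mono) (auto intro!: powr_mono2 S_mono)
    then obtain L where "(\<lambda>m. \<integral>x. S m x powr q \<partial>M) \<longlonglongrightarrow> L"
      using incseq_convergent[of "\<lambda>m. \<integral>x. S m x powr q \<partial>M" "(2 * C) powr q"] bound by blast
    then have "integrable M (\<lambda>x. s x powr q)"
    proof (rule integrable_monotone_convergence[OF Sint, rotated 2])
      show "AE x in M. mono (\<lambda>n. S n x powr q)"
        using q S0 by (auto simp: mono_def intro!: powr_mono2 S_mono)
      show "AE x in M. (\<lambda>i. S i x powr q) \<longlonglongrightarrow> s x powr q"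
        using S_lim by eventually_elim (use q S0 in \<open>auto intro!: tendsto_powr' \<close>)
    qed measurable
    moreover have "AE x in M. s x powr q = norm (s x) powr q"
      using S_le by eventually_elim (metis S0 abs_of_nonneg order_trans real_norm_def)
    ultimately show "integrable M (\<lambda>x. norm (s x) powr q)"
      by (subst integrable_cong_AE[of _ M "\<lambda>x. s x powr q"]) auto
  qed measurable
  \<comment> \<open>\<open>lim\<close> is total, which makes \<open>F\<close> measurable although
    the sequence converges only almost everywhere.\<close>
  define F where "F x = lim (\<lambda>n. f n x)" for x
  have [measurable]: "F \<in> borel_measurable M" unfolding F_def by measurable
  have conv: "AE x in M. (\<lambda>n. f n x) \<longlonglongrightarrow> F x"
    using summ
  proof eventually_elim
    case (elim x)
    have "summable (\<lambda>n. f (Suc n) x - f n x)"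
      using elim unfolding d_def by (rule summable_norm_cancel)
    then have "convergent (\<lambda>n. f n x - f 0 x)"
      by (simp only: summable_iff_convergent sum_lessThan_telescope[of "\<lambda>n. f n x"])
    then have "convergent (\<lambda>n. f n x)" by (simp add: convergent_diff_const_right_iff)
    then show ?case by (simp add: F_def convergent_LIMSEQ_iff)
  qed
  \<comment> \<open>All distances to the limit are dominated by the single function \<open>s\<close>
    in \<open>Lp\<close>, so that almost everywhere convergence gives convergence in norm.\<close>
  have le: "AE x in M. \<forall>n. norm (f n x - F x) \<le> s x"
    using conv S_le
  proof eventually_elim
    case (elim x)
    have "norm (f n x - f m x) \<le> s x" if "n \<le> m" for n m
    proof -
      have "f m x - f n x = (\<Sum>k=n..<m. f (Suc k) x - f k x)" using that by (simp add: sum_Suc_diff'[of n m "\<lambda>k. f k x"])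
      also have "norm \<dots> \<le> (\<Sum>k=n..<m. d k x)" unfolding d_def by (rule norm_sum)
      also have "\<dots> \<le> S m x" unfolding S_def by (rule sum_mono2) (auto simp: d0)
      finally show ?thesis using elim by (metis norm_minus_commute order_trans)
    qed
    moreover have "(\<lambda>m. norm (f n x - f m x)) \<longlonglongrightarrow> norm (f n x - F x)" for n
      using elim by (intro tendsto_intros)
    ultimately show ?case using LIMSEQ_le_const2 by blast
  qed
  have diff: "(\<lambda>x. f n x - F x) \<in> Lp q M" for n
  proof (rule Lp_mono[OF s, where C=1])
    show "AE x in M. norm (f n x - F x) \<le> 1 * norm (s x)"
      using le by eventually_elim (auto intro: order_trans[OF _ abs_ge_self])
  qed (use q in auto)
  have "F \<in> Lp q M" using Lp_diff[OF f[of 0] diff[of 0]] q by simp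
  moreover have "(\<lambda>n. \<integral>x. norm (f n x - F x) powr q \<partial>M) \<longlonglongrightarrow> (\<integral>x. 0 \<partial>M)"
  proof (rule integral_dominated_convergence[where w="\<lambda>x. norm (s x) powr q"])
    show "AE x in M. (\<lambda>n. norm (f n x - F x) powr q) \<longlonglongrightarrow> 0"
      using conv by eventually_elim
        (use q in \<open>auto intro!: tendsto_zero_powrI[where b=q] tendsto_norm_zero LIM_zero\<close>)
    show "AE x in M. norm (norm (f n x - F x) powr q) \<le> norm (s x) powr q" for n
      using le by eventually_elim (use q in \<open>auto intro!: powr_mono2 intro: order_trans[OF _ abs_ge_self]\<close>)
  qed (use Lp_integrable[OF s] in auto)
  then have "(\<lambda>n. Lp_norm q M (\<lambda>x. f n x - F x)) \<longlonglongrightarrow> 0"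
    unfolding Lp_norm_def using q by (auto intro!: tendsto_zero_powrI[where b="1 / q"])
  ultimately show ?thesis using conv by blast
qed

lemma Lp_dominated_convergence:
  fixes f :: "nat \<Rightarrow> 'a \<Rightarrow> 'b::euclidean_space"
  assumes q: "q > 0" and w: "w \<in> Lp q M" and f: "\<And>n. f n \<in> borel_measurable M" "F \<in> borel_measurable M"
    and lim: "AE x in M. (\<lambda>n. f n x) \<longlonglongrightarrow> F x" and le: "\<And>n. AE x in M. norm (f n x) \<le> norm (w x)"
  shows "(\<lambda>n. Lp_norm q M (\<lambda>x. f n x - F x)) \<longlonglongrightarrow> 0" "F \<in> Lp q M" "\<And>n. f n \<in> Lp q M"
proof -
  have [measurable]: "f n \<in> borel_measurable M" "F \<in> borel_measurable M" for n using f by auto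
  have le': "AE x in M. \<forall>n. norm (f n x) \<le> norm (w x)" using le by (simp add: AE_all_countable)
  have leF: "AE x in M. norm (F x) \<le> norm (w x)"
    using lim le'
  proof eventually_elim
    case (elim x)
    then have "(\<lambda>n. norm (f n x)) \<longlonglongrightarrow> norm (F x)" by (intro tendsto_norm)
    with elim show ?case by (intro LIMSEQ_le_const2) auto
  qed
  show "F \<in> Lp q M" by (rule Lp_mono[OF w f(2), where C=1]) (use leF q in auto)
  show "f n \<in> Lp q M" for n by (rule Lp_mono[OF w f(1), where C=1]) (use le q in auto)
  have "(\<lambda>n. \<integral>x. norm (f n x - F x) powr q \<partial>M) \<longlonglongrightarrow> (\<integral>x. 0 \<partial>M)"
  proof (rule integral_dominated_convergence[where w="\<lambda>x. 2 powr q * norm (w x) powr q"])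
    show "AE x in M. (\<lambda>n. norm (f n x - F x) powr q) \<longlonglongrightarrow> 0"
      using lim by eventually_elim
        (use q in \<open>auto intro!: tendsto_zero_powrI[where b=q] tendsto_norm_zero LIM_zero\<close>)
    show "AE x in M. norm (norm (f n x - F x) powr q) \<le> 2 powr q * norm (w x) powr q" for n
      using le' leF
    proof eventually_elim
      case (elim x)
      then have "norm (f n x - F x) \<le> 2 * norm (w x)"
        using norm_triangle_ineq4[of "f n x" "F x"] by (smt (verit))
      then have "norm (f n x - F x) powr q \<le> (2 * norm (w x)) powr q" using q by (intro powr_mono2) auto
      then show ?case by (simp add: powr_mult)
    qed
  qed (use Lp_integrable[OF w] in auto)
  then show "(\<lambda>n. Lp_norm q M (\<lambda>x. f n x - F x)) \<longlonglongrightarrow> 0"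
    unfolding Lp_norm_def using q by (auto intro!: tendsto_zero_powrI[where b="1 / q"])
qed

section \<open>Integration on \<open>\<real>\<^sup>N\<close>\<close>

lemma distr_diag_affine:
  fixes a c :: "real ^ 'n::finite"
  assumes "\<And>j. \<bar>c $ j\<bar> = 1"
  shows "distr lborel borel (diag_affine a c) = lborel"
proof -
  have T: "diag_affine a c = (\<lambda>x. a + (\<Sum>j\<in>Basis. (c \<bullet> j * (x \<bullet> j)) *\<^sub>R j))"
  proof
    fix x
    show "diag_affine a c x = a + (\<Sum>j\<in>Basis. (c \<bullet> j * (x \<bullet> j)) *\<^sub>R j)"
      by (rule euclidean_eqI) (auto simp: inner_add_left inner_sum_left_Basis, auto simp: Basis_vec_def inner_axis)
  qed
  have nz: "c \<bullet> j \<noteq> 0" "\<bar>c \<bullet> j\<bar> = 1" if "j \<in> Basis" for j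
    using that assms by (auto simp: Basis_vec_def inner_axis) (metis abs_zero zero_neq_one)
  have "lborel = density (distr lborel borel (diag_affine a c)) (\<lambda>_. (\<Prod>j\<in>Basis. \<bar>c \<bullet> j\<bar>))"
    unfolding T using nz by (intro lborel_affine_euclidean) auto
  then show ?thesis using nz by (simp add: density_1)
qed

lemma measurable_diag_affine [measurable]: "diag_affine a c \<in> borel_measurable (borel :: (real^'n::finite) measure)"
  by (simp add: borel_measurable_continuous_onI continuous_on_diag_affine)

context
  fixes a c :: "real ^ 'n::finite"
  assumes c: "\<And>j. \<bar>c $ j\<bar> = 1"
begin

lemma integral_diag_affine:
  fixes f :: "real ^ 'n \<Rightarrow> 'b::euclidean_space"
  assumes "f \<in> borel_measurable borel"
  shows "(\<integral>x. f (diag_affine a c x) \<partial>lborel) = (\<integral>x. f x \<partial>lborel)"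
  using integral_distr[of "diag_affine a c" lborel borel f] assms distr_diag_affine[OF c, of a] by simp

lemma integrable_diag_affine:
  fixes f :: "real ^ 'n \<Rightarrow> 'b::euclidean_space"
  assumes "integrable lborel f"
  shows "integrable lborel (\<lambda>x. f (diag_affine a c x))"
  using integrable_distr_eq[of "diag_affine a c" lborel borel f] assms distr_diag_affine[OF c, of a] by auto

lemma nn_integral_diag_affine:
  assumes "f \<in> borel_measurable borel"
  shows "(\<integral>\<^sup>+x. f (diag_affine a c x) \<partial>lborel) = (\<integral>\<^sup>+x. f x \<partial>lborel)"
  using nn_integral_distr[of "diag_affine a c" lborel borel f] assms distr_diag_affine[OF c, of a] by simp

lemma Lp_diag_affine:
  fixes f :: "real ^ 'n \<Rightarrow> 'b::euclidean_space"
  assumes "f \<in> Lp q lborel"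
  shows "(\<lambda>x. f (diag_affine a c x)) \<in> Lp q lborel"
proof (rule LpI)
  have [measurable]: "f \<in> borel_measurable borel" using assms by (simp add: Lp_def)
  show "(\<lambda>x. f (diag_affine a c x)) \<in> borel_measurable lborel" by measurable
  show "integrable lborel (\<lambda>x. norm (f (diag_affine a c x)) powr q)"
    using integrable_diag_affine[OF Lp_integrable[OF assms]] by simp
qed

end

lemma diag_affine_translate: "diag_affine a 1 x = a + x"
  by (simp add: vec_eq_iff)

lemma integral_translate:
  fixes f :: "real ^ 'n::finite \<Rightarrow> 'b::euclidean_space"
  assumes "f \<in> borel_measurable borel"
  shows "(\<integral>x. f (a + x) \<partial>lborel) = (\<integral>x. f x \<partial>lborel)"
  using integral_diag_affine[of 1 f a] assms by (simp add: diag_affine_translate)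

lemma integrable_translate:
  fixes f :: "real ^ 'n::finite \<Rightarrow> 'b::euclidean_space"
  assumes "integrable lborel f"
  shows "integrable lborel (\<lambda>x. f (a + x))"
  using integrable_diag_affine[of 1 f a] assms by (simp add: diag_affine_translate)

lemma nn_integral_translate:
  fixes f :: "real ^ 'n::finite \<Rightarrow> ennreal"
  assumes "f \<in> borel_measurable borel"
  shows "(\<integral>\<^sup>+x. f (a + x) \<partial>lborel) = (\<integral>\<^sup>+x. f x \<partial>lborel)"
  using nn_integral_diag_affine[of 1 f a] assms by (simp add: diag_affine_translate)

lemma test_functions_translate:
  fixes \<phi> :: "real ^ 'n::finite \<Rightarrow> real"
  shows "\<phi> \<in> test_functions UNIV \<Longrightarrow> (\<lambda>x. \<phi> (a + x)) \<in> test_functions UNIV"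
  using test_functions_diag_affine[of \<phi> 1 a] by (simp add: diag_affine_translate)

lemma partial_deriv_translate:
  fixes \<phi> :: "real ^ 'n::finite \<Rightarrow> real"
  shows "smooth \<phi> \<Longrightarrow> partial_deriv i (\<lambda>x. \<phi> (a + x)) = (\<lambda>x. partial_deriv i \<phi> (a + x))"
  using partial_deriv_diag_affine[of \<phi> i a 1] by (simp add: diag_affine_translate smooth_differentiable)

text \<open>Trades a restricted measure for an indicator function on the whole space, where
  translations and Fubini's theorem are available.\<close>

lemma Lp_lborel_on_iff:
  fixes f :: "'a::euclidean_space \<Rightarrow> 'b::euclidean_space"
  assumes [measurable]: "G \<in> sets borel"
  shows "f \<in> Lp q (lborel_on G) \<longleftrightarrow> (\<lambda>x. indicator G x *\<^sub>R f x) \<in> Lp q lborel"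
proof -
  have "(\<lambda>x. indicator G x *\<^sub>R norm (f x) powr q) = (\<lambda>x. norm (indicator G x *\<^sub>R f x) powr q)"
    by (auto simp: indicator_def)
  then show ?thesis
    by (simp add: Lp_def borel_measurable_restrict_space_iff integrable_restrict_space)
qed

lemma Lp_norm_lborel_on:
  fixes f :: "'a::euclidean_space \<Rightarrow> 'b::euclidean_space"
  assumes [measurable]: "G \<in> sets borel"
  shows "Lp_norm q (lborel_on G) f = Lp_norm q lborel (\<lambda>x. indicator G x *\<^sub>R f x)"
proof -
  have "(\<lambda>x. indicator G x *\<^sub>R norm (f x) powr q) = (\<lambda>x. norm (indicator G x *\<^sub>R f x) powr q)"
    by (auto simp: indicator_def)
  then show ?thesis
    by (simp add: Lp_norm_def integral_restrict_space)
qed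

lemma Lp_lborel_on_subset:
  fixes f :: "'a::euclidean_space \<Rightarrow> 'b::euclidean_space"
  assumes "f \<in> Lp q (lborel_on G)" "H \<subseteq> G" "G \<in> sets borel" "H \<in> sets borel" "q \<ge> 0"
  shows "f \<in> Lp q (lborel_on H)"
proof -
  have "(\<lambda>x. indicator H x *\<^sub>R (indicator G x *\<^sub>R f x)) \<in> Lp q lborel"
    using assms by (intro Lp_scaleR_bounded[where C=1 and f="\<lambda>x. indicator G x *\<^sub>R f x"]) (auto simp: Lp_lborel_on_iff split: split_indicator)
  also have "(\<lambda>x. indicator H x *\<^sub>R (indicator G x *\<^sub>R f x)) = (\<lambda>x. indicator H x *\<^sub>R f x)"
    using assms(2) by (intro ext) (auto split: split_indicator)
  finally show ?thesis using assms by (simp add: Lp_lborel_on_iff)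
qed

lemma AE_lborel_on_iff:
  "G \<in> sets borel \<Longrightarrow> (AE x in lborel_on G. P x) \<longleftrightarrow> (AE x in lborel. x \<in> G \<longrightarrow> P x)"
  by (subst AE_restrict_space_iff) auto

subsection \<open>Local integrability\<close>

lemma Lp_loc_integrable:
  fixes f :: "real ^ 'n::finite \<Rightarrow> 'b::euclidean_space"
  assumes "f \<in> Lp_loc 1 G" "compact K" "K \<subseteq> G"
  shows "integrable lborel (\<lambda>x. indicator K x *\<^sub>R f x)"
proof -
  have [measurable]: "K \<in> sets borel" using assms by (simp add: borel_compact)
  have "(\<lambda>x. indicator K x *\<^sub>R f x) \<in> Lp 1 lborel"
    using assms by (simp add: Lp_loc_def flip: Lp_lborel_on_iff)
  then show ?thesis
    unfolding Lp_def by (auto intro: integrable_norm_cancel)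
qed

lemma Lp_loc_1I:
  fixes f :: "real ^ 'n::finite \<Rightarrow> 'b::euclidean_space"
  assumes "\<And>K. compact K \<Longrightarrow> K \<subseteq> G \<Longrightarrow> integrable lborel (\<lambda>x. indicator K x *\<^sub>R f x)"
  shows "f \<in> Lp_loc 1 G"
  unfolding Lp_loc_def
proof (intro CollectI allI impI)
  fix K assume K: "compact K \<and> K \<subseteq> G"
  then have [measurable]: "K \<in> sets borel" by (simp add: borel_compact)
  have "integrable lborel (\<lambda>x. norm (indicator K x *\<^sub>R f x))"
    using assms[of K] K by (intro integrable_norm) auto
  with assms[of K] K show "f \<in> Lp 1 (lborel_on K)"
    by (auto simp: Lp_lborel_on_iff intro!: LpI)
qed

lemma Lp_loc_subset: "f \<in> Lp_loc q G \<Longrightarrow> H \<subseteq> G \<Longrightarrow> f \<in> Lp_loc q H"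
  by (auto simp: Lp_loc_def)

lemma Lp_imp_Lp_loc:
  fixes f :: "real ^ 'n::finite \<Rightarrow> 'b::euclidean_space"
  assumes "f \<in> Lp q (lborel_on G)" "q \<ge> 1" "G \<in> sets borel"
  shows "f \<in> Lp_loc 1 G"
proof (rule Lp_loc_1I)
  fix K assume K: "compact K" "K \<subseteq> G"
  have "integrable lborel (\<lambda>x. indicator K x *\<^sub>R (indicator G x *\<^sub>R f x))"
    using assms K by (intro Lp_imp_set_integrable[of _ q])
      (auto simp: Lp_lborel_on_iff borel_compact emeasure_compact_finite[unfolded infinity_ennreal_def])
  also have "(\<lambda>x. indicator K x *\<^sub>R (indicator G x *\<^sub>R f x)) = (\<lambda>x. indicator K x *\<^sub>R f x)"
    using K by (intro ext) (auto split: split_indicator)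
  finally show "integrable lborel (\<lambda>x. indicator K x *\<^sub>R f x)" .
qed

lemma Lp_imp_Lp_loc_UNIV:
  fixes f :: "real ^ 'n::finite \<Rightarrow> 'b::euclidean_space"
  shows "f \<in> Lp q lborel \<Longrightarrow> q \<ge> 1 \<Longrightarrow> f \<in> Lp_loc 1 UNIV"
  by (rule Lp_imp_Lp_loc[of _ q]) (auto simp: Lp_lborel_on_iff)

lemma Lp_loc_closure_imp_Lp_loc:
  fixes f :: "real ^ 'n::finite \<Rightarrow> 'b::euclidean_space"
  assumes "f \<in> Lp_loc_closure q G" "q \<ge> 1"
  shows "f \<in> Lp_loc 1 G"
proof (rule Lp_loc_1I)
  fix K assume K: "compact K" "K \<subseteq> G"
  then have "f \<in> Lp q (lborel_on (K \<inter> G))"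
    using assms(1) closure_subset unfolding Lp_loc_closure_def by blast
  then have "f \<in> Lp q (lborel_on K)" using K by (simp add: Int_absorb2)
  from Lp_imp_Lp_loc[OF this assms(2)] K
  show "integrable lborel (\<lambda>x. indicator K x *\<^sub>R f x)"
    by (intro Lp_loc_integrable[of f K]) (auto simp: borel_compact)
qed

text \<open>Local integrability gives measurability on each compact set only; an exhaustion of the
  open set by compact sets turns it into measurability of the extension by 0.\<close>

lemma Lp_loc_measurable:
  fixes f :: "real ^ 'n::finite \<Rightarrow> 'b::euclidean_space"
  assumes "f \<in> Lp_loc 1 G" "open G"
  shows "(\<lambda>x. indicator G x *\<^sub>R f x) \<in> borel_measurable borel"
proof -
  obtain C where C: "\<And>n. compact (C n)" "\<And>n. C n \<subseteq> G" "\<And>n::nat. C n \<subseteq> interior (C (Suc n))"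
      "\<Union>(range C) = G"
    using open_Union_compact_subsets[OF assms(2)] by metis
  have mono: "C m \<subseteq> C n" if "m \<le> n" for m n
    by (rule lift_Suc_mono_le[OF _ that]) (use C(3) interior_subset in blast)
  show ?thesis
  proof (rule borel_measurable_LIMSEQ_metric)
    show "(\<lambda>x. indicator (C n) x *\<^sub>R f x) \<in> borel_measurable borel" for n
      using Lp_loc_integrable[OF assms(1) C(1,2)] by auto
    show "(\<lambda>n. indicator (C n) x *\<^sub>R f x) \<longlonglongrightarrow> indicator G x *\<^sub>R f x" for x
    proof (cases "x \<in> G")
      case True
      then obtain m where "x \<in> C m" using C(4) by blast
      then have "\<forall>n\<ge>m. indicator (C n) x *\<^sub>R f x = indicator G x *\<^sub>R f x"
        using mono True by (auto simp: indicator_def)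
      then show ?thesis by (intro tendsto_eventually) (auto simp: eventually_sequentially)
    next
      case False
      then have "x \<notin> C n" for n using C(2) by blast
      with False show ?thesis by simp
    qed
  qed
qed

lemma Lp_loc_UNIV_measurable:
  fixes f :: "real ^ 'n::finite \<Rightarrow> 'b::euclidean_space"
  shows "f \<in> Lp_loc 1 UNIV \<Longrightarrow> f \<in> borel_measurable borel"
  using Lp_loc_measurable[of f UNIV] by simp

lemma test_integrable:
  fixes f :: "real ^ 'n::finite \<Rightarrow> 'b::euclidean_space"
  assumes "f \<in> Lp_loc 1 G" "\<phi> \<in> test_functions G"
  shows "integrable lborel (\<lambda>x. \<phi> x *\<^sub>R f x)"
proof -
  obtain K where K: "smooth \<phi>" "compact K" "K \<subseteq> G" "\<And>x. x \<notin> K \<Longrightarrow> \<phi> x = 0"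
    using test_functionsD[OF assms(2)] by blast
  obtain M where M: "M > 0" "\<And>x. \<bar>\<phi> x\<bar> \<le> M" using test_functions_bounded[OF assms(2)] by blast
  note I = Lp_loc_integrable[OF assms(1) K(2,3)]
  have eq: "(\<lambda>x. \<phi> x *\<^sub>R f x) = (\<lambda>x. \<phi> x *\<^sub>R (indicator K x *\<^sub>R f x))"
    using K(4) by (intro ext) (auto split: split_indicator)
  show ?thesis
    unfolding eq
  proof (rule Bochner_Integration.integrable_bound)
    show "integrable lborel (\<lambda>x. M *\<^sub>R (indicator K x *\<^sub>R f x))" using I by (rule integrable_scaleR_right)
    show "(\<lambda>x. \<phi> x *\<^sub>R (indicator K x *\<^sub>R f x)) \<in> borel_measurable lborel"
      using I smooth_borel_measurable[OF K(1)] by measurable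
    show "AE x in lborel. norm (\<phi> x *\<^sub>R (indicator K x *\<^sub>R f x)) \<le> norm (M *\<^sub>R (indicator K x *\<^sub>R f x))"
      using M by (auto intro!: mult_right_mono simp: indicator_def)
  qed
qed

lemma test_integrable_mult:
  fixes f :: "real ^ 'n::finite \<Rightarrow> real"
  assumes "f \<in> Lp_loc 1 G" "\<phi> \<in> test_functions G"
  shows "integrable lborel (\<lambda>x. f x * \<phi> x)"
  using test_integrable[OF assms] by (simp add: mult.commute)

lemma smooth_Lp_loc:
  assumes "smooth (f :: real ^ 'n::finite \<Rightarrow> real)"
  shows "f \<in> Lp_loc 1 G"
  by (rule Lp_loc_1I, rule borel_integrable_compact) (auto intro: smooth_continuous_on assms)

lemma test_Lp:
  fixes \<phi> :: "real ^ 'n::finite \<Rightarrow> real"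
  assumes "\<phi> \<in> test_functions G" "q \<ge> 0"
  shows "\<phi> \<in> Lp q lborel"
proof (rule LpI)
  obtain K where K: "smooth \<phi>" "compact K" "K \<subseteq> G" "\<And>x. x \<notin> K \<Longrightarrow> \<phi> x = 0"
    using test_functionsD[OF assms(1)] by blast
  obtain M where M: "M > 0" "\<And>x. \<bar>\<phi> x\<bar> \<le> M" using test_functions_bounded[OF assms(1)] by blast
  have [measurable]: "\<phi> \<in> borel_measurable borel" using K(1) by measurable
  show "\<phi> \<in> borel_measurable lborel" by simp
  show "integrable lborel (\<lambda>x. norm (\<phi> x) powr q)"
    by (rule integrableI_bounded_set[where A=K and B="M powr q"])
      (use K M assms(2) in \<open>auto simp: borel_compact intro!: powr_mono2
        emeasure_compact_finite[unfolded infinity_ennreal_def]\<close>)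
qed

subsection \<open>The fundamental lemma of the calculus of variations\<close>

lemma flat_0_le_1: "flat 0 s \<le> 1"
  by (simp add: flat_def)

lemma flat_0_scaled_tendsto: "(\<lambda>n. flat 0 (real (Suc n) * s)) \<longlonglongrightarrow> (if s > 0 then 1 else 0)"
proof (cases "s > 0")
  case True
  have "(\<lambda>n. - (1 / s) * inverse (real (Suc n))) \<longlonglongrightarrow> - (1 / s) * 0"
    by (intro tendsto_intros LIMSEQ_inverse_real_of_nat)
  then have "(\<lambda>n. exp (- (1 / s) * inverse (real (Suc n)))) \<longlonglongrightarrow> exp 0"
    by (intro tendsto_exp) simp
  moreover have "flat 0 (real (Suc n) * s) = exp (- (1 / s) * inverse (real (Suc n)))" for n
    using True by (simp add: flat_def divide_simps del: of_nat_Suc)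
  ultimately show ?thesis using True by simp
next
  case False
  then have "flat 0 (real (Suc n) * s) = 0" for n
    by (intro flat_eq_0) (simp add: mult_nonneg_nonpos del: of_nat_Suc)
  with False show ?thesis by simp
qed

text \<open>A product of one-dimensional cutoffs, one for each face: \<open>flat 0 (n * s)\<close>
  tends to 1 for positive \<open>s\<close> and is 0 otherwise, so the limit is the indicator of the
  open box, while the closed box contains all supports.\<close>

lemma box_bump:
  fixes l u :: "real ^ 'n::finite"
  assumes "cbox l u \<subseteq> G"
  obtains b where "\<And>n::nat. b n \<in> test_functions G" "\<And>n x. 0 \<le> b n x" "\<And>n x. b n x \<le> indicator (box l u) x"
    "\<And>x. (\<lambda>n. b n x) \<longlonglongrightarrow> indicator (box l u) x"
proof
  define b where "b n x = (\<Prod>i\<in>UNIV. flat 0 (real (Suc n) * (x $ i - l $ i)) * flat 0 (real (Suc n) * (u $ i - x $ i)))"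
    for n :: nat and x :: "real ^ 'n"
  have zero: "b n x = 0" if x: "x \<notin> box l u" for n x
  proof -
    obtain i where "x $ i \<le> l $ i \<or> u $ i \<le> x $ i"
      using x unfolding mem_box_cart by (meson not_less)
    then have "flat 0 (real (Suc n) * (x $ i - l $ i)) * flat 0 (real (Suc n) * (u $ i - x $ i)) = 0"
      by (auto simp: flat_eq_0 mult_nonneg_nonpos simp del: of_nat_Suc)
    then show ?thesis unfolding b_def by (intro prod_zero) auto
  qed
  show "b n \<in> test_functions G" for n
  proof (rule test_functionsI[of _ "cbox l u"])
    show "smooth (b n)"
      unfolding b_def by (intro smooth_prod smooth_mult smooth_flat smooth_diff smooth_coord smooth_const)
    show "b n x = 0" if "x \<notin> cbox l u" for x using zero that box_subset_cbox by blast
  qed (use assms in auto)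
  show "0 \<le> b n x" for n x unfolding b_def by (intro prod_nonneg mult_nonneg_nonneg ballI flat_nonneg)
  have "b n x \<le> 1" for n x
    unfolding b_def by (intro prod_le_1 conjI mult_nonneg_nonneg mult_le_one flat_nonneg flat_0_le_1)
  then show "b n x \<le> indicator (box l u) x" for n x
    using zero by (cases "x \<in> box l u") auto
  show "(\<lambda>n. b n x) \<longlonglongrightarrow> indicator (box l u) x" for x
  proof (cases "x \<in> box l u")
    case True
    have "(\<lambda>n. b n x) \<longlonglongrightarrow>
      (\<Prod>i\<in>UNIV. (if x $ i - l $ i > 0 then 1 else 0) * (if u $ i - x $ i > 0 then 1 else 0))"
      unfolding b_def by (intro tendsto_prod tendsto_mult flat_0_scaled_tendsto)
    with True show ?thesis by (simp add: mem_box_cart)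
  qed (simp add: zero)
qed

section \<open>From boxes to Borel sets, and the fundamental lemma\<close>

lemma AE_box_cbox: "AE x in lborel. (x \<in> cbox a b) = (x \<in> box a (b :: 'a::euclidean_space))"
proof -
  have "cbox a b - box a b \<in> null_sets lborel"
    using negligible_frontier_interval[of a b] by (simp add: negligible_iff_null_sets null_sets_completion_iff)
  then have "AE x in lborel. x \<notin> cbox a b - box a b" by (rule AE_not_in)
  then show ?thesis by eventually_elim (use box_subset_cbox in blast)
qed

lemma sigma_sets_boxes: "sets borel = sigma_sets UNIV (range (\<lambda>(a, b). box a b :: 'a::euclidean_space set))"
  by (simp add: borel_eq_box)

lemma boxes_subset_Pow: "range (\<lambda>(a, b). box a b :: 'a::euclidean_space set) \<subseteq> Pow UNIV"
  by simp

lemma Int_stable_boxes: "Int_stable (range (\<lambda>(a, b). box a b :: 'a::euclidean_space set))"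
  by (auto simp: Int_stable_def box_Int_box)

text \<open>Boxes form an intersection stable generator, and the sets over which \<open>f\<close>
  has integral 0 form a Dynkin system; the hypothesis on the whole space is what complements
  need.\<close>

lemma integrable_zero_if_box_zero:
  fixes f :: "'a::euclidean_space \<Rightarrow> real"
  assumes f: "integrable lborel f" and box: "\<And>a b. (\<integral>x. indicator (box a b) x * f x \<partial>lborel) = 0"
    and all: "(\<integral>x. f x \<partial>lborel) = 0"
  shows "AE x in lborel. f x = 0"
proof (rule sigma_finite_measure.density_zero[OF sigma_finite_lborel f])
  fix A :: "'a set" assume "A \<in> sets lborel"
  then have A: "A \<in> sigma_sets UNIV (range (\<lambda>(a, b). box a b))" by (simp add: sigma_sets_boxes)
  show "set_lebesgue_integral lborel A f = 0"
    using Int_stable_boxes boxes_subset_Pow A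
  proof (induction A rule: sigma_sets_induct_disjoint)
    case (basic A)
    then show ?case using box by (auto simp: set_lebesgue_integral_def)
  next
    case empty
    show ?case by (simp add: set_lebesgue_integral_def)
  next
    case (compl A)
    then have A: "A \<in> sets borel" by (simp add: sigma_sets_boxes)
    have "(\<integral>x. indicator (UNIV - A) x *\<^sub>R f x \<partial>lborel) = (\<integral>x. f x - indicator A x *\<^sub>R f x \<partial>lborel)"
      by (intro Bochner_Integration.integral_cong) (auto simp: indicator_def)
    also have "\<dots> = 0"
      using compl all f A integrable_mult_indicator[of A lborel f]
      by (subst Bochner_Integration.integral_diff) (auto simp: set_lebesgue_integral_def)
    finally show ?case by (simp add: set_lebesgue_integral_def)
  next
    case (union A)
    have A: "A i \<in> sets lborel" for i using union by (auto simp: sigma_sets_boxes)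
    have "set_lebesgue_integral lborel (\<Union>i. A i) f = (\<Sum>i. set_lebesgue_integral lborel (A i) f)"
    proof (rule lebesgue_integral_countable_add)
      show "set_integrable lborel (\<Union>i. A i) f"
        unfolding set_integrable_def using A f by (intro integrable_mult_indicator) auto
    qed (use A union(1) in \<open>auto simp: disjoint_family_on_def\<close>)
    then show ?case using union by simp
  qed
qed

text \<open>An open set is a countable union of closed boxes, and the faces lost in passing to open
  boxes are null sets.\<close>

lemma open_AE_from_cbox:
  fixes G :: "'a::euclidean_space set"
  assumes "open G" "\<And>a b. cbox a b \<subseteq> G \<Longrightarrow> AE x in lborel. x \<in> box a b \<longrightarrow> P x"
  shows "AE x in lborel. x \<in> G \<longrightarrow> P x"
proof -
  obtain D where D: "countable D" "D \<subseteq> Pow G" "\<And>X. X \<in> D \<Longrightarrow> \<exists>a b. X = cbox a b" "\<Union>D = G"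
    using open_countable_Union_open_cbox[OF assms(1)] by metis
  have "AE x in lborel. x \<in> X \<longrightarrow> P x" if X: "X \<in> D" for X
  proof -
    obtain a b where ab: "X = cbox a b" using D(3)[OF X] by blast
    then have "cbox a b \<subseteq> G" using D(2) X by blast
    from assms(2)[OF this] AE_box_cbox[of a b] show ?thesis unfolding ab by eventually_elim auto
  qed
  then have "AE x in lborel. \<forall>X\<in>D. x \<in> X \<longrightarrow> P x" by (subst AE_ball_countable[OF D(1)]) blast
  then show ?thesis by eventually_elim (use D(4) in blast)
qed

text \<open>Test functions approximate the indicator of a box boundedly, so \<open>f\<close>
  integrates to 0 over every box in \<open>G\<close>. Cutting \<open>f\<close> off outside one box
  at a time makes it globally integrable.\<close>

lemma fundamental_lemma:
  fixes f :: "real ^ 'n::finite \<Rightarrow> real"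
  assumes f: "f \<in> Lp_loc 1 G" and "open G"
    and zero: "\<And>\<phi>. \<phi> \<in> test_functions G \<Longrightarrow> (\<integral>x. f x * \<phi> x \<partial>lborel) = 0"
  shows "AE x in lborel. x \<in> G \<longrightarrow> f x = 0"
proof (rule open_AE_from_cbox[OF \<open>open G\<close>])
  have box0: "(\<integral>x. indicator (box a b) x * f x \<partial>lborel) = 0" if sub: "cbox a b \<subseteq> G" for a b
  proof -
    obtain c where c: "\<And>n::nat. c n \<in> test_functions G" "\<And>n x. 0 \<le> c n x" "\<And>n x. c n x \<le> indicator (box a b) x"
      "\<And>x. (\<lambda>n. c n x) \<longlonglongrightarrow> indicator (box a b) x"
      using box_bump[OF sub] by metis
    note I = Lp_loc_integrable[OF f compact_cbox sub]
    have cz: "c n x * f x = c n x * (indicator (cbox a b) x *\<^sub>R f x)" for n x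
      using c(2)[of n x] c(3)[of n x] box_subset_cbox[of a b] by (auto split: split_indicator split_indicator_asm)
    have bz: "indicator (box a b) x * f x = indicator (box a b) x * (indicator (cbox a b) x *\<^sub>R f x)" for x
      using box_subset_cbox[of a b] by (auto simp: indicator_def)
    have "(\<lambda>n. \<integral>x. c n x * f x \<partial>lborel) \<longlonglongrightarrow> (\<integral>x. indicator (box a b) x * f x \<partial>lborel)"
      unfolding cz bz
    proof (rule integral_dominated_convergence[where w="\<lambda>x. norm (indicator (cbox a b) x *\<^sub>R f x)"])
      show "AE x in lborel. norm (c n x * (indicator (cbox a b) x *\<^sub>R f x)) \<le> norm (indicator (cbox a b) x *\<^sub>R f x)" for n
      proof (rule AE_I2)
        fix x
        have "\<bar>c n x\<bar> \<le> 1" using c(2)[of n x] c(3)[of n x] by (auto split: split_indicator_asm)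
        then show "norm (c n x * (indicator (cbox a b) x *\<^sub>R f x)) \<le> norm (indicator (cbox a b) x *\<^sub>R f x)"
          by (simp add: abs_mult mult_left_le_one_le)
      qed
      show "(\<lambda>x. c n x * (indicator (cbox a b) x *\<^sub>R f x)) \<in> borel_measurable lborel" for n
        using I smooth_borel_measurable[OF test_functions_smooth[OF c(1)]] by measurable
    qed (use I c(4) in \<open>auto intro!: tendsto_intros\<close>)
    moreover have "(\<integral>x. c n x * f x \<partial>lborel) = 0" for n using zero[OF c(1)] by (simp add: mult.commute)
    ultimately show ?thesis by (simp add: LIMSEQ_const_iff)
  qed
  fix l u assume sub: "cbox l u \<subseteq> G"
  let ?F = "\<lambda>x. indicator (box l u) x * f x"
  have "AE x in lborel. ?F x = 0"
  proof (rule integrable_zero_if_box_zero)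
    have "integrable lborel (\<lambda>x. indicator (box l u) x *\<^sub>R (indicator (cbox l u) x *\<^sub>R f x))"
      by (intro integrable_mult_indicator Lp_loc_integrable[OF f compact_cbox sub]) auto
    then show "integrable lborel ?F"
      by (rule back_subst[of "integrable lborel"]) (use box_subset_cbox[of l u] in \<open>intro ext, auto split: split_indicator\<close>)
    show "(\<integral>x. ?F x \<partial>lborel) = 0" by (rule box0[OF sub])
    show "(\<integral>x. indicator (box a b) x * ?F x \<partial>lborel) = 0" for a b
    proof -
      \<comment> \<open>The intersection of two boxes is again a box, and a matching closed box
        stays inside \<open>cbox l u\<close>, hence inside \<open>G\<close>.\<close>
      obtain c e where ce: "box a b \<inter> box l u = box c e" "cbox c e \<subseteq> cbox l u"
        by (metis (no_types, lifting) Int_interval box_Int_box inf_le2)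
      have "(\<integral>x. indicator (box a b) x * ?F x \<partial>lborel) = (\<integral>x. indicator (box c e) x * f x \<partial>lborel)"
        unfolding ce(1)[symmetric] by (intro Bochner_Integration.integral_cong) (auto simp: indicator_def)
      also have "\<dots> = 0" using ce sub by (intro box0) auto
      finally show ?thesis .
    qed
  qed
  then show "AE x in lborel. x \<in> box l u \<longrightarrow> f x = 0" by eventually_elim (auto split: split_indicator_asm)
qed

subsection \<open>Density of test functions\<close>

text \<open>Membership in the \<open>Lp\<close> closure of the test functions, as a predicate stable
  under limits and linear combinations; density is then climbed from boxes over Borel sets and
  simple functions to \<open>Lp\<close>.\<close>

definition test_approx :: "real \<Rightarrow> (real ^ 'n::finite) set \<Rightarrow> (real ^ 'n \<Rightarrow> real) \<Rightarrow> bool" where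
  "test_approx q G f \<longleftrightarrow> f \<in> Lp q lborel \<and>
     (\<forall>\<epsilon>>0. \<exists>\<phi>\<in>test_functions G. Lp_norm q lborel (\<lambda>x. f x - \<phi> x) < \<epsilon>)"

context
  fixes q :: real and G :: "(real ^ 'n::finite) set"
  assumes q: "q \<ge> 1"
begin

lemma test_approx_lim:
  assumes "\<And>n. test_approx q G (f n)" "F \<in> Lp q lborel"
    "(\<lambda>n. Lp_norm q lborel (\<lambda>x. f n x - F x)) \<longlonglongrightarrow> 0"
  shows "test_approx q G F"
  unfolding test_approx_def
proof (intro conjI allI impI)
  fix \<epsilon> :: real assume "\<epsilon> > 0"
  then obtain n where n: "Lp_norm q lborel (\<lambda>x. f n x - F x) < \<epsilon> / 2"
    using order_tendstoD(2)[OF assms(3), of "\<epsilon> / 2"] eventually_happens by force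
  obtain \<phi> where \<phi>: "\<phi> \<in> test_functions G" "Lp_norm q lborel (\<lambda>x. f n x - \<phi> x) < \<epsilon> / 2"
    using assms(1)[of n] \<open>\<epsilon> > 0\<close> unfolding test_approx_def by (meson half_gt_zero)
  have "Lp_norm q lborel (\<lambda>x. F x - \<phi> x) \<le> Lp_norm q lborel (\<lambda>x. F x - f n x) + Lp_norm q lborel (\<lambda>x. f n x - \<phi> x)"
    using q assms(1)[of n] assms(2) test_Lp[OF \<phi>(1), of q] unfolding test_approx_def
    by (intro Lp_norm_triangle_diff) auto
  also have "\<dots> < \<epsilon>" using n \<phi>(2) Lp_norm_minus_commute[of q lborel F "f n"] by simp
  finally show "\<exists>\<phi>\<in>test_functions G. Lp_norm q lborel (\<lambda>x. F x - \<phi> x) < \<epsilon>" using \<phi>(1) by blast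
qed fact

lemma test_approx_test: "\<phi> \<in> test_functions G \<Longrightarrow> test_approx q G \<phi>"
  unfolding test_approx_def using test_Lp[of \<phi> G q] q by (auto simp: Lp_norm_def intro!: bexI[of _ \<phi>])

lemma test_approx_zero: "test_approx q G (\<lambda>x. 0)"
  by (rule test_approx_test) (rule test_functions_zero)

lemma test_approx_seq:
  assumes "test_approx q G f"
  obtains \<phi> where "\<And>n::nat. \<phi> n \<in> test_functions G" "(\<lambda>n. Lp_norm q lborel (\<lambda>x. f x - \<phi> n x)) \<longlonglongrightarrow> 0"
proof -
  have "\<exists>\<phi>\<in>test_functions G. Lp_norm q lborel (\<lambda>x. f x - \<phi> x) < inverse (real (Suc n))" for n
    using assms unfolding test_approx_def by simp
  then obtain \<phi> where \<phi>: "\<And>n. \<phi> n \<in> test_functions G"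
      "\<And>n. Lp_norm q lborel (\<lambda>x. f x - \<phi> n x) < inverse (real (Suc n))" by metis
  have "(\<lambda>n. Lp_norm q lborel (\<lambda>x. f x - \<phi> n x)) \<longlonglongrightarrow> 0"
    by (rule tendsto_sandwich[OF _ _ tendsto_const LIMSEQ_inverse_real_of_nat])
      (use \<phi>(2) in \<open>auto simp: Lp_norm_nonneg less_imp_le\<close>)
  with \<phi>(1) show ?thesis by (rule that)
qed

lemma test_approx_add:
  assumes "test_approx q G f" "test_approx q G g"
  shows "test_approx q G (\<lambda>x. f x + g x)"
proof -
  obtain \<phi> where \<phi>: "\<And>n::nat. \<phi> n \<in> test_functions G" "(\<lambda>n. Lp_norm q lborel (\<lambda>x. f x - \<phi> n x)) \<longlonglongrightarrow> 0"
    using test_approx_seq[OF assms(1)] by blast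
  obtain \<psi> where \<psi>: "\<And>n::nat. \<psi> n \<in> test_functions G" "(\<lambda>n. Lp_norm q lborel (\<lambda>x. g x - \<psi> n x)) \<longlonglongrightarrow> 0"
    using test_approx_seq[OF assms(2)] by blast
  have f: "f \<in> Lp q lborel" "g \<in> Lp q lborel" using assms by (auto simp: test_approx_def)
  show ?thesis
  proof (rule test_approx_lim)
    show "test_approx q G (\<lambda>x. \<phi> n x + \<psi> n x)" for n
      by (intro test_approx_test test_functions_add \<phi> \<psi>)
    show "(\<lambda>x. f x + g x) \<in> Lp q lborel" using f q by (intro Lp_add) auto
    show "(\<lambda>n. Lp_norm q lborel (\<lambda>x. \<phi> n x + \<psi> n x - (f x + g x))) \<longlonglongrightarrow> 0"
    proof (rule tendsto_sandwich[OF _ _ tendsto_const])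
      show "(\<lambda>n. Lp_norm q lborel (\<lambda>x. \<phi> n x - f x) + Lp_norm q lborel (\<lambda>x. \<psi> n x - g x)) \<longlonglongrightarrow> 0"
        using tendsto_add[OF \<phi>(2) \<psi>(2)] by (simp add: Lp_norm_minus_commute)
      have "Lp_norm q lborel (\<lambda>x. \<phi> n x + \<psi> n x - (f x + g x)) \<le>
          Lp_norm q lborel (\<lambda>x. \<phi> n x - f x) + Lp_norm q lborel (\<lambda>x. \<psi> n x - g x)" for n
        using Minkowski[OF q Lp_diff[OF test_Lp[OF \<phi>(1)] f(1)] Lp_diff[OF test_Lp[OF \<psi>(1)] f(2)], of n n] q
        by (simp add: algebra_simps)
      then show "\<forall>\<^sub>F n in sequentially. Lp_norm q lborel (\<lambda>x. \<phi> n x + \<psi> n x - (f x + g x)) \<le>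
          Lp_norm q lborel (\<lambda>x. \<phi> n x - f x) + Lp_norm q lborel (\<lambda>x. \<psi> n x - g x)" by simp
    qed (simp add: Lp_norm_nonneg)
  qed
qed

lemma test_approx_cmult:
  assumes "test_approx q G f"
  shows "test_approx q G (\<lambda>x. c * f x)"
proof -
  obtain \<phi> where \<phi>: "\<And>n::nat. \<phi> n \<in> test_functions G" "(\<lambda>n. Lp_norm q lborel (\<lambda>x. f x - \<phi> n x)) \<longlonglongrightarrow> 0"
    using test_approx_seq[OF assms(1)] by blast
  have f: "f \<in> Lp q lborel" using assms by (auto simp: test_approx_def)
  show ?thesis
  proof (rule test_approx_lim)
    show "test_approx q G (\<lambda>x. c * \<phi> n x)" for n
      by (intro test_approx_test test_functions_cmult \<phi>)
    show "(\<lambda>x. c * f x) \<in> Lp q lborel" using Lp_scaleR[OF f, of c] q by simp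
    have "Lp_norm q lborel (\<lambda>x. c * \<phi> n x - c * f x) = \<bar>c\<bar> * Lp_norm q lborel (\<lambda>x. f x - \<phi> n x)" for n
      using Lp_norm_scaleR[of q lborel c "\<lambda>x. f x - \<phi> n x"] q Lp_norm_minus_commute[of q lborel "\<lambda>x. c * \<phi> n x" "\<lambda>x. c * f x"]
      by (simp add: algebra_simps)
    then show "(\<lambda>n. Lp_norm q lborel (\<lambda>x. c * \<phi> n x - c * f x)) \<longlonglongrightarrow> 0"
      using tendsto_mult_right_zero[OF \<phi>(2), of "\<bar>c\<bar>"] by simp
  qed
qed

lemma test_approx_diff:
  "test_approx q G f \<Longrightarrow> test_approx q G g \<Longrightarrow> test_approx q G (\<lambda>x. f x - g x)"
  using test_approx_add[OF _ test_approx_cmult[of g "-1"], of f] by simp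

lemma test_approx_sum:
  "(\<And>i. i \<in> I \<Longrightarrow> test_approx q G (f i)) \<Longrightarrow> test_approx q G (\<lambda>x. \<Sum>i\<in>I. f i x)"
  by (induction I rule: infinite_finite_induct) (auto simp: test_approx_zero test_approx_add)

lemma test_approx_cong_AE:
  assumes "test_approx q G f" "f' \<in> borel_measurable borel" "AE x in lborel. f' x = f x"
  shows "test_approx q G f'"
proof (rule test_approx_lim[of "\<lambda>n. f"])
  have f: "f \<in> Lp q lborel" using assms by (auto simp: test_approx_def)
  show "f' \<in> Lp q lborel" by (rule Lp_cong_AE[OF f]) (use assms in auto)
  have "Lp_norm q lborel (\<lambda>x. f x - f' x) = Lp_norm q lborel (\<lambda>x :: real ^ 'n. 0 :: real)"
    by (rule Lp_norm_cong_AE) (use Lp_measurable[OF f] assms in auto)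
  then show "(\<lambda>n::nat. Lp_norm q lborel (\<lambda>x. f x - f' x)) \<longlonglongrightarrow> 0" by (simp add: Lp_norm_def)
qed fact

lemma indicator_Lp: "A \<in> sets borel \<Longrightarrow> emeasure lborel A < \<infinity> \<Longrightarrow> (indicator A :: real ^ 'n \<Rightarrow> real) \<in> Lp q lborel"
  using q by (intro LpI) (auto simp: indicator_def[abs_def] intro!: integrableI_bounded_set[where A=A and B=1])

lemma test_approx_box:
  assumes "cbox l u \<subseteq> G"
  shows "test_approx q G (indicator (box l u))"
proof -
  obtain c where c: "\<And>n::nat. c n \<in> test_functions G" "\<And>n x. 0 \<le> c n x" "\<And>n x. c n x \<le> indicator (box l u) x"
    "\<And>x. (\<lambda>n. c n x) \<longlonglongrightarrow> indicator (box l u) x"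
    using box_bump[OF assms] by metis
  have I: "(indicator (box l u) :: real ^ 'n \<Rightarrow> real) \<in> Lp q lborel"
    by (intro indicator_Lp) (auto simp: emeasure_lborel_box_finite[unfolded infinity_ennreal_def])
  have m: "c n \<in> borel_measurable lborel" for n
    using smooth_borel_measurable[OF test_functions_smooth[OF c(1)]] by simp
  show ?thesis
  proof (rule test_approx_lim[OF test_approx_test[OF c(1)] I])
    show "(\<lambda>n. Lp_norm q lborel (\<lambda>x. c n x - indicator (box l u) x)) \<longlonglongrightarrow> 0"
      by (rule Lp_dominated_convergence(1)[OF _ I m]) (use q c in auto)
  qed
qed

text \<open>The Borel sets whose part in the box can be approximated form a Dynkin system. Staying
  inside one box keeps every measure finite, so that complements and countable disjoint unions
  remain in \<open>Lp\<close>.\<close>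

lemma test_approx_borel_box:
  assumes sub: "cbox l u \<subseteq> G" and "A \<in> sets borel"
  shows "test_approx q G (indicator (A \<inter> box l u))"
proof -
  let ?B = "box l u"
  have fin: "emeasure lborel (X \<inter> ?B) < \<infinity>" if "X \<in> sets borel" for X
    using emeasure_mono[of "X \<inter> ?B" ?B lborel] emeasure_lborel_box_finite[of l u] by (auto intro: le_less_trans)
  have A: "A \<in> sigma_sets UNIV (range (\<lambda>(a, b). box a b))" using assms(2) by (simp add: sigma_sets_boxes)
  show ?thesis
    using Int_stable_boxes boxes_subset_Pow A
  proof (induction A rule: sigma_sets_induct_disjoint)
    case (basic A)
    then obtain a b where A: "A = box a b" by auto
    obtain c e where ce: "box a b \<inter> box l u = box c e" "cbox c e \<subseteq> cbox l u"
      by (metis (no_types, lifting) Int_interval box_Int_box inf_le2)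
    show ?case unfolding A ce(1) using ce(2) sub by (intro test_approx_box) auto
  next
    case empty
    show ?case using test_approx_zero by (simp add: indicator_def[abs_def])
  next
    case (compl A)
    have "indicator ((UNIV - A) \<inter> ?B) = (\<lambda>x. indicator ?B x - indicator (A \<inter> ?B) x :: real)"
      by (intro ext) (auto split: split_indicator)
    then show ?case using test_approx_diff[OF test_approx_box[OF sub] compl(2)] by simp
  next
    case (union A)
    have A: "A i \<in> sets borel" for i using union by (auto simp: sigma_sets_boxes)
    let ?f = "\<lambda>n x. \<Sum>i<n. indicator (A i \<inter> ?B) x :: real"
    have f: "?f n x = indicator (\<Union>i<n. A i \<inter> ?B) x" for n x
      by (subst indicator_UN_disjoint) (use union(1) in \<open>auto simp: disjoint_family_on_def\<close>)
    have I: "(indicator ((\<Union>i. A i) \<inter> ?B) :: real ^ 'n \<Rightarrow> real) \<in> Lp q lborel"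
      using A by (intro indicator_Lp fin) auto
    have "test_approx q G (?f n)" for n by (rule test_approx_sum) (rule union(3))
    then show ?case
    proof (rule test_approx_lim[OF _ I])
      show "(\<lambda>n. Lp_norm q lborel (\<lambda>x. ?f n x - indicator ((\<Union>i. A i) \<inter> ?B) x)) \<longlonglongrightarrow> 0"
        unfolding f
      proof (rule Lp_dominated_convergence(1)[OF _ I])
        show "AE x in lborel. (\<lambda>n. indicator (\<Union>i<n. A i \<inter> ?B) x :: real) \<longlonglongrightarrow> indicator ((\<Union>i. A i) \<inter> ?B) x"
          using LIMSEQ_indicator_UN[of "\<lambda>i. A i \<inter> ?B"] by auto
      qed (use q A in \<open>auto split: split_indicator\<close>)
    qed
  qed
qed

lemma test_approx_borel_cbox:
  assumes "cbox l u \<subseteq> G" and [measurable]: "A \<in> sets borel"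
  shows "test_approx q G (indicator (A \<inter> cbox l u))"
proof (rule test_approx_cong_AE[OF test_approx_borel_box[OF assms]])
  show "AE x in lborel. indicator (A \<inter> cbox l u) x = (indicator (A \<inter> box l u) x :: real)"
    using AE_box_cbox[of l u] by eventually_elim (auto split: split_indicator)
qed measurable

lemma test_approx_set:
  assumes "open G" and A: "A \<in> sets borel" "A \<subseteq> G" and I: "(indicator A :: real ^ 'n \<Rightarrow> real) \<in> Lp q lborel"
  shows "test_approx q G (indicator A)"
proof (cases "G = {}")
  case True
  then show ?thesis using A test_approx_zero by (simp add: indicator_def[abs_def])
next
  case False
  obtain D where D: "countable D" "D \<subseteq> Pow G" "\<And>X. X \<in> D \<Longrightarrow> \<exists>a b. X = cbox a b" "\<Union>D = G"
    using open_countable_Union_open_cbox[OF assms(1)] by metis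
  then have "D \<noteq> {}" using False by auto
  define B where "B n = from_nat_into D n" for n
  have rB: "range B = D" unfolding B_def using range_from_nat_into[OF \<open>D \<noteq> {}\<close> D(1)] .
  have B: "\<exists>a b. B n = cbox a b \<and> cbox a b \<subseteq> G" for n
    using D(2,3) rB by (metis Pow_iff rangeI subsetD)
  have Bm [measurable]: "B n \<in> sets borel" for n using B[of n] by auto
  have [measurable]: "A \<in> sets borel" by fact
  let ?f = "\<lambda>n. indicator (A \<inter> (\<Union>i<n. B i)) :: real ^ 'n \<Rightarrow> real"
  have "test_approx q G (?f n)" for n
  proof (induction n)
    case 0
    show ?case using test_approx_zero by (simp add: indicator_def[abs_def])
  next
    case (Suc n)
    obtain a b where ab: "B n = cbox a b" "cbox a b \<subseteq> G" using B by blast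
    \<comment> \<open>Only the part of \<open>A\<close> in the new box that earlier boxes do not
      cover is added, so that the indicators add up.\<close>
    have "test_approx q G (indicator ((A - (\<Union>i<n. B i)) \<inter> B n))"
      unfolding ab(1) by (rule test_approx_borel_cbox[OF ab(2)]) measurable
    moreover have "?f (Suc n) = (\<lambda>x. ?f n x + indicator ((A - (\<Union>i<n. B i)) \<inter> B n) x)"
      by (intro ext) (auto split: split_indicator simp: less_Suc_eq)
    ultimately show ?case using test_approx_add[OF Suc] by simp
  qed
  then show ?thesis
  proof (rule test_approx_lim[OF _ I])
    show "(\<lambda>n. Lp_norm q lborel (\<lambda>x. ?f n x - indicator A x)) \<longlonglongrightarrow> 0"
    proof (rule Lp_dominated_convergence(1)[OF _ I])
      have U: "(\<Union>i. A \<inter> B i) = A" using rB D(4) A(2) by blast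
      have fin: "A \<inter> (\<Union>i<n. B i) = (\<Union>i<n. A \<inter> B i)" for n by blast
      have "(\<lambda>n. ?f n x) \<longlonglongrightarrow> indicator A x" for x
        using LIMSEQ_indicator_UN[of "\<lambda>i. A \<inter> B i" x] unfolding U fin .
      then show "AE x in lborel. (\<lambda>n. ?f n x) \<longlonglongrightarrow> indicator A x" by simp
    qed (use q in \<open>auto split: split_indicator\<close>)
  qed
qed

lemma test_approx_Lp:
  assumes "open G" and f: "f \<in> Lp q lborel" and out: "\<And>x. x \<notin> G \<Longrightarrow> f x = 0"
  shows "test_approx q G f"
proof -
  have fm: "f \<in> borel_measurable borel" using Lp_measurable[OF f] by simp
  obtain s where s: "\<And>i. simple_function borel (s i)" "\<And>x. (\<lambda>i. s i x) \<longlonglongrightarrow> f x"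
      "\<And>i x. norm (s i x) \<le> 2 * norm (f x)"
    using borel_measurable_implies_sequence_metric[OF fm, of 0] by auto
  have sm [measurable]: "s i \<in> borel_measurable borel" for i using s(1) by (rule borel_measurable_simple_function)
  have "test_approx q G (s i)" for i
  proof -
    have fin: "finite (range (s i))" using s(1)[of i] by (simp add: simple_function_def)
    have rep: "s i = (\<lambda>x. \<Sum>y\<in>range (s i). y * indicator (s i -` {y}) x)"
      using fin by (intro ext) (simp add: indicator_def if_distrib sum.delta' cong: if_cong)
    have "test_approx q G (\<lambda>x. y * indicator (s i -` {y}) x)" for y
    proof (cases "y = 0")
      case True
      then show ?thesis using test_approx_zero by simp
    next
      case False
      have A: "s i -` {y} \<in> sets borel"
        using measurable_sets[OF sm[of i], of "{y}"] by simp
      have "(indicator (s i -` {y}) :: real ^ 'n \<Rightarrow> real) \<in> Lp q lborel"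
      \<comment> \<open>On the level set of \<open>y \<noteq> 0\<close> the bound
        \<open>\<bar>s i x\<bar> \<le> 2 * \<bar>f x\<bar>\<close> gives a Chebyshev estimate; the
        same bound forces this set into \<open>G\<close>.\<close>
      proof (rule Lp_mono[OF f, where C="2 / \<bar>y\<bar>"])
        show "AE x in lborel. norm (indicator (s i -` {y}) x :: real) \<le> 2 / \<bar>y\<bar> * norm (f x)"
          using s(3)[of i] False by (auto simp: field_simps split: split_indicator)
      qed (use A q in auto)
      moreover have "s i -` {y} \<subseteq> G"
      proof
        fix x assume "x \<in> s i -` {y}"
        then show "x \<in> G" using s(3)[of i x] out[of x] False by (cases "x \<in> G") auto
      qed
      ultimately show ?thesis using A by (intro test_approx_cmult test_approx_set \<open>open G\<close>)
    qed
    then show ?thesis by (subst rep) (rule test_approx_sum)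
  qed
  then show ?thesis
  proof (rule test_approx_lim[OF _ f])
    show "(\<lambda>n. Lp_norm q lborel (\<lambda>x. s n x - f x)) \<longlonglongrightarrow> 0"
    proof (rule Lp_dominated_convergence(1)[OF _ Lp_scaleR[OF f, of 2]])
      show "AE x in lborel. norm (s n x) \<le> norm (2 *\<^sub>R f x)" for n
        using s(3)[of n] by (simp add: abs_mult)
    qed (use q s(2) fm in auto)
  qed
qed

end

lemma test_functions_dense:
  fixes f :: "real ^ 'n::finite \<Rightarrow> real ^ 'n"
  assumes q: "q \<ge> 1" and "open G" and f: "f \<in> Lp q lborel" and out: "\<And>x. x \<notin> G \<Longrightarrow> f x = 0"
  obtains F where "\<And>n i. (\<lambda>x. F n x $ i) \<in> test_functions G"
    "(\<lambda>n::nat. Lp_norm q lborel (\<lambda>x. f x - F n x)) \<longlonglongrightarrow> 0"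
proof -
  have "\<exists>\<phi>. (\<forall>n::nat. \<phi> n \<in> test_functions G) \<and> (\<lambda>n. Lp_norm q lborel (\<lambda>x. f x $ i - \<phi> n x)) \<longlonglongrightarrow> 0" for i
  proof -
    have "test_approx q G (\<lambda>x. f x $ i)"
      by (rule test_approx_Lp) (use assms Lp_component[OF f, of i] in auto)
    from test_approx_seq[OF q this] show ?thesis by blast
  qed
  then obtain \<phi> where \<phi>: "\<And>i n::nat. \<phi> i n \<in> test_functions G"
      "\<And>i. (\<lambda>n. Lp_norm q lborel (\<lambda>x. f x $ i - \<phi> i n x)) \<longlonglongrightarrow> 0" by metis
  define F where "F n x = (\<chi> i. \<phi> i n x)" for n x
  have d: "(\<lambda>x. f x $ i - \<phi> i n x) \<in> Lp q lborel" for i n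
    using q by (intro Lp_diff Lp_component f test_Lp[OF \<phi>(1)]) auto
  have le: "Lp_norm q lborel (\<lambda>x. f x - F n x) \<le> (\<Sum>i\<in>UNIV. Lp_norm q lborel (\<lambda>x. f x $ i - \<phi> i n x))" for n
  proof -
    have "Lp_norm q lborel (\<lambda>x. f x - F n x) \<le> Lp_norm q lborel (\<lambda>x. \<Sum>i\<in>UNIV. norm (f x $ i - \<phi> i n x))"
    proof (rule Lp_norm_mono)
      show "(\<lambda>x. \<Sum>i\<in>UNIV. norm (f x $ i - \<phi> i n x)) \<in> Lp q lborel"
        using q d by (intro Lp_sum Lp_norm_fun) auto
      have "F n \<in> Lp q lborel" by (rule Lp_componentI) (use q in \<open>auto simp: F_def intro: test_Lp[OF \<phi>(1)]\<close>)
      then show "(\<lambda>x. f x - F n x) \<in> borel_measurable lborel" using f by measurable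
      show "AE x in lborel. norm (f x - F n x) \<le> norm (\<Sum>i\<in>UNIV. norm (f x $ i - \<phi> i n x))"
      proof (rule AE_I2)
        fix x
        have "norm (f x - F n x) \<le> (\<Sum>i\<in>UNIV. \<bar>(f x - F n x) $ i\<bar>)" by (rule norm_le_l1_cart)
        then show "norm (f x - F n x) \<le> norm (\<Sum>i\<in>UNIV. norm (f x $ i - \<phi> i n x))"
          by (simp add: F_def sum_nonneg)
      qed
    qed (use q in auto)
    also have "\<dots> \<le> (\<Sum>i\<in>UNIV. Lp_norm q lborel (\<lambda>x. norm (f x $ i - \<phi> i n x)))"
      using q d by (intro Lp_norm_sum_le Lp_norm_fun) auto
    finally show ?thesis by (simp add: Lp_norm_def)
  qed
  have "(\<lambda>n. Lp_norm q lborel (\<lambda>x. f x - F n x)) \<longlonglongrightarrow> 0"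
  proof (rule tendsto_sandwich[OF _ _ tendsto_const])
    show "(\<lambda>n. \<Sum>i\<in>UNIV. Lp_norm q lborel (\<lambda>x. f x $ i - \<phi> i n x)) \<longlonglongrightarrow> 0"
      by (intro tendsto_null_sum \<phi>(2))
  qed (use le in \<open>auto simp: Lp_norm_nonneg\<close>)
  then show ?thesis by (rule that[rotated]) (simp add: F_def \<phi>(1))
qed

section \<open>Weak gradients\<close>

lemma integral_lborel_on_eq:
  fixes F :: "real ^ 'n::finite \<Rightarrow> 'b::euclidean_space"
  assumes "G \<in> sets borel" "\<And>x. x \<notin> G \<Longrightarrow> F x = 0"
  shows "(\<integral>x. F x \<partial>lborel_on G) = (\<integral>x. F x \<partial>lborel)"
  using assms by (subst integral_restrict_space)
    (auto intro!: Bochner_Integration.integral_cong split: split_indicator)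

lemma test_functions_zero_outside: "\<phi> \<in> test_functions G \<Longrightarrow> x \<notin> G \<Longrightarrow> \<phi> x = 0"
  using test_functionsD by blast

lemma is_weak_grad_iff:
  assumes "G \<in> sets borel"
  shows "is_weak_grad G f g \<longleftrightarrow> f \<in> Lp_loc 1 G \<and> g \<in> Lp_loc 1 G \<and>
     (\<forall>\<phi> \<in> test_functions G. \<forall>i::'n::finite.
        (\<integral>x. f x * partial_deriv i \<phi> x \<partial>lborel) = - (\<integral>x. g x $ i * \<phi> x \<partial>lborel))"
proof -
  have "(\<integral>x. f x * partial_deriv i \<phi> x \<partial>lborel_on G) = (\<integral>x. f x * partial_deriv i \<phi> x \<partial>lborel)"
    "(\<integral>x. g x $ i * \<phi> x \<partial>lborel_on G) = (\<integral>x. g x $ i * \<phi> x \<partial>lborel)"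
    if "\<phi> \<in> test_functions G" for \<phi> i
    using that test_functions_zero_outside[OF test_functions_partial_deriv[OF that]]
      test_functions_zero_outside[OF that] assms
    by (auto intro!: integral_lborel_on_eq)
  then show ?thesis unfolding is_weak_grad_def by auto
qed

lemma is_weak_gradD:
  assumes "is_weak_grad G f g" "G \<in> sets borel"
  shows "f \<in> Lp_loc 1 G" "g \<in> Lp_loc 1 G"
    "\<phi> \<in> test_functions G \<Longrightarrow> (\<integral>x. f x * partial_deriv i \<phi> x \<partial>lborel) = - (\<integral>x. g x $ i * \<phi> x \<partial>lborel)"
  using assms by (auto simp: is_weak_grad_iff)

lemma is_weak_grad_subset:
  assumes "is_weak_grad G f g" "H \<subseteq> G" "G \<in> sets borel" "H \<in> sets borel"
  shows "is_weak_grad H f g"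
  using assms test_functions_mono[OF _ assms(2)] by (auto simp: is_weak_grad_iff intro: Lp_loc_subset)

lemma Lp_loc_component:
  fixes g :: "real ^ 'm::finite \<Rightarrow> real ^ 'n::finite"
  assumes "g \<in> Lp_loc q G" "q \<ge> 0"
  shows "(\<lambda>x. g x $ i) \<in> Lp_loc q G"
  using assms by (auto simp: Lp_loc_def intro: Lp_component)

lemma integral_test_cong_AE:
  fixes f f' :: "real ^ 'n::finite \<Rightarrow> real"
  assumes "f \<in> Lp_loc 1 G" "f' \<in> Lp_loc 1 G" "AE x in lborel. x \<in> G \<longrightarrow> f x = f' x" "\<phi> \<in> test_functions G"
  shows "(\<integral>x. f x * \<phi> x \<partial>lborel) = (\<integral>x. f' x * \<phi> x \<partial>lborel)"
proof (rule integral_cong_AE)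
  show "AE x in lborel. f x * \<phi> x = f' x * \<phi> x"
    using assms(3) by eventually_elim (use test_functions_zero_outside[OF assms(4)] in auto)
qed (use test_integrable_mult[OF assms(1,4)] test_integrable_mult[OF assms(2,4)] in auto)

lemma is_weak_grad_cong:
  fixes f f' :: "real ^ 'n::finite \<Rightarrow> real"
  assumes "is_weak_grad G f g" "G \<in> sets borel" "f' \<in> Lp_loc 1 G" "g' \<in> Lp_loc 1 G"
    "AE x in lborel. x \<in> G \<longrightarrow> f' x = f x" "AE x in lborel. x \<in> G \<longrightarrow> g' x = g x"
  shows "is_weak_grad G f' g'"
  unfolding is_weak_grad_iff[OF assms(2)]
proof (intro conjI ballI allI)
  note D = is_weak_gradD[OF assms(1,2)]
  fix \<phi> i assume \<phi>: "\<phi> \<in> test_functions G"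
  have "(\<integral>x. f' x * partial_deriv i \<phi> x \<partial>lborel) = (\<integral>x. f x * partial_deriv i \<phi> x \<partial>lborel)"
    by (rule integral_test_cong_AE[OF assms(3) D(1) assms(5) test_functions_partial_deriv[OF \<phi>]])
  also have "\<dots> = - (\<integral>x. g x $ i * \<phi> x \<partial>lborel)" by (rule D(3)[OF \<phi>])
  also have "(\<integral>x. g x $ i * \<phi> x \<partial>lborel) = (\<integral>x. g' x $ i * \<phi> x \<partial>lborel)"
    by (rule integral_test_cong_AE[OF _ _ _ \<phi>])
      (use assms(4,6) D(2) in \<open>auto intro!: Lp_loc_component elim: eventually_mono\<close>)
  finally show "(\<integral>x. f' x * partial_deriv i \<phi> x \<partial>lborel) = - (\<integral>x. g' x $ i * \<phi> x \<partial>lborel)" .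
qed fact+

lemma Lp_loc_diff:
  fixes f g :: "real ^ 'n::finite \<Rightarrow> 'b::euclidean_space"
  assumes "f \<in> Lp_loc q G" "g \<in> Lp_loc q G" "q \<ge> 0"
  shows "(\<lambda>x. f x - g x) \<in> Lp_loc q G"
  using assms by (auto simp: Lp_loc_def intro: Lp_diff)

lemma Lp_loc_add:
  fixes f g :: "real ^ 'n::finite \<Rightarrow> 'b::euclidean_space"
  assumes "f \<in> Lp_loc q G" "g \<in> Lp_loc q G" "q \<ge> 0"
  shows "(\<lambda>x. f x + g x) \<in> Lp_loc q G"
  using assms by (auto simp: Lp_loc_def intro: Lp_add)

lemma Lp_loc_scaleR:
  fixes f :: "real ^ 'n::finite \<Rightarrow> 'b::euclidean_space"
  assumes "f \<in> Lp_loc q G" "q \<ge> 0"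
  shows "(\<lambda>x. c *\<^sub>R f x) \<in> Lp_loc q G"
  using assms by (auto simp: Lp_loc_def intro: Lp_scaleR)

lemma fundamental_lemma_eq:
  fixes f g :: "real ^ 'n::finite \<Rightarrow> real"
  assumes "f \<in> Lp_loc 1 G" "g \<in> Lp_loc 1 G" "open G"
    and "\<And>\<phi>. \<phi> \<in> test_functions G \<Longrightarrow> (\<integral>x. f x * \<phi> x \<partial>lborel) = (\<integral>x. g x * \<phi> x \<partial>lborel)"
  shows "AE x in lborel. x \<in> G \<longrightarrow> f x = g x"
proof -
  have "AE x in lborel. x \<in> G \<longrightarrow> f x - g x = 0"
    by (rule fundamental_lemma[OF Lp_loc_diff[OF assms(1,2)] assms(3)])
      (use assms(4) test_integrable_mult[OF assms(1)] test_integrable_mult[OF assms(2)] in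
        \<open>auto simp: left_diff_distrib\<close>)
  then show ?thesis by simp
qed

lemma is_weak_grad_unique:
  fixes f f' :: "real ^ 'n::finite \<Rightarrow> real"
  assumes "is_weak_grad G f g" "is_weak_grad G f' g'" "open G" "AE x in lborel. x \<in> G \<longrightarrow> f x = f' x"
  shows "AE x in lborel. x \<in> G \<longrightarrow> g x = g' x"
proof -
  have G: "G \<in> sets borel" using assms(3) by simp
  note D = is_weak_gradD[OF assms(1) G] and D' = is_weak_gradD[OF assms(2) G]
  have "AE x in lborel. x \<in> G \<longrightarrow> g x $ i = g' x $ i" for i
  proof (rule fundamental_lemma_eq)
    fix \<phi> assume \<phi>: "\<phi> \<in> test_functions G"
    from D(3)[OF this, of i] D'(3)[OF this, of i]
      integral_test_cong_AE[OF D(1) D'(1) assms(4) test_functions_partial_deriv[OF \<phi>]]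
    show "(\<integral>x. g x $ i * \<phi> x \<partial>lborel) = (\<integral>x. g' x $ i * \<phi> x \<partial>lborel)" by simp
  qed (use D(2) D'(2) assms(3) in \<open>auto intro: Lp_loc_component\<close>)
  then have "AE x in lborel. \<forall>i. x \<in> G \<longrightarrow> g x $ i = g' x $ i"
    unfolding AE_all_countable by blast
  then show ?thesis by eventually_elim (auto simp: vec_eq_iff)
qed

lemma is_weak_grad_weak_grad:
  "is_weak_grad G f g \<Longrightarrow> is_weak_grad G f (weak_grad G f)"
  unfolding weak_grad_def by (rule someI[of "is_weak_grad G f"])

lemma weak_grad_AE_eq:
  fixes f :: "real ^ 'n::finite \<Rightarrow> real"
  assumes "is_weak_grad G f g" "open G"
  shows "AE x in lborel. x \<in> G \<longrightarrow> weak_grad G f x = g x"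
  using is_weak_grad_unique[OF is_weak_grad_weak_grad[OF assms(1)] assms] by auto

lemma weak_grad_Lp:
  fixes f :: "real ^ 'n::finite \<Rightarrow> real"
  assumes "is_weak_grad G f g" "open G" "g \<in> Lp q (lborel_on G)"
  shows "weak_grad G f \<in> Lp q (lborel_on G)" "Lp_norm q (lborel_on G) (weak_grad G f) = Lp_norm q (lborel_on G) g"
proof -
  have "(\<lambda>x. indicator G x *\<^sub>R weak_grad G f x) \<in> borel_measurable borel"
    using is_weak_grad_weak_grad[OF assms(1)] assms(2) by (auto intro!: Lp_loc_measurable simp: is_weak_grad_def)
  then have m: "weak_grad G f \<in> borel_measurable (lborel_on G)"
    using assms(2) by (subst borel_measurable_restrict_space_iff) auto
  have AE: "AE x in lborel_on G. weak_grad G f x = g x"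
    using weak_grad_AE_eq[OF assms(1,2)] assms(2) by (subst AE_lborel_on_iff) auto
  show "weak_grad G f \<in> Lp q (lborel_on G)" by (rule Lp_cong_AE[OF assms(3) m AE])
  show "Lp_norm q (lborel_on G) (weak_grad G f) = Lp_norm q (lborel_on G) g"
    by (rule Lp_norm_cong_AE[OF _ m AE]) (use assms(3) in auto)
qed

lemma is_weak_grad_add:
  fixes f f' :: "real ^ 'n::finite \<Rightarrow> real"
  assumes "is_weak_grad G f g" "is_weak_grad G f' g'" "G \<in> sets borel"
  shows "is_weak_grad G (\<lambda>x. f x + f' x) (\<lambda>x. g x + g' x)"
  unfolding is_weak_grad_iff[OF assms(3)]
proof (intro conjI ballI allI)
  note D = is_weak_gradD[OF assms(1,3)] and D' = is_weak_gradD[OF assms(2,3)]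
  show "(\<lambda>x. f x + f' x) \<in> Lp_loc 1 G" "(\<lambda>x. g x + g' x) \<in> Lp_loc 1 G"
    using D D' by (auto intro: Lp_loc_add)
  fix \<phi> i assume \<phi>: "\<phi> \<in> test_functions G"
  note \<phi>' = test_functions_partial_deriv[OF \<phi>, of i]
  show "(\<integral>x. (f x + f' x) * partial_deriv i \<phi> x \<partial>lborel) = - (\<integral>x. (g x + g' x) $ i * \<phi> x \<partial>lborel)"
    using test_integrable_mult[OF D(1) \<phi>'] test_integrable_mult[OF D'(1) \<phi>']
      test_integrable_mult[OF Lp_loc_component[OF D(2)] \<phi>, of i]
      test_integrable_mult[OF Lp_loc_component[OF D'(2)] \<phi>, of i] D(3)[OF \<phi>, of i] D'(3)[OF \<phi>, of i]
    by (simp add: distrib_right)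
qed

lemma is_weak_grad_cmult:
  fixes f :: "real ^ 'n::finite \<Rightarrow> real"
  assumes "is_weak_grad G f g" "G \<in> sets borel"
  shows "is_weak_grad G (\<lambda>x. c * f x) (\<lambda>x. c *\<^sub>R g x)"
  unfolding is_weak_grad_iff[OF assms(2)]
proof (intro conjI ballI allI)
  note D = is_weak_gradD[OF assms(1,2)]
  show "(\<lambda>x. c * f x) \<in> Lp_loc 1 G" "(\<lambda>x. c *\<^sub>R g x) \<in> Lp_loc 1 G"
    using Lp_loc_scaleR[OF D(1), of c] Lp_loc_scaleR[OF D(2), of c] by auto
  fix \<phi> i assume \<phi>: "\<phi> \<in> test_functions G"
  show "(\<integral>x. c * f x * partial_deriv i \<phi> x \<partial>lborel) = - (\<integral>x. (c *\<^sub>R g x) $ i * \<phi> x \<partial>lborel)"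
    using D(3)[OF \<phi>, of i] by (simp add: mult.assoc)
qed

lemma is_weak_grad_diff:
  fixes f f' :: "real ^ 'n::finite \<Rightarrow> real"
  assumes "is_weak_grad G f g" "is_weak_grad G f' g'" "G \<in> sets borel"
  shows "is_weak_grad G (\<lambda>x. f x - f' x) (\<lambda>x. g x - g' x)"
  using is_weak_grad_add[OF assms(1) is_weak_grad_cmult[OF assms(2,3), of "-1"] assms(3)] by simp

subsection \<open>Integration by parts\<close>

lemma has_real_derivative_along:
  fixes \<phi> :: "real ^ 'n::finite \<Rightarrow> real"
  assumes "smooth \<phi>"
  shows "((\<lambda>t. \<phi> (x + t *\<^sub>R h)) has_real_derivative grad \<phi> (x + t *\<^sub>R h) \<bullet> h) (at t)"
proof -
  have "((\<phi> \<circ> (\<lambda>t. x + t *\<^sub>R h)) has_derivative ((\<lambda>k. grad \<phi> (x + t *\<^sub>R h) \<bullet> k) \<circ> (\<lambda>s. s *\<^sub>R h))) (at t)"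
    by (intro diff_chain_at has_derivative_grad smooth_differentiable[OF assms])
      (auto intro!: derivative_eq_intros)
  then show ?thesis
    by (simp add: o_def has_field_derivative_def mult_commute_abs)
qed

lemma grad_axis: "grad \<phi> x \<bullet> axis i 1 = partial_deriv i \<phi> (x :: real ^ 'n::finite)"
  by (simp add: inner_axis grad_def)

lemma indicator_smooth_Lp_loc:
  fixes \<psi> :: "real ^ 'n::finite \<Rightarrow> real"
  assumes "smooth \<psi>" "H \<in> sets borel"
  shows "(\<lambda>x. indicator H x * \<psi> x) \<in> Lp_loc 1 G"
proof (rule Lp_loc_1I)
  fix K :: "(real ^ 'n) set" assume "compact K"
  then have "integrable lborel (\<lambda>x. indicator H x *\<^sub>R (indicator K x *\<^sub>R \<psi> x))"
    using assms(2) by (intro integrable_mult_indicator borel_integrable_compact smooth_continuous_on assms(1)) auto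
  then show "integrable lborel (\<lambda>x. indicator K x *\<^sub>R (indicator H x * \<psi> x))" by (simp add: ac_simps)
qed

text \<open>By translation invariance the integral of every difference quotient vanishes.\<close>

lemma integral_partial_deriv_invariant:
  fixes \<phi> :: "real ^ 'n::finite \<Rightarrow> real"
  assumes \<phi>: "\<phi> \<in> test_functions UNIV" and [measurable]: "H \<in> sets borel"
    and H: "\<And>x t. t *\<^sub>R axis i 1 + x \<in> H \<longleftrightarrow> x \<in> H"
  shows "(\<integral>x. indicator H x * partial_deriv i \<phi> x \<partial>lborel) = 0"
proof -
  have [measurable]: "\<phi> \<in> borel_measurable borel" "partial_deriv i \<phi> \<in> borel_measurable borel"
    using \<phi> by (auto intro: smooth_borel_measurable smooth_partial_deriv test_functions_smooth)
  have int: "integrable lborel (\<lambda>x. indicator H x * \<phi> x)"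
    using test_integrable_mult[OF indicator_smooth_Lp_loc[OF smooth_const[of 1]] \<phi>] by simp
  let ?e = "axis i (1::real) :: real ^ 'n"
  define D where "D n x = real (Suc n) * (\<phi> (inverse (real (Suc n)) *\<^sub>R ?e + x) - \<phi> x)" for n x
  obtain M where M: "M > 0" "\<And>x. \<bar>partial_deriv i \<phi> x\<bar> \<le> M"
    using test_functions_bounded[OF test_functions_partial_deriv[OF \<phi>]] by blast
  obtain R where R: "R > 0" "\<And>x. x \<notin> ball 0 R \<Longrightarrow> \<phi> x = 0" using test_functions_ball[OF \<phi>] by blast
  have Dlim: "(\<lambda>n. D n x) \<longlonglongrightarrow> partial_deriv i \<phi> x" for x
  proof -
    have "((\<lambda>t. \<phi> (x + t *\<^sub>R ?e)) has_real_derivative partial_deriv i \<phi> x) (at 0)"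
      using has_real_derivative_along[OF test_functions_smooth[OF \<phi>], of x ?e 0] by (simp add: grad_axis)
    then have "((\<lambda>h. (\<phi> (x + h *\<^sub>R ?e) - \<phi> x) / h) \<longlongrightarrow> partial_deriv i \<phi> x) (at 0)"
      by (simp add: DERIV_def)
    moreover have "filterlim (\<lambda>n. inverse (real (Suc n))) (at 0) sequentially"
      using LIMSEQ_inverse_real_of_nat by (auto simp: filterlim_at eventually_sequentially)
    ultimately have "(\<lambda>n. (\<phi> (x + inverse (real (Suc n)) *\<^sub>R ?e) - \<phi> x) / inverse (real (Suc n))) \<longlonglongrightarrow> partial_deriv i \<phi> x"
      by (rule filterlim_compose)
    then show ?thesis unfolding D_def by (simp add: divide_inverse add.commute mult.commute)
  qed
  have Dle: "\<bar>D n x\<bar> \<le> M" for n x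
  proof -
    have "\<exists>z. 0 < z \<and> z < inverse (real (Suc n)) \<and>
        \<phi> (x + inverse (real (Suc n)) *\<^sub>R ?e) - \<phi> (x + 0 *\<^sub>R ?e) =
        (inverse (real (Suc n)) - 0) * (grad \<phi> (x + z *\<^sub>R ?e) \<bullet> ?e)"
      by (rule MVT2) (auto intro: has_real_derivative_along[OF test_functions_smooth[OF \<phi>]])
    then obtain z where "\<phi> (x + inverse (real (Suc n)) *\<^sub>R ?e) - \<phi> x =
        inverse (real (Suc n)) * partial_deriv i \<phi> (x + z *\<^sub>R ?e)"
      by (auto simp: grad_axis simp del: of_nat_Suc)
    then have "D n x = partial_deriv i \<phi> (x + z *\<^sub>R ?e)"
      unfolding D_def by (simp add: add.commute del: of_nat_Suc)
    then show ?thesis using M by simp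
  qed
  \<comment> \<open>The shifts have length at most 1, so one ball of radius \<open>R + 1\<close>
    contains the supports of all difference quotients and carries the dominating function.\<close>
  have Dz: "D n x = 0" if "x \<notin> ball 0 (R + 1)" for n x
  proof -
    have "norm (inverse (real (Suc n)) *\<^sub>R ?e) \<le> 1" by (simp add: norm_axis_1 inverse_le_1_iff)
    then have "norm (inverse (real (Suc n)) *\<^sub>R ?e + x) \<ge> R"
      using that norm_triangle_ineq4[of "inverse (real (Suc n)) *\<^sub>R ?e + x" "inverse (real (Suc n)) *\<^sub>R ?e"] by auto
    then show ?thesis using R that by (simp add: D_def)
  qed
  have "(\<lambda>n. \<integral>x. indicator H x * D n x \<partial>lborel) \<longlonglongrightarrow> (\<integral>x. indicator H x * partial_deriv i \<phi> x \<partial>lborel)"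
  proof (rule integral_dominated_convergence[where w="\<lambda>x. M * indicator (ball 0 (R + 1)) x"])
    show "AE x in lborel. norm (indicator H x * D n x) \<le> M * indicator (ball 0 (R + 1)) x" for n
    proof (rule AE_I2)
      fix x
      have "norm (indicator H x * D n x) \<le> \<bar>D n x\<bar>" by (auto simp: indicator_def)
      also have "\<dots> \<le> M * indicator (ball 0 (R + 1)) x"
        using Dle[of n x] Dz[of x n] M by (cases "x \<in> ball 0 (R + 1)") auto
      finally show "norm (indicator H x * D n x) \<le> M * indicator (ball 0 (R + 1)) x" .
    qed
    show "integrable lborel (\<lambda>x. M * indicator (ball 0 (R + 1)) (x :: real ^ 'n))"
      by (intro integrable_mult_right) (simp add: emeasure_lborel_ball_finite[unfolded infinity_ennreal_def])
    show "(\<lambda>x. indicator H x * D n x) \<in> borel_measurable lborel" for n unfolding D_def by measurable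
  qed (use Dlim in \<open>auto intro!: tendsto_intros\<close>)
  moreover have "(\<integral>x. indicator H x * D n x \<partial>lborel) = 0" for n
  proof -
    let ?a = "inverse (real (Suc n)) *\<^sub>R ?e"
    have eq: "indicator H x * D n x = real (Suc n) * (indicator H (?a + x) * \<phi> (?a + x) - indicator H x * \<phi> x)" for x
      by (simp only: D_def indicator_def H) (simp add: algebra_simps)
    have "(\<integral>x. indicator H (?a + x) * \<phi> (?a + x) \<partial>lborel) = (\<integral>x. indicator H x * \<phi> x \<partial>lborel)"
      by (rule integral_translate) measurable
    then show ?thesis
      unfolding eq using int integrable_translate[OF int, of ?a] by simp
  qed
  ultimately show ?thesis by (simp add: LIMSEQ_const_iff)
qed

lemma integral_by_parts_invariant:
  fixes \<phi> \<psi> :: "real ^ 'n::finite \<Rightarrow> real"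
  assumes \<phi>: "\<phi> \<in> test_functions UNIV" and \<psi>: "smooth \<psi>" and [measurable]: "H \<in> sets borel"
    and H: "\<And>x t. t *\<^sub>R axis i 1 + x \<in> H \<longleftrightarrow> x \<in> H"
  shows "(\<integral>x. indicator H x * \<psi> x * partial_deriv i \<phi> x \<partial>lborel) = - (\<integral>x. indicator H x * partial_deriv i \<psi> x * \<phi> x \<partial>lborel)"
proof -
  have "(\<integral>x. indicator H x * partial_deriv i (\<lambda>x. \<phi> x * \<psi> x) x \<partial>lborel) = 0"
    by (rule integral_partial_deriv_invariant[OF test_functions_mult[OF \<phi> \<psi>] _ H]) measurable
  also have "(\<lambda>x. indicator H x * partial_deriv i (\<lambda>x. \<phi> x * \<psi> x) x) =
      (\<lambda>x. indicator H x * partial_deriv i \<psi> x * \<phi> x + indicator H x * \<psi> x * partial_deriv i \<phi> x)"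
    by (subst smooth_partial_mult[OF test_functions_smooth[OF \<phi>] \<psi>]) (auto simp: algebra_simps)
  finally show ?thesis
    using test_integrable_mult[OF indicator_smooth_Lp_loc[OF smooth_partial_deriv[OF \<psi>, of i]] \<phi>]
      test_integrable_mult[OF indicator_smooth_Lp_loc[OF \<psi>] test_functions_partial_deriv[OF \<phi>, of i]] by simp
qed

lemma is_weak_grad_smooth:
  fixes \<psi> :: "real ^ 'n::finite \<Rightarrow> real"
  assumes "smooth \<psi>" "G \<in> sets borel"
  shows "is_weak_grad G \<psi> (grad \<psi>)"
  unfolding is_weak_grad_iff[OF assms(2)]
proof (intro conjI ballI allI)
  show "\<psi> \<in> Lp_loc 1 G" by (rule smooth_Lp_loc[OF assms(1)])
  show "grad \<psi> \<in> Lp_loc 1 G"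
    by (rule Lp_loc_1I, rule borel_integrable_compact)
      (auto simp: grad_def[abs_def] intro!: continuous_on_vec_lambda smooth_continuous_on smooth_partial_deriv assms)
  fix \<phi> i assume "\<phi> \<in> test_functions G"
  then have "\<phi> \<in> test_functions UNIV" by (rule test_functions_mono) simp
  from integral_by_parts_invariant[OF this assms(1), of UNIV i]
  show "(\<integral>x. \<psi> x * partial_deriv i \<phi> x \<partial>lborel) = - (\<integral>x. grad \<psi> x $ i * \<phi> x \<partial>lborel)"
    by (simp add: grad_nth)
qed

lemma grad_test_Lp:
  fixes \<phi> :: "real ^ 'n::finite \<Rightarrow> real"
  assumes "\<phi> \<in> test_functions G" "q \<ge> 0"
  shows "grad \<phi> \<in> Lp q lborel"
  by (rule Lp_componentI) (auto simp: grad_nth assms intro: test_Lp[OF test_functions_partial_deriv[OF assms(1)]])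

subsection \<open>Translation estimates\<close>

lemma integrable_prod_mult:
  fixes f :: "'a::euclidean_space \<Rightarrow> real" and k :: "'b::euclidean_space \<Rightarrow> real"
  assumes f: "integrable lborel f" and k: "integrable lborel k"
  shows "integrable (lborel \<Otimes>\<^sub>M lborel) (\<lambda>(x, y). f x * k y)"
proof (rule lborel_pair.Fubini_integrable)
  have [measurable]: "f \<in> borel_measurable borel" "k \<in> borel_measurable borel" using f k by auto
  show "(\<lambda>(x, y). f x * k y) \<in> borel_measurable (lborel \<Otimes>\<^sub>M lborel)" by measurable
  show "integrable lborel (\<lambda>x. \<integral>y. norm (case (x, y) of (x, y) \<Rightarrow> f x * k y) \<partial>lborel)"
    using f k by (simp add: abs_mult)
qed (use k in simp)

lemma Lp_loc_translate:
  fixes g :: "real ^ 'n::finite \<Rightarrow> 'b::euclidean_space"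
  assumes "g \<in> Lp_loc 1 UNIV"
  shows "(\<lambda>x. g (a + x)) \<in> Lp_loc 1 UNIV"
proof (rule Lp_loc_1I)
  fix K :: "(real ^ 'n) set" assume "compact K"
  then have "integrable lborel (\<lambda>x. indicator ((+) a ` K) x *\<^sub>R g x)"
    by (intro Lp_loc_integrable[OF assms] compact_translation) auto
  from integrable_translate[OF this, of a]
  show "integrable lborel (\<lambda>x. indicator K x *\<^sub>R g (a + x))"
    by (simp add: indicator_def inj_image_mem_iff)
qed

text \<open>Prepares Fubini for averages of \<open>g\<close> along a segment: for \<open>t\<close>
  in the unit interval the shifted point stays in a ball of radius \<open>R + norm h\<close>, and by
  translation invariance the inner integral is bounded independently of \<open>t\<close>.\<close>

lemma segment_integrable:
  fixes g :: "real ^ 'n::finite \<Rightarrow> real ^ 'n"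
  assumes g: "g \<in> Lp_loc 1 UNIV" and [measurable]: "\<psi> \<in> borel_measurable borel"
    and M: "\<And>x. \<bar>\<psi> x\<bar> \<le> M" and R: "\<And>x. x \<notin> cball 0 R \<Longrightarrow> \<psi> x = 0"
  shows "integrable (lborel \<Otimes>\<^sub>M lborel) (\<lambda>(t::real, x). \<psi> x * (indicator {0..1} t * (h \<bullet> g (t *\<^sub>R h + x))))"
proof (rule lborel_pair.Fubini_integrable)
  have [measurable]: "g \<in> borel_measurable borel" by (rule Lp_loc_UNIV_measurable[OF g])
  let ?R = "R + norm h"
  let ?k = "\<lambda>x. indicator (cball 0 ?R) x * norm (g x)"
  have k: "integrable lborel ?k"
    using integrable_norm[OF Lp_loc_integrable[OF g compact_cball[of 0 ?R]]] by simp
  have M0: "M \<ge> 0" using M[of 0] by simp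
  have [measurable]: "cball 0 ?R \<in> sets (borel :: (real ^ 'n) measure)" by simp
  have le: "norm (\<psi> x * (indicator {0..1} t * (h \<bullet> g (t *\<^sub>R h + x)))) \<le>
      indicator {0..1} t * (M * norm h * ?k (t *\<^sub>R h + x))" for t :: real and x
  proof (cases "t \<in> {0..1} \<and> x \<in> cball 0 R")
    case True
    have "norm (t *\<^sub>R h + x) \<le> norm (t *\<^sub>R h) + norm x" by (rule norm_triangle_ineq)
    also have "\<dots> \<le> norm h + R" using True by (intro add_mono) (auto intro: mult_left_le_one_le)
    finally have "t *\<^sub>R h + x \<in> cball 0 ?R" by simp
    moreover have "\<bar>\<psi> x\<bar> * \<bar>h \<bullet> g (t *\<^sub>R h + x)\<bar> \<le> M * (norm h * norm (g (t *\<^sub>R h + x)))"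
      using M M0 by (intro mult_mono Cauchy_Schwarz_ineq2) auto
    ultimately show ?thesis using True by (simp add: abs_mult mult.assoc)
  next
    case False
    then show ?thesis using R[of x] M0 by (auto simp: indicator_def)
  qed
  have int: "integrable lborel (\<lambda>x. \<psi> x * (indicator {0..1} t * (h \<bullet> g (t *\<^sub>R h + x))))" for t :: real
  proof (rule Bochner_Integration.integrable_bound)
    show "integrable lborel (\<lambda>x. indicator {0..1} t * (M * norm h * ?k (t *\<^sub>R h + x)))"
      using integrable_translate[OF k, of "t *\<^sub>R h"] by (intro integrable_mult_right)
  qed (use le in \<open>auto intro: order_trans[OF _ abs_ge_self]\<close>)
  show "(\<lambda>(t::real, x). \<psi> x * (indicator {0..1} t * (h \<bullet> g (t *\<^sub>R h + x)))) \<in> borel_measurable (lborel \<Otimes>\<^sub>M lborel)"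
    by measurable
  show "integrable lborel (\<lambda>t. \<integral>x. norm (case (t, x) of (t::real, x) \<Rightarrow>
      \<psi> x * (indicator {0..1} t * (h \<bullet> g (t *\<^sub>R h + x)))) \<partial>lborel)"
  proof (rule Bochner_Integration.integrable_bound)
    show "integrable lborel (\<lambda>t::real. indicator {0..1} t * (M * norm h * (\<integral>x. ?k x \<partial>lborel)))"
      by (intro integrable_mult_left) simp
    show "AE t in lborel. norm (\<integral>x. norm (case (t, x) of (t::real, x) \<Rightarrow>
        \<psi> x * (indicator {0..1} t * (h \<bullet> g (t *\<^sub>R h + x)))) \<partial>lborel)
        \<le> norm (indicator {0..1} t * (M * norm h * (\<integral>x. ?k x \<partial>lborel)))"
    proof (rule AE_I2)
      fix t :: real
      have "(\<integral>x. norm (\<psi> x * (indicator {0..1} t * (h \<bullet> g (t *\<^sub>R h + x)))) \<partial>lborel) \<le>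
          (\<integral>x. indicator {0..1} t * (M * norm h * ?k (t *\<^sub>R h + x)) \<partial>lborel)"
        using int[of t] integrable_translate[OF k, of "t *\<^sub>R h"] le by (intro integral_mono) auto
      also have "\<dots> = indicator {0..1} t * (M * norm h * (\<integral>x. ?k (t *\<^sub>R h + x) \<partial>lborel))"
        by simp
      also have "(\<integral>x. ?k (t *\<^sub>R h + x) \<partial>lborel) = (\<integral>x. ?k x \<partial>lborel)"
        by (rule integral_translate) measurable
      finally show "norm (\<integral>x. norm (case (t, x) of (t::real, x) \<Rightarrow>
          \<psi> x * (indicator {0..1} t * (h \<bullet> g (t *\<^sub>R h + x)))) \<partial>lborel)
          \<le> norm (indicator {0..1} t * (M * norm h * (\<integral>x. ?k x \<partial>lborel)))" by simp
    qed
  qed measurable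
  show "AE t in lborel. integrable lborel (\<lambda>x. case (t, x) of (t::real, x) \<Rightarrow>
      \<psi> x * (indicator {0..1} t * (h \<bullet> g (t *\<^sub>R h + x))))"
    using int by simp
qed
 
text \<open>The fundamental theorem of calculus along a segment is available for test functions;
  translation and Fubini carry it over to \<open>u\<close> under the integral, and the fundamental
  lemma removes the test function.\<close>

lemma weak_grad_translation:
  fixes u :: "real ^ 'n::finite \<Rightarrow> real"
  assumes "is_weak_grad UNIV u g"
  shows "AE x in lborel. u (h + x) - u x = (\<integral>t. indicator {0..1} t * (h \<bullet> g (t *\<^sub>R h + x)) \<partial>lborel)"
proof -
  have D: "u \<in> Lp_loc 1 UNIV" "g \<in> Lp_loc 1 UNIV"
    "\<And>\<phi> i. \<phi> \<in> test_functions UNIV \<Longrightarrow> (\<integral>x. u x * partial_deriv i \<phi> x \<partial>lborel) = - (\<integral>x. g x $ i * \<phi> x \<partial>lborel)"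
    using is_weak_gradD[OF assms] by auto
  have [measurable]: "u \<in> borel_measurable borel" "g \<in> borel_measurable borel"
    using D Lp_loc_UNIV_measurable by auto
  define P where "P x = (\<integral>t. indicator {0..1} t * (h \<bullet> g (t *\<^sub>R h + x)) \<partial>lborel)" for x
  have P_loc: "P \<in> Lp_loc 1 UNIV"
  proof (rule Lp_loc_1I)
    fix K :: "(real ^ 'n) set" assume K: "compact K"
    then obtain R where R: "K \<subseteq> cball 0 R"
      by (meson ball_subset_cball bounded_subset_ballD compact_imp_bounded order_trans)
    have [measurable]: "K \<in> sets borel" using K by (rule borel_compact)
    have "integrable (lborel \<Otimes>\<^sub>M lborel) (\<lambda>(t::real, x). indicator K x * (indicator {0..1} t * (h \<bullet> g (t *\<^sub>R h + x))))"
      by (rule segment_integrable[OF D(2), where M=1 and R=R]) (use R in \<open>auto split: split_indicator\<close>)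
    from lborel_pair.integrable_snd[OF this]
    show "integrable lborel (\<lambda>x. indicator K x *\<^sub>R P x)" by (simp add: P_def)
  qed
  have "AE x in lborel. x \<in> UNIV \<longrightarrow> u (h + x) - u x = P x"
  proof (rule fundamental_lemma_eq[OF _ P_loc])
    show "(\<lambda>x. u (h + x) - u x) \<in> Lp_loc 1 UNIV" by (intro Lp_loc_diff Lp_loc_translate D) simp
    fix \<psi> :: "real ^ 'n \<Rightarrow> real" assume \<psi>: "\<psi> \<in> test_functions UNIV"
    note s = test_functions_smooth[OF \<psi>]
    have [measurable]: "\<psi> \<in> borel_measurable borel" by (rule smooth_borel_measurable[OF s])
    have [measurable]: "grad \<psi> \<in> borel_measurable borel" using grad_test_Lp[OF \<psi>, of 1] Lp_measurable by fastforce
    note \<psi>t = test_functions_translate[OF \<psi>]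
    obtain M where M: "M > 0" "\<And>x. \<bar>\<psi> x\<bar> \<le> M" using test_functions_bounded[OF \<psi>] by blast
    obtain R where R: "R > 0" "\<And>x. x \<notin> ball 0 R \<Longrightarrow> \<psi> x = 0" using test_functions_ball[OF \<psi>] by blast
    \<comment> \<open>Substitution moves the translation to the test function, whose translate is
      again a test function, so the weak derivative applies for each fixed \<open>t\<close>.\<close>
    have inner: "(\<integral>x. \<psi> x * (indicator {0..1} t * (h \<bullet> g (t *\<^sub>R h + x))) \<partial>lborel) =
        - (\<integral>x. u x * (indicator {0..1} t * (grad \<psi> (- t *\<^sub>R h + x) \<bullet> h)) \<partial>lborel)" for t :: real
    proof -
      let ?\<psi> = "\<lambda>x. \<psi> (- t *\<^sub>R h + x)"
      note T = \<psi>t[of "- t *\<^sub>R h"]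
      have pd: "partial_deriv i ?\<psi> x = grad \<psi> (- t *\<^sub>R h + x) $ i" for i x
        by (simp only: partial_deriv_translate[OF s] grad_nth)
      have int1: "integrable lborel (\<lambda>x. h $ i * (g x $ i * ?\<psi> x))" for i
        by (intro integrable_mult_right test_integrable_mult[OF _ T] Lp_loc_component D) simp
      have int2: "integrable lborel (\<lambda>x. h $ i * (u x * partial_deriv i ?\<psi> x))" for i
        by (intro integrable_mult_right test_integrable_mult[OF _ test_functions_partial_deriv[OF T]] D)
      have "(\<integral>x. \<psi> x * (h \<bullet> g (t *\<^sub>R h + x)) \<partial>lborel) = (\<integral>x. ?\<psi> (t *\<^sub>R h + x) * (h \<bullet> g (t *\<^sub>R h + x)) \<partial>lborel)"
        by simp
      also have "\<dots> = (\<integral>x. ?\<psi> x * (h \<bullet> g x) \<partial>lborel)" by (rule integral_translate) measurable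
      also have "\<dots> = (\<integral>x. (\<Sum>i\<in>UNIV. h $ i * (g x $ i * ?\<psi> x)) \<partial>lborel)"
        by (simp add: inner_vec_def sum_distrib_left ac_simps)
      also have "\<dots> = (\<Sum>i\<in>UNIV. h $ i * (\<integral>x. g x $ i * ?\<psi> x \<partial>lborel))"
        using int1 by simp
      also have "\<dots> = (\<Sum>i\<in>UNIV. h $ i * - (\<integral>x. u x * partial_deriv i ?\<psi> x \<partial>lborel))"
        using D(3)[OF T] by simp
      also have "\<dots> = - (\<integral>x. (\<Sum>i\<in>UNIV. h $ i * (u x * partial_deriv i ?\<psi> x)) \<partial>lborel)"
        using int2 by (simp add: sum_negf)
      also have "(\<lambda>x. \<Sum>i\<in>UNIV. h $ i * (u x * partial_deriv i ?\<psi> x)) = (\<lambda>x. u x * (grad \<psi> (- t *\<^sub>R h + x) \<bullet> h))"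
        unfolding pd by (simp add: inner_vec_def sum_distrib_left ac_simps)
      finally show ?thesis by (cases "t \<in> {0..1}") simp_all
    qed
    have FTC: "\<psi> (- h + x) - \<psi> x = - (\<integral>t. indicator {0..1} t * (grad \<psi> (- t *\<^sub>R h + x) \<bullet> h) \<partial>lborel)" for x
    proof -
      have cont: "isCont (\<lambda>t. grad \<psi> (x + t *\<^sub>R - h) \<bullet> - h) t" for t
      proof -
        have "continuous_on UNIV (\<lambda>t. grad \<psi> (x + t *\<^sub>R - h))"
          unfolding grad_def
          by (intro continuous_on_vec_lambda continuous_on_compose2[OF smooth_continuous_on[OF smooth_partial_deriv[OF s]]])
            (auto intro!: continuous_intros)
        then show ?thesis by (intro continuous_intros) (simp add: continuous_on_eq_continuous_at)
      qed
      have "(\<integral>t. (grad \<psi> (x + t *\<^sub>R - h) \<bullet> - h) * indicator {0..1} t \<partial>lborel) = \<psi> (x + 1 *\<^sub>R - h) - \<psi> (x + 0 *\<^sub>R - h)"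
        by (rule integral_FTC_Icc_real[OF _ has_real_derivative_along[OF s] cont]) simp
      then show ?thesis by (simp add: algebra_simps)
    qed
    obtain B where B: "\<And>x. norm (grad \<psi> x) \<le> B" using grad_bounded[OF \<psi>] by blast
    have B0: "B \<ge> 0" using order_trans[OF norm_ge_zero B] .
    have "(\<integral>x. (u (h + x) - u x) * \<psi> x \<partial>lborel) = (\<integral>x. u (h + x) * \<psi> x \<partial>lborel) - (\<integral>x. u x * \<psi> x \<partial>lborel)"
      using test_integrable_mult[OF Lp_loc_translate[OF D(1)] \<psi>] test_integrable_mult[OF D(1) \<psi>]
      by (simp add: left_diff_distrib)
    also have "(\<integral>x. u (h + x) * \<psi> x \<partial>lborel) = (\<integral>x. u (h + x) * \<psi> (- h + (h + x)) \<partial>lborel)" by simp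
    also have "\<dots> = (\<integral>x. u x * \<psi> (- h + x) \<partial>lborel)" by (rule integral_translate) measurable
    also have "\<dots> - (\<integral>x. u x * \<psi> x \<partial>lborel) = (\<integral>x. u x * (\<psi> (- h + x) - \<psi> x) \<partial>lborel)"
      using test_integrable_mult[OF D(1) \<psi>t[of "- h"]] test_integrable_mult[OF D(1) \<psi>]
      by (simp add: right_diff_distrib)
    also have "\<dots> = - (\<integral>x. \<integral>t. u x * (indicator {0..1} t * (grad \<psi> (- t *\<^sub>R h + x) \<bullet> h)) \<partial>lborel \<partial>lborel)"
      unfolding FTC by simp
    also have "(\<integral>x. \<integral>t. u x * (indicator {0..1} t * (grad \<psi> (- t *\<^sub>R h + x) \<bullet> h)) \<partial>lborel \<partial>lborel) =
        (\<integral>t. \<integral>x. u x * (indicator {0..1} t * (grad \<psi> (- t *\<^sub>R h + x) \<bullet> h)) \<partial>lborel \<partial>lborel)"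
    proof (rule lborel_pair.Fubini_integral, rule Bochner_Integration.integrable_bound)
      have u: "integrable lborel (\<lambda>x. indicator (cball 0 (R + norm h)) x * \<bar>u x\<bar>)"
        using integrable_norm[OF Lp_loc_integrable[OF D(1) compact_cball[of 0 "R + norm h"]]] by (simp add: abs_mult)
      show "integrable (lborel \<Otimes>\<^sub>M lborel) (\<lambda>(t::real, x). (indicator {0..1} t * (B * norm h)) * (indicator (cball 0 (R + norm h)) x * \<bar>u x\<bar>))"
        by (intro integrable_prod_mult u integrable_mult_left) simp
      show "(\<lambda>(t::real, x). u x * (indicator {0..1} t * (grad \<psi> (- t *\<^sub>R h + x) \<bullet> h))) \<in> borel_measurable (lborel \<Otimes>\<^sub>M lborel)"
        by measurable
      have gz: "grad \<psi> (- t *\<^sub>R h + x) = 0" if "t \<in> {0..1}" "x \<notin> cball 0 (R + norm h)" for t x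
      proof -
        have "norm x \<le> norm (- t *\<^sub>R h + x) + norm (t *\<^sub>R h)"
          using norm_triangle_ineq[of "- t *\<^sub>R h + x" "t *\<^sub>R h"] by simp
        also have "norm (t *\<^sub>R h) \<le> norm h" using that by (auto intro: mult_left_le_one_le)
        finally have "- t *\<^sub>R h + x \<notin> cball 0 R" using that by auto
        then show ?thesis
          unfolding vec_eq_iff grad_nth
          by (auto intro!: partial_deriv_eq_0[of "cball 0 R"] R(2))
      qed
      have "\<bar>u x * (indicator {0..1} t * (grad \<psi> (- t *\<^sub>R h + x) \<bullet> h))\<bar> \<le>
          indicator {0..1} t * (B * norm h) * (indicator (cball 0 (R + norm h)) x * \<bar>u x\<bar>)" for t :: real and x
      proof (cases "t \<in> {0..1} \<and> x \<in> cball 0 (R + norm h)")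
        case True
        have "\<bar>grad \<psi> (- t *\<^sub>R h + x) \<bullet> h\<bar> \<le> B * norm h"
          by (rule order_trans[OF Cauchy_Schwarz_ineq2]) (intro mult_right_mono B norm_ge_zero)
        then have "\<bar>u x\<bar> * \<bar>grad \<psi> (- t *\<^sub>R h + x) \<bullet> h\<bar> \<le> \<bar>u x\<bar> * (B * norm h)" by (intro mult_left_mono) auto
        then show ?thesis using True by (simp add: abs_mult mult.commute)
      next
        case False
        then show ?thesis using gz[of t x] B0 by (cases "t \<in> {0..1}") auto
      qed
      then show "AE p in lborel \<Otimes>\<^sub>M lborel. norm (case p of (t::real, x) \<Rightarrow> u x * (indicator {0..1} t * (grad \<psi> (- t *\<^sub>R h + x) \<bullet> h))) \<le>
         norm (case p of (t, x) \<Rightarrow> indicator {0..1} t * (B * norm h) * (indicator (cball 0 (R + norm h)) x * \<bar>u x\<bar>))"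
        by (auto intro!: AE_I2 order_trans[OF _ abs_ge_self] simp: case_prod_beta)
    qed
    also have "- \<dots> = (\<integral>t. \<integral>x. \<psi> x * (indicator {0..1} t * (h \<bullet> g (t *\<^sub>R h + x))) \<partial>lborel \<partial>lborel)"
      unfolding inner by simp
    also have "\<dots> = (\<integral>x. \<integral>t. \<psi> x * (indicator {0..1} t * (h \<bullet> g (t *\<^sub>R h + x))) \<partial>lborel \<partial>lborel)"
      by (rule lborel_pair.Fubini_integral[symmetric], rule segment_integrable[OF D(2) _ M(2), where R=R])
        (use R in auto)
    also have "\<dots> = (\<integral>x. P x * \<psi> x \<partial>lborel)" by (simp add: P_def mult.commute)
    finally show "(\<integral>x. (u (h + x) - u x) * \<psi> x \<partial>lborel) = (\<integral>x. P x * \<psi> x \<partial>lborel)" .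
  qed simp
  then show ?thesis by (simp add: P_def)
qed

section \<open>Bounds in \<open>Lp\<close> for differences of translates\<close>

lemma nn_integral_norm_powr:
  "f \<in> Lp q M \<Longrightarrow> q > 0 \<Longrightarrow> (\<integral>\<^sup>+x. ennreal (norm (f x) powr q) \<partial>M) = ennreal (Lp_norm q M f powr q)"
  by (simp add: nn_integral_eq_integral Lp_integrable Lp_norm_powr)

text \<open>Hoelder's inequality against the indicator of the unit interval, which has norm 1,
  bounds the power of the segment mean by the mean of the power; integrating in \<open>x\<close>
  removes the translations. Nonnegative integrals are used because the difference of translates is
  not known to lie in \<open>Lp\<close> beforehand.\<close>

lemma translation_estimate:
  fixes u :: "real ^ 'n::finite \<Rightarrow> real"
  assumes wg: "is_weak_grad UNIV u g" and g: "g \<in> Lp q lborel" and q: "q > 1"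
  shows "(\<integral>\<^sup>+x. ennreal (\<bar>u (h + x) - u x\<bar> powr q) \<partial>lborel) \<le> ennreal ((norm h * Lp_norm q lborel g) powr q)"
proof -
  have [measurable]: "g \<in> borel_measurable borel" using Lp_measurable[OF g] by simp
  let ?J = "\<lambda>x. \<integral>\<^sup>+t. ennreal (indicator {0..1} t * norm (g (t *\<^sub>R h + x)) powr q) \<partial>lborel"
  have J: "(\<integral>\<^sup>+x. ?J x \<partial>lborel) = ennreal (Lp_norm q lborel g powr q)"
  proof -
    have "(\<integral>\<^sup>+x. ?J x \<partial>lborel) = (\<integral>\<^sup>+t. \<integral>\<^sup>+x. ennreal (indicator {0..1} t * norm (g (t *\<^sub>R h + x)) powr q) \<partial>lborel \<partial>(lborel :: real measure))"
      by (rule lborel_pair.Fubini') measurable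
    also have "\<dots> = (\<integral>\<^sup>+t. indicator {0..1} t * (\<integral>\<^sup>+x. ennreal (norm (g (t *\<^sub>R h + x)) powr q) \<partial>lborel) \<partial>(lborel :: real measure))"
      by (intro nn_integral_cong) (auto simp: indicator_def)
    also have "\<dots> = (\<integral>\<^sup>+t. indicator {0..1} t * ennreal (Lp_norm q lborel g powr q) \<partial>(lborel :: real measure))"
      using nn_integral_translate[of "\<lambda>x. ennreal (norm (g x) powr q)"] nn_integral_norm_powr[OF g] q by simp
    also have "\<dots> = ennreal (Lp_norm q lborel g powr q)" by (simp add: nn_integral_multc)
    finally show ?thesis .
  qed
  \<comment> \<open>Finiteness for almost every \<open>x\<close> puts \<open>g\<close> restricted to
    the segment into \<open>Lp\<close>, as Hoelder's inequality requires.\<close>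
  have "AE x in lborel. ?J x \<noteq> \<infinity>"
    by (rule nn_integral_PInf_AE) (simp_all add: J)
  with weak_grad_translation[OF wg, of h]
  have "AE x in lborel. ennreal (\<bar>u (h + x) - u x\<bar> powr q) \<le> ennreal (norm h powr q) * ?J x"
  proof eventually_elim
    case (elim x)
    let ?f = "\<lambda>t::real. indicator {0..1} t *\<^sub>R g (t *\<^sub>R h + x)"
    have eq: "norm (?f t) powr q = indicator {0..1} t * norm (g (t *\<^sub>R h + x)) powr q" for t by (simp add: indicator_def)
    have "integrable lborel (\<lambda>t::real. indicator {0..1} t * norm (g (t *\<^sub>R h + x)) powr q)"
      using elim by (intro integrableI_nonneg) (auto simp: less_top)
    then have f: "?f \<in> Lp q lborel" by (intro LpI) (simp_all only: eq, measurable)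
    have I: "(indicator {0..1} :: real \<Rightarrow> real) \<in> Lp (q / (q - 1)) lborel"
      by (rule LpI) (auto simp: indicator_def[abs_def] intro!: integrableI_bounded_set[where A="{0..1}" and B=1])
    have "Lp_norm (q / (q - 1)) lborel (indicator {0..1} :: real \<Rightarrow> real) = 1"
    proof -
      have "(\<lambda>x. norm (indicator {0..1} x :: real) powr (q / (q - 1))) = indicator {0..1 :: real}" by (auto simp: indicator_def)
      then show ?thesis by (simp add: Lp_norm_def)
    qed
    with Holder[OF q f I] have H: "integrable lborel (\<lambda>t. norm (?f t) * norm (indicator {0..1} t :: real))"
      "(\<integral>t. norm (?f t) * norm (indicator {0..1} t :: real) \<partial>lborel) \<le> Lp_norm q lborel ?f" by auto
    have "\<bar>u (h + x) - u x\<bar> \<le> (\<integral>t. norm h * (norm (?f t) * norm (indicator {0..1} t :: real)) \<partial>lborel)"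
      unfolding elim(1)
    proof -
      have le: "\<bar>indicator {0..1} t * (h \<bullet> g (t *\<^sub>R h + x))\<bar> \<le> norm h * (norm (?f t) * norm (indicator {0..1} t :: real))" for t :: real
        by (auto simp: indicator_def Cauchy_Schwarz_ineq2)
      have i: "integrable lborel (\<lambda>t::real. norm h * (norm (?f t) * norm (indicator {0..1} t :: real)))"
        by (intro integrable_mult_right H)
      then have "integrable lborel (\<lambda>t::real. indicator {0..1} t * (h \<bullet> g (t *\<^sub>R h + x)))"
        by (rule Bochner_Integration.integrable_bound) (use le in \<open>auto intro!: AE_I2 order_trans[OF _ abs_ge_self] simp del: norm_scaleR\<close>)
      with i show "\<bar>\<integral>t. indicator {0..1} t * (h \<bullet> g (t *\<^sub>R h + x)) \<partial>lborel\<bar> \<le>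
          (\<integral>t. norm h * (norm (?f t) * norm (indicator {0..1} t :: real)) \<partial>lborel)"
        by (intro order_trans[OF integral_abs_bound] integral_mono le) auto
    qed
    also have "\<dots> \<le> norm h * Lp_norm q lborel ?f"
      using H(2) by (simp add: mult_left_mono)
    finally have "\<bar>u (h + x) - u x\<bar> powr q \<le> (norm h * Lp_norm q lborel ?f) powr q"
      using q by (intro powr_mono2) auto
    also have "\<dots> = norm h powr q * Lp_norm q lborel ?f powr q" by (simp add: powr_mult Lp_norm_nonneg)
    finally have "ennreal (\<bar>u (h + x) - u x\<bar> powr q) \<le> ennreal (norm h powr q) * ennreal (Lp_norm q lborel ?f powr q)"
      by (simp add: ennreal_mult[symmetric])
    also have "ennreal (Lp_norm q lborel ?f powr q) = ?J x"
      using nn_integral_norm_powr[OF f] q unfolding eq by simp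
    finally show ?case .
  qed
  then have "(\<integral>\<^sup>+x. ennreal (\<bar>u (h + x) - u x\<bar> powr q) \<partial>lborel) \<le> (\<integral>\<^sup>+x. ennreal (norm h powr q) * ?J x \<partial>lborel)"
    by (rule nn_integral_mono_AE)
  also have "\<dots> = ennreal (norm h powr q) * (\<integral>\<^sup>+x. ?J x \<partial>lborel)" by (rule nn_integral_cmult) measurable
  also have "\<dots> = ennreal ((norm h * Lp_norm q lborel g) powr q)"
    unfolding J by (simp add: powr_mult Lp_norm_nonneg ennreal_mult)
  finally show ?thesis .
qed

subsection \<open>The Poincare inequality\<close>

lemma hat_H1_UNIV_iff:
  fixes u :: "real ^ 'n::finite \<Rightarrow> real"
  shows "u \<in> hat_H1 q UNIV \<longleftrightarrow> (\<forall>K. compact K \<longrightarrow> (\<lambda>x. indicator K x *\<^sub>R u x) \<in> Lp q lborel) \<and>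
    (\<exists>g. is_weak_grad UNIV u g \<and> g \<in> Lp q lborel)"
  by (auto simp: hat_H1_def Lp_loc_closure_def Lp_lborel_on_iff borel_compact)

text \<open>With \<open>y = x + h\<close>, pairs of points of the ball have
  \<open>norm h < 2 * R\<close>; this gives both the ball of shifts and the factor
  \<open>2 * R\<close> in the translation estimate.\<close>

lemma double_integral_estimate:
  fixes u :: "real ^ 'n::finite \<Rightarrow> real"
  assumes wg: "is_weak_grad UNIV u g" and g: "g \<in> Lp q lborel" and q: "q > 1" and R: "R > 0"
  shows "(\<integral>\<^sup>+x. indicator (ball 0 R) x * (\<integral>\<^sup>+y. indicator (ball 0 R) y * ennreal (\<bar>u x - u y\<bar> powr q) \<partial>lborel) \<partial>lborel)
     \<le> emeasure lborel (ball (0 :: real ^ 'n) (2 * R)) * ennreal ((2 * R * Lp_norm q lborel g) powr q)"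
proof -
  let ?B = "ball (0 :: real ^ 'n) R" and ?B2 = "ball (0 :: real ^ 'n) (2 * R)"
  have [measurable]: "u \<in> borel_measurable borel" using wg Lp_loc_UNIV_measurable by (auto simp: is_weak_grad_def)
  have [measurable]: "?B \<in> sets borel" "?B2 \<in> sets borel" by simp_all
  have "(\<integral>\<^sup>+y. indicator ?B y * ennreal (\<bar>u x - u y\<bar> powr q) \<partial>lborel) =
      (\<integral>\<^sup>+h. indicator ?B (x + h) * ennreal (\<bar>u x - u (x + h)\<bar> powr q) \<partial>lborel)" for x
    by (rule nn_integral_translate[symmetric]) measurable
  then have "(\<integral>\<^sup>+x. indicator ?B x * (\<integral>\<^sup>+y. indicator ?B y * ennreal (\<bar>u x - u y\<bar> powr q) \<partial>lborel) \<partial>lborel)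
    = (\<integral>\<^sup>+x. indicator ?B x * (\<integral>\<^sup>+h. indicator ?B (x + h) * ennreal (\<bar>u x - u (x + h)\<bar> powr q) \<partial>lborel) \<partial>lborel)"
    by simp
  also have "\<dots> \<le> (\<integral>\<^sup>+x. \<integral>\<^sup>+h. indicator ?B2 h * ennreal (\<bar>u (h + x) - u x\<bar> powr q) \<partial>lborel \<partial>lborel)"
  proof (intro nn_integral_mono)
    fix x :: "real ^ 'n"
    have "indicator ?B x * (\<integral>\<^sup>+h. indicator ?B (x + h) * ennreal (\<bar>u x - u (x + h)\<bar> powr q) \<partial>lborel) =
        (\<integral>\<^sup>+h. indicator ?B x * (indicator ?B (x + h) * ennreal (\<bar>u x - u (x + h)\<bar> powr q)) \<partial>lborel)"
      by (rule nn_integral_cmult[symmetric]) measurable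
    also have "\<dots> \<le> (\<integral>\<^sup>+h. indicator ?B2 h * ennreal (\<bar>u (h + x) - u x\<bar> powr q) \<partial>lborel)"
    proof (intro nn_integral_mono)
      fix h
      have "h \<in> ?B2" if "x \<in> ?B" "x + h \<in> ?B"
        using norm_triangle_ineq4[of "x + h" x] that by simp
      then show "indicator ?B x * (indicator ?B (x + h) * ennreal (\<bar>u x - u (x + h)\<bar> powr q)) \<le>
          indicator ?B2 h * ennreal (\<bar>u (h + x) - u x\<bar> powr q)"
        by (auto simp: indicator_def abs_minus_commute add.commute)
    qed
    finally show "indicator ?B x * (\<integral>\<^sup>+h. indicator ?B (x + h) * ennreal (\<bar>u x - u (x + h)\<bar> powr q) \<partial>lborel) \<le>
      (\<integral>\<^sup>+h. indicator ?B2 h * ennreal (\<bar>u (h + x) - u x\<bar> powr q) \<partial>lborel)" .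
  qed
  also have "\<dots> = (\<integral>\<^sup>+h. \<integral>\<^sup>+x. indicator ?B2 h * ennreal (\<bar>u (h + x) - u x\<bar> powr q) \<partial>lborel \<partial>lborel)"
    by (rule lborel_pair.Fubini') measurable
  also have "\<dots> = (\<integral>\<^sup>+h. indicator ?B2 h * (\<integral>\<^sup>+x. ennreal (\<bar>u (h + x) - u x\<bar> powr q) \<partial>lborel) \<partial>lborel)"
    by (intro nn_integral_cong nn_integral_cmult) measurable
  also have "\<dots> \<le> (\<integral>\<^sup>+h. indicator ?B2 h * ennreal ((2 * R * Lp_norm q lborel g) powr q) \<partial>lborel)"
  proof (intro nn_integral_mono)
    fix h :: "real ^ 'n"
    show "indicator ?B2 h * (\<integral>\<^sup>+x. ennreal (\<bar>u (h + x) - u x\<bar> powr q) \<partial>lborel) \<le>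
      indicator ?B2 h * ennreal ((2 * R * Lp_norm q lborel g) powr q)"
    proof (cases "h \<in> ?B2")
      case True
      note translation_estimate[OF wg g q, of h]
      also have "ennreal ((norm h * Lp_norm q lborel g) powr q) \<le> ennreal ((2 * R * Lp_norm q lborel g) powr q)"
        using True q by (intro ennreal_leI powr_mono2 mult_right_mono) (auto simp: Lp_norm_nonneg)
      finally show ?thesis using True by simp
    qed simp
  qed
  also have "\<dots> = emeasure lborel ?B2 * ennreal ((2 * R * Lp_norm q lborel g) powr q)"
    by (simp add: nn_integral_multc)
  finally show ?thesis .
qed

definition ball_mean :: "real \<Rightarrow> (real ^ 'n::finite \<Rightarrow> real) \<Rightarrow> real" where
  "ball_mean r u = (\<integral>x. indicator (ball 0 r) x * u x \<partial>lborel) / measure lborel (ball (0 :: real ^ 'n) r)"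

lemma ball_measure_pos: "r > 0 \<Longrightarrow> measure lborel (ball (0 :: real ^ 'n::finite) r) > 0"
  by (simp add: content_ball_pos)

lemma Lp_ball_if_Lp_compact:
  fixes u :: "real ^ 'n::finite \<Rightarrow> real"
  assumes "\<And>K. compact K \<Longrightarrow> (\<lambda>x. indicator K x *\<^sub>R u x) \<in> Lp q lborel" "q \<ge> 0"
  shows "(\<lambda>x. indicator (ball 0 R) x *\<^sub>R u x) \<in> Lp q lborel"
proof -
  have "(\<lambda>x. indicator (ball 0 R) x *\<^sub>R (indicator (cball 0 R) x *\<^sub>R u x)) \<in> Lp q lborel"
    by (rule Lp_scaleR_bounded[where C=1, OF assms(1)[OF compact_cball]]) (use assms(2) in \<open>auto intro!: borel_measurable_indicator\<close>)
  also have "(\<lambda>x. indicator (ball 0 R) x *\<^sub>R (indicator (cball 0 R) x *\<^sub>R u x)) = (\<lambda>x. indicator (ball 0 R) x *\<^sub>R u x)"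
    by (intro ext) (auto split: split_indicator)
  finally show ?thesis .
qed

text \<open>Jensen's inequality for the average over a ball, obtained from Hoelder's inequality
  against the indicator of the ball.\<close>

lemma ball_mean_pointwise:
  fixes u :: "real ^ 'n::finite \<Rightarrow> real"
  assumes u: "(\<lambda>x. indicator (ball 0 r) x *\<^sub>R u x) \<in> Lp q lborel" and q: "q > 1" and r: "r > 0"
  shows "ennreal (\<bar>a - ball_mean r u\<bar> powr q) \<le> ennreal (1 / measure lborel (ball (0 :: real ^ 'n) r)) *
    (\<integral>\<^sup>+y. indicator (ball 0 r) y * ennreal (\<bar>a - u y\<bar> powr q) \<partial>lborel)"
proof -
  let ?B = "ball (0 :: real ^ 'n) r" and ?p = "q / (q - 1)"
  define V where "V = measure lborel ?B"
  have V: "V > 0" unfolding V_def by (rule ball_measure_pos[OF r])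
  have fin: "emeasure lborel ?B < \<infinity>" by (rule emeasure_lborel_ball_finite)
  have IB: "(indicator ?B :: real ^ 'n \<Rightarrow> real) \<in> Lp s lborel" if "s \<ge> 1" for s
    using that fin by (intro indicator_Lp) auto
  have p: "?p > 1" using q by (simp add: field_simps)
  let ?f = "\<lambda>y. indicator ?B y * (a - u y)"
  have "(\<lambda>y. a *\<^sub>R indicator ?B y - indicator ?B y *\<^sub>R u y) \<in> Lp q lborel"
    using q u IB[of q] by (intro Lp_diff Lp_scaleR) auto
  then have f: "?f \<in> Lp q lborel" by (simp add: algebra_simps)
  have nI: "Lp_norm ?p lborel (indicator ?B :: real ^ 'n \<Rightarrow> real) = V powr (1 / ?p)"
  proof -
    have "(\<lambda>x. norm (indicator ?B x :: real) powr ?p) = indicator ?B" by (auto simp: indicator_def)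
    then show ?thesis by (simp add: Lp_norm_def V_def)
  qed
  have "(\<integral>y. indicator ?B y * (a - u y) \<partial>lborel) = a * V - (\<integral>y. indicator ?B y * u y \<partial>lborel)"
  proof -
    have "integrable lborel (\<lambda>x. indicator ?B x *\<^sub>R (indicator ?B x *\<^sub>R u x))"
      by (rule Lp_imp_set_integrable[OF u]) (use q fin in auto)
    also have "(\<lambda>x. indicator ?B x *\<^sub>R (indicator ?B x *\<^sub>R u x)) = (\<lambda>x. indicator ?B x * u x)"
      by (auto simp: indicator_def)
    finally have "integrable lborel (\<lambda>x. indicator ?B x * u x)" .
    moreover have "integrable lborel (\<lambda>x. indicator ?B x * a)" using fin by (intro integrable_mult_left) simp
    ultimately show ?thesis by (simp add: right_diff_distrib V_def)
  qed
  then have "V * (a - ball_mean r u) = (\<integral>y. ?f y \<bullet> indicator ?B y \<partial>lborel)"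
  proof -
    have "(\<lambda>y. ?f y \<bullet> indicator ?B y) = ?f" by (auto simp: indicator_def)
    then show ?thesis using V \<open>(\<integral>y. ?f y \<partial>lborel) = _\<close>
      by (simp add: ball_mean_def right_diff_distrib flip: V_def)
  qed
  with Holder_inner(2)[OF q f IB[of ?p]] p nI
  have "\<bar>V * (a - ball_mean r u)\<bar> \<le> Lp_norm q lborel ?f * V powr (1 / ?p)" by simp
  then have "\<bar>V * (a - ball_mean r u)\<bar> powr q \<le> (Lp_norm q lborel ?f * V powr (1 / ?p)) powr q"
    using q by (intro powr_mono2) auto
  \<comment> \<open>The exponents are conjugate, so \<open>q / ?p = q - 1\<close>.\<close>
  then have "V powr q * \<bar>a - ball_mean r u\<bar> powr q \<le> Lp_norm q lborel ?f powr q * V powr (q - 1)"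
    using V q by (simp add: powr_mult abs_mult Lp_norm_nonneg powr_powr)
  also have "V powr (q - 1) = V powr q * (1 / V)" using V by (simp add: powr_diff)
  finally have le: "V powr q * \<bar>a - ball_mean r u\<bar> powr q \<le> Lp_norm q lborel ?f powr q * (V powr q * (1 / V))" .
  have "\<bar>a - ball_mean r u\<bar> powr q \<le> 1 / V * Lp_norm q lborel ?f powr q"
    by (rule mult_left_le_imp_le[of "V powr q"]) (use le V in \<open>simp_all add: mult.commute mult.left_commute\<close>)
  then have "ennreal (\<bar>a - ball_mean r u\<bar> powr q) \<le> ennreal (1 / V) * ennreal (Lp_norm q lborel ?f powr q)"
    using V by (simp add: ennreal_mult[symmetric] ennreal_leI)
  also have "ennreal (Lp_norm q lborel ?f powr q) = (\<integral>\<^sup>+y. ennreal (norm (?f y) powr q) \<partial>lborel)"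
    using nn_integral_norm_powr[OF f] q by simp
  also have "\<dots> = (\<integral>\<^sup>+y. indicator ?B y * ennreal (\<bar>a - u y\<bar> powr q) \<partial>lborel)"
    by (intro nn_integral_cong) (auto simp: indicator_def)
  finally show ?thesis unfolding V_def .
qed

text \<open>The mean is taken over a ball of radius \<open>r\<close> that may be smaller than the
  ball of the estimate: \<open>r = 1\<close> normalises a function simultaneously on all larger
  balls, while \<open>r = R\<close> yields a constant that grows only linearly in \<open>R\<close>.
  The factor \<open>(2 * R / r) ^ CARD('n)\<close> is the volume of the ball of shifts divided by
  that of the averaging ball.\<close>

lemma Poincare:
  fixes u :: "real ^ 'n::finite \<Rightarrow> real"
  assumes uc: "\<And>K. compact K \<Longrightarrow> (\<lambda>x. indicator K x *\<^sub>R u x) \<in> Lp q lborel"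
    and wg: "is_weak_grad UNIV u g" and g: "g \<in> Lp q lborel" and q: "q > 1" and r: "0 < r" "r \<le> R"
  shows "Lp_norm q lborel (\<lambda>x. indicator (ball 0 R) x *\<^sub>R (u x - ball_mean r u))
      \<le> ((2 * R / r) ^ CARD('n)) powr (1 / q) * (2 * R * Lp_norm q lborel g)"
    and "(\<lambda>x. indicator (ball 0 R) x *\<^sub>R (u x - ball_mean r u)) \<in> Lp q lborel"
proof -
  let ?B = "ball (0 :: real ^ 'n) r" and ?BR = "ball (0 :: real ^ 'n) R" and ?B2 = "ball (0 :: real ^ 'n) (2 * R)"
  have R: "R > 0" using r by simp
  have [measurable]: "?BR \<in> sets borel" by simp
  define V where "V = measure lborel ?B"
  have V: "V > 0" unfolding V_def by (rule ball_measure_pos[OF r(1)])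
  have [measurable]: "u \<in> borel_measurable borel" using wg Lp_loc_UNIV_measurable by (auto simp: is_weak_grad_def)
  let ?F = "\<lambda>x. indicator ?BR x *\<^sub>R (u x - ball_mean r u)"
  have "(\<lambda>x. indicator ?BR x *\<^sub>R u x - ball_mean r u *\<^sub>R indicator ?BR x) \<in> Lp q lborel"
    using q Lp_ball_if_Lp_compact[OF uc]
    by (intro Lp_diff Lp_scaleR indicator_Lp) (auto simp: emeasure_lborel_ball_finite[unfolded infinity_ennreal_def])
  then show F: "?F \<in> Lp q lborel" by (simp add: algebra_simps)
  have "ennreal (Lp_norm q lborel ?F powr q) = (\<integral>\<^sup>+x. ennreal (norm (?F x) powr q) \<partial>lborel)"
    using nn_integral_norm_powr[OF F] q by simp
  also have "\<dots> = (\<integral>\<^sup>+x. indicator ?BR x * ennreal (\<bar>u x - ball_mean r u\<bar> powr q) \<partial>lborel)"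
    by (intro nn_integral_cong) (auto simp: indicator_def)
  also have "\<dots> \<le> (\<integral>\<^sup>+x. ennreal (1 / V) * (indicator ?BR x * (\<integral>\<^sup>+y. indicator ?BR y * ennreal (\<bar>u x - u y\<bar> powr q) \<partial>lborel)) \<partial>lborel)"
  proof (intro nn_integral_mono)
    fix x
    have "ennreal (\<bar>u x - ball_mean r u\<bar> powr q) \<le> ennreal (1 / V) *
        (\<integral>\<^sup>+y. indicator ?B y * ennreal (\<bar>u x - u y\<bar> powr q) \<partial>lborel)"
      unfolding V_def using q r by (intro ball_mean_pointwise Lp_ball_if_Lp_compact uc) auto
    also have "\<dots> \<le> ennreal (1 / V) * (\<integral>\<^sup>+y. indicator ?BR y * ennreal (\<bar>u x - u y\<bar> powr q) \<partial>lborel)"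
      using r by (intro mult_left_mono nn_integral_mono mult_right_mono) (auto simp: indicator_def)
    finally show "indicator ?BR x * ennreal (\<bar>u x - ball_mean r u\<bar> powr q) \<le> ennreal (1 / V) *
        (indicator ?BR x * (\<integral>\<^sup>+y. indicator ?BR y * ennreal (\<bar>u x - u y\<bar> powr q) \<partial>lborel))"
      by (auto simp: indicator_def)
  qed
  also have "\<dots> = ennreal (1 / V) * (\<integral>\<^sup>+x. indicator ?BR x * (\<integral>\<^sup>+y. indicator ?BR y * ennreal (\<bar>u x - u y\<bar> powr q) \<partial>lborel) \<partial>lborel)"
    by (rule nn_integral_cmult) measurable
  also have "\<dots> \<le> ennreal (1 / V) * (emeasure lborel ?B2 * ennreal ((2 * R * Lp_norm q lborel g) powr q))"
    by (intro mult_left_mono double_integral_estimate[OF wg g q R]) simp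
  also have "emeasure lborel ?B2 = ennreal (measure lborel ?B2)"
    using emeasure_lborel_ball_finite by (intro emeasure_eq_ennreal_measure) (auto simp: less_top)
  also have "ennreal (1 / V) * (ennreal (measure lborel ?B2) * ennreal ((2 * R * Lp_norm q lborel g) powr q)) =
      ennreal (measure lborel ?B2 / V * (2 * R * Lp_norm q lborel g) powr q)"
    using V by (simp add: ennreal_mult[symmetric])
  also have "measure lborel ?B2 / V = (2 * R / r) ^ CARD('n)"
  proof -
    have "measure lborel (ball (0 :: real ^ 'n) s) = unit_ball_vol (real CARD('n)) * s ^ CARD('n)" if "s > 0" for s
      using that emeasure_ball[of s "0 :: real ^ 'n"] by (simp add: measure_def)
    moreover have "unit_ball_vol (real CARD('n)) \<noteq> 0"
      using unit_ball_vol_pos[of "real CARD('n)"] by linarith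
    ultimately show ?thesis using r R unfolding V_def
      by (simp add: power_divide)
  qed
  finally have "Lp_norm q lborel ?F powr q \<le> (2 * R / r) ^ CARD('n) * (2 * R * Lp_norm q lborel g) powr q"
    using R r by simp
  then show "Lp_norm q lborel ?F \<le> ((2 * R / r) ^ CARD('n)) powr (1 / q) * (2 * R * Lp_norm q lborel g)"
  proof (intro Lp_norm_le)
    assume "Lp_norm q lborel ?F powr q \<le> (2 * R / r) ^ CARD('n) * (2 * R * Lp_norm q lborel g) powr q"
    moreover have "Lp_norm q lborel ?F powr q = (\<integral>x. norm (?F x) powr q \<partial>lborel)"
      using q by (intro Lp_norm_powr) simp
    moreover have "(((2 * R / r) ^ CARD('n)) powr (1 / q) * (2 * R * Lp_norm q lborel g)) powr q =
        (2 * R / r) ^ CARD('n) * (2 * R * Lp_norm q lborel g) powr q"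
      using q r R by (subst powr_mult) (simp_all add: powr_powr Lp_norm_nonneg)
    ultimately show "(\<integral>x. norm (?F x) powr q \<partial>lborel) \<le>
        (((2 * R / r) ^ CARD('n)) powr (1 / q) * (2 * R * Lp_norm q lborel g)) powr q" by simp
  qed (use q R in \<open>auto simp: Lp_norm_nonneg\<close>)
qed

subsection \<open>Completeness of \<open>\<hat>H\<^sup>1\<^sub>q\<close>\<close>

lemma ball_mean_diff:
  fixes u v :: "real ^ 'n::finite \<Rightarrow> real"
  assumes "u \<in> Lp_loc 1 UNIV" "v \<in> Lp_loc 1 UNIV"
  shows "ball_mean r (\<lambda>x. u x - v x) = ball_mean r u - ball_mean r v"
proof -
  have "integrable lborel (\<lambda>x. indicator (ball 0 r) x * w x)" if "w \<in> Lp_loc 1 UNIV" for w :: "real ^ 'n \<Rightarrow> real"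
  proof -
    have "integrable lborel (\<lambda>x. indicator (ball 0 r) x *\<^sub>R (indicator (cball 0 r) x *\<^sub>R w x))"
      by (intro integrable_mult_indicator Lp_loc_integrable[OF that]) auto
    also have "(\<lambda>x. indicator (ball 0 r) x *\<^sub>R (indicator (cball 0 r) x *\<^sub>R w x)) = (\<lambda>x. indicator (ball 0 r) x * w x)"
      by (intro ext) (auto split: split_indicator)
    finally show ?thesis .
  qed
  from this[OF assms(1)] this[OF assms(2)] show ?thesis
    by (simp add: ball_mean_def right_diff_distrib diff_divide_distrib)
qed

text \<open>Convergence of gradients controls functions up to constants only. After subtraction of
  the mean over the unit ball, Poincare's inequality gives a Cauchy sequence on every ball.\<close>

lemma hat_H1_closed:
  fixes u :: "nat \<Rightarrow> real ^ 'n::finite \<Rightarrow> real"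
  assumes q: "q > 1" and u: "\<And>n. u n \<in> hat_H1 q UNIV" and wg: "\<And>n. is_weak_grad UNIV (u n) (g n)"
    and g: "\<And>n. g n \<in> Lp q lborel" and G: "G \<in> Lp q lborel"
    and lim: "(\<lambda>n. Lp_norm q lborel (\<lambda>x. g n x - G x)) \<longlonglongrightarrow> 0"
  obtains w where "w \<in> hat_H1 q UNIV" "is_weak_grad UNIV w G"
proof -
  \<comment> \<open>A subsequence with geometric rate makes the functions converge almost
    everywhere, not only in norm.\<close>
  have "\<exists>N. Lp_norm q lborel (\<lambda>x. g N x - G x) < (1 / 2) ^ Suc n" for n
    using order_tendstoD(2)[OF lim, of "(1 / 2) ^ Suc n"] eventually_happens by force
  then obtain N where N: "\<And>n. Lp_norm q lborel (\<lambda>x. g (N n) x - G x) < (1 / 2) ^ Suc n" by metis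
  define h where "h n = g (N n)" for n
  define v where "v n x = u (N n) x - ball_mean 1 (u (N n))" for n x
  have h: "h n \<in> Lp q lborel" for n unfolding h_def by (rule g)
  have uL: "\<And>K. compact K \<Longrightarrow> (\<lambda>x. indicator K x *\<^sub>R u n x) \<in> Lp q lborel" for n using u hat_H1_UNIV_iff by blast
  have hfast: "Lp_norm q lborel (\<lambda>x. h (Suc n) x - h n x) \<le> (1 / 2) ^ n" for n
  proof -
    have "Lp_norm q lborel (\<lambda>x. h (Suc n) x - h n x) \<le>
        Lp_norm q lborel (\<lambda>x. h (Suc n) x - G x) + Lp_norm q lborel (\<lambda>x. G x - h n x)"
      using q by (intro Lp_norm_triangle_diff h G) auto
    also have "\<dots> \<le> (1 / 2) ^ Suc (Suc n) + (1 / 2) ^ Suc n"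
      using N[of n] N[of "Suc n"] unfolding h_def by (intro add_mono) (simp_all add: Lp_norm_minus_commute)
    also have "\<dots> \<le> (1 / 2) ^ n" by simp
    finally show ?thesis .
  qed
  have hlim: "(\<lambda>n. Lp_norm q lborel (\<lambda>x. h n x - G x)) \<longlonglongrightarrow> 0"
  proof (rule tendsto_sandwich[OF _ _ tendsto_const])
    show "(\<lambda>n. (1 / 2 :: real) ^ Suc n) \<longlonglongrightarrow> 0" by (rule LIMSEQ_Suc) (rule LIMSEQ_power_zero, simp)
  qed (use N in \<open>auto simp: h_def Lp_norm_nonneg less_imp_le\<close>)
  have wgv: "is_weak_grad UNIV (v n) (h n)" for n
    using is_weak_grad_diff[OF wg[of "N n"] is_weak_grad_smooth[OF smooth_const[of "ball_mean 1 (u (N n))"]]]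
    by (simp add: v_def[abs_def] h_def grad_def partial_deriv_const zero_vec_def[symmetric])
  have vloc: "v n \<in> Lp_loc 1 UNIV" "h n \<in> Lp_loc 1 UNIV" for n using wgv is_weak_grad_def by blast+
  have [measurable]: "v n \<in> borel_measurable borel" for n by (rule Lp_loc_UNIV_measurable[OF vloc(1)])
  define C where "C R = ((2 * R / 1) ^ CARD('n)) powr (1 / q) * (2 * R)" for R :: real
  have vball: "(\<lambda>x. indicator (ball 0 R) x *\<^sub>R v n x) \<in> Lp q lborel" if "R \<ge> 1" for R n
    unfolding v_def by (rule Poincare(2)[OF uL wg g q]) (use that in auto)
  have vfast: "Lp_norm q lborel (\<lambda>x. indicator (ball 0 R) x *\<^sub>R v (Suc n) x - indicator (ball 0 R) x *\<^sub>R v n x)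
      \<le> C R * (1 / 2) ^ n" if "R \<ge> 1" for R n
  proof -
    let ?w = "\<lambda>x. u (N (Suc n)) x - u (N n) x"
    have uloc: "u n \<in> Lp_loc 1 UNIV" for n using wg is_weak_grad_def by blast
    have "Lp_norm q lborel (\<lambda>x. indicator (ball 0 R) x *\<^sub>R (?w x - ball_mean 1 ?w))
      \<le> ((2 * R / 1) ^ CARD('n)) powr (1 / q) * (2 * R * Lp_norm q lborel (\<lambda>x. h (Suc n) x - h n x))"
    proof (rule Poincare(1)[OF _ _ _ q])
      show "(\<lambda>x. indicator K x *\<^sub>R ?w x) \<in> Lp q lborel" if "compact K" for K
        using Lp_diff[OF uL[OF that] uL[OF that], of "N (Suc n)" "N n"] q by (simp add: right_diff_distrib)
      show "is_weak_grad UNIV ?w (\<lambda>x. h (Suc n) x - h n x)"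
        unfolding h_def by (rule is_weak_grad_diff[OF wg wg]) simp
      show "(\<lambda>x. h (Suc n) x - h n x) \<in> Lp q lborel" using q by (intro Lp_diff h) simp
    qed (use that in auto)
    also have "\<dots> \<le> ((2 * R / 1) ^ CARD('n)) powr (1 / q) * (2 * R * (1 / 2) ^ n)"
      using that by (intro mult_left_mono hfast) auto
    also have "(\<lambda>x. indicator (ball 0 R) x *\<^sub>R (?w x - ball_mean 1 ?w)) =
        (\<lambda>x. indicator (ball 0 R) x *\<^sub>R v (Suc n) x - indicator (ball 0 R) x *\<^sub>R v n x)"
      unfolding ball_mean_diff[OF uloc uloc] v_def by (simp add: algebra_simps)
    finally show ?thesis by (simp add: C_def mult.assoc)
  qed
  \<comment> \<open>One pointwise limit serves all radii, so that limits on different balls need not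
    be matched.\<close>
  define w where "w x = lim (\<lambda>n. v n x)" for x
  have [measurable]: "w \<in> borel_measurable borel" unfolding w_def by measurable
  have key: "(\<lambda>x. indicator (ball 0 R) x *\<^sub>R w x) \<in> Lp q lborel \<and>
      (\<lambda>n. Lp_norm q lborel (\<lambda>x. indicator (ball 0 R) x *\<^sub>R v n x - indicator (ball 0 R) x *\<^sub>R w x)) \<longlonglongrightarrow> 0"
    if R: "R \<ge> 1" for R
  proof -
    have [measurable]: "ball 0 R \<in> sets (borel :: (real ^ 'n) measure)" by simp
    have "q \<ge> 1" using q by simp
    from Lp_complete_fast[of q "\<lambda>n x. indicator (ball 0 R) x *\<^sub>R v n x" lborel "C R", OF this vball[OF R] vfast[OF R]]
    obtain F where F: "F \<in> Lp q lborel" "AE x in lborel. (\<lambda>n. indicator (ball 0 R) x *\<^sub>R v n x) \<longlonglongrightarrow> F x"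
      "(\<lambda>n. Lp_norm q lborel (\<lambda>x. indicator (ball 0 R) x *\<^sub>R v n x - F x)) \<longlonglongrightarrow> 0"
      by blast
    have eq: "AE x in lborel. indicator (ball 0 R) x *\<^sub>R w x = F x"
      using F(2)
    proof eventually_elim
      case (elim x)
      show ?case
      proof (cases "x \<in> ball 0 R")
        case True
        with elim show ?thesis by (simp add: w_def limI)
      next
        case False
        with elim show ?thesis by (simp add: LIMSEQ_const_iff)
      qed
    qed
    have wL: "(\<lambda>x. indicator (ball 0 R) x *\<^sub>R w x) \<in> Lp q lborel"
      by (rule Lp_cong_AE[OF F(1) _ eq]) measurable
    have "Lp_norm q lborel (\<lambda>x. indicator (ball 0 R) x *\<^sub>R v n x - indicator (ball 0 R) x *\<^sub>R w x) =
        Lp_norm q lborel (\<lambda>x. indicator (ball 0 R) x *\<^sub>R v n x - F x)" for n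
      by (rule Lp_norm_cong_AE) (use eq Lp_measurable[OF F(1)] in auto)
    with F(3) wL show ?thesis by simp
  qed
  have wK: "(\<lambda>x. indicator K x *\<^sub>R w x) \<in> Lp q lborel" if K: "compact K" for K
  proof -
    obtain R where R: "K \<subseteq> ball 0 R" using bounded_subset_ballD compact_imp_bounded K by blast
    have "(\<lambda>x. indicator K x *\<^sub>R (indicator (ball 0 (max R 1)) x *\<^sub>R w x)) \<in> Lp q lborel"
      by (rule Lp_scaleR_bounded[where C=1, OF conjunct1[OF key]])
        (use q borel_compact[OF K] in \<open>auto intro!: borel_measurable_indicator\<close>)
    also have "(\<lambda>x. indicator K x *\<^sub>R (indicator (ball 0 (max R 1)) x *\<^sub>R w x)) = (\<lambda>x. indicator K x *\<^sub>R w x)"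
      using R by (intro ext) (auto split: split_indicator)
    finally show ?thesis .
  qed
  have "is_weak_grad UNIV w G"
  proof (subst is_weak_grad_iff, simp, intro conjI ballI allI)
    show "w \<in> Lp_loc 1 UNIV"
      by (rule Lp_loc_closure_imp_Lp_loc[of _ q])
        (use wK q in \<open>auto simp: Lp_loc_closure_def Lp_lborel_on_iff borel_compact\<close>)
    show "G \<in> Lp_loc 1 UNIV" using q by (intro Lp_imp_Lp_loc_UNIV[OF G]) simp
    fix \<phi> :: "real ^ 'n \<Rightarrow> real" and i assume \<phi>: "\<phi> \<in> test_functions UNIV"
    obtain R0 where R0: "R0 > 0" "\<And>x. x \<notin> ball 0 R0 \<Longrightarrow> \<phi> x = 0" using test_functions_ball[OF \<phi>] by blast
    define R where "R = R0 + 1"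
    have R: "R \<ge> 1" using R0 by (simp add: R_def)
    have z: "\<phi> x = 0" "partial_deriv i \<phi> x = 0" if "x \<notin> ball 0 R" for x
    proof -
      show "\<phi> x = 0" using that R0 by (simp add: R_def)
      show "partial_deriv i \<phi> x = 0"
        by (rule partial_deriv_eq_0[of "cball 0 R0"]) (use R0 that in \<open>auto simp: R_def\<close>)
    qed
    have p: "q / (q - 1) \<ge> 0" using q by simp
    have eqR: "indicator (ball 0 R) x *\<^sub>R f x * partial_deriv i \<phi> x = f x * partial_deriv i \<phi> x" for f :: "_ \<Rightarrow> real" and x
      using z(2)[of x] by (auto simp: indicator_def)
    have "(\<lambda>n. \<integral>x. v n x * partial_deriv i \<phi> x \<partial>lborel) \<longlonglongrightarrow> (\<integral>x. w x * partial_deriv i \<phi> x \<partial>lborel)"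
      using Lp_inner_tendsto[OF q vball[OF R] conjunct1[OF key[OF R]] conjunct2[OF key[OF R]]
          test_Lp[OF test_functions_partial_deriv[OF \<phi>, of i] p]]
      unfolding inner_real_def eqR .
    moreover have vh: "(\<integral>x. v n x * partial_deriv i \<phi> x \<partial>lborel) = - (\<integral>x. h n x $ i * \<phi> x \<partial>lborel)" for n
      using is_weak_gradD(3)[OF wgv _ \<phi>] by simp
    moreover have hG: "(\<lambda>n. \<integral>x. h n x $ i * \<phi> x \<partial>lborel) \<longlonglongrightarrow> (\<integral>x. G x $ i * \<phi> x \<partial>lborel)"
    proof -
      have L: "(\<lambda>x. \<phi> x *\<^sub>R axis i 1 :: real ^ 'n) \<in> Lp (q / (q - 1)) lborel"
        by (rule Lp_mono[OF test_Lp[OF \<phi> p], where C=1])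
          (use p Lp_measurable[OF test_Lp[OF \<phi> p]] in \<open>auto simp: norm_axis_1\<close>)
      show ?thesis using Lp_inner_tendsto[OF q h G hlim L] by (simp add: inner_axis mult.commute)
    qed
    ultimately show "(\<integral>x. w x * partial_deriv i \<phi> x \<partial>lborel) = - (\<integral>x. G x $ i * \<phi> x \<partial>lborel)"
      by (intro LIMSEQ_unique[OF _ tendsto_minus[OF hG, folded vh]])
  qed
  moreover from this have "w \<in> hat_H1 q UNIV" unfolding hat_H1_UNIV_iff using wK G by blast
  ultimately show ?thesis using that by blast
qed

section \<open>Testing with functions of \<open>\<hat>H\<^sup>1\<close>\<close>

text \<open>Turns a statement almost everywhere into points arbitrarily close to \<open>x0\<close>,
  for use with continuity there.\<close>

lemma AE_lborel_ball_ex: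
  fixes x0 :: "'a::euclidean_space"
  assumes "AE x in lborel. P x" "r > 0"
  obtains y where "y \<in> ball x0 r" "P y"
proof -
  obtain N where N: "N \<in> null_sets lborel" "{x. \<not> P x} \<subseteq> N"
    using assms(1) by (auto simp: eventually_ae_filter)
  have "\<not> ball x0 r \<subseteq> N"
  proof
    assume "ball x0 r \<subseteq> N"
    then have "emeasure lborel (ball x0 r) \<le> emeasure lborel N" using N by (intro emeasure_mono) auto
    then have "emeasure lborel (ball x0 r) = 0" using N by auto
    moreover have "measure lborel (ball x0 r) > 0" using assms(2) by (simp add: content_ball_pos)
    ultimately show False by (simp add: measure_def)
  qed
  with N that show ?thesis by blast
qed

section \<open>Pairings of a field with translates of another\<close>

lemma integral_reflect_at:
  fixes f :: "real ^ 'n::finite \<Rightarrow> 'b::euclidean_space"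
  assumes "f \<in> borel_measurable borel"
  shows "(\<integral>y. f (x - y) \<partial>lborel) = (\<integral>y. f y \<partial>lborel)"
proof -
  have "diag_affine x (- 1) = (\<lambda>y. x - y)" by (auto simp: vec_eq_iff)
  with integral_diag_affine[of "- 1" f x] assms show ?thesis by simp
qed

lemma integrable_reflect_at:
  fixes f :: "real ^ 'n::finite \<Rightarrow> 'b::euclidean_space"
  assumes "integrable lborel f"
  shows "integrable lborel (\<lambda>y. f (x - y))"
proof -
  have "diag_affine x (- 1) = (\<lambda>y. x - y)" by (auto simp: vec_eq_iff)
  with integrable_diag_affine[of "- 1" f x] assms show ?thesis by simp
qed

lemma Lp_translate:
  fixes f :: "real ^ 'n::finite \<Rightarrow> 'b::euclidean_space"
  shows "f \<in> Lp q lborel \<Longrightarrow> (\<lambda>x. f (x - y)) \<in> Lp q lborel"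
  using Lp_diag_affine[of 1 f q "- y"] by (simp add: diag_affine_translate)

lemma Lp_norm_translate:
  fixes f :: "real ^ 'n::finite \<Rightarrow> 'b::euclidean_space"
  assumes "f \<in> Lp q lborel"
  shows "Lp_norm q lborel (\<lambda>x. f (x - y)) = Lp_norm q lborel f"
proof -
  have "(\<lambda>x. norm (f x) powr q) \<in> borel_measurable borel" using Lp_integrable[OF assms] by auto
  from integral_translate[OF this, of "- y"] show ?thesis by (simp add: Lp_norm_def)
qed

lemma integrable_convolution:
  fixes k w :: "real ^ 'n::finite \<Rightarrow> real"
  assumes k: "integrable lborel k" and w: "integrable lborel w"
  shows "integrable (lborel \<Otimes>\<^sub>M lborel) (\<lambda>(x, y). k x * w (x - y))"
proof (rule lborel_pair.Fubini_integrable)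
  have [measurable]: "k \<in> borel_measurable borel" "w \<in> borel_measurable borel" using k w by auto
  show "(\<lambda>(x, y). k x * w (x - y)) \<in> borel_measurable (lborel \<Otimes>\<^sub>M lborel)" by measurable
  have "(\<integral>y. \<bar>w (x - y)\<bar> \<partial>lborel) = (\<integral>y. \<bar>w y\<bar> \<partial>lborel)" for x by (rule integral_reflect_at) measurable
  then have "(\<lambda>x. \<integral>y. norm (case (x, y) of (x, y) \<Rightarrow> k x * w (x - y)) \<partial>lborel) = (\<lambda>x. \<bar>k x\<bar> * (\<integral>y. \<bar>w y\<bar> \<partial>lborel))"
    by (simp add: abs_mult)
  then show "integrable lborel (\<lambda>x. \<integral>y. norm (case (x, y) of (x, y) \<Rightarrow> k x * w (x - y)) \<partial>lborel)"
    using k by simp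
  show "AE x in lborel. integrable lborel (\<lambda>y. case (x, y) of (x, y) \<Rightarrow> k x * w (x - y))"
    using integrable_reflect_at[OF w] by simp
qed

text \<open>The two changes of the order of integration in \<open>\<integral> A(y) \<eta>(y) dy\<close> for \<open>A(y) = \<integral> F(x) \<bullet> W(x - y) dx\<close>.\<close>

lemma pairing_swap:
  fixes F W :: "real ^ 'n::finite \<Rightarrow> real ^ 'n"
  assumes F: "F \<in> Lp_loc 1 UNIV" and W: "integrable lborel W" "\<And>x. x \<notin> cball 0 R \<Longrightarrow> W x = 0"
    and \<eta>: "\<eta> \<in> borel_measurable borel" "\<And>x. \<bar>\<eta> x\<bar> \<le> M" "\<And>x. x \<notin> cball 0 R \<Longrightarrow> \<eta> x = (0::real)"
  shows "(\<integral>y. (\<integral>x. F x \<bullet> W (x - y) \<partial>lborel) * \<eta> y \<partial>lborel) = (\<integral>x. \<integral>z. F x \<bullet> W z * \<eta> (x - z) \<partial>lborel \<partial>lborel)"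
    and "(\<integral>x. \<integral>z. F x \<bullet> W z * \<eta> (x - z) \<partial>lborel \<partial>lborel) = (\<integral>z. \<integral>x. F x \<bullet> W z * \<eta> (x - z) \<partial>lborel \<partial>lborel)"
proof -
  have [measurable]: "F \<in> borel_measurable borel" "W \<in> borel_measurable borel" "\<eta> \<in> borel_measurable borel"
    using Lp_loc_UNIV_measurable[OF F] W(1) \<eta>(1) by auto
  have M0: "M \<ge> 0" using order_trans[OF abs_ge_zero \<eta>(2)] .
  let ?k = "\<lambda>x. M * (indicator (cball 0 (2 * R)) x * norm (F x))"
  have k: "integrable lborel ?k"
    using integrable_norm[OF Lp_loc_integrable[OF F compact_cball[of 0 "2 * R"]]] by simp
  have w: "integrable lborel (\<lambda>x. norm (W x))" using W(1) by simp
  have le: "\<bar>F x \<bullet> W z * \<eta> (x - z)\<bar> \<le> ?k x * norm (W z)" for x z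
  proof (cases "z \<in> cball 0 R \<and> x - z \<in> cball 0 R")
    case True
    then have "x \<in> cball 0 (2 * R)" using norm_triangle_ineq[of "x - z" z] by simp
    moreover have "\<bar>F x \<bullet> W z\<bar> * \<bar>\<eta> (x - z)\<bar> \<le> norm (F x) * norm (W z) * M"
      by (intro mult_mono Cauchy_Schwarz_ineq2 \<eta>(2)) auto
    ultimately show ?thesis by (simp add: abs_mult mult_ac)
  next
    case False
    then show ?thesis using W(2)[of z] \<eta>(3)[of "x - z"] M0 by auto
  qed
  have "(\<integral>y. (\<integral>x. F x \<bullet> W (x - y) \<partial>lborel) * \<eta> y \<partial>lborel) = (\<integral>y. \<integral>x. F x \<bullet> W (x - y) * \<eta> y \<partial>lborel \<partial>lborel)"
    by simp
  also have "\<dots> = (\<integral>x. \<integral>y. F x \<bullet> W (x - y) * \<eta> y \<partial>lborel \<partial>lborel)"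
  proof (rule lborel_pair.Fubini_integral, rule Bochner_Integration.integrable_bound)
    show "integrable (lborel \<Otimes>\<^sub>M lborel) (\<lambda>(x, y). ?k x * norm (W (x - y)))"
      by (rule integrable_convolution[OF k w])
    show "(\<lambda>(x, y). F x \<bullet> W (x - y) * \<eta> y) \<in> borel_measurable (lborel \<Otimes>\<^sub>M lborel)" by measurable
    have "\<bar>F x \<bullet> W (x - y) * \<eta> y\<bar> \<le> ?k x * norm (W (x - y))" for x y using le[of x "x - y"] by simp
    then show "AE p in lborel \<Otimes>\<^sub>M lborel. norm (case p of (x, y) \<Rightarrow> F x \<bullet> W (x - y) * \<eta> y) \<le>
        norm (case p of (x, y) \<Rightarrow> ?k x * norm (W (x - y)))"
      by (auto intro!: AE_I2 order_trans[OF _ abs_ge_self] simp del: norm_mult)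
  qed
  also have "\<dots> = (\<integral>x. \<integral>z. F x \<bullet> W z * \<eta> (x - z) \<partial>lborel \<partial>lborel)"
  proof (rule Bochner_Integration.integral_cong[OF refl])
    fix x
    have "(\<integral>z. F x \<bullet> W (x - z) * \<eta> (x - (x - z)) \<partial>lborel) = (\<integral>z. F x \<bullet> W z * \<eta> (x - z) \<partial>lborel)"
      by (rule integral_reflect_at) measurable
    then show "(\<integral>y. F x \<bullet> W (x - y) * \<eta> y \<partial>lborel) = (\<integral>z. F x \<bullet> W z * \<eta> (x - z) \<partial>lborel)" by simp
  qed
  finally show "(\<integral>y. (\<integral>x. F x \<bullet> W (x - y) \<partial>lborel) * \<eta> y \<partial>lborel) = (\<integral>x. \<integral>z. F x \<bullet> W z * \<eta> (x - z) \<partial>lborel \<partial>lborel)" .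
  show "(\<integral>x. \<integral>z. F x \<bullet> W z * \<eta> (x - z) \<partial>lborel \<partial>lborel) = (\<integral>z. \<integral>x. F x \<bullet> W z * \<eta> (x - z) \<partial>lborel \<partial>lborel)"
  proof (rule lborel_pair.Fubini_integral[symmetric], rule Bochner_Integration.integrable_bound)
    show "integrable (lborel \<Otimes>\<^sub>M lborel) (\<lambda>(x, z). ?k x * norm (W z))"
      by (rule integrable_prod_mult[OF k w])
    show "(\<lambda>(x, z). F x \<bullet> W z * \<eta> (x - z)) \<in> borel_measurable (lborel \<Otimes>\<^sub>M lborel)" by measurable
    show "AE p in lborel \<Otimes>\<^sub>M lborel. norm (case p of (x, z) \<Rightarrow> F x \<bullet> W z * \<eta> (x - z)) \<le>
        norm (case p of (x, z) \<Rightarrow> ?k x * norm (W z))"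
      using le by (auto intro!: AE_I2 order_trans[OF _ abs_ge_self] simp del: norm_mult)
  qed
qed

text \<open>Neither field is continuous: \<open>F\<close> is replaced by a field \<open>H\<close> of
  test functions with an error uniform in the shift, and for \<open>H\<close> the shift moves from
  \<open>W\<close> onto \<open>H\<close>, where dominated convergence applies.\<close>

lemma pairing_tendsto:
  fixes F W :: "real ^ 'n::finite \<Rightarrow> real ^ 'n"
  assumes q: "q > 1" and F: "F \<in> Lp q lborel" and W: "W \<in> Lp (q / (q - 1)) lborel" and y: "y \<longlonglongrightarrow> 0"
  shows "(\<lambda>n. \<integral>x. F x \<bullet> W (x - y n) \<partial>lborel) \<longlonglongrightarrow> (\<integral>x. F x \<bullet> W x \<partial>lborel)"
proof (rule metric_LIMSEQ_I)
  fix \<epsilon> :: real assume \<epsilon>: "\<epsilon> > 0"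
  let ?p = "q / (q - 1)"
  have p: "?p > 1" using q by (simp add: field_simps)
  have [measurable]: "W \<in> borel_measurable borel" using Lp_measurable[OF W] by simp
  obtain G where G: "\<And>n i. (\<lambda>x. G n x $ i) \<in> test_functions (UNIV :: (real ^ 'n) set)"
    "(\<lambda>n::nat. Lp_norm q lborel (\<lambda>x. F x - G n x)) \<longlonglongrightarrow> 0"
    using test_functions_dense[OF _ open_UNIV F] q by force
  have "(\<lambda>n. Lp_norm q lborel (\<lambda>x. F x - G n x) * Lp_norm ?p lborel W) \<longlonglongrightarrow> 0"
    using G(2) by (rule tendsto_mult_left_zero)
  then obtain m where m: "Lp_norm q lborel (\<lambda>x. F x - G m x) * Lp_norm ?p lborel W < \<epsilon> / 3"
    using order_tendstoD(2)[of _ 0 sequentially "\<epsilon> / 3"] \<epsilon> eventually_happens by force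
  define H where "H = G m"
  have Ht: "(\<lambda>x. H x $ i) \<in> test_functions UNIV" for i unfolding H_def by (rule G(1))
  have HL: "H \<in> Lp q lborel" by (rule Lp_componentI) (use q test_Lp[OF Ht] in auto)
  have [measurable]: "H \<in> borel_measurable borel" using Lp_measurable[OF HL] by simp
  have Hcont: "continuous_on UNIV H"
    using continuous_on_vec_lambda[of UNIV "\<lambda>i x. H x $ i"] smooth_continuous_on[OF test_functions_smooth[OF Ht]]
    by simp
  have "\<exists>M. \<forall>x. \<bar>H x $ i\<bar> \<le> M" for i using test_functions_bounded[OF Ht] by metis
  then obtain B where B: "\<And>i x. \<bar>H x $ i\<bar> \<le> B i" by metis
  define M where "M = (\<Sum>i\<in>UNIV. B i)"
  have M: "norm (H x) \<le> M" for x
    unfolding M_def by (rule order_trans[OF norm_le_l1_cart]) (intro sum_mono B)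
  have "\<exists>R. \<forall>x. x \<notin> ball 0 R \<longrightarrow> H x $ i = 0" for i using test_functions_ball[OF Ht] by metis
  then obtain r where r: "\<And>i x. x \<notin> ball 0 (r i) \<Longrightarrow> H x $ i = 0" by metis
  define R where "R = Max (range r)"
  have R: "H x = 0" if "x \<notin> ball 0 R" for x
  proof -
    have "r i \<le> R" for i unfolding R_def by (rule Max_ge) auto
    then have "x \<notin> ball 0 (r i)" for i using that by (meson subset_ball subsetD)
    then show ?thesis using r by (simp add: vec_eq_iff)
  qed
  have lim: "(\<lambda>n. \<integral>x. H (y n + x) \<bullet> W x \<partial>lborel) \<longlonglongrightarrow> (\<integral>x. H x \<bullet> W x \<partial>lborel)"
  proof -
    obtain Y where Y: "\<And>n. norm (y n) \<le> Y"
      using convergent_imp_Bseq[OF convergentI[OF y]] by (auto simp: Bseq_def)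
    show ?thesis
    proof (rule integral_dominated_convergence[where w="\<lambda>x. M * (indicator (cball 0 (R + Y)) x * norm (W x))"])
      have "W \<in> Lp_loc 1 UNIV" by (rule Lp_imp_Lp_loc_UNIV[OF W]) (use p in simp)
      from integrable_norm[OF Lp_loc_integrable[OF this compact_cball[of 0 "R + Y"]]]
      show "integrable lborel (\<lambda>x. M * (indicator (cball 0 (R + Y)) x * norm (W x)))" by simp
      show "AE x in lborel. (\<lambda>n. H (y n + x) \<bullet> W x) \<longlonglongrightarrow> H x \<bullet> W x"
      proof (rule AE_I2)
        fix x
        have "(\<lambda>n. y n + x) \<longlonglongrightarrow> 0 + x" by (intro tendsto_intros y)
        then have "(\<lambda>n. H (y n + x)) \<longlonglongrightarrow> H (0 + x)"
          using Hcont by (intro continuous_on_tendsto_compose[of UNIV H]) auto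
        then show "(\<lambda>n. H (y n + x) \<bullet> W x) \<longlonglongrightarrow> H x \<bullet> W x" by (intro tendsto_intros) simp
      qed
      have "\<bar>H (y n + x) \<bullet> W x\<bar> \<le> M * (indicator (cball 0 (R + Y)) x * norm (W x))" for n x
      proof (cases "x \<in> cball 0 (R + Y)")
        case True
        have "\<bar>H (y n + x) \<bullet> W x\<bar> \<le> norm (H (y n + x)) * norm (W x)" by (rule Cauchy_Schwarz_ineq2)
        also have "\<dots> \<le> M * norm (W x)" by (intro mult_right_mono M) simp
        finally show ?thesis using True by simp
      next
        case False
        have "norm x \<le> norm (y n + x) + norm (y n)" using norm_triangle_ineq4[of "y n + x" "y n"] by simp
        with False Y[of n] have "y n + x \<notin> ball 0 R" by auto
        from R[OF this] False show ?thesis by simp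
      qed
      then show "AE x in lborel. norm (H (y n + x) \<bullet> W x) \<le> M * (indicator (cball 0 (R + Y)) x * norm (W x))" for n
        by simp
    qed measurable
  qed
  have trans: "(\<integral>x. H x \<bullet> W (x - y n) \<partial>lborel) = (\<integral>x. H (y n + x) \<bullet> W x \<partial>lborel)" for n
    using integral_translate[of "\<lambda>x. H x \<bullet> W (x - y n)" "y n"] by simp
  have close: "\<bar>(\<integral>x. F x \<bullet> W (x - z) \<partial>lborel) - (\<integral>x. H x \<bullet> W (x - z) \<partial>lborel)\<bar> < \<epsilon> / 3" for z
  proof -
    note Wz = Lp_translate[OF W, of z]
    have "(\<integral>x. F x \<bullet> W (x - z) \<partial>lborel) - (\<integral>x. H x \<bullet> W (x - z) \<partial>lborel) = (\<integral>x. (F x - H x) \<bullet> W (x - z) \<partial>lborel)"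
      using Holder_inner(1)[OF q F Wz] Holder_inner(1)[OF q HL Wz] by (simp add: inner_diff_left)
    also have "\<bar>\<dots>\<bar> \<le> Lp_norm q lborel (\<lambda>x. F x - H x) * Lp_norm ?p lborel (\<lambda>x. W (x - z))"
      using q by (intro Holder_inner(2) Lp_diff F HL Wz) auto
    finally show ?thesis using m Lp_norm_translate[OF W, of z] unfolding H_def by simp
  qed
  obtain N where N: "\<And>n. n \<ge> N \<Longrightarrow> \<bar>(\<integral>x. H (y n + x) \<bullet> W x \<partial>lborel) - (\<integral>x. H x \<bullet> W x \<partial>lborel)\<bar> < \<epsilon> / 3"
    using metric_LIMSEQ_D[OF lim, of "\<epsilon> / 3"] \<epsilon> by (auto simp: dist_real_def)
  have "\<bar>(\<integral>x. F x \<bullet> W (x - y n) \<partial>lborel) - (\<integral>x. F x \<bullet> W x \<partial>lborel)\<bar> < \<epsilon>" if "n \<ge> N" for n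
  proof -
    have "\<bar>(\<integral>x. F x \<bullet> W x \<partial>lborel) - (\<integral>x. H x \<bullet> W x \<partial>lborel)\<bar> < \<epsilon> / 3" using close[of 0] by simp
    then show ?thesis using N[OF that] close[of "y n"] unfolding trans by argo
  qed
  then show "\<exists>no. \<forall>n\<ge>no. dist (\<integral>x. F x \<bullet> W (x - y n) \<partial>lborel) (\<integral>x. F x \<bullet> W x \<partial>lborel) < \<epsilon>"
    by (auto simp: dist_real_def)
qed

lemma grad_reflect_at:
  fixes \<eta> :: "real ^ 'n::finite \<Rightarrow> real"
  assumes "\<eta> \<in> test_functions UNIV"
  shows "(\<lambda>z. \<eta> (x - z)) \<in> test_functions UNIV" "partial_deriv i (\<lambda>z. \<eta> (x - z)) z = - partial_deriv i \<eta> (x - z)"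
proof -
  have eq: "diag_affine x (- 1) = (\<lambda>y. x - y)" by (auto simp: vec_eq_iff)
  show "(\<lambda>z. \<eta> (x - z)) \<in> test_functions UNIV" using test_functions_diag_affine[OF assms, of "-1" x] by (simp add: eq)
  show "partial_deriv i (\<lambda>z. \<eta> (x - z)) z = - partial_deriv i \<eta> (x - z)"
    using partial_deriv_diag_affine[of \<eta> i x "-1"] by (simp add: eq smooth_differentiable test_functions_smooth[OF assms])
qed

text \<open>Mollification without smoothness: by Fubini, \<open>A(y) = \<integral> F(x) \<bullet> W(x - y) dx\<close> is orthogonal
  to all test functions, since for fixed \<open>z\<close> the function \<open>x \<mapsto> \<eta>(x - z)\<close> is a test function.\<close>

lemma weak_solution_extend_compact:
  fixes F W :: "real ^ 'n::finite \<Rightarrow> real ^ 'n"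
  assumes q: "q > 1" and F: "F \<in> Lp q lborel" and sol: "\<And>\<psi>. \<psi> \<in> test_functions UNIV \<Longrightarrow> (\<integral>x. F x \<bullet> grad \<psi> x \<partial>lborel) = 0"
    and wg: "is_weak_grad UNIV \<phi> W" and W: "W \<in> Lp (q / (q - 1)) lborel"
    and R: "\<And>x. x \<notin> cball 0 R \<Longrightarrow> \<phi> x = 0" "\<And>x. x \<notin> cball 0 R \<Longrightarrow> W x = 0"
  shows "(\<integral>x. F x \<bullet> W x \<partial>lborel) = 0"
proof -
  let ?p = "q / (q - 1)"
  have p: "?p > 1" using q by (simp add: field_simps)
  have Floc: "F \<in> Lp_loc 1 UNIV" using q by (intro Lp_imp_Lp_loc_UNIV[OF F]) simp
  note D = is_weak_gradD[OF wg, simplified]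
  have [measurable]: "F \<in> borel_measurable borel" "W \<in> borel_measurable borel" "\<phi> \<in> borel_measurable borel"
    using Lp_loc_UNIV_measurable Floc D by auto
  have int_comp: "integrable lborel f" if "f \<in> Lp_loc 1 UNIV" "\<And>x. x \<notin> cball 0 R \<Longrightarrow> f x = 0"
    for f :: "real ^ 'n \<Rightarrow> 'b::euclidean_space"
  proof -
    have "integrable lborel (\<lambda>x. indicator (cball 0 R) x *\<^sub>R f x)" by (rule Lp_loc_integrable[OF that(1)]) auto
    also have "(\<lambda>x. indicator (cball 0 R) x *\<^sub>R f x) = f"
      using that(2) by (intro ext) (auto simp: indicator_def)
    finally show ?thesis .
  qed
  have Wint: "integrable lborel W" using int_comp[OF D(2) R(2)] .
  have \<phi>int: "integrable lborel \<phi>" using int_comp[OF D(1) R(1)] .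
  define A where "A y = (\<integral>x. F x \<bullet> W (x - y) \<partial>lborel)" for y
  have [measurable]: "A \<in> borel_measurable borel" unfolding A_def by measurable
  have Abound: "\<bar>A y\<bar> \<le> Lp_norm q lborel F * Lp_norm ?p lborel W" for y
    using Holder_inner(2)[OF q F Lp_translate[OF W, of y]] Lp_norm_translate[OF W, of y] by (simp add: A_def)
  have "AE y in lborel. y \<in> UNIV \<longrightarrow> A y = 0"
  proof (rule fundamental_lemma)
    show "A \<in> Lp_loc 1 UNIV"
    proof (rule Lp_loc_1I)
      fix K :: "(real ^ 'n) set" assume K: "compact K"
      show "integrable lborel (\<lambda>x. indicator K x *\<^sub>R A x)"
        by (rule integrableI_bounded_set[where A=K and B="Lp_norm q lborel F * Lp_norm ?p lborel W"])
          (use K borel_compact[OF K] Abound in \<open>auto simp: emeasure_compact_finite[unfolded infinity_ennreal_def]\<close>)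
    qed
    fix \<eta> :: "real ^ 'n \<Rightarrow> real" assume \<eta>: "\<eta> \<in> test_functions UNIV"
    have [measurable]: "\<eta> \<in> borel_measurable borel" by (rule smooth_borel_measurable[OF test_functions_smooth[OF \<eta>]])
    have [measurable]: "grad \<eta> \<in> borel_measurable borel" using Lp_measurable[OF grad_test_Lp[OF \<eta>, of 1]] by simp
    obtain M where M: "\<And>x. \<bar>\<eta> x\<bar> \<le> M" using test_functions_bounded[OF \<eta>] by blast
    obtain S where S: "\<And>x. x \<notin> ball 0 S \<Longrightarrow> \<eta> x = 0" using test_functions_ball[OF \<eta>] by blast
    define T where "T = max R S"
    have T: "W x = 0" "\<eta> x = 0" "\<phi> x = 0" if "x \<notin> cball 0 T" for x
      using R[of x] S[of x] that by (auto simp: T_def)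
    obtain B where B: "\<And>x. norm (grad \<eta> x) \<le> B" using grad_bounded[OF \<eta>] by blast
    have B0: "B \<ge> 0" using order_trans[OF norm_ge_zero B] .
    have gT: "grad \<eta> x = 0" if "x \<notin> cball 0 T" for x by (rule grad_eq_0[of "cball 0 T"]) (use T that in auto)
    have "(\<integral>y. A y * \<eta> y \<partial>lborel) = (\<integral>x. \<integral>z. F x \<bullet> W z * \<eta> (x - z) \<partial>lborel \<partial>lborel)"
      unfolding A_def by (rule pairing_swap(1)[OF Floc Wint T(1) _ M T(2)]) auto
    \<comment> \<open>For fixed \<open>x\<close> the function
      \<open>z \<mapsto> \<eta> (x - z)\<close> is a test function as well; the sign of its
      derivative cancels the sign in the weak derivative of \<open>\<phi>\<close>.\<close>
    also have "\<dots> = (\<integral>x. \<integral>z. \<phi> z * (F x \<bullet> grad \<eta> (x - z)) \<partial>lborel \<partial>lborel)"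
    proof (rule Bochner_Integration.integral_cong[OF refl])
      fix x
      note \<eta>x = grad_reflect_at[OF \<eta>, where x=x]
      have i1: "integrable lborel (\<lambda>z. F x $ i * (W z $ i * \<eta> (x - z)))" for i
        by (intro integrable_mult_right test_integrable_mult[OF _ \<eta>x(1)] Lp_loc_component D) simp
      have i2: "integrable lborel (\<lambda>z. F x $ i * (\<phi> z * partial_deriv i \<eta> (x - z)))" for i
        using test_integrable_mult[OF D(1) test_functions_partial_deriv[OF \<eta>x(1), of i]]
        by (intro integrable_mult_right) (simp add: \<eta>x(2))
      have "(\<integral>z. F x \<bullet> W z * \<eta> (x - z) \<partial>lborel) = (\<integral>z. (\<Sum>i\<in>UNIV. F x $ i * (W z $ i * \<eta> (x - z))) \<partial>lborel)"
        by (simp add: inner_vec_def sum_distrib_right mult.assoc)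
      also have "\<dots> = (\<Sum>i\<in>UNIV. F x $ i * (\<integral>z. W z $ i * \<eta> (x - z) \<partial>lborel))" using i1 by simp
      also have "\<dots> = (\<Sum>i\<in>UNIV. F x $ i * (\<integral>z. \<phi> z * partial_deriv i \<eta> (x - z) \<partial>lborel))"
        using D(3)[OF \<eta>x(1)] by (simp add: \<eta>x(2))
      also have "\<dots> = (\<integral>z. (\<Sum>i\<in>UNIV. F x $ i * (\<phi> z * partial_deriv i \<eta> (x - z))) \<partial>lborel)" using i2 by simp
      also have "\<dots> = (\<integral>z. \<phi> z * (F x \<bullet> grad \<eta> (x - z)) \<partial>lborel)"
        by (simp add: inner_vec_def sum_distrib_left grad_nth mult_ac)
      finally show "(\<integral>z. F x \<bullet> W z * \<eta> (x - z) \<partial>lborel) = (\<integral>z. \<phi> z * (F x \<bullet> grad \<eta> (x - z)) \<partial>lborel)" .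
    qed
    also have "\<dots> = (\<integral>z. \<integral>x. \<phi> z * (F x \<bullet> grad \<eta> (x - z)) \<partial>lborel \<partial>lborel)"
    proof (rule lborel_pair.Fubini_integral[symmetric], rule Bochner_Integration.integrable_bound)
      let ?k = "\<lambda>x. B * (indicator (cball 0 (2 * T)) x * norm (F x))"
      have k: "integrable lborel ?k"
        using integrable_norm[OF Lp_loc_integrable[OF Floc compact_cball[of 0 "2 * T"]]] by simp
      show "integrable (lborel \<Otimes>\<^sub>M lborel) (\<lambda>(x, z). ?k x * \<bar>\<phi> z\<bar>)"
        by (rule integrable_prod_mult[OF k]) (use \<phi>int in simp)
      show "(\<lambda>(x, z). \<phi> z * (F x \<bullet> grad \<eta> (x - z))) \<in> borel_measurable (lborel \<Otimes>\<^sub>M lborel)" by measurable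
      have "\<bar>\<phi> z * (F x \<bullet> grad \<eta> (x - z))\<bar> \<le> ?k x * \<bar>\<phi> z\<bar>" for x z
      proof (cases "z \<in> cball 0 T \<and> x - z \<in> cball 0 T")
        case True
        then have "x \<in> cball 0 (2 * T)" using norm_triangle_ineq[of "x - z" z] by simp
        moreover have "\<bar>F x \<bullet> grad \<eta> (x - z)\<bar> \<le> norm (F x) * B"
          by (rule order_trans[OF Cauchy_Schwarz_ineq2]) (intro mult_left_mono B norm_ge_zero)
        then have "\<bar>\<phi> z\<bar> * \<bar>F x \<bullet> grad \<eta> (x - z)\<bar> \<le> \<bar>\<phi> z\<bar> * (norm (F x) * B)" by (intro mult_left_mono) auto
        ultimately show ?thesis by (simp add: abs_mult mult_ac)
      next
        case False
        then show ?thesis using T(3)[of z] gT[of "x - z"] B0 by auto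
      qed
      then show "AE p in lborel \<Otimes>\<^sub>M lborel. norm (case p of (x, z) \<Rightarrow> \<phi> z * (F x \<bullet> grad \<eta> (x - z))) \<le>
          norm (case p of (x, z) \<Rightarrow> ?k x * \<bar>\<phi> z\<bar>)"
        by (auto intro!: AE_I2 order_trans[OF _ abs_ge_self] simp del: norm_mult)
    qed
    also have "\<dots> = 0"
    proof -
      have "(\<integral>x. F x \<bullet> grad \<eta> (x - z) \<partial>lborel) = 0" for z
      proof -
        have "grad (\<lambda>x. \<eta> (- z + x)) = (\<lambda>x. grad \<eta> (x - z))"
          by (intro ext) (simp add: vec_eq_iff grad_nth partial_deriv_translate[OF test_functions_smooth[OF \<eta>], of _ "- z", simplified])
        with sol[OF test_functions_translate[OF \<eta>, of "- z"]] show ?thesis by simp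
      qed
      then show ?thesis by simp
    qed
    finally show "(\<integral>y. A y * \<eta> y \<partial>lborel) = 0" .
  qed simp
  then have AE0: "AE y in lborel. A y = 0" by simp
  \<comment> \<open>Vanishing almost everywhere says nothing about the origin itself; zeros of
    \<open>A\<close> that converge to it, together with continuity of the pairing, do.\<close>
  have "\<exists>y. y \<in> ball 0 (inverse (real (Suc n))) \<and> A y = 0" for n
    using AE_lborel_ball_ex[OF AE0, of "inverse (real (Suc n))" 0] by (metis inverse_positive_iff_positive of_nat_0_less_iff zero_less_Suc)
  then obtain y where y: "\<And>n. y n \<in> ball 0 (inverse (real (Suc n)))" "\<And>n. A (y n) = 0" by metis
  have "y \<longlonglongrightarrow> 0"
    by (rule Lim_null_comparison[OF _ LIMSEQ_inverse_real_of_nat]) (use y(1) in \<open>intro always_eventually allI less_imp_le, simp\<close>)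
  from pairing_tendsto[OF q F W this] y(2) show ?thesis by (simp add: A_def LIMSEQ_const_iff)
qed

subsection \<open>Radial bumps\<close>

text \<open>With \<open>y = 1 / s\<close> this is \<open>y ^ m / fact m \<le> exp y\<close>, one
  term of the exponential series. It is the source of the factorials in the cutoff bounds
  below.\<close>

lemma flat_le_fact: "flat m s \<le> fact m"
proof (cases "s > 0")
  case True
  define y where "y = 1 / s"
  have "y ^ m /\<^sub>R fact m \<le> exp y"
    unfolding exp_def using sum_le_suminf[OF summable_exp_generic[of y], of "{m}"] True
    by (simp add: y_def)
  then have "y ^ m * exp (- y) \<le> fact m"
    by (simp add: exp_minus divide_simps mult.commute)
  then show ?thesis using True by (simp add: flat_def y_def power_one_over divide_simps)
qed (simp add: flat_eq_0)

text \<open>For positive \<open>\<mu>\<close> it is positive exactly on the ball of radius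
  \<open>1 / \<mu>\<close> about \<open>a\<close>. It is written through squares of coordinates, not
  through the norm, so that smoothness follows from the closure rules for sums and products.\<close>

definition bump_arg :: "real \<Rightarrow> real ^ 'n::finite \<Rightarrow> real ^ 'n \<Rightarrow> real" where
  "bump_arg \<mu> a x = 1 - \<mu>\<^sup>2 * (\<Sum>j\<in>UNIV. (x $ j - a $ j) * (x $ j - a $ j))"

lemma bump_arg_norm: "bump_arg \<mu> a x = 1 - (\<mu> * norm (x - a))\<^sup>2"
  by (simp add: bump_arg_def power_mult_distrib power2_norm_eq_inner inner_vec_def)

lemma bump_arg_nonpos: "\<mu> > 0 \<Longrightarrow> x \<notin> ball a (1 / \<mu>) \<Longrightarrow> bump_arg \<mu> a x \<le> 0"
proof -
  assume \<mu>: "\<mu> > 0" and x: "x \<notin> ball a (1 / \<mu>)"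
  then have "\<mu> * norm (x - a) \<ge> 1" by (simp add: dist_norm norm_minus_commute field_simps)
  then have "(\<mu> * norm (x - a))\<^sup>2 \<ge> 1\<^sup>2" by (intro power_mono) auto
  then show ?thesis by (simp add: bump_arg_norm)
qed

lemma bump_arg_pos: "\<mu> > 0 \<Longrightarrow> x \<in> ball a (1 / \<mu>) \<Longrightarrow> bump_arg \<mu> a x > 0"
proof -
  assume \<mu>: "\<mu> > 0" and x: "x \<in> ball a (1 / \<mu>)"
  then have "\<mu> * norm (x - a) < 1" by (simp add: dist_norm norm_minus_commute field_simps)
  then have "(\<mu> * norm (x - a))\<^sup>2 < 1\<^sup>2" using \<mu> by (intro power_strict_mono) auto
  then show ?thesis by (simp add: bump_arg_norm)
qed

lemma bump_arg_le_1: "bump_arg \<mu> a x \<le> 1"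
  by (simp add: bump_arg_norm)

lemma smooth_bump_arg: "smooth (bump_arg \<mu> a)"
  unfolding bump_arg_def[abs_def]
  by (intro smooth_diff smooth_mult smooth_sum smooth_const smooth_coord)

section \<open>Derivatives of radial bumps and their symmetry\<close>

lemma partial_deriv_sum:
  assumes "\<And>j. j \<in> I \<Longrightarrow> smooth (f j)"
  shows "partial_deriv i (\<lambda>x. \<Sum>j\<in>I. f j x) = (\<lambda>x. \<Sum>j\<in>I. partial_deriv i (f j) x)"
  using assms
  by (induction I rule: infinite_finite_induct)
    (auto simp: partial_deriv_const smooth_partial_add smooth_sum)

lemma partial_deriv_bump_arg:
  "partial_deriv i (bump_arg \<mu> a) = (\<lambda>x :: real ^ 'n::finite. - 2 * \<mu>\<^sup>2 * (x $ i - a $ i))"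
proof -
  have s: "smooth (\<lambda>x :: real ^ 'n. x $ j - a $ j)" for j by (intro smooth_diff smooth_const smooth_coord)
  have d: "partial_deriv i (\<lambda>x :: real ^ 'n. x $ j - a $ j) = (\<lambda>x. if i = j then 1 else 0)" for j
    by (simp add: smooth_partial_diff smooth_coord smooth_const partial_deriv_coord partial_deriv_const)
  have "partial_deriv i (\<lambda>x :: real ^ 'n. \<Sum>j\<in>UNIV. (x $ j - a $ j) * (x $ j - a $ j)) =
      (\<lambda>x. \<Sum>j\<in>UNIV. partial_deriv i (\<lambda>x. (x $ j - a $ j) * (x $ j - a $ j)) x)"
    by (rule partial_deriv_sum) (intro smooth_mult s)
  also have "\<dots> = (\<lambda>x. \<Sum>j\<in>UNIV. (if i = j then 2 * (x $ j - a $ j) else 0))"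
    by (intro ext sum.cong refl) (subst smooth_partial_mult[OF s s], simp add: d)
  also have "\<dots> = (\<lambda>x. 2 * (x $ i - a $ i))" by simp
  finally show ?thesis
    unfolding bump_arg_def[abs_def]
    by (simp add: smooth_partial_diff smooth_const smooth_cmult smooth_sum smooth_mult s smooth_partial_cmult partial_deriv_const)
      (simp add: fun_eq_iff algebra_simps)
qed

lemma bump_test:
  assumes "\<mu> > 0"
  shows "(\<lambda>x. flat m (bump_arg \<mu> a x)) \<in> test_functions UNIV"
  by (rule test_functionsI[of _ "cball a (1 / \<mu>)"])
    (use bump_arg_nonpos[OF assms, of _ a] ball_subset_cball in \<open>auto intro!: smooth_flat smooth_bump_arg flat_eq_0\<close>)

lemma partial_deriv_bump:
  "partial_deriv i (\<lambda>x. flat m (bump_arg \<mu> a x)) =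
   (\<lambda>x :: real ^ 'n::finite. (flat (m + 2) (bump_arg \<mu> a x) - real m * flat (m + 1) (bump_arg \<mu> a x)) *
      (- 2 * \<mu>\<^sup>2 * (x $ i - a $ i)))"
  by (simp add: partial_deriv_flat smooth_differentiable[OF smooth_bump_arg] partial_deriv_bump_arg)

text \<open>Symmetry of second derivatives as a property that products, differences and multiples
  inherit; for the bumps it is checked by computation.\<close>

definition commuting :: "(real ^ 'n::finite \<Rightarrow> real) \<Rightarrow> bool" where
  "commuting f \<longleftrightarrow> smooth f \<and> (\<forall>i j. partial_deriv i (partial_deriv j f) = partial_deriv j (partial_deriv i f))"

lemma commuting_mult: "commuting f \<Longrightarrow> commuting g \<Longrightarrow> commuting (\<lambda>x. f x * g x)"
  unfolding commuting_def
  by (auto simp: smooth_partial_mult smooth_partial_add smooth_mult smooth_partial_deriv algebra_simps)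

lemma commuting_affine: "commuting (\<lambda>x. b + c * x $ k)"
  unfolding commuting_def
  by (auto simp: smooth_partial_mult smooth_partial_add smooth_mult smooth_add smooth_const smooth_coord
      partial_deriv_const partial_deriv_coord)

lemma commuting_diff: "commuting f \<Longrightarrow> commuting g \<Longrightarrow> commuting (\<lambda>x. f x - g x)"
  unfolding commuting_def by (auto simp: smooth_partial_diff smooth_diff smooth_partial_deriv)

lemma commuting_cmult: "commuting f \<Longrightarrow> commuting (\<lambda>x. c * f x)"
  unfolding commuting_def by (auto simp: smooth_partial_cmult smooth_cmult smooth_partial_deriv)

lemma commuting_bump: "commuting (\<lambda>x. flat m (bump_arg \<mu> a x))"
  unfolding commuting_def
proof (intro conjI allI)
  fix i j :: 'a
  have s: "smooth (\<lambda>x. flat m (bump_arg \<mu> a x))" for m by (intro smooth_flat smooth_bump_arg)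
  have l: "smooth (\<lambda>x :: real ^ 'a. - 2 * \<mu>\<^sup>2 * (x $ j - a $ j))" for j
    by (intro smooth_mult smooth_diff smooth_const smooth_coord)
  have d: "partial_deriv i (\<lambda>x :: real ^ 'a. - 2 * \<mu>\<^sup>2 * (x $ j - a $ j)) = (\<lambda>x. if i = j then - 2 * \<mu>\<^sup>2 else 0)" for i j
  proof -
    have "smooth (\<lambda>x :: real ^ 'a. x $ j - a $ j)" by (intro smooth_diff smooth_const smooth_coord)
    then show ?thesis
      by (subst smooth_partial_cmult) (auto simp: smooth_partial_diff smooth_coord smooth_const partial_deriv_coord partial_deriv_const)
  qed
  have E: "partial_deriv i (partial_deriv j (\<lambda>x. flat m (bump_arg \<mu> a x))) =
    (\<lambda>x. (flat (m + 2) (bump_arg \<mu> a x) - real m * flat (m + 1) (bump_arg \<mu> a x)) * (if i = j then - 2 * \<mu>\<^sup>2 else 0) +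
      (partial_deriv i (\<lambda>x. flat (m + 2) (bump_arg \<mu> a x)) x - real m * partial_deriv i (\<lambda>x. flat (m + 1) (bump_arg \<mu> a x)) x) *
      (- 2 * \<mu>\<^sup>2 * (x $ j - a $ j)))" for i j
    unfolding partial_deriv_bump[of j m \<mu> a]
    by (subst smooth_partial_mult[OF smooth_diff[OF s smooth_cmult[OF s]] l])
      (simp only: d smooth_partial_diff[OF s smooth_cmult[OF s]] smooth_partial_cmult[OF s])
  show "partial_deriv i (partial_deriv j (\<lambda>x. flat m (bump_arg \<mu> a x))) =
      partial_deriv j (partial_deriv i (\<lambda>x. flat m (bump_arg \<mu> a x)))"
    unfolding E unfolding partial_deriv_bump
    by (intro ext) (cases "i = j"; simp add: algebra_simps)
qed (intro smooth_flat smooth_bump_arg)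

text \<open>Symmetry for the first derivatives of a bump supplies the exchange of third derivatives
  in the argument with the Laplacian.\<close>

lemma commuting_partial_bump: "commuting (partial_deriv i (\<lambda>x. flat m (bump_arg \<mu> a x)))"
proof -
  have "commuting (\<lambda>x :: real ^ 'a. - 2 * \<mu>\<^sup>2 * (x $ i - a $ i))"
    using commuting_affine[of "2 * \<mu>\<^sup>2 * a $ i" "- 2 * \<mu>\<^sup>2" i] by (simp add: algebra_simps)
  then show ?thesis
    unfolding partial_deriv_bump
    by (intro commuting_mult[OF commuting_diff[OF commuting_bump commuting_cmult[OF commuting_bump]]])
qed

subsection \<open>Cutting off\<close>

text \<open>The product \<open>\<psi> * \<tau>\<close> is a test function; Leibniz' rule for it,
  inserted into the weak equation of \<open>\<phi>\<close>, rearranges to the claim.\<close>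

lemma is_weak_grad_mult:
  fixes \<phi> :: "real ^ 'n::finite \<Rightarrow> real"
  assumes wg: "is_weak_grad UNIV \<phi> W" and \<tau>: "\<tau> \<in> test_functions UNIV"
  shows "is_weak_grad UNIV (\<lambda>x. \<tau> x * \<phi> x) (\<lambda>x. \<tau> x *\<^sub>R W x + \<phi> x *\<^sub>R grad \<tau> x)"
proof (subst is_weak_grad_iff, simp, intro conjI ballI allI)
  note D = is_weak_gradD[OF wg, simplified]
  note s = test_functions_smooth[OF \<tau>]
  have i: "integrable lborel (\<lambda>x. \<tau> x *\<^sub>R \<phi> x)" "integrable lborel (\<lambda>x. \<tau> x *\<^sub>R W x)"
    using test_integrable[OF D(1) \<tau>] test_integrable[OF D(2) \<tau>] by auto
  have "integrable lborel (\<lambda>x. \<Sum>i\<in>UNIV. (\<phi> x * partial_deriv i \<tau> x) *\<^sub>R axis i (1::real) :: real ^ 'n)"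
    by (intro Bochner_Integration.integrable_sum integrable_scaleR_left test_integrable_mult[OF D(1)] test_functions_partial_deriv[OF \<tau>])
  also have "(\<lambda>x. \<Sum>i\<in>UNIV. (\<phi> x * partial_deriv i \<tau> x) *\<^sub>R axis i (1::real) :: real ^ 'n) = (\<lambda>x. \<phi> x *\<^sub>R grad \<tau> x)"
    by (auto simp: vec_eq_iff grad_nth axis_def if_distrib cong: if_cong)
  finally have i3: "integrable lborel (\<lambda>x. \<phi> x *\<^sub>R grad \<tau> x)" .
  have loc: "f \<in> Lp_loc 1 UNIV" if "integrable lborel f" for f :: "real ^ 'n \<Rightarrow> 'c::euclidean_space"
    by (rule Lp_loc_1I) (use that in \<open>auto intro!: integrable_mult_indicator borel_compact\<close>)
  show "(\<lambda>x. \<tau> x * \<phi> x) \<in> Lp_loc 1 UNIV" using loc[OF i(1)] by simp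
  show "(\<lambda>x. \<tau> x *\<^sub>R W x + \<phi> x *\<^sub>R grad \<tau> x) \<in> Lp_loc 1 UNIV" by (intro loc Bochner_Integration.integrable_add i i3)
  fix \<psi> :: "real ^ 'n \<Rightarrow> real" and i assume \<psi>: "\<psi> \<in> test_functions UNIV"
  note t = test_functions_mult[OF \<psi> s]
  have pd: "partial_deriv i (\<lambda>x. \<psi> x * \<tau> x) = (\<lambda>x. \<psi> x * partial_deriv i \<tau> x + partial_deriv i \<psi> x * \<tau> x)"
    by (rule smooth_partial_mult[OF test_functions_smooth[OF \<psi>] s])
  have j1: "integrable lborel (\<lambda>x. \<phi> x * (\<psi> x * partial_deriv i \<tau> x))"
    by (intro test_integrable_mult[OF D(1)] test_functions_mult \<psi> smooth_partial_deriv s)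
  have j2: "integrable lborel (\<lambda>x. \<phi> x * (partial_deriv i \<psi> x * \<tau> x))"
    by (intro test_integrable_mult[OF D(1)] test_functions_mult test_functions_partial_deriv \<psi> s)
  have j3: "integrable lborel (\<lambda>x. W x $ i * (\<psi> x * \<tau> x))"
    by (intro test_integrable_mult[OF _ t] Lp_loc_component D) simp
  have "(\<integral>x. \<phi> x * (\<psi> x * partial_deriv i \<tau> x) \<partial>lborel) + (\<integral>x. \<phi> x * (partial_deriv i \<psi> x * \<tau> x) \<partial>lborel) =
      - (\<integral>x. W x $ i * (\<psi> x * \<tau> x) \<partial>lborel)"
    using D(3)[OF t, of i] j1 j2 by (simp add: pd distrib_left)
  moreover have "(\<integral>x. (\<tau> x *\<^sub>R W x + \<phi> x *\<^sub>R grad \<tau> x) $ i * \<psi> x \<partial>lborel) =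
      (\<integral>x. W x $ i * (\<psi> x * \<tau> x) + \<phi> x * (\<psi> x * partial_deriv i \<tau> x) \<partial>lborel)"
    by (intro Bochner_Integration.integral_cong) (auto simp: grad_nth algebra_simps)
  moreover have "(\<integral>x. \<tau> x * \<phi> x * partial_deriv i \<psi> x \<partial>lborel) = (\<integral>x. \<phi> x * (partial_deriv i \<psi> x * \<tau> x) \<partial>lborel)"
    by (intro Bochner_Integration.integral_cong) (auto simp: algebra_simps)
  ultimately show "(\<integral>x. \<tau> x * \<phi> x * partial_deriv i \<psi> x \<partial>lborel) =
      - (\<integral>x. (\<tau> x *\<^sub>R W x + \<phi> x *\<^sub>R grad \<tau> x) $ i * \<psi> x \<partial>lborel)"
    using j1 j3 by simp
qed

text \<open>The commutator \<open>(\<phi> - c) \<nabla>\<tau>\<close> of the cutoff is bounded in \<open>L\<^sub>q\<^sub>'\<close> by the Poincare inequality and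
  concentrates at infinity, where \<open>F\<close> is small.\<close>

lemma weak_solution_extend:
  fixes F W :: "real ^ 'n::finite \<Rightarrow> real ^ 'n"
  assumes q: "q > 1" and F: "F \<in> Lp q lborel" and sol: "\<And>\<psi>. \<psi> \<in> test_functions UNIV \<Longrightarrow> (\<integral>x. F x \<bullet> grad \<psi> x \<partial>lborel) = 0"
    and \<phi>: "\<phi> \<in> hat_H1 (q / (q - 1)) UNIV" and wg: "is_weak_grad UNIV \<phi> W" and W: "W \<in> Lp (q / (q - 1)) lborel"
  shows "(\<integral>x. F x \<bullet> W x \<partial>lborel) = 0"
proof -
  define p where "p = q / (q - 1)"
  have p: "p > 1" using q by (simp add: p_def field_simps)
  have WL: "W \<in> Lp p lborel" using W by (simp add: p_def)
  have \<phi>K: "\<And>K. compact K \<Longrightarrow> (\<lambda>x. indicator K x *\<^sub>R \<phi> x) \<in> Lp p lborel"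
    using \<phi> unfolding hat_H1_UNIV_iff p_def by blast
  have [measurable]: "F \<in> borel_measurable borel" "W \<in> borel_measurable borel" "\<phi> \<in> borel_measurable borel"
    using Lp_measurable[OF F] Lp_measurable[OF W] Lp_loc_UNIV_measurable wg by (auto simp: is_weak_grad_def)
  define R where "R n = real (Suc n)" for n
  have R: "R n > 0" for n by (simp add: R_def)
  define s where "s n = bump_arg (1 / R n) (0 :: real ^ 'n)" for n
  \<comment> \<open>The factor \<open>exp 1\<close> makes the pointwise limit 1, since
    \<open>flat 0 1 = exp (- 1)\<close>.\<close>
  define \<tau> where "\<tau> n x = exp 1 * flat 0 (s n x)" for n x
  \<comment> \<open>The mean over the same ball as the cutoff makes the Poincare constant linear in
    \<open>R n\<close>; the gradient of the cutoff, of size \<open>1 / R n\<close>, compensates this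
    growth.\<close>
  define c where "c n = ball_mean (R n) \<phi>" for n
  define g where "g n x = (- (2 * exp 1) * flat 2 (s n x) / (R n)\<^sup>2) *\<^sub>R x" for n and x :: "real ^ 'n"
  have \<tau>t: "\<tau> n \<in> test_functions UNIV" for n
    unfolding \<tau>_def[abs_def] s_def by (intro test_functions_cmult bump_test) (simp add: R)
  note \<tau>s = test_functions_smooth[OF \<tau>t]
  have [measurable]: "\<tau> n \<in> borel_measurable borel" for n by (rule smooth_borel_measurable[OF \<tau>s])
  have g: "grad (\<tau> n) = g n" for n
  proof -
    have "partial_deriv i (\<tau> n) x = g n x $ i" for i x
      unfolding \<tau>_def[abs_def] s_def g_def
      by (subst smooth_partial_cmult[OF smooth_flat[OF smooth_bump_arg]])
        (simp only: partial_deriv_bump, simp add: power_divide numeral_2_eq_2)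
    then show ?thesis by (auto simp: vec_eq_iff grad_nth)
  qed
  have s0: "s n x \<le> 0" if "x \<notin> ball 0 (R n)" for n x
    unfolding s_def using R[of n] that by (intro bump_arg_nonpos) auto
  have out: "\<tau> n x = 0" "g n x = 0" if "x \<notin> ball 0 (R n)" for n x
    using s0[OF that] by (auto simp: \<tau>_def g_def flat_eq_0)
  have gnorm: "norm (g n x) \<le> 4 * exp 1 * norm x / (R n)\<^sup>2" for n x
  proof -
    have "norm (g n x) = 2 * exp 1 * norm x / (R n)\<^sup>2 * flat 2 (s n x)"
      by (simp add: g_def abs_mult flat_nonneg)
    also have "\<dots> \<le> 2 * exp 1 * norm x / (R n)\<^sup>2 * fact 2"
      by (intro mult_left_mono flat_le_fact) auto
    finally show ?thesis by (simp add: fact_2)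
  qed
  have Rg: "R n * norm (g n x) \<le> 4 * exp 1" for n x
  proof (cases "x \<in> ball 0 (R n)")
    case True
    have "R n * norm (g n x) \<le> R n * (4 * exp 1 * norm x / (R n)\<^sup>2)"
      using R[of n] by (intro mult_left_mono gnorm) auto
    also have "\<dots> \<le> R n * (4 * exp 1 * R n / (R n)\<^sup>2)"
      using R[of n] True by (intro mult_left_mono divide_right_mono) auto
    finally show ?thesis using R[of n] by (simp add: power2_eq_square)
  qed (simp add: out)
  have \<tau>01: "0 \<le> \<tau> n x" "\<tau> n x \<le> 1" for n x
  proof -
    show "0 \<le> \<tau> n x" by (simp add: \<tau>_def flat_nonneg)
    have "s n x \<le> 1" unfolding s_def by (rule bump_arg_le_1)
    then have "exp 1 * exp (- 1 / s n x) \<le> exp 0" if "s n x > 0"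
      using that by (subst exp_add[symmetric], subst exp_le_cancel_iff) (simp add: field_simps)
    then show "\<tau> n x \<le> 1" by (auto simp: \<tau>_def flat_def)
  qed
  have Rinf: "(\<lambda>n. 1 / R n) \<longlonglongrightarrow> 0"
    using LIMSEQ_inverse_real_of_nat by (simp add: R_def inverse_eq_divide)
  have \<tau>lim: "(\<lambda>n. \<tau> n x) \<longlonglongrightarrow> 1" for x
  proof -
    have "(\<lambda>n. 1 - (1 / R n * norm x)\<^sup>2) \<longlonglongrightarrow> 1 - (0 * norm x)\<^sup>2" by (intro tendsto_intros Rinf)
    then have "(\<lambda>n. s n x) \<longlonglongrightarrow> 1" by (simp add: s_def bump_arg_norm)
    then have "(\<lambda>n. flat 0 (s n x)) \<longlonglongrightarrow> flat 0 1"
      by (intro continuous_on_tendsto_compose[OF continuous_on_flat[of UNIV 0]]) auto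
    then have "(\<lambda>n. exp 1 * flat 0 (s n x)) \<longlonglongrightarrow> exp 1 * flat 0 1" by (intro tendsto_intros)
    then show ?thesis by (simp add: \<tau>_def flat_def exp_minus)
  qed
  let ?\<phi> = "\<lambda>n x. \<phi> x - c n"
  define Wn where "Wn n x = \<tau> n x *\<^sub>R W x + ?\<phi> n x *\<^sub>R g n x" for n x
  have wgc: "is_weak_grad UNIV (?\<phi> n) W" for n
    using is_weak_grad_diff[OF wg is_weak_grad_smooth[OF smooth_const[of "c n"]]]
    by (simp add: grad_def partial_deriv_const zero_vec_def[symmetric])
  have wgn: "is_weak_grad UNIV (\<lambda>x. \<tau> n x * ?\<phi> n x) (Wn n)" for n
    using is_weak_grad_mult[OF wgc \<tau>t, of n n] by (simp add: g Wn_def[abs_def])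
  let ?K = "\<lambda>n x. indicator (ball 0 (R n)) x *\<^sub>R ?\<phi> n x"
  have KL: "?K n \<in> Lp p lborel" for n
    unfolding c_def by (rule Poincare(2)[OF \<phi>K wg WL p R order_refl])
  have Knorm: "Lp_norm p lborel (\<lambda>x. (1 / R n) *\<^sub>R ?K n x) \<le> (2 ^ CARD('n)) powr (1 / p) * 2 * Lp_norm p lborel W" for n
  proof -
    have "Lp_norm p lborel (?K n) \<le> (2 ^ CARD('n)) powr (1 / p) * (2 * R n * Lp_norm p lborel W)"
      using Poincare(1)[OF \<phi>K wg WL p R order_refl, of n] R[of n] unfolding c_def by simp
    then have "1 / R n * Lp_norm p lborel (?K n) \<le> 1 / R n * ((2 ^ CARD('n)) powr (1 / p) * (2 * R n * Lp_norm p lborel W))"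
      using R[of n] by (intro mult_left_mono) auto
    then show ?thesis using R[of n] p by (subst Lp_norm_scaleR) auto
  qed
  have gm: "g n \<in> borel_measurable borel" for n
    using Lp_measurable[OF grad_test_Lp[OF \<tau>t, of 1 n]] by (simp add: g)
  note [measurable] = gm
  have WnL1: "(\<lambda>x. \<tau> n x *\<^sub>R W x) \<in> Lp p lborel" for n
    by (rule Lp_scaleR_bounded[OF WL, where C=1]) (use \<tau>01 p in auto)
  have WnL2: "(\<lambda>x. ?\<phi> n x *\<^sub>R g n x) \<in> Lp p lborel" for n
  proof (rule Lp_mono[OF KL[of n], where C="4 * exp 1 / R n"])
    show "AE x in lborel. norm (?\<phi> n x *\<^sub>R g n x) \<le> 4 * exp 1 / R n * norm (?K n x)"
    proof (rule AE_I2)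
      fix x
      have "norm (g n x) \<le> 4 * exp 1 / R n" using Rg[of n x] R[of n] by (simp add: field_simps)
      then have "\<bar>?\<phi> n x\<bar> * norm (g n x) \<le> \<bar>?\<phi> n x\<bar> * (4 * exp 1 / R n)" by (rule mult_left_mono) simp
      then show "norm (?\<phi> n x *\<^sub>R g n x) \<le> 4 * exp 1 / R n * norm (?K n x)"
        using out(2)[of x n] by (cases "x \<in> ball 0 (R n)") (auto simp: mult.commute)
    qed
  qed (use p R[of n] in auto)
  have zero: "(\<integral>x. F x \<bullet> Wn n x \<partial>lborel) = 0" for n
  proof (rule weak_solution_extend_compact[OF q F sol wgn, where R="R n"])
    show "Wn n \<in> Lp (q / (q - 1)) lborel"
      unfolding p_def[symmetric] Wn_def using WnL1 WnL2 p by (intro Lp_add) auto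
    show "\<tau> n x * ?\<phi> n x = 0" "Wn n x = 0" if "x \<notin> cball 0 (R n)" for x
      using out[of x n] that by (auto simp: Wn_def)
  qed
  \<comment> \<open>The factor \<open>R n\<close> is moved to the side of \<open>F\<close>: the
    fields \<open>R n *\<^sub>R g n x\<close> are bounded and tend to 0 pointwise, so
    \<open>?H n\<close> tends to 0 in \<open>Lp\<close>, while the other factor, divided by
    \<open>R n\<close>, stays bounded by Poincare's inequality.\<close>
  let ?H = "\<lambda>n x. F x \<bullet> (R n *\<^sub>R g n x)"
  have Hle: "\<bar>?H n x\<bar> \<le> norm ((4 * exp 1) *\<^sub>R F x)" for n x
  proof -
    have "\<bar>?H n x\<bar> \<le> norm (F x) * norm (R n *\<^sub>R g n x)" by (rule Cauchy_Schwarz_ineq2)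
    also have "\<dots> \<le> norm (F x) * (4 * exp 1)" using Rg[of n x] R[of n] by (intro mult_left_mono) auto
    finally show ?thesis by (simp add: mult.commute)
  qed
  have Hlim: "(\<lambda>n. ?H n x) \<longlonglongrightarrow> 0" for x
  proof (rule Lim_null_comparison)
    show "(\<lambda>n. norm (F x) * (4 * exp 1 * norm x) * (1 / R n)) \<longlonglongrightarrow> 0"
      by (intro tendsto_mult_right_zero Rinf)
    have "norm (?H n x) \<le> norm (F x) * (4 * exp 1 * norm x) * (1 / R n)" for n
    proof -
      have "norm (?H n x) \<le> norm (F x) * norm (R n *\<^sub>R g n x)" by (simp only: real_norm_def Cauchy_Schwarz_ineq2)
      also have "norm (R n *\<^sub>R g n x) \<le> R n * (4 * exp 1 * norm x / (R n)\<^sup>2)"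
        using mult_left_mono[OF gnorm[of n x], of "R n"] R[of n] by simp
      then have "norm (F x) * norm (R n *\<^sub>R g n x) \<le> norm (F x) * (R n * (4 * exp 1 * norm x / (R n)\<^sup>2))"
        by (rule mult_left_mono) simp
      finally show ?thesis using R[of n] by (simp add: power2_eq_square)
    qed
    then show "\<forall>\<^sub>F n in sequentially. norm (?H n x) \<le> norm (F x) * (4 * exp 1 * norm x) * (1 / R n)" by simp
  qed
  have H: "(\<lambda>n. Lp_norm q lborel (\<lambda>x. ?H n x - 0)) \<longlonglongrightarrow> 0" "\<And>n. ?H n \<in> Lp q lborel"
  proof -
    note LF = Lp_scaleR[OF F, of "4 * exp 1"]
    show "(\<lambda>n. Lp_norm q lborel (\<lambda>x. ?H n x - 0)) \<longlonglongrightarrow> 0" "\<And>n. ?H n \<in> Lp q lborel"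
      using Lp_dominated_convergence(1)[OF _ LF, of ?H "\<lambda>x. 0"] Lp_dominated_convergence(3)[OF _ LF, of ?H "\<lambda>x. 0"]
        q Hle Hlim by auto
  qed
  have E: "(\<lambda>n. \<integral>x. ?H n x * ((1 / R n) *\<^sub>R ?K n x) \<partial>lborel) \<longlonglongrightarrow> 0"
  proof (rule Lim_null_comparison)
    let ?C = "(2 ^ CARD('n)) powr (1 / p) * 2 * Lp_norm p lborel W"
    show "(\<lambda>n. Lp_norm q lborel (?H n) * ?C) \<longlonglongrightarrow> 0" using H(1) by (intro tendsto_mult_left_zero) simp
    have "norm (\<integral>x. ?H n x * ((1 / R n) *\<^sub>R ?K n x) \<partial>lborel) \<le> Lp_norm q lborel (?H n) * ?C" for n
    proof -
      have "(\<lambda>x. (1 / R n) *\<^sub>R ?K n x) \<in> Lp (q / (q - 1)) lborel"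
        unfolding p_def[symmetric] using p by (intro Lp_scaleR KL) simp
      from Holder_inner(2)[OF q H(2) this, of n]
      have "norm (\<integral>x. ?H n x * ((1 / R n) *\<^sub>R ?K n x) \<partial>lborel) \<le>
          Lp_norm q lborel (?H n) * Lp_norm p lborel (\<lambda>x. (1 / R n) *\<^sub>R ?K n x)"
        unfolding inner_real_def p_def real_norm_def .
      also have "\<dots> \<le> Lp_norm q lborel (?H n) * ?C" by (intro mult_left_mono Knorm Lp_norm_nonneg)
      finally show ?thesis .
    qed
    then show "\<forall>\<^sub>F n in sequentially. norm (\<integral>x. ?H n x * ((1 / R n) *\<^sub>R ?K n x) \<partial>lborel) \<le> Lp_norm q lborel (?H n) * ?C"
      by simp
  qed
  have FW: "integrable lborel (\<lambda>x. F x \<bullet> W x)" using Holder_inner(1)[OF q F W] .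
  have lim1: "(\<lambda>n. \<integral>x. \<tau> n x * (F x \<bullet> W x) \<partial>lborel) \<longlonglongrightarrow> (\<integral>x. F x \<bullet> W x \<partial>lborel)"
  proof (rule integral_dominated_convergence[where w="\<lambda>x. \<bar>F x \<bullet> W x\<bar>"])
    show "AE x in lborel. (\<lambda>n. \<tau> n x * (F x \<bullet> W x)) \<longlonglongrightarrow> F x \<bullet> W x"
      using tendsto_mult[OF \<tau>lim tendsto_const] by fastforce
    show "AE x in lborel. norm (\<tau> n x * (F x \<bullet> W x)) \<le> \<bar>F x \<bullet> W x\<bar>" for n
      using \<tau>01 by (auto simp: abs_mult intro!: mult_left_le_one_le)
  qed (use FW in auto)
  have "(\<integral>x. ?H n x * ((1 / R n) *\<^sub>R ?K n x) \<partial>lborel) = - (\<integral>x. \<tau> n x * (F x \<bullet> W x) \<partial>lborel)" for n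
  proof -
    have "(\<integral>x. ?H n x * ((1 / R n) *\<^sub>R ?K n x) \<partial>lborel) = (\<integral>x. F x \<bullet> (?\<phi> n x *\<^sub>R g n x) \<partial>lborel)"
    proof (rule Bochner_Integration.integral_cong[OF refl])
      fix x show "?H n x * ((1 / R n) *\<^sub>R ?K n x) = F x \<bullet> (?\<phi> n x *\<^sub>R g n x)"
        using R[of n] out(2)[of x n] by (cases "x \<in> ball 0 (R n)") auto
    qed
    moreover have "(\<integral>x. F x \<bullet> Wn n x \<partial>lborel) = (\<integral>x. F x \<bullet> (\<tau> n x *\<^sub>R W x) \<partial>lborel) + (\<integral>x. F x \<bullet> (?\<phi> n x *\<^sub>R g n x) \<partial>lborel)"
      unfolding Wn_def inner_add_right using WnL1[of n] WnL2[of n]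
      by (intro Bochner_Integration.integral_add Holder_inner(1)[OF q F]) (auto simp: p_def)
    ultimately show ?thesis using zero[of n] by simp
  qed
  with E have "(\<lambda>n. - (\<integral>x. \<tau> n x * (F x \<bullet> W x) \<partial>lborel)) \<longlonglongrightarrow> 0" by simp
  from LIMSEQ_unique[OF this tendsto_minus[OF lim1]] show ?thesis by simp
qed

section \<open>A Liouville theorem\<close>

text \<open>Since \<open>G\<close> is a gradient, \<open>G x $ i\<close> tested with a derivative in
  direction \<open>j\<close> equals \<open>G x $ j\<close> tested with one in direction
  \<open>i\<close>. After this exchange the sum over \<open>j\<close> is the pairing of
  \<open>G\<close> with the gradient of the test function
  \<open>partial_deriv i \<zeta>\<close>.\<close>

lemma integral_laplace_eq_0:
  fixes G :: "real ^ 'n::finite \<Rightarrow> real ^ 'n"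
  assumes wg: "is_weak_grad UNIV h G" and sol: "\<And>\<psi>. \<psi> \<in> test_functions UNIV \<Longrightarrow> (\<integral>x. G x \<bullet> grad \<psi> x \<partial>lborel) = 0"
    and z: "\<zeta> \<in> test_functions UNIV" "commuting \<zeta>" "\<And>j. commuting (partial_deriv j \<zeta>)"
  shows "(\<integral>x. G x $ i * (\<Sum>j\<in>UNIV. partial_deriv j (partial_deriv j \<zeta>) x) \<partial>lborel) = 0"
proof -
  note D = is_weak_gradD[OF wg, simplified]
  note t = test_functions_partial_deriv
  have int: "integrable lborel (\<lambda>x. G x $ i * \<psi> x)" if "\<psi> \<in> test_functions UNIV" for \<psi> i
    by (intro test_integrable_mult[OF _ that] Lp_loc_component D) simp
  have "(\<integral>x. G x $ i * partial_deriv j (partial_deriv j \<zeta>) x \<partial>lborel) =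
      (\<integral>x. G x $ j * partial_deriv j (partial_deriv i \<zeta>) x \<partial>lborel)" for j
  proof -
    let ?\<psi> = "partial_deriv j \<zeta>"
    have "(\<integral>x. G x $ i * partial_deriv j ?\<psi> x \<partial>lborel) = - (\<integral>x. h x * partial_deriv i (partial_deriv j ?\<psi>) x \<partial>lborel)"
      using D(3)[OF t[OF t[OF z(1)]], of i j j] by simp
    also have "partial_deriv i (partial_deriv j ?\<psi>) = partial_deriv j (partial_deriv i ?\<psi>)"
      using z(3)[of j] by (simp add: commuting_def)
    also have "- (\<integral>x. h x * partial_deriv j (partial_deriv i ?\<psi>) x \<partial>lborel) = (\<integral>x. G x $ j * partial_deriv i ?\<psi> x \<partial>lborel)"
      using D(3)[OF t[OF t[OF z(1)]], of j i j] by simp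
    also have "partial_deriv i ?\<psi> = partial_deriv j (partial_deriv i \<zeta>)"
      using z(2) by (simp add: commuting_def)
    finally show ?thesis .
  qed
  then have "(\<integral>x. G x $ i * (\<Sum>j\<in>UNIV. partial_deriv j (partial_deriv j \<zeta>) x) \<partial>lborel) =
      (\<Sum>j\<in>UNIV. \<integral>x. G x $ j * partial_deriv j (partial_deriv i \<zeta>) x \<partial>lborel)"
    using int[OF t[OF t[OF z(1)]]] by (simp add: sum_distrib_left)
  also have "\<dots> = (\<integral>x. G x \<bullet> grad (partial_deriv i \<zeta>) x \<partial>lborel)"
    using int[OF t[OF t[OF z(1)]]] by (simp add: inner_vec_def grad_nth)
  also have "\<dots> = 0" by (rule sol[OF t[OF z(1)]])
  finally show ?thesis .
qed

text \<open>The derivative in \<open>\<mu>\<close> of \<open>\<mu>\<^sup>N \<phi>(\<mu> (x - a))\<close> is a multiple of a Laplacian, as \<open>x \<phi>(x)\<close> is a gradient;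
  hence the mean of a weakly harmonic function with this kernel is independent of \<open>\<mu>\<close>.\<close>

definition bump_kernel :: "real \<Rightarrow> real ^ 'n::finite \<Rightarrow> real ^ 'n \<Rightarrow> real" where
  "bump_kernel \<mu> a x = \<mu> ^ CARD('n) * flat 2 (bump_arg \<mu> a x)"

text \<open>The potential is \<open>flat 0\<close> because its gradient is
  \<open>- 2 * \<mu>\<^sup>2 * (x - a)\<close> times \<open>flat 2\<close>, the profile of the
  kernel.\<close>

definition bump_laplace :: "real \<Rightarrow> real ^ 'n::finite \<Rightarrow> real ^ 'n \<Rightarrow> real" where
  "bump_laplace \<mu> a x = (\<Sum>j\<in>UNIV. partial_deriv j (partial_deriv j (\<lambda>x. flat 0 (bump_arg \<mu> a x))) x)"

lemma bump_laplace_eq: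
  fixes a x :: "real ^ 'n::finite"
  shows "bump_laplace \<mu> a x = 4 * \<mu> ^ 4 * (norm (x - a))\<^sup>2 * (flat 4 (bump_arg \<mu> a x) - 2 * flat 3 (bump_arg \<mu> a x))
    - 2 * \<mu>\<^sup>2 * real CARD('n) * flat 2 (bump_arg \<mu> a x)"
proof -
  have l: "smooth (\<lambda>x :: real ^ 'n. - 2 * \<mu>\<^sup>2 * (x $ j - a $ j))" "smooth (\<lambda>x :: real ^ 'n. x $ j - a $ j)" for j
    by (intro smooth_mult smooth_diff smooth_const smooth_coord)+
  have dl: "partial_deriv j (\<lambda>x :: real ^ 'n. - 2 * \<mu>\<^sup>2 * (x $ j - a $ j)) = (\<lambda>x. - 2 * \<mu>\<^sup>2)" for j
    by (subst smooth_partial_cmult[OF l(2)]) (simp add: smooth_partial_diff smooth_coord smooth_const partial_deriv_coord partial_deriv_const)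
  have s: "smooth (\<lambda>x. flat m (bump_arg \<mu> a x))" for m by (intro smooth_flat smooth_bump_arg)
  have d1: "partial_deriv j (\<lambda>x. flat 0 (bump_arg \<mu> a x)) = (\<lambda>x. flat 2 (bump_arg \<mu> a x) * (- 2 * \<mu>\<^sup>2 * (x $ j - a $ j)))" for j
    by (simp only: partial_deriv_bump) (simp add: numeral_2_eq_2)
  have "partial_deriv j (partial_deriv j (\<lambda>x. flat 0 (bump_arg \<mu> a x))) x =
      4 * \<mu> ^ 4 * (flat 4 (bump_arg \<mu> a x) - 2 * flat 3 (bump_arg \<mu> a x)) * ((x $ j - a $ j) * (x $ j - a $ j))
      - 2 * \<mu>\<^sup>2 * flat 2 (bump_arg \<mu> a x)" for j
    unfolding d1 by (subst smooth_partial_mult[OF s l(1)], subst dl, subst partial_deriv_bump)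
      (simp add: algebra_simps power2_eq_square power4_eq_xxxx flip: numeral_3_eq_3)
  then have "bump_laplace \<mu> a x = 4 * \<mu> ^ 4 * (flat 4 (bump_arg \<mu> a x) - 2 * flat 3 (bump_arg \<mu> a x)) *
      (\<Sum>j\<in>UNIV. (x $ j - a $ j) * (x $ j - a $ j)) - (\<Sum>j\<in>(UNIV :: 'n set). 2 * \<mu>\<^sup>2 * flat 2 (bump_arg \<mu> a x))"
    unfolding bump_laplace_def by (simp add: sum_subtractf sum_distrib_left)
  also have "(\<Sum>j\<in>UNIV. (x $ j - a $ j) * (x $ j - a $ j)) = (norm (x - a))\<^sup>2"
    by (simp add: power2_norm_eq_inner inner_vec_def)
  finally show ?thesis by simp
qed

text \<open>In \<open>y = \<mu> (x - a)\<close> and with \<open>N = CARD('n)\<close>, the derivative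
  is \<open>\<mu> ^ (N - 1)\<close> times the divergence of \<open>y flat 2 (1 - |y|^2)\<close>, and
  this field is minus half the gradient of \<open>flat 0 (1 - |y|^2)\<close>. Returning to
  derivatives in \<open>x\<close> costs another \<open>\<mu> ^ 2\<close> in the denominator, hence
  the factor \<open>\<mu> ^ N / (2 * \<mu> ^ 3)\<close>.\<close>

lemma DERIV_bump_kernel:
  fixes a x :: "real ^ 'n::finite"
  assumes "\<mu> > 0"
  shows "((\<lambda>\<mu>. bump_kernel \<mu> a x) has_real_derivative - (\<mu> ^ CARD('n) / (2 * \<mu> ^ 3)) * bump_laplace \<mu> a x) (at \<mu>)"
proof -
  let ?n = "CARD('n)" and ?r = "(norm (x - a))\<^sup>2"
  have d: "((\<lambda>\<mu>. bump_arg \<mu> a x) has_real_derivative - (2 * \<mu> * ?r)) (at \<mu>)"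
    unfolding bump_arg_norm power_mult_distrib by (auto intro!: derivative_eq_intros)
  have "((\<lambda>\<mu>. \<mu> ^ ?n * flat 2 (bump_arg \<mu> a x)) has_real_derivative
      (real ?n * \<mu> ^ (?n - Suc 0)) * flat 2 (bump_arg \<mu> a x) +
      (flat 4 (bump_arg \<mu> a x) - 2 * flat 3 (bump_arg \<mu> a x)) * (- (2 * \<mu> * ?r)) * \<mu> ^ ?n) (at \<mu>)"
    using DERIV_mult[OF DERIV_pow[of ?n \<mu> UNIV] DERIV_chain2[OF DERIV_flat[of 2] d]] by simp
  moreover have "\<mu> ^ ?n = \<mu> * \<mu> ^ (?n - Suc 0)" by (metis One_nat_def power_eq_if zero_less_card_finite less_numeral_extra(3))
  then have "(real ?n * \<mu> ^ (?n - Suc 0)) * flat 2 (bump_arg \<mu> a x) +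
      (flat 4 (bump_arg \<mu> a x) - 2 * flat 3 (bump_arg \<mu> a x)) * (- (2 * \<mu> * ?r)) * \<mu> ^ ?n =
      - (\<mu> ^ ?n / (2 * \<mu> ^ 3)) * bump_laplace \<mu> a x"
    using assms by (simp add: bump_laplace_eq field_simps power2_eq_square power3_eq_cube power4_eq_xxxx)
  ultimately show ?thesis unfolding bump_kernel_def by simp
qed

text \<open>On the support \<open>\<mu> * norm (x - a) \<le> 1\<close>, and the factorial bounds for
  \<open>flat 4\<close>, \<open>flat 3\<close> and \<open>flat 2\<close> are 24, 6 and 2; then
  \<open>144 = 4 * (24 + 2 * 6)\<close> and \<open>4 = 2 * 2\<close>.\<close>

lemma bump_laplace_bound:
  fixes a x :: "real ^ 'n::finite"
  assumes "\<mu> > 0"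
  shows "\<bar>bump_laplace \<mu> a x\<bar> \<le> \<mu>\<^sup>2 * (144 + 4 * real CARD('n)) * indicator (ball a (1 / \<mu>)) x"
proof (cases "x \<in> ball a (1 / \<mu>)")
  case False
  then show ?thesis using bump_arg_nonpos[OF assms False] by (simp add: bump_laplace_eq flat_eq_0)
next
  case True
  let ?s = "bump_arg \<mu> a x"
  have "\<mu> * norm (x - a) \<le> 1" using True assms by (simp add: dist_norm norm_minus_commute field_simps)
  then have "(\<mu> * norm (x - a))\<^sup>2 \<le> 1\<^sup>2" using assms by (intro power_mono) auto
  then have r: "\<mu>\<^sup>2 * (norm (x - a))\<^sup>2 \<le> 1" by (simp add: power_mult_distrib)
  have f: "flat 4 ?s \<le> 24" "flat 3 ?s \<le> 6" "flat 2 ?s \<le> 2"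
    using flat_le_fact[of 4 ?s] flat_le_fact[of 3 ?s] flat_le_fact[of 2 ?s] by (simp_all add: fact_numeral)
  have "\<bar>flat 4 ?s - 2 * flat 3 ?s\<bar> \<le> 36" using f flat_nonneg[of 4 ?s] flat_nonneg[of 3 ?s] by (simp add: abs_le_iff)
  then have "\<mu>\<^sup>2 * (norm (x - a))\<^sup>2 * \<bar>flat 4 ?s - 2 * flat 3 ?s\<bar> \<le> 1 * 36"
    using r by (intro mult_mono) auto
  then have "4 * \<mu>\<^sup>2 * (\<mu>\<^sup>2 * (norm (x - a))\<^sup>2 * \<bar>flat 4 ?s - 2 * flat 3 ?s\<bar>) \<le> 4 * \<mu>\<^sup>2 * 36"
    by (intro mult_left_mono) auto
  moreover have "2 * \<mu>\<^sup>2 * real CARD('n) * flat 2 ?s \<le> 2 * \<mu>\<^sup>2 * real CARD('n) * 2"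
    using f by (intro mult_left_mono) auto
  moreover have "\<bar>bump_laplace \<mu> a x\<bar> \<le> 4 * \<mu>\<^sup>2 * (\<mu>\<^sup>2 * (norm (x - a))\<^sup>2 * \<bar>flat 4 ?s - 2 * flat 3 ?s\<bar>) +
      2 * \<mu>\<^sup>2 * real CARD('n) * flat 2 ?s"
    unfolding bump_laplace_eq
    by (rule order_trans[OF abs_triangle_ineq4]) (simp add: abs_mult flat_nonneg power2_eq_square power4_eq_xxxx mult_ac)
  ultimately have "\<bar>bump_laplace \<mu> a x\<bar> \<le> 4 * \<mu>\<^sup>2 * 36 + 2 * \<mu>\<^sup>2 * real CARD('n) * 2" by argo
  then show ?thesis using True by (simp add: algebra_simps)
qed

text \<open>Instead of differentiating under the integral sign, the difference of the kernels is
  written as an integral over the scale; after Fubini each scale contributes 0.\<close>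

lemma bump_kernel_integral_const:
  fixes G :: "real ^ 'n::finite \<Rightarrow> real ^ 'n"
  assumes wg: "is_weak_grad UNIV h G" and sol: "\<And>\<psi>. \<psi> \<in> test_functions UNIV \<Longrightarrow> (\<integral>x. G x \<bullet> grad \<psi> x \<partial>lborel) = 0"
    and ab: "0 < \<alpha>" "\<alpha> \<le> \<beta>"
  shows "(\<integral>x. G x $ i * bump_kernel \<beta> a x \<partial>lborel) = (\<integral>x. G x $ i * bump_kernel \<alpha> a x \<partial>lborel)"
proof -
  note D = is_weak_gradD[OF wg, simplified]
  have [measurable]: "G \<in> borel_measurable borel" by (rule Lp_loc_UNIV_measurable[OF D(2)])
  have [measurable]: "(\<lambda>p. bump_arg (fst p) a (snd p)) \<in> borel_measurable (borel \<Otimes>\<^sub>M borel)"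
    "(\<lambda>\<mu>. bump_arg \<mu> a x) \<in> borel_measurable borel" for x
    unfolding bump_arg_norm by measurable
  define k' where "k' \<mu> x = - (\<mu> ^ CARD('n) / (2 * \<mu> ^ 3)) * bump_laplace \<mu> a x" for \<mu> x
  have test: "bump_kernel \<mu> a \<in> test_functions UNIV" if "\<mu> > 0" for \<mu>
    unfolding bump_kernel_def[abs_def] by (intro test_functions_cmult bump_test that)
  have int: "integrable lborel (\<lambda>x. G x $ i * bump_kernel \<mu> a x)" if "\<mu> > 0" for \<mu>
    by (intro test_integrable_mult[OF _ test[OF that]] Lp_loc_component D) simp
  have FTC: "bump_kernel \<beta> a x - bump_kernel \<alpha> a x = (\<integral>\<mu>. indicator {\<alpha>..\<beta>} \<mu> * k' \<mu> x \<partial>lborel)" for x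
  proof -
    have "isCont (\<lambda>\<mu>. k' \<mu> x) \<mu>" if "\<mu> > 0" for \<mu>
      unfolding k'_def bump_laplace_eq bump_arg_norm using that
      by (intro continuous_intros continuous_on_interior[OF continuous_on_flat[of UNIV]]
          isCont_o2[OF _ continuous_on_interior[OF continuous_on_flat[of UNIV]]]) auto
    then have "(\<integral>\<mu>. k' \<mu> x * indicator {\<alpha>..\<beta>} \<mu> \<partial>lborel) = bump_kernel \<beta> a x - bump_kernel \<alpha> a x"
      using ab DERIV_bump_kernel[of _ a x] unfolding k'_def[symmetric]
      by (intro integral_FTC_Icc_real) auto
    then show ?thesis by (simp add: mult.commute)
  qed
  have "(\<integral>x. G x $ i * bump_kernel \<beta> a x \<partial>lborel) - (\<integral>x. G x $ i * bump_kernel \<alpha> a x \<partial>lborel) =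
      (\<integral>x. G x $ i * (bump_kernel \<beta> a x - bump_kernel \<alpha> a x) \<partial>lborel)"
    using int[of \<beta>] int[of \<alpha>] ab by (simp add: right_diff_distrib)
  also have "\<dots> = (\<integral>x. \<integral>\<mu>. G x $ i * (indicator {\<alpha>..\<beta>} \<mu> * k' \<mu> x) \<partial>lborel \<partial>lborel)"
    unfolding FTC by simp
  also have "\<dots> = (\<integral>\<mu>. \<integral>x. G x $ i * (indicator {\<alpha>..\<beta>} \<mu> * k' \<mu> x) \<partial>lborel \<partial>lborel)"
  proof (rule lborel_pair.Fubini_integral, rule Bochner_Integration.integrable_bound)
    \<comment> \<open>Uniform over the scales in \<open>{\<alpha>..\<beta>}\<close>: the numerators
      are largest at \<open>\<beta>\<close>, while the smallest denominator and the largest support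
      belong to \<open>\<alpha>\<close>.\<close>
    define C where "C = \<beta> ^ CARD('n) / (2 * \<alpha> ^ 3) * (\<beta>\<^sup>2 * (144 + 4 * real CARD('n)))"
    have "integrable lborel (\<lambda>x. indicator (cball a (1 / \<alpha>)) x *\<^sub>R (G x $ i))"
      by (intro Lp_loc_integrable[of _ UNIV] Lp_loc_component D) auto
    then have "integrable lborel (\<lambda>x. C * (indicator (cball a (1 / \<alpha>)) x * \<bar>G x $ i\<bar>))"
      using integrable_norm[of lborel "\<lambda>x. indicator (cball a (1 / \<alpha>)) x *\<^sub>R (G x $ i)"] by (simp add: abs_mult)
    moreover have "integrable lborel (indicator {\<alpha>..\<beta>} :: real \<Rightarrow> real)"
      by (rule integrable_real_indicator) (auto simp: emeasure_lborel_Icc_eq)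
    ultimately show "integrable (lborel \<Otimes>\<^sub>M lborel) (\<lambda>(\<mu>::real, x). indicator {\<alpha>..\<beta>} \<mu> * (C * (indicator (cball a (1 / \<alpha>)) x * \<bar>G x $ i\<bar>)))"
      by (intro integrable_prod_mult)
    show "(\<lambda>(\<mu>, x). G x $ i * (indicator {\<alpha>..\<beta>} \<mu> * k' \<mu> x)) \<in> borel_measurable (lborel \<Otimes>\<^sub>M lborel)"
      unfolding k'_def bump_laplace_eq case_prod_beta by measurable
    have "\<bar>G x $ i * (indicator {\<alpha>..\<beta>} \<mu> * k' \<mu> x)\<bar> \<le> indicator {\<alpha>..\<beta>} \<mu> * (C * (indicator (cball a (1 / \<alpha>)) x * \<bar>G x $ i\<bar>))" for \<mu> x
    proof (cases "\<mu> \<in> {\<alpha>..\<beta>}")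
      case True
      then have \<mu>: "\<mu> > 0" "\<alpha> \<le> \<mu>" "\<mu> \<le> \<beta>" using ab by auto
      have sub: "indicator (ball a (1 / \<mu>)) x \<le> (indicator (cball a (1 / \<alpha>)) x :: real)"
      proof -
        have "1 / \<mu> \<le> 1 / \<alpha>" using \<mu> ab by (intro divide_left_mono) auto
        then show ?thesis by (auto simp: indicator_def)
      qed
      have "\<bar>k' \<mu> x\<bar> = \<mu> ^ CARD('n) / (2 * \<mu> ^ 3) * \<bar>bump_laplace \<mu> a x\<bar>" using \<mu> by (simp add: k'_def abs_mult)
      also have "\<dots> \<le> \<beta> ^ CARD('n) / (2 * \<alpha> ^ 3) * (\<mu>\<^sup>2 * (144 + 4 * real CARD('n)) * indicator (ball a (1 / \<mu>)) x)"
        using \<mu> ab by (intro mult_mono bump_laplace_bound frac_le power_mono mult_left_mono) auto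
      also have "\<dots> \<le> \<beta> ^ CARD('n) / (2 * \<alpha> ^ 3) * (\<beta>\<^sup>2 * (144 + 4 * real CARD('n)) * indicator (cball a (1 / \<alpha>)) x)"
        using \<mu> ab sub by (intro mult_mono mult_left_mono mult_right_mono power_mono) auto
      finally have "\<bar>k' \<mu> x\<bar> \<le> C * indicator (cball a (1 / \<alpha>)) x" by (simp add: C_def mult.assoc)
      then have "\<bar>G x $ i\<bar> * \<bar>k' \<mu> x\<bar> \<le> \<bar>G x $ i\<bar> * (C * indicator (cball a (1 / \<alpha>)) x)" by (intro mult_left_mono) auto
      with True show ?thesis by (simp add: abs_mult mult_ac)
    qed simp
    then show "AE p in lborel \<Otimes>\<^sub>M lborel. norm (case p of (\<mu>, x) \<Rightarrow> G x $ i * (indicator {\<alpha>..\<beta>} \<mu> * k' \<mu> x)) \<le>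
        norm (case p of (\<mu>::real, x) \<Rightarrow> indicator {\<alpha>..\<beta>} \<mu> * (C * (indicator (cball a (1 / \<alpha>)) x * \<bar>G x $ i\<bar>)))"
      by (auto intro!: AE_I2 order_trans[OF _ abs_ge_self] simp del: norm_mult)
  qed
  also have "\<dots> = 0"
  proof -
    have "(\<integral>x. G x $ i * (indicator {\<alpha>..\<beta>} \<mu> * k' \<mu> x) \<partial>lborel) = 0" for \<mu>
    proof (cases "\<mu> \<in> {\<alpha>..\<beta>}")
      case True
      then have \<mu>: "\<mu> > 0" using ab by simp
      have "(\<integral>x. G x $ i * bump_laplace \<mu> a x \<partial>lborel) = 0"
        unfolding bump_laplace_def
        by (rule integral_laplace_eq_0[OF wg sol bump_test[OF \<mu>] commuting_bump commuting_partial_bump])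
      then have "(\<integral>x. - (\<mu> ^ CARD('n) / (2 * \<mu> ^ 3)) * (G x $ i * bump_laplace \<mu> a x) \<partial>lborel) = 0" by simp
      moreover have "G x $ i * (indicator {\<alpha>..\<beta>} \<mu> * k' \<mu> x) = - (\<mu> ^ CARD('n) / (2 * \<mu> ^ 3)) * (G x $ i * bump_laplace \<mu> a x)" for x
        using True by (simp add: k'_def)
      ultimately show ?thesis by simp
    qed simp
    then show ?thesis by simp
  qed
  finally show ?thesis by simp
qed

text \<open>With \<open>t = \<mu> ^ CARD('n)\<close>, the kernel is at most \<open>2 * t\<close> on
  a ball of volume \<open>\<kappa> / t\<close>, so the \<open>p\<close>-th power of its norm for the
  conjugate exponent \<open>p\<close> is at most
  \<open>2 powr p * \<kappa> * t powr (p - 1)\<close>. This tends to 0 with \<open>\<mu>\<close>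
  because \<open>p > 1\<close>, whereas the pairing does not depend on the scale.\<close>

lemma bump_kernel_integral_eq_0:
  fixes G :: "real ^ 'n::finite \<Rightarrow> real ^ 'n"
  assumes q: "q > 1" and G: "G \<in> Lp q lborel" and wg: "is_weak_grad UNIV h G"
    and sol: "\<And>\<psi>. \<psi> \<in> test_functions UNIV \<Longrightarrow> (\<integral>x. G x \<bullet> grad \<psi> x \<partial>lborel) = 0" and \<mu>: "\<mu> > 0"
  shows "(\<integral>x. G x $ i * bump_kernel \<mu> a x \<partial>lborel) = 0"
proof -
  define p where "p = q / (q - 1)"
  have p: "p > 1" using q by (simp add: p_def field_simps)
  define \<kappa> where "\<kappa> = unit_ball_vol (real CARD('n))"
  have \<kappa>: "\<kappa> \<ge> 0" by (simp add: \<kappa>_def)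
  define m where "m n = inverse (real (Suc n))" for n
  have m: "m n > 0" for n by (simp add: m_def)
  define t where "t n = m n ^ CARD('n)" for n
  have t: "t n > 0" for n using m by (simp add: t_def)
  have tlim: "(\<lambda>n. t n) \<longlonglongrightarrow> 0"
  proof -
    have "(\<lambda>n. m n ^ CARD('n)) \<longlonglongrightarrow> 0 ^ CARD('n)"
      unfolding m_def by (intro tendsto_intros LIMSEQ_inverse_real_of_nat)
    then show ?thesis unfolding t_def zero_power[OF zero_less_card_finite] .
  qed
  have kt: "bump_kernel (m n) a \<in> test_functions UNIV" for n
    unfolding bump_kernel_def[abs_def] by (intro test_functions_cmult bump_test m)
  have kp: "bump_kernel (m n) a \<in> Lp p lborel" for n using p by (intro test_Lp[OF kt]) simp
  have norm_le: "Lp_norm p lborel (bump_kernel (m n) a) \<le> (2 powr p * \<kappa> * t n powr (p - 1)) powr (1 / p)" for n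
  proof -
    let ?B = "ball a (1 / m n)"
    have B: "measure lborel ?B = \<kappa> / t n"
      using emeasure_ball[of "1 / m n" a] m[of n] by (simp add: measure_def \<kappa>_def t_def power_one_over divide_inverse power_inverse)
    have "(\<integral>x. norm (bump_kernel (m n) a x) powr p \<partial>lborel) \<le> (\<integral>x. (2 * t n) powr p * indicator ?B x \<partial>lborel)"
    proof (rule integral_mono[OF Lp_integrable[OF kp]])
      show "integrable lborel (\<lambda>x. (2 * t n) powr p * indicator ?B x)"
        by (intro integrable_mult_right) (simp add: emeasure_lborel_ball_finite[unfolded infinity_ennreal_def])
      show "norm (bump_kernel (m n) a x) powr p \<le> (2 * t n) powr p * indicator ?B x" for x
      proof (cases "x \<in> ?B")
        case True
        have "norm (bump_kernel (m n) a x) \<le> t n * 2"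
          using flat_le_fact[of 2 "bump_arg (m n) a x"] t[of n]
          by (simp add: bump_kernel_def abs_mult flat_nonneg t_def fact_2 less_imp_le)
        then have "norm (bump_kernel (m n) a x) powr p \<le> (2 * t n) powr p"
          using p by (intro powr_mono2) auto
        with True show ?thesis by simp
      next
        case False
        then show ?thesis using bump_arg_nonpos[OF m False] by (simp add: bump_kernel_def flat_eq_0)
      qed
    qed
    also have "\<dots> = (2 * t n) powr p * (\<kappa> / t n)" by (simp add: B)
    also have "\<dots> = 2 powr p * \<kappa> * t n powr (p - 1)" using t[of n] by (simp add: powr_mult powr_diff)
    finally have "(\<integral>x. norm (bump_kernel (m n) a x) powr p \<partial>lborel) \<le> 2 powr p * \<kappa> * t n powr (p - 1)" .
    then show ?thesis unfolding Lp_norm_def using p by (intro powr_mono2) auto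
  qed
  have "(\<lambda>n. (2 powr p * \<kappa> * t n powr (p - 1)) powr (1 / p)) \<longlonglongrightarrow> 0"
  proof -
    have "(\<lambda>n. t n powr (p - 1)) \<longlonglongrightarrow> 0"
      using p t less_imp_le[OF t] by (intro tendsto_zero_powrI[OF tlim tendsto_const]) auto
    then have "(\<lambda>n. 2 powr p * \<kappa> * t n powr (p - 1)) \<longlonglongrightarrow> 0" by (rule tendsto_mult_right_zero)
    then show ?thesis using p \<kappa> by (intro tendsto_zero_powrI[OF _ tendsto_const]) auto
  qed
  then have lim: "(\<lambda>n. Lp_norm q lborel (\<lambda>x. G x $ i) * (2 powr p * \<kappa> * t n powr (p - 1)) powr (1 / p)) \<longlonglongrightarrow> 0"
    by (rule tendsto_mult_right_zero)
  have Gi: "(\<lambda>x. G x $ i) \<in> Lp q lborel" using q by (intro Lp_component G) simp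
  have "(\<lambda>n. \<integral>x. G x $ i * bump_kernel (m n) a x \<partial>lborel) \<longlonglongrightarrow> 0"
  proof (rule Lim_null_comparison[OF _ lim])
    have "norm (\<integral>x. G x $ i * bump_kernel (m n) a x \<partial>lborel) \<le>
        Lp_norm q lborel (\<lambda>x. G x $ i) * (2 powr p * \<kappa> * t n powr (p - 1)) powr (1 / p)" for n
    proof -
      have "norm (\<integral>x. G x $ i * bump_kernel (m n) a x \<partial>lborel) \<le> Lp_norm q lborel (\<lambda>x. G x $ i) * Lp_norm p lborel (bump_kernel (m n) a)"
        using Holder_inner(2)[OF q Gi kp[of n, unfolded p_def]] by (simp add: p_def)
      also have "\<dots> \<le> Lp_norm q lborel (\<lambda>x. G x $ i) * (2 powr p * \<kappa> * t n powr (p - 1)) powr (1 / p)"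
        by (intro mult_left_mono norm_le Lp_norm_nonneg)
      finally show ?thesis .
    qed
    then show "\<forall>\<^sub>F n in sequentially. norm (\<integral>x. G x $ i * bump_kernel (m n) a x \<partial>lborel) \<le>
        Lp_norm q lborel (\<lambda>x. G x $ i) * (2 powr p * \<kappa> * t n powr (p - 1)) powr (1 / p)" by simp
  qed
  moreover have "\<forall>\<^sub>F n in sequentially. (\<integral>x. G x $ i * bump_kernel (m n) a x \<partial>lborel) = (\<integral>x. G x $ i * bump_kernel \<mu> a x \<partial>lborel)"
  proof -
    have "\<forall>\<^sub>F n in sequentially. m n < \<mu>"
      using order_tendstoD(2)[OF LIMSEQ_inverse_real_of_nat \<mu>] by (simp add: m_def)
    then show ?thesis
    proof eventually_elim
      case (elim n)
      then show ?case by (intro bump_kernel_integral_const[OF wg sol m, symmetric] less_imp_le)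
    qed
  qed
  ultimately have "(\<lambda>n. \<integral>x. G x $ i * bump_kernel \<mu> a x \<partial>lborel) \<longlonglongrightarrow> 0" by (rule Lim_transform_eventually)
  then show ?thesis by (simp add: LIMSEQ_const_iff)
qed

text \<open>Orthogonality to the kernels at all centres is turned into orthogonality to an arbitrary
  \<open>\<psi>\<close>: the pairing \<open>A\<close> with the translates of \<open>\<psi>\<close>
  is continuous at 0, so if \<open>A 0\<close> were nonzero, averaging \<open>A\<close> with a
  kernel supported in a small ball would give a nonzero value. By Fubini this average is a
  superposition of kernel pairings, all of which are 0.\<close>

theorem Liouville_weak:
  fixes G :: "real ^ 'n::finite \<Rightarrow> real ^ 'n"
  assumes q: "q > 1" and G: "G \<in> Lp q lborel" and wg: "is_weak_grad UNIV h G"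
    and sol: "\<And>\<psi>. \<psi> \<in> test_functions UNIV \<Longrightarrow> (\<integral>x. G x \<bullet> grad \<psi> x \<partial>lborel) = 0"
  shows "AE x in lborel. G x = 0"
proof -
  have Gloc: "G \<in> Lp_loc 1 UNIV" using q by (intro Lp_imp_Lp_loc_UNIV[OF G]) simp
  have p: "q / (q - 1) > 1" using q by (simp add: field_simps)
  have [measurable]: "G \<in> borel_measurable borel" by (rule Lp_loc_UNIV_measurable[OF Gloc])
  have "AE x in lborel. x \<in> UNIV \<longrightarrow> G x $ i = 0" for i
  proof (rule fundamental_lemma)
    show "(\<lambda>x. G x $ i) \<in> Lp_loc 1 UNIV" by (intro Lp_loc_component Gloc) simp
    fix \<psi> :: "real ^ 'n \<Rightarrow> real" assume \<psi>: "\<psi> \<in> test_functions UNIV"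
    have [measurable]: "\<psi> \<in> borel_measurable borel" by (rule smooth_borel_measurable[OF test_functions_smooth[OF \<psi>]])
    define W :: "real ^ 'n \<Rightarrow> real ^ 'n" where "W x = \<psi> x *\<^sub>R axis i 1" for x
    have [measurable]: "W \<in> borel_measurable borel" unfolding W_def by measurable
    have GW: "G x \<bullet> W y = G x $ i * \<psi> y" for x y by (simp add: W_def inner_axis)
    have W: "W \<in> Lp s lborel" if "s \<ge> 1" for s
      by (rule Lp_mono[OF test_Lp[OF \<psi>], where C=1]) (use that in \<open>auto simp: W_def norm_axis_1\<close>)
    have Wint: "integrable lborel W"
      using Lp_integrable[OF W[of 1]] by (auto intro: integrable_norm_cancel)
    obtain R where R: "\<And>x. x \<notin> ball 0 R \<Longrightarrow> \<psi> x = 0" using test_functions_ball[OF \<psi>] by blast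
    define A where "A y = (\<integral>x. G x \<bullet> W (x - y) \<partial>lborel)" for y
    have [measurable]: "A \<in> borel_measurable borel" unfolding A_def by measurable
    have Abound: "\<bar>A y\<bar> \<le> Lp_norm q lborel G * Lp_norm (q / (q - 1)) lborel W" for y
      using Holder_inner(2)[OF q G Lp_translate[OF W, of _ y]] Lp_norm_translate[OF W, of _ y] p by (simp add: A_def)
    show "(\<integral>x. G x $ i * \<psi> x \<partial>lborel) = 0"
    proof (rule ccontr)
      assume "(\<integral>x. G x $ i * \<psi> x \<partial>lborel) \<noteq> 0"
      then have A0: "A 0 \<noteq> 0" by (simp add: A_def GW)
      \<comment> \<open>Multiplication by \<open>A 0\<close> turns a constant sign of
        \<open>A\<close> near 0 into positivity, whichever sign \<open>A 0\<close> has.\<close>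
      have "\<exists>\<delta>>0. \<forall>y\<in>ball 0 \<delta>. A 0 * A y > 0"
      proof (rule ccontr)
        assume "\<not> ?thesis"
        then have "\<exists>y. y \<in> ball 0 (inverse (real (Suc n))) \<and> A 0 * A y \<le> 0" for n
          by (meson inverse_positive_iff_positive not_less of_nat_0_less_iff zero_less_Suc)
        then obtain y where y: "\<And>n. y n \<in> ball 0 (inverse (real (Suc n)))" "\<And>n. A 0 * A (y n) \<le> 0" by metis
        have "y \<longlonglongrightarrow> 0"
          by (rule Lim_null_comparison[OF _ LIMSEQ_inverse_real_of_nat])
            (use y(1) in \<open>intro always_eventually allI less_imp_le, simp\<close>)
        then have "(\<lambda>n. A (y n)) \<longlonglongrightarrow> A 0"
          using pairing_tendsto[OF q G W] p by (simp add: A_def)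
        then have "(\<lambda>n. A 0 * A (y n)) \<longlonglongrightarrow> A 0 * A 0" by (intro tendsto_intros)
        then have "A 0 * A 0 \<le> 0" by (rule LIMSEQ_le_const2) (use y(2) in auto)
        moreover have "(A 0)\<^sup>2 > 0" using A0 by simp
        ultimately show False by (simp add: power2_eq_square)
      qed
      then obtain \<delta> where \<delta>: "\<delta> > 0" "\<And>y. y \<in> ball 0 \<delta> \<Longrightarrow> A 0 * A y > 0" by blast
      define \<mu> where "\<mu> = 1 / \<delta>"
      have \<mu>: "\<mu> > 0" "1 / \<mu> = \<delta>" using \<delta> by (auto simp: \<mu>_def)
      define k where "k = bump_kernel \<mu> (0 :: real ^ 'n)"
      have kt: "k \<in> test_functions UNIV"
        unfolding k_def bump_kernel_def[abs_def] by (intro test_functions_cmult bump_test \<mu>)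
      have [measurable]: "k \<in> borel_measurable borel" by (rule smooth_borel_measurable[OF test_functions_smooth[OF kt]])
      obtain M where M: "\<And>x. \<bar>k x\<bar> \<le> M" using test_functions_bounded[OF kt] by blast
      have kz: "k x = 0" if "x \<notin> ball 0 \<delta>" for x
        using bump_arg_nonpos[OF \<mu>(1), of x 0] that by (simp add: k_def bump_kernel_def flat_eq_0 \<mu>)
      have kpos: "k x > 0" if "x \<in> ball 0 \<delta>" for x
        using bump_arg_pos[OF \<mu>(1), of x 0] that \<mu> by (simp add: k_def bump_kernel_def flat_pos)
      have kshift: "k (x - z) = bump_kernel \<mu> z x" for x z
        by (simp add: k_def bump_kernel_def bump_arg_norm)
      define S where "S = max R \<delta>"
      have "(\<integral>y. A y * k y \<partial>lborel) = (\<integral>x. \<integral>z. G x \<bullet> W z * k (x - z) \<partial>lborel \<partial>lborel)"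
        unfolding A_def by (rule pairing_swap(1)[OF Gloc Wint _ _ M, of S]) (auto simp: W_def S_def R kz)
      also have "\<dots> = (\<integral>z. \<integral>x. G x \<bullet> W z * k (x - z) \<partial>lborel \<partial>lborel)"
        by (rule pairing_swap(2)[OF Gloc Wint _ _ M, of S]) (auto simp: W_def S_def R kz)
      also have "\<dots> = 0"
      proof -
        have "(\<integral>x. G x \<bullet> W z * k (x - z) \<partial>lborel) = 0" for z
        proof -
          have "(\<integral>x. \<psi> z * (G x $ i * bump_kernel \<mu> z x) \<partial>lborel) = 0"
            using bump_kernel_integral_eq_0[OF q G wg sol \<mu>(1)] by simp
          then show ?thesis by (simp add: GW kshift mult_ac)
        qed
        then show ?thesis by simp
      qed
      finally have "(\<integral>y. A 0 * (A y * k y) \<partial>lborel) = 0" by simp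
      moreover have "integrable lborel (\<lambda>y. A 0 * (A y * k y))"
      proof (rule Bochner_Integration.integrable_bound)
        have "integrable lborel k"
          by (rule integrable_norm_cancel) (use Lp_integrable[OF test_Lp[OF kt, of 1]] in simp_all)
        then show "integrable lborel (\<lambda>y. A 0 * (Lp_norm q lborel G * Lp_norm (q / (q - 1)) lborel W * k y))" by simp
        show "AE y in lborel. norm (A 0 * (A y * k y)) \<le>
            norm (A 0 * (Lp_norm q lborel G * Lp_norm (q / (q - 1)) lborel W * k y))"
        proof (rule AE_I2)
          fix y
          have "\<bar>A 0\<bar> * (\<bar>A y\<bar> * \<bar>k y\<bar>) \<le> \<bar>A 0\<bar> * (Lp_norm q lborel G * Lp_norm (q / (q - 1)) lborel W * \<bar>k y\<bar>)"
            by (intro mult_left_mono mult_right_mono Abound) auto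
          then show "norm (A 0 * (A y * k y)) \<le> norm (A 0 * (Lp_norm q lborel G * Lp_norm (q / (q - 1)) lborel W * k y))"
            by (simp add: abs_mult Lp_norm_nonneg)
        qed
      qed measurable
      moreover have "0 \<le> A 0 * (A y * k y)" for y
      proof (cases "y \<in> ball 0 \<delta>")
        case True
        then show ?thesis using mult_pos_pos[OF \<delta>(2)[OF True] kpos[OF True]] by (simp add: mult.assoc)
      qed (simp add: kz)
      ultimately have "AE y in lborel. A 0 * (A y * k y) = 0"
        using integral_nonneg_eq_0_iff_AE[of lborel "\<lambda>y. A 0 * (A y * k y)"] by simp
      then obtain y where y: "y \<in> ball 0 \<delta>" "A 0 * (A y * k y) = 0" using AE_lborel_ball_ex[OF _ \<delta>(1)] by blast
      have "A 0 * (A y * k y) > 0"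
        unfolding mult.assoc[symmetric] by (rule mult_pos_pos[OF \<delta>(2)[OF y(1)] kpos[OF y(1)]])
      with y(2) show False by linarith
    qed
  qed simp
  then have "AE x in lborel. \<forall>i. G x $ i = 0" unfolding AE_all_countable by simp
  then show ?thesis by eventually_elim (simp add: vec_eq_iff)
qed

section \<open>Half spaces\<close>

text \<open>The sign \<open>\<sigma>\<close>, 1 or \<open>- 1\<close>, lets both half spaces be
  treated at once; \<open>- \<sigma>\<close> is then the component of the outward normal and fixes
  the sign of boundary terms.\<close>

definition half_space :: "real \<Rightarrow> 'n::finite \<Rightarrow> (real ^ 'n) set" where
  "half_space \<sigma> d = {x. \<sigma> * x $ d > 0}"

lemma upper_half_eq: "upper_half d = half_space 1 d"
  by (simp add: upper_half_def half_space_def)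

lemma lower_half_eq: "lower_half d = half_space (- 1) d"
  by (simp add: lower_half_def half_space_def)

lemma open_half_space [simp]: "open (half_space \<sigma> d)"
  unfolding half_space_def by (intro open_Collect_less continuous_intros)

lemma half_space_borel [measurable, simp]: "half_space \<sigma> d \<in> sets borel"
  by (rule borel_open) simp

lemma AE_not_plane: "AE x in lborel. x $ d \<noteq> (0 :: real)" for d :: "'n::finite"
proof -
  have "closed {x :: real ^ 'n. x $ d = 0}" by (intro closed_Collect_eq continuous_intros)
  then have "{x :: real ^ 'n. x $ d = 0} \<in> null_sets lborel"
    using negligible_standard_hyperplane_cart[of d]
    by (simp add: negligible_iff_null_sets null_sets_completion_iff)
  from AE_not_in[OF this] show ?thesis by simp
qed

lemma flat_large:
  assumes "t > 0"
  shows "flat 1 t \<le> 1 / t" "flat 2 t \<le> 1 / t * (1 / t)"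
  using assms by (auto simp: flat_def power2_eq_square divide_right_mono)

text \<open>At each fixed point of the half space the argument of the cutoffs grows without bound,
  so the cutoffs tend to 1 and their derivatives can be shown to disappear.\<close>

lemma cut_seq_at_top:
  assumes "s > 0"
  shows "filterlim (\<lambda>n. real (Suc n) * s - 1 / real (Suc n)) at_top sequentially"
proof (rule filterlim_at_top_mono)
  have "filterlim (\<lambda>n. s * real (Suc n)) at_top sequentially"
    by (intro filterlim_tendsto_pos_mult_at_top[OF tendsto_const assms]
        filterlim_compose[OF filterlim_real_sequentially filterlim_Suc])
  then show "filterlim (\<lambda>n. - 1 + s * real (Suc n)) at_top sequentially"
    by (rule filterlim_tendsto_add_at_top[OF tendsto_const])
  show "\<forall>\<^sub>F n in sequentially. - 1 + s * real (Suc n) \<le> real (Suc n) * s - 1 / real (Suc n)"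
    by (intro always_eventually allI) (simp add: mult.commute)
qed

lemma indicator_Lp_loc:
  fixes v :: "real ^ 'n::finite \<Rightarrow> 'b::euclidean_space"
  assumes "v \<in> Lp_loc 1 UNIV" "H \<in> sets borel"
  shows "(\<lambda>x. indicator H x *\<^sub>R v x) \<in> Lp_loc 1 UNIV"
proof (rule Lp_loc_1I)
  fix K :: "(real ^ 'n) set" assume "compact K"
  then have "integrable lborel (\<lambda>x. indicator H x *\<^sub>R (indicator K x *\<^sub>R v x))"
    using assms by (intro integrable_mult_indicator Lp_loc_integrable[OF assms(1)]) auto
  then show "integrable lborel (\<lambda>x. indicator K x *\<^sub>R (indicator H x *\<^sub>R v x))" by (simp add: mult.commute)
qed

text \<open>The test function is multiplied by a cutoff that vanishes near the boundary plane. If it vanishes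
  on the plane, then the derivative of the cutoff is compensated by the bound \<open>|\<phi> x| \<le> M |x\<^sub>d|\<close>.\<close>

lemma half_space_by_parts:
  fixes v :: "real ^ 'n::finite \<Rightarrow> real"
  assumes \<sigma>: "\<bar>\<sigma>\<bar> = 1" and wg: "is_weak_grad (half_space \<sigma> d) v g"
    and v: "(\<lambda>x. indicator (half_space \<sigma> d) x *\<^sub>R v x) \<in> Lp_loc 1 UNIV"
    and g: "(\<lambda>x. indicator (half_space \<sigma> d) x *\<^sub>R g x) \<in> Lp_loc 1 UNIV"
    and \<phi>: "\<phi> \<in> test_functions UNIV" and i: "i \<noteq> d \<or> (\<forall>x. x $ d = 0 \<longrightarrow> \<phi> x = 0)"
  shows "(\<integral>x. indicator (half_space \<sigma> d) x * v x * partial_deriv i \<phi> x \<partial>lborel) =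
    - (\<integral>x. indicator (half_space \<sigma> d) x * g x $ i * \<phi> x \<partial>lborel)"
proof -
  let ?H = "half_space \<sigma> d"
  note D = is_weak_gradD[OF wg half_space_borel]
  note s = test_functions_smooth[OF \<phi>]
  obtain M where M: "M > 0" "\<And>x. \<bar>partial_deriv i \<phi> x\<bar> \<le> M"
    using test_functions_bounded[OF test_functions_partial_deriv[OF \<phi>]] by metis
  obtain M0 where M0: "M0 > 0" "\<And>x. \<bar>\<phi> x\<bar> \<le> M0" using test_functions_bounded[OF \<phi>] by metis
  obtain R where R: "R > 0" "\<And>x. x \<notin> ball 0 R \<Longrightarrow> \<phi> x = 0" using test_functions_ball[OF \<phi>] by blast
  have R': "partial_deriv i \<phi> x = 0" if "x \<notin> cball 0 R" for x
    by (rule partial_deriv_eq_0[of "cball 0 R"]) (use R(2) that in auto)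
  define N where "N n = real (Suc n)" for n
  have N: "N n > 0" "N n \<ge> 1" for n by (auto simp: N_def)
  \<comment> \<open>The shift by \<open>1 / N n\<close> makes the cutoff vanish for
    \<open>\<sigma> * x $ d \<le> 1 / (N n)\<^sup>2\<close>, so that its support keeps a positive
    distance from the plane.\<close>
  define t where "t n x = N n * \<sigma> * x $ d - 1 / N n" for n and x :: "real ^ 'n"
  define \<tau> where "\<tau> n x = flat 0 (t n x)" for n x
  have ts: "smooth (t n)" for n
    unfolding t_def[abs_def] by (intro smooth_diff smooth_mult smooth_const smooth_coord)
  have \<tau>s: "smooth (\<tau> n)" for n unfolding \<tau>_def[abs_def] by (rule smooth_flat[OF ts])
  have td: "partial_deriv i (t n) = (\<lambda>x. if i = d then N n * \<sigma> else 0)" for n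
  proof -
    have "partial_deriv i (t n) = (\<lambda>x. partial_deriv i (\<lambda>x. N n * \<sigma> * x $ d) x - partial_deriv i (\<lambda>x :: real ^ 'n. 1 / N n) x)"
      unfolding t_def[abs_def] by (intro smooth_partial_diff smooth_mult smooth_const smooth_coord)
    also have "partial_deriv i (\<lambda>x. N n * \<sigma> * x $ d) = (\<lambda>x :: real ^ 'n. N n * \<sigma> * (if i = d then 1 else 0))"
      by (subst smooth_partial_cmult[OF smooth_coord]) (simp add: partial_deriv_coord)
    finally show ?thesis by (simp add: partial_deriv_const)
  qed
  define E where "E n x = (if i = d then \<phi> x * (flat 2 (t n x) * (N n * \<sigma>)) else 0)" for n x
  have pd: "partial_deriv i (\<lambda>x. \<phi> x * \<tau> n x) = (\<lambda>x. E n x + partial_deriv i \<phi> x * \<tau> n x)" for n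
  proof -
    have "partial_deriv i (\<tau> n) = (\<lambda>x. flat 2 (t n x) * (if i = d then N n * \<sigma> else 0))"
      unfolding \<tau>_def[abs_def] by (subst partial_deriv_flat) (simp_all add: smooth_differentiable[OF ts] td numeral_2_eq_2)
    then show ?thesis by (subst smooth_partial_mult[OF s \<tau>s]) (auto simp: E_def fun_eq_iff)
  qed
  have in_H: "\<sigma> * x $ d \<ge> 1 / (N n)\<^sup>2" if "t n x > 0" for n x
  proof -
    have "N n * (1 / (N n)\<^sup>2) \<le> N n * (\<sigma> * x $ d)" using that N[of n] by (simp add: t_def power2_eq_square mult.assoc)
    then show ?thesis using N[of n] by (simp only: mult_le_cancel_left_pos)
  qed
  have test: "(\<lambda>x. \<phi> x * \<tau> n x) \<in> test_functions ?H" for n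
  proof (rule test_functionsI[of _ "cball 0 R \<inter> {x. \<sigma> * x $ d \<ge> 1 / (N n)\<^sup>2}"])
    show "smooth (\<lambda>x. \<phi> x * \<tau> n x)" by (intro smooth_mult s \<tau>s)
    show "compact (cball 0 R \<inter> {x. \<sigma> * x $ d \<ge> 1 / (N n)\<^sup>2})"
      by (intro compact_Int_closed compact_cball closed_Collect_le continuous_intros)
    show "cball 0 R \<inter> {x. \<sigma> * x $ d \<ge> 1 / (N n)\<^sup>2} \<subseteq> ?H"
    proof
      fix x assume "x \<in> cball 0 R \<inter> {x. \<sigma> * x $ d \<ge> 1 / (N n)\<^sup>2}"
      moreover have "1 / (N n)\<^sup>2 > 0" using N[of n] by simp
      ultimately show "x \<in> ?H" by (auto simp: half_space_def simp del: zero_less_divide_1_iff)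
    qed
    show "\<phi> x * \<tau> n x = 0" if "x \<notin> cball 0 R \<inter> {x. \<sigma> * x $ d \<ge> 1 / (N n)\<^sup>2}" for x
    proof (cases "x \<in> cball 0 R")
      case True
      then have "\<not> t n x > 0" using in_H that by blast
      then show ?thesis by (simp add: \<tau>_def flat_eq_0)
    qed (use R in auto)
  qed
  \<comment> \<open>The mean value inequality along the normal line, starting from the foot point in
    the plane, where \<open>\<phi>\<close> is 0.\<close>
  have \<phi>d: "\<bar>\<phi> x\<bar> \<le> M * \<bar>x $ d\<bar>" if "i = d" for x
  proof -
    let ?x = "x - (x $ d) *\<^sub>R axis d 1"
    have "?x $ d = 0" by (simp add: axis_def)
    then have z: "\<phi> ?x = 0" using i that by blast
    show ?thesis
    proof (cases "x $ d = 0")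
      case False
      have der: "((\<lambda>r. \<phi> (?x + r *\<^sub>R axis d 1)) has_real_derivative partial_deriv d \<phi> (?x + r *\<^sub>R axis d 1)) (at r)" for r
        using has_real_derivative_along[OF s, of ?x "axis d 1" r] by (simp add: grad_axis)
      have "\<bar>\<phi> (?x + (x $ d) *\<^sub>R axis d 1) - \<phi> (?x + 0 *\<^sub>R axis d 1)\<bar> \<le> M * \<bar>x $ d - 0\<bar>"
        using field_differentiable_bound[of UNIV "\<lambda>r. \<phi> (?x + r *\<^sub>R axis d 1)" "\<lambda>r. partial_deriv d \<phi> (?x + r *\<^sub>R axis d 1)" M "x $ d" 0]
          der M that by simp
      then show ?thesis using z by simp
    qed (use z in simp)
  qed
  \<comment> \<open>The factor \<open>N n\<close> from the derivative of the cutoff meets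
    \<open>\<bar>x $ d\<bar>\<close> from the previous bound; their product is
    \<open>t n x + 1 / N n\<close>, and \<open>t n x * flat 2 (t n x)\<close> is
    \<open>flat 1 (t n x)\<close>.\<close>
  have E_le: "\<bar>E n x\<bar> \<le> M * (flat 1 (t n x) + flat 2 (t n x))" if "x \<in> ?H" for n x
  proof (cases "i = d \<and> t n x > 0")
    case True
    have "\<bar>x $ d\<bar> = \<sigma> * x $ d" using that \<sigma> by (auto simp: half_space_def abs_if zero_less_mult_iff split: if_splits)
    then have Nx: "N n * \<bar>x $ d\<bar> = t n x + 1 / N n" by (simp add: t_def mult.assoc)
    have "\<bar>E n x\<bar> = \<bar>\<phi> x\<bar> * (N n * flat 2 (t n x))" using True \<sigma> N[of n] by (simp add: E_def abs_mult flat_nonneg)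
    also have "\<dots> \<le> M * \<bar>x $ d\<bar> * (N n * flat 2 (t n x))"
      using True N[of n] by (intro mult_right_mono \<phi>d) (auto simp: flat_nonneg)
    also have "\<dots> = M * ((t n x + 1 / N n) * flat 2 (t n x))" by (simp add: Nx[symmetric] mult_ac)
    also have "\<dots> \<le> M * ((t n x + 1) * flat 2 (t n x))"
      using M N[of n] by (intro mult_left_mono mult_right_mono add_left_mono) (auto simp: flat_nonneg)
    also have "t n x * flat 2 (t n x) = flat 1 (t n x)" using True by (simp add: flat_def power2_eq_square)
    then have "(t n x + 1) * flat 2 (t n x) = flat 1 (t n x) + flat 2 (t n x)" by (simp add: distrib_right)
    finally show ?thesis .
  next
    case False
    then have "E n x = 0" by (auto simp: E_def flat_eq_0)
    then show ?thesis using M by (simp add: flat_nonneg)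
  qed
  have lims: "(\<lambda>n. \<tau> n x) \<longlonglongrightarrow> 1" "(\<lambda>n. E n x) \<longlonglongrightarrow> 0" if "x \<in> ?H" for x
  proof -
    have top: "filterlim (\<lambda>n. t n x) at_top sequentially"
      using cut_seq_at_top[of "\<sigma> * x $ d"] that by (simp add: t_def N_def half_space_def mult.assoc)
    then have inv: "(\<lambda>n. 1 / t n x) \<longlonglongrightarrow> 0" by (intro tendsto_divide_0[OF tendsto_const] filterlim_at_top_imp_at_infinity)
    have pos: "\<forall>\<^sub>F n in sequentially. t n x > 0" using top unfolding filterlim_at_top_dense by blast
    have "(\<lambda>n. exp (- (1 / t n x))) \<longlonglongrightarrow> exp (- 0)" by (intro tendsto_intros inv)
    then have "(\<lambda>n. exp (- (1 / t n x))) \<longlonglongrightarrow> 1" by simp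
    then show "(\<lambda>n. \<tau> n x) \<longlonglongrightarrow> 1"
      by (rule Lim_transform_eventually[OF _ eventually_mono[OF pos]]) (simp_all add: \<tau>_def flat_def)
    show "(\<lambda>n. E n x) \<longlonglongrightarrow> 0"
    proof (rule Lim_null_comparison)
      show "(\<lambda>n. M * (1 / t n x + 1 / t n x * (1 / t n x))) \<longlonglongrightarrow> 0"
        using tendsto_mult[OF tendsto_const[of M] tendsto_add[OF inv tendsto_mult[OF inv inv]]] by simp
      show "\<forall>\<^sub>F n in sequentially. norm (E n x) \<le> M * (1 / t n x + 1 / t n x * (1 / t n x))"
        using pos
      proof eventually_elim
        case (elim n)
        have "\<bar>E n x\<bar> \<le> M * (flat 1 (t n x) + flat 2 (t n x))" by (rule E_le[OF that])
        also have "\<dots> \<le> M * (1 / t n x + 1 / t n x * (1 / t n x))"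
          using M elim by (intro mult_left_mono add_mono flat_large) auto
        finally show ?case by simp
      qed
    qed
  qed
  have \<tau>01: "0 \<le> \<tau> n x" "\<tau> n x \<le> 1" for n x by (auto simp: \<tau>_def flat_nonneg flat_0_le_1)
  have eq: "(\<integral>x. indicator ?H x * v x * (E n x + partial_deriv i \<phi> x * \<tau> n x) \<partial>lborel) =
      - (\<integral>x. indicator ?H x * g x $ i * (\<phi> x * \<tau> n x) \<partial>lborel)" for n
  proof -
    have z: "partial_deriv i (\<lambda>x. \<phi> x * \<tau> n x) x = 0" "\<phi> x * \<tau> n x = 0" if "x \<notin> ?H" for x
      using test_functions_zero_outside[OF test_functions_partial_deriv[OF test] that] test_functions_zero_outside[OF test that] .
    have "(\<integral>x. indicator ?H x * v x * (E n x + partial_deriv i \<phi> x * \<tau> n x) \<partial>lborel) =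
        (\<integral>x. v x * partial_deriv i (\<lambda>x. \<phi> x * \<tau> n x) x \<partial>lborel)"
    proof (rule Bochner_Integration.integral_cong[OF refl])
      fix x show "indicator ?H x * v x * (E n x + partial_deriv i \<phi> x * \<tau> n x) = v x * partial_deriv i (\<lambda>x. \<phi> x * \<tau> n x) x"
        using z(1)[of x] by (cases "x \<in> ?H") (simp_all only: pd indicator_simps mult_1 mult_zero_left mult_zero_right simp_thms)
    qed
    also have "\<dots> = - (\<integral>x. g x $ i * (\<phi> x * \<tau> n x) \<partial>lborel)" by (rule D(3)[OF test])
    also have "(\<integral>x. g x $ i * (\<phi> x * \<tau> n x) \<partial>lborel) = (\<integral>x. indicator ?H x * g x $ i * (\<phi> x * \<tau> n x) \<partial>lborel)"
      using z(2) by (intro Bochner_Integration.integral_cong) (auto simp: indicator_def)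
    finally show ?thesis .
  qed
  have meas: "(\<lambda>x. indicator ?H x * v x) \<in> borel_measurable borel" "(\<lambda>x. indicator ?H x * g x $ i) \<in> borel_measurable borel"
    using Lp_loc_UNIV_measurable[OF v] borel_measurable_vec_component[OF Lp_loc_UNIV_measurable[OF g], of i] by simp_all
  note [measurable] = meas smooth_borel_measurable[OF s] smooth_borel_measurable[OF smooth_partial_deriv[OF s]]
    smooth_borel_measurable[OF \<tau>s] smooth_borel_measurable[OF ts]
  have [measurable]: "E n \<in> borel_measurable borel" for n unfolding E_def[abs_def] by measurable
  have L1: "(\<lambda>n. \<integral>x. indicator ?H x * v x * (E n x + partial_deriv i \<phi> x * \<tau> n x) \<partial>lborel) \<longlonglongrightarrow>
      (\<integral>x. indicator ?H x * v x * partial_deriv i \<phi> x \<partial>lborel)"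
  \<comment> \<open>\<open>3 * M\<close> bounds the cutoff term, since
    \<open>fact 1 + fact 2 = 3\<close>, and \<open>M\<close> bounds the other one.\<close>
  proof (rule integral_dominated_convergence[where w="\<lambda>x. (4 * M) * \<bar>indicator (cball 0 R) x * (indicator ?H x * v x)\<bar>"])
    have "integrable lborel (\<lambda>x. indicator (cball 0 R) x *\<^sub>R (indicator ?H x *\<^sub>R v x))"
      by (rule Lp_loc_integrable[OF v]) auto
    then show "integrable lborel (\<lambda>x. (4 * M) * \<bar>indicator (cball 0 R) x * (indicator ?H x * v x)\<bar>)"
      by (intro integrable_mult_right integrable_abs) simp
    show "AE x in lborel. (\<lambda>n. indicator ?H x * v x * (E n x + partial_deriv i \<phi> x * \<tau> n x)) \<longlonglongrightarrow>
        indicator ?H x * v x * partial_deriv i \<phi> x"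
    proof (rule AE_I2)
      fix x
      show "(\<lambda>n. indicator ?H x * v x * (E n x + partial_deriv i \<phi> x * \<tau> n x)) \<longlonglongrightarrow> indicator ?H x * v x * partial_deriv i \<phi> x"
      proof (cases "x \<in> ?H")
        case True
        have "(\<lambda>n. indicator ?H x * v x * (E n x + partial_deriv i \<phi> x * \<tau> n x)) \<longlonglongrightarrow>
            indicator ?H x * v x * (0 + partial_deriv i \<phi> x * 1)"
          by (intro tendsto_intros lims True)
        then show ?thesis by simp
      qed simp
    qed
    show "AE x in lborel. norm (indicator ?H x * v x * (E n x + partial_deriv i \<phi> x * \<tau> n x)) \<le>
        (4 * M) * \<bar>indicator (cball 0 R) x * (indicator ?H x * v x)\<bar>" for n
    proof (rule AE_I2)
      fix x
      show "norm (indicator ?H x * v x * (E n x + partial_deriv i \<phi> x * \<tau> n x)) \<le>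
        (4 * M) * \<bar>indicator (cball 0 R) x * (indicator ?H x * v x)\<bar>"
      proof (cases "x \<in> ?H \<and> x \<in> cball 0 R")
        case True
        have "\<bar>E n x\<bar> \<le> M * (flat 1 (t n x) + flat 2 (t n x))" by (rule E_le) (use True in simp)
        also have "\<dots> \<le> M * (fact 1 + fact 2)" using M by (intro mult_left_mono add_mono flat_le_fact) auto
        finally have "\<bar>E n x\<bar> \<le> 3 * M" by (simp add: fact_2)
        moreover have "\<bar>partial_deriv i \<phi> x * \<tau> n x\<bar> \<le> M * 1"
          unfolding abs_mult using M \<tau>01 by (intro mult_mono) auto
        ultimately have "\<bar>E n x + partial_deriv i \<phi> x * \<tau> n x\<bar> \<le> 4 * M" by linarith
        then have "\<bar>v x\<bar> * \<bar>E n x + partial_deriv i \<phi> x * \<tau> n x\<bar> \<le> \<bar>v x\<bar> * (4 * M)" by (rule mult_left_mono) simp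
        with True show ?thesis by (simp add: abs_mult mult.commute)
      next
        case False
        then have "x \<in> ?H \<Longrightarrow> E n x = 0 \<and> partial_deriv i \<phi> x = 0" using R(2)[of x] R'[of x] by (auto simp: E_def)
        then show ?thesis using M by (cases "x \<in> ?H") auto
      qed
    qed
  qed measurable
  have L2: "(\<lambda>n. \<integral>x. indicator ?H x * g x $ i * (\<phi> x * \<tau> n x) \<partial>lborel) \<longlonglongrightarrow>
      (\<integral>x. indicator ?H x * g x $ i * \<phi> x \<partial>lborel)"
  proof (rule integral_dominated_convergence[where w="\<lambda>x. \<bar>indicator ?H x * g x $ i * \<phi> x\<bar>"])
    have "integrable lborel (\<lambda>x. (indicator ?H x *\<^sub>R g x) $ i * \<phi> x)"
      by (intro test_integrable_mult[OF _ \<phi>] Lp_loc_component g) simp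
    then show "integrable lborel (\<lambda>x. \<bar>indicator ?H x * g x $ i * \<phi> x\<bar>)" by simp
    show "AE x in lborel. (\<lambda>n. indicator ?H x * g x $ i * (\<phi> x * \<tau> n x)) \<longlonglongrightarrow> indicator ?H x * g x $ i * \<phi> x"
    proof (rule AE_I2)
      fix x show "(\<lambda>n. indicator ?H x * g x $ i * (\<phi> x * \<tau> n x)) \<longlonglongrightarrow> indicator ?H x * g x $ i * \<phi> x"
      proof (cases "x \<in> ?H")
        case True
        have "(\<lambda>n. indicator ?H x * g x $ i * (\<phi> x * \<tau> n x)) \<longlonglongrightarrow> indicator ?H x * g x $ i * (\<phi> x * 1)"
          by (intro tendsto_intros lims True)
        then show ?thesis by simp
      qed simp
    qed
    show "AE x in lborel. norm (indicator ?H x * g x $ i * (\<phi> x * \<tau> n x)) \<le> \<bar>indicator ?H x * g x $ i * \<phi> x\<bar>" for n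
    proof (rule AE_I2)
      fix x
      have "\<bar>indicator ?H x * g x $ i * \<phi> x\<bar> * \<bar>\<tau> n x\<bar> \<le> \<bar>indicator ?H x * g x $ i * \<phi> x\<bar> * 1"
        using \<tau>01[of n x] by (intro mult_left_mono) auto
      then show "norm (indicator ?H x * g x $ i * (\<phi> x * \<tau> n x)) \<le> \<bar>indicator ?H x * g x $ i * \<phi> x\<bar>"
        by (simp add: abs_mult mult.assoc)
    qed
  qed measurable
  from L1 have "(\<lambda>n. - (\<integral>x. indicator ?H x * g x $ i * (\<phi> x * \<tau> n x) \<partial>lborel)) \<longlonglongrightarrow>
      (\<integral>x. indicator ?H x * v x * partial_deriv i \<phi> x \<partial>lborel)" unfolding eq .
  from LIMSEQ_unique[OF this tendsto_minus[OF L2]] show ?thesis .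
qed

section \<open>Weights that are constant on each side of the plane\<close>

definition phase_weight :: "'n::finite \<Rightarrow> real \<Rightarrow> real \<Rightarrow> real ^ 'n \<Rightarrow> real" where
  "phase_weight d a b x = a * indicator (half_space 1 d) x + b * indicator (half_space (- 1) d) x"

lemma two_phase_density_eq: "two_phase_density d a b = phase_weight d a b"
  by (simp add: fun_eq_iff two_phase_density_def phase_weight_def upper_half_eq lower_half_eq)

lemma phase_weight_cases:
  "x $ d > 0 \<Longrightarrow> phase_weight d a b x = a"
  "x $ d < 0 \<Longrightarrow> phase_weight d a b x = b"
  "x $ d = 0 \<Longrightarrow> phase_weight d a b x = 0"
  by (auto simp: phase_weight_def half_space_def)

text \<open>On the plane both sides are 0, because the inverse of 0 is 0; the density and its
  inverse are thus instances of the same weight.\<close>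

lemma inverse_phase_weight: "inverse (phase_weight d a b x) = phase_weight d (inverse a) (inverse b) x"
  by (cases "x $ d" "0 :: real" rule: linorder_cases) (simp_all add: phase_weight_cases)

lemma phase_weight_measurable [measurable]: "phase_weight d a b \<in> borel_measurable borel"
  unfolding phase_weight_def[abs_def] by measurable

lemma phase_weight_bound: "\<bar>phase_weight d a b x\<bar> \<le> \<bar>a\<bar> + \<bar>b\<bar>"
  by (cases "x $ d" "0 :: real" rule: linorder_cases) (simp_all add: phase_weight_cases)

lemma phase_weight_plane: "x \<in> plane d \<Longrightarrow> phase_weight d a b x = 0"
  by (simp add: plane_def phase_weight_cases)

lemma phase_weight_Lp:
  fixes g :: "real ^ 'n::finite \<Rightarrow> 'b::euclidean_space"
  shows "g \<in> Lp q lborel \<Longrightarrow> q \<ge> 0 \<Longrightarrow> (\<lambda>x. phase_weight d a b x *\<^sub>R g x) \<in> Lp q lborel"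
  by (rule Lp_scaleR_bounded[OF _ _ phase_weight_bound]) auto

lemma phase_weight_Lp_loc:
  fixes v :: "real ^ 'n::finite \<Rightarrow> 'b::euclidean_space"
  assumes "v \<in> Lp_loc 1 UNIV"
  shows "(\<lambda>x. phase_weight d a b x *\<^sub>R v x) \<in> Lp_loc 1 UNIV"
proof -
  have "(\<lambda>x. a *\<^sub>R (indicator (half_space 1 d) x *\<^sub>R v x) + b *\<^sub>R (indicator (half_space (- 1) d) x *\<^sub>R v x)) \<in> Lp_loc 1 UNIV"
    by (intro Lp_loc_add Lp_loc_scaleR indicator_Lp_loc assms) auto
  then show ?thesis by (simp add: phase_weight_def scaleR_add_left)
qed

text \<open>Integration by parts is done on each side separately. The condition on \<open>i\<close>
  and \<open>\<phi>\<close> removes the boundary terms, which need not cancel when the weights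
  differ.\<close>

lemma phase_weight_by_parts:
  fixes u :: "real ^ 'n::finite \<Rightarrow> real"
  assumes wg: "is_weak_grad UNIV u g" and \<phi>: "\<phi> \<in> test_functions UNIV"
    and i: "i \<noteq> d \<or> (\<forall>x. x $ d = 0 \<longrightarrow> \<phi> x = 0)"
  shows "(\<integral>x. phase_weight d a b x * u x * partial_deriv i \<phi> x \<partial>lborel) =
    - (\<integral>x. phase_weight d a b x * g x $ i * \<phi> x \<partial>lborel)"
proof -
  note D = is_weak_gradD[OF wg, simplified]
  let ?H = "half_space 1 d" and ?L = "half_space (- 1) d"
  have wH: "is_weak_grad (half_space \<sigma> d) u g" for \<sigma> by (rule is_weak_grad_subset[OF wg]) auto
  have P: "(\<integral>x. indicator (half_space \<sigma> d) x * u x * partial_deriv i \<phi> x \<partial>lborel) =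
      - (\<integral>x. indicator (half_space \<sigma> d) x * g x $ i * \<phi> x \<partial>lborel)" if "\<bar>\<sigma>\<bar> = 1" for \<sigma>
    by (rule half_space_by_parts[OF that wH _ _ \<phi> i]) (intro indicator_Lp_loc D half_space_borel)+
  have i1: "integrable lborel (\<lambda>x. indicator (half_space \<sigma> d) x * u x * partial_deriv i \<phi> x)" for \<sigma>
    using test_integrable_mult[OF indicator_Lp_loc[OF D(1) half_space_borel] test_functions_partial_deriv[OF \<phi>]] by simp
  have i2: "integrable lborel (\<lambda>x. indicator (half_space \<sigma> d) x * g x $ i * \<phi> x)" for \<sigma>
    using test_integrable_mult[OF Lp_loc_component[OF indicator_Lp_loc[OF D(2) half_space_borel], where i=i] \<phi>] by simp
  have "(\<integral>x. phase_weight d a b x * u x * partial_deriv i \<phi> x \<partial>lborel) =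
      (\<integral>x. a * (indicator ?H x * u x * partial_deriv i \<phi> x) + b * (indicator ?L x * u x * partial_deriv i \<phi> x) \<partial>lborel)"
    by (simp add: phase_weight_def algebra_simps)
  also have "\<dots> = a * (\<integral>x. indicator ?H x * u x * partial_deriv i \<phi> x \<partial>lborel) + b * (\<integral>x. indicator ?L x * u x * partial_deriv i \<phi> x \<partial>lborel)"
    using i1 by simp
  also have "\<dots> = - (a * (\<integral>x. indicator ?H x * g x $ i * \<phi> x \<partial>lborel) + b * (\<integral>x. indicator ?L x * g x $ i * \<phi> x \<partial>lborel))"
    by (simp add: P)
  also have "a * (\<integral>x. indicator ?H x * g x $ i * \<phi> x \<partial>lborel) + b * (\<integral>x. indicator ?L x * g x $ i * \<phi> x \<partial>lborel) =
      (\<integral>x. a * (indicator ?H x * g x $ i * \<phi> x) + b * (indicator ?L x * g x $ i * \<phi> x) \<partial>lborel)"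
    using i2 by simp
  also have "\<dots> = (\<integral>x. phase_weight d a b x * g x $ i * \<phi> x \<partial>lborel)"
    by (simp add: phase_weight_def algebra_simps)
  finally show ?thesis .
qed

subsection \<open>Reflection in the plane\<close>

definition reflect :: "'n::finite \<Rightarrow> real ^ 'n \<Rightarrow> real ^ 'n" where
  "reflect d = diag_affine 0 (\<chi> j. if j = d then - 1 else 1)"

abbreviation refl_sign :: "'n \<Rightarrow> 'n \<Rightarrow> real" where
  "refl_sign d i \<equiv> (if i = d then - 1 else 1)"

lemma reflect_nth [simp]: "reflect d x $ i = refl_sign d i * x $ i"
  by (simp add: reflect_def)

lemma reflect_reflect [simp]: "reflect d (reflect d x) = x"
  by (simp add: vec_eq_iff)

lemma reflect_inner: "reflect d x \<bullet> y = x \<bullet> reflect d y"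
  by (simp add: inner_vec_def) (intro sum.cong, auto)

lemma reflect_linear: "reflect d (a *\<^sub>R x) = a *\<^sub>R reflect d x" "reflect d (x + y) = reflect d x + reflect d y"
  "reflect d (x - y) = reflect d x - reflect d y" "reflect d 0 = 0"
  by (auto simp: vec_eq_iff algebra_simps)

lemma norm_reflect: "norm (reflect d x) = norm x"
  by (simp add: norm_eq_sqrt_inner reflect_inner)

lemma reflect_measurable [measurable]: "reflect d \<in> borel_measurable borel"
  unfolding reflect_def by measurable

lemma integral_reflect:
  fixes f :: "real ^ 'n::finite \<Rightarrow> 'b::euclidean_space"
  shows "f \<in> borel_measurable borel \<Longrightarrow> (\<integral>x. f (reflect d x) \<partial>lborel) = (\<integral>x. f x \<partial>lborel)"
  unfolding reflect_def by (rule integral_diag_affine) simp_all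

lemma integrable_reflect:
  fixes f :: "real ^ 'n::finite \<Rightarrow> 'b::euclidean_space"
  shows "integrable lborel f \<Longrightarrow> integrable lborel (\<lambda>x. f (reflect d x))"
  unfolding reflect_def by (rule integrable_diag_affine) simp_all

lemma Lp_reflect:
  fixes g :: "real ^ 'n::finite \<Rightarrow> real ^ 'n"
  assumes "g \<in> Lp q lborel" "q \<ge> 0"
  shows "(\<lambda>x. reflect d (g (reflect d x))) \<in> Lp q lborel"
proof (rule Lp_mono[where C=1])
  show "(\<lambda>x. g (reflect d x)) \<in> Lp q lborel"
    unfolding reflect_def by (rule Lp_diag_affine) (use assms in simp_all)
  have "g \<in> borel_measurable borel" using Lp_measurable[OF assms(1)] by simp
  then show "(\<lambda>x. reflect d (g (reflect d x))) \<in> borel_measurable lborel" by measurable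
qed (use assms(2) in \<open>auto simp: norm_reflect\<close>)

lemma test_reflect:
  fixes \<phi> :: "real ^ 'n::finite \<Rightarrow> real"
  assumes "\<phi> \<in> test_functions UNIV"
  shows "(\<lambda>x. \<phi> (reflect d x)) \<in> test_functions UNIV"
    "partial_deriv i (\<lambda>x. \<phi> (reflect d x)) = (\<lambda>x. refl_sign d i * partial_deriv i \<phi> (reflect d x))"
    "grad (\<lambda>x. \<phi> (reflect d x)) x = reflect d (grad \<phi> (reflect d x))"
proof -
  show "(\<lambda>x. \<phi> (reflect d x)) \<in> test_functions UNIV"
    unfolding reflect_def by (rule test_functions_diag_affine[OF assms]) simp
  show pd: "partial_deriv i (\<lambda>x. \<phi> (reflect d x)) = (\<lambda>x. refl_sign d i * partial_deriv i \<phi> (reflect d x))" for i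
    unfolding reflect_def
    by (subst partial_deriv_diag_affine[OF smooth_differentiable[OF test_functions_smooth[OF assms]]]) simp
  show "grad (\<lambda>x. \<phi> (reflect d x)) x = reflect d (grad \<phi> (reflect d x))"
    by (simp add: vec_eq_iff grad_nth pd)
qed

lemma integral_reflect_swap:
  fixes f k :: "real ^ 'n::finite \<Rightarrow> real"
  assumes [measurable]: "f \<in> borel_measurable borel" "k \<in> borel_measurable borel"
  shows "(\<integral>x. f (reflect d x) * k x \<partial>lborel) = (\<integral>x. f x * k (reflect d x) \<partial>lborel)"
  using integral_reflect[of "\<lambda>x. f x * k (reflect d x)" d] by simp

lemma Lp_loc_reflect:
  fixes f :: "real ^ 'n::finite \<Rightarrow> 'b::euclidean_space"
  assumes "f \<in> Lp_loc 1 UNIV"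
  shows "(\<lambda>x. f (reflect d x)) \<in> Lp_loc 1 UNIV"
proof (rule Lp_loc_1I)
  fix K :: "(real ^ 'n) set" assume "compact K"
  then have c: "compact (reflect d ` K)"
    unfolding reflect_def by (intro compact_continuous_image continuous_on_diag_affine)
  have "reflect d x \<in> reflect d ` K \<longleftrightarrow> x \<in> K" for x by (metis image_iff reflect_reflect)
  with integrable_reflect[OF Lp_loc_integrable[OF assms c], of d]
  show "integrable lborel (\<lambda>x. indicator K x *\<^sub>R f (reflect d x))" by (simp add: indicator_def)
qed

lemma Lp_loc_reflect_vec:
  fixes g :: "real ^ 'n::finite \<Rightarrow> real ^ 'n"
  assumes "g \<in> Lp_loc 1 UNIV"
  shows "(\<lambda>x. reflect d (g (reflect d x))) \<in> Lp_loc 1 UNIV"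
proof (rule Lp_loc_1I)
  fix K :: "(real ^ 'n) set" assume K: "compact K"
  have [measurable]: "g \<in> borel_measurable borel" by (rule Lp_loc_UNIV_measurable[OF assms])
  have [measurable]: "K \<in> sets borel" by (rule borel_compact[OF K])
  show "integrable lborel (\<lambda>x. indicator K x *\<^sub>R reflect d (g (reflect d x)))"
    by (rule Bochner_Integration.integrable_bound[OF Lp_loc_integrable[OF Lp_loc_reflect[OF assms] K]])
      (auto simp: norm_reflect)
qed

lemma test_hat_H1:
  fixes \<phi> :: "real ^ 'n::finite \<Rightarrow> real"
  assumes "\<phi> \<in> test_functions UNIV" "q \<ge> 1"
  shows "\<phi> \<in> hat_H1 q UNIV" "is_weak_grad UNIV \<phi> (grad \<phi>)" "grad \<phi> \<in> Lp q lborel"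
proof -
  show wg: "is_weak_grad UNIV \<phi> (grad \<phi>)" by (rule is_weak_grad_smooth[OF test_functions_smooth[OF assms(1)]]) simp
  show L: "grad \<phi> \<in> Lp q lborel" using assms(2) by (intro grad_test_Lp[OF assms(1)]) simp
  have "(\<lambda>x. indicator K x *\<^sub>R \<phi> x) \<in> Lp q lborel" if "compact K" for K
    by (rule Lp_scaleR_bounded[OF test_Lp[OF assms(1)], where C=1])
      (use assms(2) borel_compact[OF that] in \<open>auto intro!: borel_measurable_indicator\<close>)
  with wg L show "\<phi> \<in> hat_H1 q UNIV" unfolding hat_H1_UNIV_iff by blast
qed

section \<open>Uniqueness\<close>

text \<open>With the reflection \<open>R\<close> in the plane, both \<open>u - u \<circ> R\<close> and \<open>\<rho>\<inverse> u + (\<rho>\<inverse> u) \<circ> R\<close> have gradients in \<open>L\<^sub>q\<close>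
  and are weakly harmonic, hence constant by Liouville's theorem.\<close>

theorem two_phase_unique:
  fixes u :: "real ^ 'n::finite \<Rightarrow> real"
  assumes q: "q > 1" and \<rho>: "\<rho>p > 0" "\<rho>m > 0"
    and wg: "is_weak_grad UNIV u g" and g: "g \<in> Lp q lborel"
    and sol: "\<And>\<phi> W. \<phi> \<in> hat_H1 (q / (q - 1)) UNIV \<Longrightarrow> is_weak_grad UNIV \<phi> W \<Longrightarrow> W \<in> Lp (q / (q - 1)) lborel \<Longrightarrow>
      (\<integral>x. (phase_weight d (inverse \<rho>p) (inverse \<rho>m) x *\<^sub>R g x) \<bullet> W x \<partial>lborel) = 0"
  shows "AE x in lborel. g x = 0"
proof -
  define p where "p = q / (q - 1)"
  have p: "p \<ge> 1" using q by (simp add: p_def field_simps)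
  note sol = sol[folded p_def]
  define r where "r = phase_weight d (inverse \<rho>p) (inverse \<rho>m)"
  define w where "w = phase_weight d \<rho>p \<rho>m"
  define F where "F x = r x *\<^sub>R g x" for x
  note D = is_weak_gradD[OF wg, simplified]
  have FL: "F \<in> Lp q lborel" unfolding F_def r_def using q by (intro phase_weight_Lp g) simp
  have Floc: "F \<in> Lp_loc 1 UNIV" unfolding F_def r_def by (rule phase_weight_Lp_loc[OF D(2)])
  have ruloc: "(\<lambda>x. r x * u x) \<in> Lp_loc 1 UNIV" using phase_weight_Lp_loc[OF D(1)] by (simp add: r_def)
  have [measurable]: "u \<in> borel_measurable borel" "g \<in> borel_measurable borel" "F \<in> borel_measurable borel"
    using D Floc Lp_loc_UNIV_measurable by auto
  have [measurable]: "r \<in> borel_measurable borel" "w \<in> borel_measurable borel" by (simp_all add: r_def w_def)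
  have Ftest: "(\<integral>x. F x \<bullet> grad \<phi> x \<partial>lborel) = 0" if "\<phi> \<in> test_functions UNIV" for \<phi>
    using sol[OF test_hat_H1(1,2,3)[OF that p]] by (simp add: F_def r_def)
  have Fint: "integrable lborel (\<lambda>x. F x \<bullet> grad \<phi> x)" "integrable lborel (\<lambda>x. g x \<bullet> grad \<phi> x)"
    if "\<phi> \<in> test_functions UNIV" for \<phi>
    using Holder_inner(1)[OF q FL grad_test_Lp[OF that]] Holder_inner(1)[OF q g grad_test_Lp[OF that]] p
    by (simp_all add: p_def)
  have tm [measurable_dest]: "\<phi> \<in> borel_measurable borel" "partial_deriv i \<phi> \<in> borel_measurable borel" "grad \<phi> \<in> borel_measurable borel"
    if "\<phi> \<in> test_functions UNIV" for \<phi> :: "real ^ 'n \<Rightarrow> real" and i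
    using that Lp_measurable[OF grad_test_Lp[OF that, of 1]]
    by (auto intro: smooth_borel_measurable smooth_partial_deriv test_functions_smooth)
  have reflect_pair: "(\<integral>x. reflect d (f (reflect d x)) \<bullet> grad \<phi> x \<partial>lborel) = (\<integral>x. f x \<bullet> grad (\<lambda>x. \<phi> (reflect d x)) x \<partial>lborel)"
    if "f \<in> borel_measurable borel" "\<phi> \<in> test_functions UNIV" for f :: "real ^ 'n \<Rightarrow> real ^ 'n" and \<phi>
  proof -
    have [measurable]: "f \<in> borel_measurable borel" "grad \<phi> \<in> borel_measurable borel" using that tm by auto
    show ?thesis
      using integral_reflect[of "\<lambda>x. f x \<bullet> reflect d (grad \<phi> (reflect d x))" d]
      by (simp add: test_reflect(3)[OF that(2)] reflect_inner)
  qed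
  have sum_grad: "grad (\<lambda>x. \<phi> x + \<psi> x) x = grad \<phi> x + grad \<psi> x" "grad (\<lambda>x. \<phi> x - \<psi> x) x = grad \<phi> x - grad \<psi> x"
    if "\<phi> \<in> test_functions UNIV" "\<psi> \<in> test_functions UNIV" for \<phi> \<psi> :: "real ^ 'n \<Rightarrow> real" and x
    using test_functions_smooth[OF that(1)] test_functions_smooth[OF that(2)]
    by (auto simp: vec_eq_iff grad_nth smooth_partial_add smooth_partial_diff)

  define GS where "GS x = F x + reflect d (F (reflect d x))" for x
  have "AE x in lborel. GS x = 0"
  proof (rule Liouville_weak[OF q])
    show "GS \<in> Lp q lborel" unfolding GS_def using q by (intro Lp_add FL Lp_reflect) auto
    show "is_weak_grad UNIV (\<lambda>x. r x * u x + r (reflect d x) * u (reflect d x)) GS"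
    proof (subst is_weak_grad_iff, simp, intro conjI ballI allI)
      show "(\<lambda>x. r x * u x + r (reflect d x) * u (reflect d x)) \<in> Lp_loc 1 UNIV"
        using Lp_loc_reflect[OF ruloc, of d] by (intro Lp_loc_add ruloc) auto
      show "GS \<in> Lp_loc 1 UNIV" unfolding GS_def by (intro Lp_loc_add Floc Lp_loc_reflect_vec) simp
      fix \<psi> :: "real ^ 'n \<Rightarrow> real" and i assume \<psi>: "\<psi> \<in> test_functions UNIV"
      let ?c = "refl_sign d i"
      note R = test_reflect[OF \<psi>, where d=d]
      note s = test_functions_smooth[OF \<psi>] and sR = test_functions_smooth[OF R(1)]
      \<comment> \<open>The reflection is moved to the test function. For the normal derivative the
        sign makes \<open>\<Psi>\<close> odd, hence 0 on the plane; tangential derivatives produce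
        no boundary term anyway.\<close>
      define \<Psi> where "\<Psi> x = \<psi> x + ?c * \<psi> (reflect d x)" for x
      have \<Psi>: "\<Psi> \<in> test_functions UNIV"
        unfolding \<Psi>_def[abs_def] by (intro test_functions_add \<psi> test_functions_cmult R(1))
      have pd: "partial_deriv i \<Psi> = (\<lambda>x. partial_deriv i \<psi> x + partial_deriv i \<psi> (reflect d x))"
        unfolding \<Psi>_def[abs_def]
        by (subst smooth_partial_add[OF s smooth_cmult[OF sR]], subst smooth_partial_cmult[OF sR], subst R(2)) auto
      have van: "i \<noteq> d \<or> (\<forall>x. x $ d = 0 \<longrightarrow> \<Psi> x = 0)"
      proof -
        have "reflect d x = x" if "x $ d = 0" for x using that by (auto simp: vec_eq_iff)
        then show ?thesis by (auto simp: \<Psi>_def)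
      qed
      have [measurable]: "\<psi> \<in> borel_measurable borel" "partial_deriv i \<psi> \<in> borel_measurable borel" using tm[OF \<psi>] by auto
      note t\<psi> = test_functions_partial_deriv[OF \<psi>, of i]
      have i1: "integrable lborel (\<lambda>x. (r x * u x) * partial_deriv i \<psi> x)" by (rule test_integrable_mult[OF ruloc t\<psi>])
      have i2: "integrable lborel (\<lambda>x. (r (reflect d x) * u (reflect d x)) * partial_deriv i \<psi> x)"
        by (rule test_integrable_mult[OF Lp_loc_reflect[OF ruloc] t\<psi>])
      have i2': "integrable lborel (\<lambda>x. (r x * u x) * partial_deriv i \<psi> (reflect d x))"
        using integrable_reflect[OF i2, of d] by simp
      have i3: "integrable lborel (\<lambda>x. F x $ i * \<psi> x)" by (intro test_integrable_mult[OF _ \<psi>] Lp_loc_component Floc) simp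
      have i4: "integrable lborel (\<lambda>x. F (reflect d x) $ i * \<psi> x)"
        by (intro test_integrable_mult[OF _ \<psi>] Lp_loc_component Lp_loc_reflect Floc) simp
      have i4': "integrable lborel (\<lambda>x. F x $ i * \<psi> (reflect d x))" using integrable_reflect[OF i4, of d] by simp
      have "(\<integral>x. (r x * u x + r (reflect d x) * u (reflect d x)) * partial_deriv i \<psi> x \<partial>lborel) =
          (\<integral>x. (r x * u x) * partial_deriv i \<psi> x \<partial>lborel) + (\<integral>x. (r (reflect d x) * u (reflect d x)) * partial_deriv i \<psi> x \<partial>lborel)"
        using i1 i2 by (simp add: distrib_right)
      also have "(\<integral>x. (r (reflect d x) * u (reflect d x)) * partial_deriv i \<psi> x \<partial>lborel) =
          (\<integral>x. (r x * u x) * partial_deriv i \<psi> (reflect d x) \<partial>lborel)"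
        by (rule integral_reflect_swap) measurable
      also have "(\<integral>x. (r x * u x) * partial_deriv i \<psi> x \<partial>lborel) + (\<integral>x. (r x * u x) * partial_deriv i \<psi> (reflect d x) \<partial>lborel) =
          (\<integral>x. r x * u x * partial_deriv i \<Psi> x \<partial>lborel)"
        using i1 i2' by (simp add: pd distrib_left)
      also have "\<dots> = - (\<integral>x. r x * g x $ i * \<Psi> x \<partial>lborel)"
        unfolding r_def by (rule phase_weight_by_parts[OF wg \<Psi> van])
      also have "(\<integral>x. r x * g x $ i * \<Psi> x \<partial>lborel) = (\<integral>x. F x $ i * \<psi> x + ?c * (F x $ i * \<psi> (reflect d x)) \<partial>lborel)"
        by (intro Bochner_Integration.integral_cong) (auto simp: F_def \<Psi>_def algebra_simps)
      also have "\<dots> = (\<integral>x. F x $ i * \<psi> x \<partial>lborel) + ?c * (\<integral>x. F x $ i * \<psi> (reflect d x) \<partial>lborel)"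
        using i3 i4' by (simp del: if_split)
      also have "(\<integral>x. F x $ i * \<psi> (reflect d x) \<partial>lborel) = (\<integral>x. F (reflect d x) $ i * \<psi> x \<partial>lborel)"
        using integral_reflect_swap[of "\<lambda>x. F x $ i" \<psi> d] by simp
      also have "(\<integral>x. F x $ i * \<psi> x \<partial>lborel) + ?c * (\<integral>x. F (reflect d x) $ i * \<psi> x \<partial>lborel) =
          (\<integral>x. F x $ i * \<psi> x + ?c * (F (reflect d x) $ i * \<psi> x) \<partial>lborel)"
        using i3 i4 by (simp del: if_split)
      also have "\<dots> = (\<integral>x. GS x $ i * \<psi> x \<partial>lborel)"
        by (intro Bochner_Integration.integral_cong) (auto simp: GS_def algebra_simps)
      finally show "(\<integral>x. (r x * u x + r (reflect d x) * u (reflect d x)) * partial_deriv i \<psi> x \<partial>lborel) =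
          - (\<integral>x. GS x $ i * \<psi> x \<partial>lborel)" .
    qed
    fix \<phi> :: "real ^ 'n \<Rightarrow> real" assume \<phi>: "\<phi> \<in> test_functions UNIV"
    note R = test_reflect(1)[OF \<phi>, where d=d]
    have i: "integrable lborel (\<lambda>x. reflect d (F (reflect d x)) \<bullet> grad \<phi> x)"
      using Holder_inner(1)[OF q Lp_reflect[OF FL] grad_test_Lp[OF \<phi>]] q p by (simp add: p_def)
    have "(\<integral>x. GS x \<bullet> grad \<phi> x \<partial>lborel) = (\<integral>x. F x \<bullet> grad \<phi> x \<partial>lborel) + (\<integral>x. reflect d (F (reflect d x)) \<bullet> grad \<phi> x \<partial>lborel)"
      using Fint(1)[OF \<phi>] i by (simp add: GS_def inner_add_left)
    then show "(\<integral>x. GS x \<bullet> grad \<phi> x \<partial>lborel) = 0"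
      using Ftest[OF \<phi>] Ftest[OF R] reflect_pair[OF \<open>F \<in> borel_measurable borel\<close> \<phi>] by simp
  qed
  moreover
  define GD where "GD x = g x - reflect d (g (reflect d x))" for x
  have "AE x in lborel. GD x = 0"
  proof (rule Liouville_weak[OF q])
    show "GD \<in> Lp q lborel" unfolding GD_def using q by (intro Lp_diff g Lp_reflect) auto
    have "is_weak_grad UNIV (\<lambda>x. u (reflect d x)) (\<lambda>x. reflect d (g (reflect d x)))"
    proof (subst is_weak_grad_iff, simp, intro conjI ballI allI)
      show "(\<lambda>x. u (reflect d x)) \<in> Lp_loc 1 UNIV" "(\<lambda>x. reflect d (g (reflect d x))) \<in> Lp_loc 1 UNIV"
        by (intro Lp_loc_reflect Lp_loc_reflect_vec D)+
      fix \<psi> :: "real ^ 'n \<Rightarrow> real" and i assume \<psi>: "\<psi> \<in> test_functions UNIV"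
      have [measurable]: "\<psi> \<in> borel_measurable borel" "partial_deriv i \<psi> \<in> borel_measurable borel" using tm[OF \<psi>] by auto
      note R = test_reflect[OF \<psi>, where d=d]
      have "(\<integral>x. u (reflect d x) * partial_deriv i \<psi> x \<partial>lborel) = (\<integral>x. u x * partial_deriv i \<psi> (reflect d x) \<partial>lborel)"
        by (rule integral_reflect_swap) measurable
      also have "\<dots> = (\<integral>x. refl_sign d i * (u x * partial_deriv i (\<lambda>x. \<psi> (reflect d x)) x) \<partial>lborel)"
        by (intro Bochner_Integration.integral_cong) (auto simp: R(2))
      also have "\<dots> = refl_sign d i * - (\<integral>x. g x $ i * \<psi> (reflect d x) \<partial>lborel)"
        using D(3)[OF R(1), of i] by (simp del: if_split)
      also have "(\<integral>x. g x $ i * \<psi> (reflect d x) \<partial>lborel) = (\<integral>x. g (reflect d x) $ i * \<psi> x \<partial>lborel)"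
        using integral_reflect_swap[of "\<lambda>x. g x $ i" \<psi> d] by simp
      finally show "(\<integral>x. u (reflect d x) * partial_deriv i \<psi> x \<partial>lborel) = - (\<integral>x. reflect d (g (reflect d x)) $ i * \<psi> x \<partial>lborel)"
        by (auto simp: mult.assoc)
    qed
    from is_weak_grad_diff[OF wg this] show "is_weak_grad UNIV (\<lambda>x. u x - u (reflect d x)) GD" by (simp add: GD_def[abs_def])
    fix \<phi> :: "real ^ 'n \<Rightarrow> real" assume \<phi>: "\<phi> \<in> test_functions UNIV"
    note R = test_reflect(1)[OF \<phi>, where d=d]
    \<comment> \<open>By reflection, testing the difference \<open>GD\<close> with
      \<open>\<phi>\<close> is testing \<open>g\<close> itself with twice the odd part of
      \<open>\<phi>\<close>, which vanishes on the plane.\<close>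
    define \<Phi> where "\<Phi> x = \<phi> x - \<phi> (reflect d x)" for x
    have \<Phi>: "\<Phi> \<in> test_functions UNIV" unfolding \<Phi>_def[abs_def] by (intro test_functions_diff \<phi> R)
    have [measurable]: "\<Phi> \<in> borel_measurable borel" "grad \<Phi> \<in> borel_measurable borel" using tm[OF \<Phi>] by auto
    have van: "\<Phi> x = 0" if "x $ d = 0" for x
    proof -
      have "reflect d x = x" using that by (auto simp: vec_eq_iff)
      then show ?thesis by (simp add: \<Phi>_def)
    qed
    have i: "integrable lborel (\<lambda>x. reflect d (g (reflect d x)) \<bullet> grad \<phi> x)"
      using Holder_inner(1)[OF q Lp_reflect[OF g] grad_test_Lp[OF \<phi>]] q p by (simp add: p_def)
    have "(\<integral>x. GD x \<bullet> grad \<phi> x \<partial>lborel) = (\<integral>x. g x \<bullet> grad \<phi> x \<partial>lborel) - (\<integral>x. reflect d (g (reflect d x)) \<bullet> grad \<phi> x \<partial>lborel)"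
      using Fint(2)[OF \<phi>] i by (simp add: GD_def inner_diff_left)
    also have "\<dots> = (\<integral>x. g x \<bullet> grad \<Phi> x \<partial>lborel)"
      using Fint(2)[OF \<phi>] Fint(2)[OF R] reflect_pair[OF \<open>g \<in> borel_measurable borel\<close> \<phi>]
      by (simp add: \<Phi>_def[abs_def] sum_grad(2)[OF \<phi> R] inner_diff_right)
    also have "\<dots> = (\<integral>x. F x \<bullet> (w x *\<^sub>R grad \<Phi> x) \<partial>lborel)"
    proof (rule integral_cong_AE)
      show "AE x in lborel. g x \<bullet> grad \<Phi> x = F x \<bullet> (w x *\<^sub>R grad \<Phi> x)"
        using AE_not_plane[of d]
      proof eventually_elim
        case (elim x)
        then have "r x * w x = 1" using \<rho>
          by (cases "x $ d" "0 :: real" rule: linorder_cases) (simp_all add: r_def w_def phase_weight_cases)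
        then show ?case by (simp add: F_def) (metis mult.assoc mult.commute mult_1)
      qed
    qed measurable
    also have "\<dots> = 0"
    proof -
      \<comment> \<open>Despite its jump, the weight \<open>w\<close> may multiply
        \<open>\<Phi>\<close>, since \<open>\<Phi>\<close> is 0 on the plane. Testing the equation
        with \<open>w * \<Phi>\<close> cancels the coefficient and leaves \<open>g\<close> paired
        with the gradient of \<open>\<Phi>\<close>.\<close>
      have wgw: "is_weak_grad UNIV (\<lambda>x. w x * \<Phi> x) (\<lambda>x. w x *\<^sub>R grad \<Phi> x)"
      proof (subst is_weak_grad_iff, simp, intro conjI ballI allI)
        note TD = is_weak_gradD[OF test_hat_H1(2)[OF \<Phi> order_refl], simplified]
        show l1: "(\<lambda>x. w x * \<Phi> x) \<in> Lp_loc 1 UNIV" using phase_weight_Lp_loc[OF TD(1)] by (simp add: w_def)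
        show l2: "(\<lambda>x. w x *\<^sub>R grad \<Phi> x) \<in> Lp_loc 1 UNIV" using phase_weight_Lp_loc[OF TD(2)] by (simp add: w_def)
        fix \<psi> :: "real ^ 'n \<Rightarrow> real" and i assume \<psi>: "\<psi> \<in> test_functions UNIV"
        \<comment> \<open>The product rule for \<open>w * \<Phi>\<close> comes from the weighted
          integration by parts for the constant function 1 with test function
          \<open>\<Phi> * \<psi>\<close>.\<close>
        have one: "is_weak_grad UNIV (\<lambda>x :: real ^ 'n. 1) (\<lambda>x. 0)"
          using is_weak_grad_smooth[OF smooth_const[of 1], of "UNIV :: (real ^ 'n) set"]
          by (simp add: grad_const)
        have "(\<integral>x. w x * 1 * partial_deriv i (\<lambda>x. \<Phi> x * \<psi> x) x \<partial>lborel) = - (\<integral>x. w x * (0 :: real ^ 'n) $ i * (\<Phi> x * \<psi> x) \<partial>lborel)"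
          unfolding w_def
          by (rule phase_weight_by_parts[OF one test_functions_mult[OF \<Phi> test_functions_smooth[OF \<psi>]]]) (simp add: van)
        then have "(\<integral>x. (w x * \<Phi> x) * partial_deriv i \<psi> x + (w x *\<^sub>R grad \<Phi> x) $ i * \<psi> x \<partial>lborel) = 0"
          by (simp add: smooth_partial_mult[OF test_functions_smooth[OF \<Phi>] test_functions_smooth[OF \<psi>]] grad_nth distrib_left mult.assoc)
        moreover have "integrable lborel (\<lambda>x. (w x * \<Phi> x) * partial_deriv i \<psi> x)"
          by (rule test_integrable_mult[OF l1 test_functions_partial_deriv[OF \<psi>]])
        moreover have "integrable lborel (\<lambda>x. (w x *\<^sub>R grad \<Phi> x) $ i * \<psi> x)"
          by (intro test_integrable_mult[OF _ \<psi>] Lp_loc_component l2) simp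
        ultimately show "(\<integral>x. w x * \<Phi> x * partial_deriv i \<psi> x \<partial>lborel) = - (\<integral>x. (w x *\<^sub>R grad \<Phi> x) $ i * \<psi> x \<partial>lborel)"
          by (subst (asm) Bochner_Integration.integral_add) auto
      qed
      have WL: "(\<lambda>x. w x *\<^sub>R grad \<Phi> x) \<in> Lp p lborel"
        unfolding w_def using p by (intro phase_weight_Lp test_hat_H1(3)[OF \<Phi>]) auto
      have "(\<lambda>x. indicator K x *\<^sub>R (w x * \<Phi> x)) \<in> Lp p lborel" if K: "compact K" for K
      proof -
        have "(\<lambda>x. indicator K x *\<^sub>R (w x *\<^sub>R \<Phi> x)) \<in> Lp p lborel"
          unfolding w_def using p
          by (intro Lp_scaleR_bounded[where C=1] phase_weight_Lp test_Lp[OF \<Phi>])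
            (auto intro!: borel_measurable_indicator borel_compact[OF K])
        then show ?thesis by simp
      qed
      with wgw WL have "(\<lambda>x. w x * \<Phi> x) \<in> hat_H1 p UNIV" unfolding hat_H1_UNIV_iff by blast
      from sol[OF this wgw WL] show ?thesis by (simp add: F_def r_def)
    qed
    finally show "(\<integral>x. GD x \<bullet> grad \<phi> x \<partial>lborel) = 0" .
  qed
  ultimately show ?thesis using AE_not_plane[of d]
  proof eventually_elim
    case (elim x)
    \<comment> \<open>The odd identity expresses the reflected gradient by \<open>g x\<close>;
      inserted into the even identity it leaves \<open>g x\<close> times a positive number.\<close>
    have "reflect d (F (reflect d x)) = r (reflect d x) *\<^sub>R g x"
      using elim(2) by (simp add: F_def GD_def reflect_linear)
    with elim(1) have "(r x + r (reflect d x)) *\<^sub>R g x = 0" by (simp add: GS_def F_def scaleR_add_left)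
    moreover have "r x + r (reflect d x) > 0"
      using elim(3) \<rho> by (cases "x $ d" "0 :: real" rule: linorder_cases) (simp_all add: r_def phase_weight_cases add_pos_pos)
    ultimately show ?case by simp
  qed
qed

text \<open>Poincare's inequality with vanishing right-hand side; taking the mean over the unit ball
  for all radii makes the constant the same on every ball.\<close>

lemma weak_grad_0_imp_const:
  fixes u :: "real ^ 'n::finite \<Rightarrow> real"
  assumes u: "u \<in> hat_H1 q UNIV" and wg: "is_weak_grad UNIV u g" and g: "g \<in> Lp q lborel" and q: "q > 1"
    and zero: "AE x in lborel. g x = 0"
  shows "\<exists>c. AE x in lborel. u x = c"
proof -
  have uK: "\<And>K. compact K \<Longrightarrow> (\<lambda>x. indicator K x *\<^sub>R u x) \<in> Lp q lborel" using u unfolding hat_H1_UNIV_iff by blast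
  have "Lp_norm q lborel g = Lp_norm q lborel (\<lambda>x :: real ^ 'n. 0 :: real ^ 'n)"
    by (rule Lp_norm_cong_AE) (use Lp_measurable[OF g] zero in auto)
  then have g0: "Lp_norm q lborel g = 0" by (simp add: Lp_norm_def)
  have "AE x in lborel. indicator (ball 0 (real (Suc n))) x *\<^sub>R (u x - ball_mean 1 u) = 0" for n
  proof (rule Lp_norm_eq_0_AE)
    show "(\<lambda>x. indicator (ball 0 (real (Suc n))) x *\<^sub>R (u x - ball_mean 1 u)) \<in> Lp q lborel"
      by (rule Poincare(2)[OF uK wg g q]) auto
    show "Lp_norm q lborel (\<lambda>x. indicator (ball 0 (real (Suc n))) x *\<^sub>R (u x - ball_mean 1 u)) = 0"
      using Poincare(1)[OF uK wg g q, of 1 "real (Suc n)"] by (intro antisym) (auto simp: g0 Lp_norm_nonneg)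
  qed (use q in simp)
  then have "AE x in lborel. \<forall>n. indicator (ball 0 (real (Suc n))) x *\<^sub>R (u x - ball_mean 1 u) = 0"
    unfolding AE_all_countable by blast
  then have "AE x in lborel. u x = ball_mean 1 u"
  proof eventually_elim
    case (elim x)
    obtain n where "norm x < real n" using reals_Archimedean2 by blast
    then have "x \<in> ball 0 (real (Suc n))" by simp
    with elim[rule_format, of n] show ?case by simp
  qed
  then show ?thesis by blast
qed

section \<open>Traces\<close>

lemma borel_measurable_vec_lambda:
  fixes f :: "'i::finite \<Rightarrow> 'a \<Rightarrow> real"
  assumes "\<And>i. f i \<in> borel_measurable M"
  shows "(\<lambda>x. \<chi> i. f i x) \<in> borel_measurable M"
  by (subst borel_measurable_euclidean_space) (auto simp: Basis_vec_def inner_axis assms)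

text \<open>Lebesgue measure is identified with a product measure in order to split off the
  coordinate \<open>d\<close>; the remaining factor is the one in
  \<open>plane_measure\<close>.\<close>

lemma lborel_vec: "(lborel :: (real ^ 'n::finite) measure) = distr (Pi\<^sub>M UNIV (\<lambda>_. lborel)) borel (\<lambda>f. \<chi> i. f i)"
proof (rule lborel_eqI)
  interpret product_sigma_finite "\<lambda>_ :: 'n. lborel :: real measure" ..
  let ?P = "Pi\<^sub>M (UNIV :: 'n set) (\<lambda>_. lborel :: real measure)"
  have m: "(\<lambda>f. \<chi> i. f i) \<in> borel_measurable ?P"
    by (rule borel_measurable_vec_lambda) (use measurable_component_singleton[of _ UNIV "\<lambda>_. lborel"] in simp)
  fix l u :: "real ^ 'n" assume le: "\<And>b. b \<in> Basis \<Longrightarrow> l \<bullet> b \<le> u \<bullet> b"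
  have le': "l $ i \<le> u $ i" for i using le[of "axis i 1"] by (auto simp: inner_axis Basis_vec_def)
  have "(\<lambda>f. \<chi> i. f i) -` box l u \<inter> space ?P = Pi\<^sub>E UNIV (\<lambda>i. {l $ i <..< u $ i})"
    by (auto simp: mem_box_cart space_PiM PiE_iff)
  then have "emeasure (distr ?P borel (\<lambda>f. \<chi> i. f i)) (box l u) = emeasure ?P (Pi\<^sub>E UNIV (\<lambda>i. {l $ i <..< u $ i}))"
    using m by (simp add: emeasure_distr)
  also have "\<dots> = (\<Prod>i\<in>UNIV. emeasure lborel {l $ i <..< u $ i})" by (rule emeasure_PiM) auto
  also have "\<dots> = ennreal (\<Prod>i\<in>UNIV. u $ i - l $ i)" using le' by (simp add: prod_ennreal)
  also have "(\<Prod>i\<in>UNIV. u $ i - l $ i) = (\<Prod>b\<in>Basis. (u - l) \<bullet> b)"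
  proof -
    have "Basis = (\<lambda>i. axis i (1::real)) ` (UNIV :: 'n set)" by (auto simp: Basis_vec_def)
    moreover have "inj (\<lambda>i :: 'n. axis i (1::real))" by (auto simp: inj_on_def axis_eq_axis)
    ultimately show ?thesis by (intro prod.reindex_cong[symmetric]) (auto simp: inner_axis)
  qed
  finally show "emeasure (distr ?P borel (\<lambda>f. \<chi> i. f i)) (box l u) = (\<Prod>b\<in>Basis. (u - l) \<bullet> b)" .
qed simp

context
  fixes d :: "'n::finite"
begin

abbreviation (input) "hyper_prod \<equiv> Pi\<^sub>M (UNIV - {d}) (\<lambda>_. lborel :: real measure)"

abbreviation (input) "plane_embed \<equiv> (\<lambda>y :: 'n \<Rightarrow> real. \<chi> i. if i = d then 0 else y i)"

lemma plane_embed_measurable: "plane_embed \<in> borel_measurable hyper_prod"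
proof (rule borel_measurable_vec_lambda)
  fix i show "(\<lambda>y. if i = d then 0 else y i) \<in> borel_measurable hyper_prod"
    using measurable_component_singleton[of i "UNIV - {d}" "\<lambda>_. lborel"] by (cases "i = d") auto
qed

lemma sets_plane_measure [simp, measurable_cong]: "sets (plane_measure d) = sets borel"
  by (simp add: plane_measure_def)

lemma AE_plane_measure: "AE y in plane_measure d. y $ d = 0"
  unfolding plane_measure_def by (subst AE_distr_iff[OF plane_embed_measurable]) auto

lemma plane_measure_ball_finite: "emeasure (plane_measure d) (ball 0 R) < \<infinity>"
proof -
  interpret product_sigma_finite "\<lambda>_ :: 'n. lborel :: real measure" ..
  have "emeasure (plane_measure d) (ball 0 R) = emeasure hyper_prod (plane_embed -` ball 0 R \<inter> space hyper_prod)"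
    unfolding plane_measure_def using plane_embed_measurable by (simp add: emeasure_distr)
  also have "\<dots> \<le> emeasure hyper_prod (Pi\<^sub>E (UNIV - {d}) (\<lambda>_. {- R..R}))"
  proof (rule emeasure_mono)
    show "plane_embed -` ball 0 R \<inter> space hyper_prod \<subseteq> Pi\<^sub>E (UNIV - {d}) (\<lambda>_. {- R..R})"
    proof
      fix y assume y: "y \<in> plane_embed -` ball 0 R \<inter> space hyper_prod"
      have "\<bar>y i\<bar> \<le> R" if "i \<noteq> d" for i
        using y that component_le_norm_cart[of "plane_embed y" i] by auto
      then show "y \<in> Pi\<^sub>E (UNIV - {d}) (\<lambda>_. {- R..R})"
        using y by (auto simp: space_PiM PiE_iff abs_le_iff minus_le_iff)
    qed
    show "Pi\<^sub>E (UNIV - {d}) (\<lambda>_. {- R..R}) \<in> sets hyper_prod" by (rule sets_PiM_I_finite) auto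
  qed
  also have "\<dots> = (\<Prod>i\<in>UNIV - {d}. emeasure lborel {- R..R})" by (rule emeasure_PiM) auto
  also have "\<dots> < \<infinity>" by (simp add: power_less_top_ennreal emeasure_lborel_Icc_eq)
  finally show ?thesis .
qed

lemma integral_plane_slices:
  fixes F :: "real ^ 'n \<Rightarrow> real"
  assumes F: "integrable lborel F"
  shows "(\<integral>x. F x \<partial>lborel) = (\<integral>y. (\<integral>t. F (y + t *\<^sub>R axis d 1) \<partial>lborel) \<partial>plane_measure d)"
proof -
  interpret product_sigma_finite "\<lambda>_ :: 'n. lborel :: real measure" ..
  have [measurable]: "F \<in> borel_measurable borel" using F by simp
  let ?P = "Pi\<^sub>M (UNIV :: 'n set) (\<lambda>_. lborel :: real measure)"
  have m: "(\<lambda>f. \<chi> i. f i) \<in> borel_measurable ?P"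
    by (rule borel_measurable_vec_lambda) (use measurable_component_singleton[of _ UNIV "\<lambda>_. lborel"] in simp)
  have U: "insert d (UNIV - {d}) = UNIV" by auto
  have "integrable (distr ?P borel (\<lambda>f. \<chi> i. f i)) F" using F by (simp flip: lborel_vec)
  then have int: "integrable (Pi\<^sub>M (insert d (UNIV - {d})) (\<lambda>_. lborel)) (\<lambda>f. F (\<chi> i. f i))"
    unfolding U using m by (subst (asm) integrable_distr_eq) auto
  have "(\<integral>x. F x \<partial>lborel) = (\<integral>x. F x \<partial>distr ?P borel (\<lambda>f. \<chi> i. f i))" by (simp flip: lborel_vec)
  also have "\<dots> = (\<integral>f. F (\<chi> i. f i) \<partial>Pi\<^sub>M (insert d (UNIV - {d})) (\<lambda>_. lborel))"
    unfolding U using m by (intro integral_distr) auto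
  also have "\<dots> = (\<integral>y. (\<integral>t. F (\<chi> i. (y(d := t)) i) \<partial>lborel) \<partial>hyper_prod)"
    by (rule product_integral_insert[OF _ _ int]) auto
  also have "\<dots> = (\<integral>y. (\<integral>t. F (plane_embed y + t *\<^sub>R axis d 1) \<partial>lborel) \<partial>hyper_prod)"
  proof -
    have "(\<chi> i. (y(d := t)) i) = plane_embed y + t *\<^sub>R axis d 1" for y t by (auto simp: vec_eq_iff axis_def)
    then show ?thesis by (simp only:)
  qed
  also have "\<dots> = (\<integral>y. (\<integral>t. F (y + t *\<^sub>R axis d 1) \<partial>lborel) \<partial>plane_measure d)"
    unfolding plane_measure_def by (rule integral_distr[symmetric, OF plane_embed_measurable]) measurable
  finally show ?thesis .
qed

text \<open>The fundamental theorem of calculus on every line normal to the plane: one end lies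
  outside the support, the other in the plane, and the outward normal fixes the sign.\<close>

lemma half_space_normal_derivative:
  fixes \<psi> :: "real ^ 'n \<Rightarrow> real"
  assumes \<psi>: "\<psi> \<in> test_functions UNIV" and \<sigma>: "\<sigma> = 1 \<or> \<sigma> = - 1"
  shows "(\<integral>x. indicator (half_space \<sigma> d) x * partial_deriv d \<psi> x \<partial>lborel) = - \<sigma> * (\<integral>y. \<psi> y \<partial>plane_measure d)"
proof -
  note s = test_functions_smooth[OF \<psi>]
  let ?e = "axis d (1::real)"
  obtain R where R: "R > 0" "\<And>x. x \<notin> ball 0 R \<Longrightarrow> \<psi> x = 0" using test_functions_ball[OF \<psi>] by blast
  have [measurable]: "\<psi> \<in> borel_measurable borel" "partial_deriv d \<psi> \<in> borel_measurable borel"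
    by (auto intro: smooth_borel_measurable smooth_partial_deriv s)
  have int: "integrable lborel (\<lambda>x. indicator (half_space \<sigma> d) x * partial_deriv d \<psi> x)"
    using test_integrable_mult[OF indicator_smooth_Lp_loc[OF smooth_const[of 1]] test_functions_partial_deriv[OF \<psi>]] by simp
  have slice: "(\<integral>t. indicator (half_space \<sigma> d) (y + t *\<^sub>R ?e) * partial_deriv d \<psi> (y + t *\<^sub>R ?e) \<partial>lborel) = - \<sigma> * \<psi> y"
    if y: "y $ d = 0" for y
  proof -
    let ?f = "\<lambda>t. partial_deriv d \<psi> (y + t *\<^sub>R ?e)"
    have comp: "(y + t *\<^sub>R ?e) $ d = t" for t using y by (simp add: axis_def)
    have out: "y + t *\<^sub>R ?e \<notin> ball 0 R" if "\<bar>t\<bar> \<ge> R" for t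
      using component_le_norm_cart[of "y + t *\<^sub>R ?e" d] that unfolding comp by auto
    have f0: "?f t = 0" if "\<bar>t\<bar> > R" for t
    proof (rule partial_deriv_eq_0[of "cball 0 R"])
      show "y + t *\<^sub>R ?e \<notin> cball 0 R"
        using component_le_norm_cart[of "y + t *\<^sub>R ?e" d] that unfolding comp by auto
    qed (use R(2) in auto)
    have der: "((\<lambda>t. \<psi> (y + t *\<^sub>R ?e)) has_real_derivative ?f t) (at t)" for t
      using has_real_derivative_along[OF s, of y ?e t] by (simp add: grad_axis)
    have cont: "isCont ?f t" for t
    proof -
      have "continuous_on UNIV ?f"
        by (intro continuous_on_compose2[OF smooth_continuous_on[OF smooth_partial_deriv[OF s]]])
          (auto intro!: continuous_intros)
      then show ?thesis by (simp add: continuous_on_eq_continuous_at)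
    qed
    have FTC: "(\<integral>t. ?f t * indicator {a..b} t \<partial>lborel) = \<psi> (y + b *\<^sub>R ?e) - \<psi> (y + a *\<^sub>R ?e)" if "a \<le> b" for a b
      by (rule integral_FTC_Icc_real[OF that der cont])
    have AE0: "AE t in lborel. t \<noteq> (0::real)" by (rule AE_lborel_singleton)
    have m [measurable]: "?f \<in> borel_measurable borel" by measurable
    from \<sigma> show ?thesis
    proof
      assume \<sigma>1: "\<sigma> = 1"
      have "(\<integral>t. indicator (half_space \<sigma> d) (y + t *\<^sub>R ?e) * ?f t \<partial>lborel) = (\<integral>t. ?f t * indicator {0..R} t \<partial>lborel)"
      proof (rule integral_cong_AE)
        show "AE t in lborel. indicator (half_space \<sigma> d) (y + t *\<^sub>R ?e) * ?f t = ?f t * indicator {0..R} t"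
          using AE0
        proof eventually_elim
          case (elim t)
          then show ?case using f0[of t] R(1) unfolding \<sigma>1 half_space_def indicator_def comp mem_Collect_eq
            by (cases "t > R") auto
        qed
      qed measurable
      also have "\<dots> = - \<sigma> * \<psi> y" using FTC[of 0 R] R(1) R(2)[OF out[of R]] by (simp add: \<sigma>1)
      finally show ?thesis .
    next
      assume \<sigma>1: "\<sigma> = - 1"
      have "(\<integral>t. indicator (half_space \<sigma> d) (y + t *\<^sub>R ?e) * ?f t \<partial>lborel) = (\<integral>t. ?f t * indicator {- R..0} t \<partial>lborel)"
      proof (rule integral_cong_AE)
        show "AE t in lborel. indicator (half_space \<sigma> d) (y + t *\<^sub>R ?e) * ?f t = ?f t * indicator {- R..0} t"
          using AE0
        proof eventually_elim
          case (elim t)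
          then show ?case using f0[of t] R(1) unfolding \<sigma>1 half_space_def indicator_def comp mem_Collect_eq
            by (cases "t < - R") auto
        qed
      qed measurable
      also have "\<dots> = - \<sigma> * \<psi> y" using FTC[of "- R" 0] R(1) R(2)[OF out[of "- R"]] by (simp add: \<sigma>1)
      finally show ?thesis .
    qed
  qed
  have "(\<integral>x. indicator (half_space \<sigma> d) x * partial_deriv d \<psi> x \<partial>lborel) =
      (\<integral>y. (\<integral>t. indicator (half_space \<sigma> d) (y + t *\<^sub>R ?e) * partial_deriv d \<psi> (y + t *\<^sub>R ?e) \<partial>lborel) \<partial>plane_measure d)"
    by (rule integral_plane_slices[OF int])
  also have "\<dots> = (\<integral>y. - \<sigma> * \<psi> y \<partial>plane_measure d)"
  proof (rule integral_cong_AE)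
    show "AE y in plane_measure d. (\<integral>t. indicator (half_space \<sigma> d) (y + t *\<^sub>R ?e) * partial_deriv d \<psi> (y + t *\<^sub>R ?e) \<partial>lborel) = - \<sigma> * \<psi> y"
      using AE_plane_measure by eventually_elim (rule slice)
  qed measurable
  also have "\<dots> = - \<sigma> * (\<integral>y. \<psi> y \<partial>plane_measure d)" by (rule integral_mult_right_zero)
  finally show ?thesis .
qed

lemma restrict_plane_integral:
  fixes f :: "real ^ 'n \<Rightarrow> real"
  assumes "\<And>x. x \<notin> ball 0 R \<Longrightarrow> f x = 0"
  shows "(\<integral>y. f y \<partial>restrict_space (plane_measure d) (ball 0 R)) = (\<integral>y. f y \<partial>plane_measure d)"
  using assms by (subst integral_restrict_space)
    (auto intro!: Bochner_Integration.integral_cong split: split_indicator)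

lemma test_Lp_restrict_plane:
  fixes \<phi> :: "real ^ 'n \<Rightarrow> real"
  assumes "\<phi> \<in> test_functions G" "p \<ge> 0"
  shows "\<phi> \<in> Lp p (restrict_space (plane_measure d) (ball 0 R))"
proof (rule LpI)
  obtain M where M: "M > 0" "\<And>x. \<bar>\<phi> x\<bar> \<le> M" using test_functions_bounded[OF assms(1)] by blast
  have [measurable]: "\<phi> \<in> borel_measurable borel" by (rule smooth_borel_measurable[OF test_functions_smooth[OF assms(1)]])
  show m: "\<phi> \<in> borel_measurable (restrict_space (plane_measure d) (ball 0 R))"
    by (rule measurable_restrict_space1) measurable
  have "finite_measure (restrict_space (plane_measure d) (ball 0 R))"
    using plane_measure_ball_finite[of R]
    by (intro finite_measureI) (simp add: emeasure_restrict_space space_restrict_space)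
  then interpret finite_measure "restrict_space (plane_measure d) (ball 0 R)" .
  show "integrable (restrict_space (plane_measure d) (ball 0 R)) (\<lambda>x. norm (\<phi> x) powr p)"
    by (rule integrable_const_bound[where B="M powr p"]) (use m M assms(2) in \<open>auto intro!: powr_mono2\<close>)
qed

lemma has_trace_integrable:
  assumes tr: "has_trace q d G v b" and q: "q > 1" and \<phi>: "\<phi> \<in> test_functions UNIV"
  shows "integrable (plane_measure d) (\<lambda>y. b y * \<phi> y)"
proof -
  obtain R where R: "R > 0" "\<And>x. x \<notin> ball 0 R \<Longrightarrow> \<phi> x = 0" using test_functions_ball[OF \<phi>] by blast
  have p: "q / (q - 1) \<ge> 0" using q by simp
  have "b \<in> Lp q (restrict_space (plane_measure d) (ball 0 R))"
    using tr R(1) unfolding has_trace_def Lp_tendsto_def by blast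
  from Holder_inner(1)[OF q this test_Lp_restrict_plane[OF \<phi> p]]
  have "integrable (plane_measure d) (\<lambda>y. indicator (ball 0 R) y *\<^sub>R (b y * \<phi> y))"
    by (subst (asm) integrable_restrict_space) auto
  also have "(\<lambda>y. indicator (ball 0 R) y *\<^sub>R (b y * \<phi> y)) = (\<lambda>y. b y * \<phi> y)"
    using R(2) by (intro ext) (auto split: split_indicator)
  finally show ?thesis .
qed

text \<open>The identity holds for the smooth approximants in the definition of the trace and passes
  to the limit, since each of its three terms is a pairing continuous under one of the three
  convergences there.\<close>

lemma trace_by_parts:
  assumes tr: "has_trace q d (half_space \<sigma> d) v b" and q: "q > 1" and \<sigma>: "\<sigma> = 1 \<or> \<sigma> = - 1"
    and wg: "is_weak_grad (half_space \<sigma> d) v g" and \<phi>: "\<phi> \<in> test_functions UNIV"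
    and gL: "(\<lambda>x. indicator (half_space \<sigma> d) x *\<^sub>R g x) \<in> Lp_loc 1 UNIV"
  shows "(\<integral>x. indicator (half_space \<sigma> d) x * v x * partial_deriv d \<phi> x \<partial>lborel) =
    - (\<integral>x. indicator (half_space \<sigma> d) x * g x $ d * \<phi> x \<partial>lborel) - \<sigma> * (\<integral>y. b y * \<phi> y \<partial>plane_measure d)"
proof -
  let ?H = "half_space \<sigma> d"
  define p where "p = q / (q - 1)"
  have p: "p \<ge> 0" using q by (simp add: p_def)
  obtain R0 where R0: "R0 > 0" "\<And>x. x \<notin> ball 0 R0 \<Longrightarrow> \<phi> x = 0" using test_functions_ball[OF \<phi>] by blast
  \<comment> \<open>The derivative of \<open>\<phi>\<close> is known to vanish outside a closed ball
    of radius \<open>R0\<close>; the enlarged radius puts it into an open ball, as in the definition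
    of the trace.\<close>
  define R where "R = R0 + 1"
  have R: "R > 0" "\<And>x. x \<notin> ball 0 R \<Longrightarrow> \<phi> x = 0" "\<And>x. x \<notin> ball 0 R \<Longrightarrow> partial_deriv d \<phi> x = 0"
  proof -
    show "R > 0" using R0 by (simp add: R_def)
    show "\<phi> x = 0" if "x \<notin> ball 0 R" for x using that R0 by (auto simp: R_def)
    show "partial_deriv d \<phi> x = 0" if "x \<notin> ball 0 R" for x
      by (rule partial_deriv_eq_0[of "cball 0 R0"]) (use R0 that in \<open>auto simp: R_def\<close>)
  qed
  obtain g0 w where g0: "is_weak_grad ?H v g0" and ws: "\<And>n. smooth (w n)"
    and lims: "\<And>R. R > 0 \<Longrightarrow> Lp_tendsto q (lborel_on (?H \<inter> ball 0 R)) w v \<and>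
      Lp_tendsto q (lborel_on (?H \<inter> ball 0 R)) (\<lambda>n. grad (w n)) g0 \<and>
      Lp_tendsto q (restrict_space (plane_measure d) (ball 0 R)) w b"
    using tr unfolding has_trace_def by metis
  let ?M = "lborel_on (?H \<inter> ball 0 R)" and ?N = "restrict_space (plane_measure d) (ball 0 R)"
  have B: "?H \<inter> ball 0 R \<in> sets borel" by simp
  have toM: "(\<integral>x. f x \<partial>?M) = (\<integral>x. indicator ?H x * f x \<partial>lborel)" if "\<And>x. x \<notin> ball 0 R \<Longrightarrow> f x = 0" for f :: "real ^ 'n \<Rightarrow> real"
    using that by (subst integral_restrict_space)
      (auto intro!: Bochner_Integration.integral_cong split: split_indicator)
  have LM: "f \<in> Lp p ?M" if "f \<in> Lp p lborel" for f :: "real ^ 'n \<Rightarrow> 'b::euclidean_space"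
    unfolding Lp_lborel_on_iff[OF B] using that p
    by (intro Lp_scaleR_bounded[where C=1]) (auto intro!: borel_measurable_indicator)
  have \<phi>e: "(\<lambda>x. \<phi> x *\<^sub>R axis d 1 :: real ^ 'n) \<in> Lp p lborel"
    by (rule Lp_mono[OF test_Lp[OF \<phi> p], where C=1])
      (use p Lp_measurable[OF test_Lp[OF \<phi> p]] in \<open>auto simp: norm_axis_1\<close>)
  have l1: "(\<lambda>n. \<integral>x. w n x * partial_deriv d \<phi> x \<partial>?M) \<longlonglongrightarrow> (\<integral>x. v x * partial_deriv d \<phi> x \<partial>?M)"
    using Lp_inner_tendsto[OF q, of w ?M v "partial_deriv d \<phi>"] lims[OF R(1)]
      LM[OF test_Lp[OF test_functions_partial_deriv[OF \<phi>] p]] by (simp add: Lp_tendsto_def p_def)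
  have l2: "(\<lambda>n. \<integral>x. partial_deriv d (w n) x * \<phi> x \<partial>?M) \<longlonglongrightarrow> (\<integral>x. g0 x $ d * \<phi> x \<partial>?M)"
    using Lp_inner_tendsto[OF q, of "\<lambda>n. grad (w n)" ?M g0 "\<lambda>x. \<phi> x *\<^sub>R axis d 1"] lims[OF R(1)] LM[OF \<phi>e]
    by (simp add: Lp_tendsto_def p_def inner_axis grad_nth mult.commute)
  have l3: "(\<lambda>n. \<integral>y. w n y * \<phi> y \<partial>?N) \<longlonglongrightarrow> (\<integral>y. b y * \<phi> y \<partial>?N)"
    using Lp_inner_tendsto[OF q, of w ?N b \<phi>] lims[OF R(1)] test_Lp_restrict_plane[OF \<phi> p]
    by (simp add: Lp_tendsto_def p_def)
  have id: "(\<integral>x. w n x * partial_deriv d \<phi> x \<partial>?M) + (\<integral>x. partial_deriv d (w n) x * \<phi> x \<partial>?M) = - \<sigma> * (\<integral>y. w n y * \<phi> y \<partial>?N)" for n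
  proof -
    note \<psi> = test_functions_mult[OF \<phi> ws[of n]]
    have i1: "integrable lborel (\<lambda>x. indicator ?H x * w n x * partial_deriv d \<phi> x)"
      by (intro test_integrable_mult[OF indicator_smooth_Lp_loc[OF ws half_space_borel, where G=UNIV]] test_functions_partial_deriv \<phi>)
    have i2: "integrable lborel (\<lambda>x. indicator ?H x * partial_deriv d (w n) x * \<phi> x)"
      by (intro test_integrable_mult[OF indicator_smooth_Lp_loc[OF smooth_partial_deriv[OF ws] half_space_borel, where G=UNIV]] \<phi>)
    have "(\<integral>x. indicator ?H x * partial_deriv d (\<lambda>x. \<phi> x * w n x) x \<partial>lborel) = - \<sigma> * (\<integral>y. \<phi> y * w n y \<partial>plane_measure d)"
      by (rule half_space_normal_derivative[OF \<psi> \<sigma>])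
    also have "(\<integral>x. indicator ?H x * partial_deriv d (\<lambda>x. \<phi> x * w n x) x \<partial>lborel) =
        (\<integral>x. indicator ?H x * w n x * partial_deriv d \<phi> x + indicator ?H x * partial_deriv d (w n) x * \<phi> x \<partial>lborel)"
      by (subst smooth_partial_mult[OF test_functions_smooth[OF \<phi>] ws])
        (auto intro!: Bochner_Integration.integral_cong simp: algebra_simps)
    also have "\<dots> = (\<integral>x. w n x * partial_deriv d \<phi> x \<partial>?M) + (\<integral>x. partial_deriv d (w n) x * \<phi> x \<partial>?M)"
    proof -
      have "(\<integral>x. w n x * partial_deriv d \<phi> x \<partial>?M) = (\<integral>x. indicator ?H x * (w n x * partial_deriv d \<phi> x) \<partial>lborel)"
        by (rule toM) (use R(3) in simp)
      moreover have "(\<integral>x. partial_deriv d (w n) x * \<phi> x \<partial>?M) = (\<integral>x. indicator ?H x * (partial_deriv d (w n) x * \<phi> x) \<partial>lborel)"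
        by (rule toM) (use R(2) in simp)
      ultimately show ?thesis using i1 i2 by (simp add: mult.assoc)
    qed
    also have "(\<integral>y. \<phi> y * w n y \<partial>plane_measure d) = (\<integral>y. w n y * \<phi> y \<partial>?N)"
      using R(2) by (subst restrict_plane_integral) (auto simp: mult.commute)
    finally show ?thesis .
  qed
  have "(\<integral>x. v x * partial_deriv d \<phi> x \<partial>?M) + (\<integral>x. g0 x $ d * \<phi> x \<partial>?M) = - \<sigma> * (\<integral>y. b y * \<phi> y \<partial>?N)"
    by (rule LIMSEQ_unique[OF tendsto_add[OF l1 l2]]) (unfold id, intro tendsto_intros l3)
  moreover have "(\<integral>x. v x * partial_deriv d \<phi> x \<partial>?M) = (\<integral>x. indicator ?H x * v x * partial_deriv d \<phi> x \<partial>lborel)"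
    using R(3) by (subst toM) (auto simp: mult.assoc)
  \<comment> \<open>The gradient \<open>g0\<close> from the definition of the trace is only some
    weak gradient; it agrees with \<open>g\<close> almost everywhere in the half space.\<close>
  moreover have "(\<integral>x. g0 x $ d * \<phi> x \<partial>?M) = (\<integral>x. indicator ?H x * g x $ d * \<phi> x \<partial>lborel)"
  proof -
    have g0H: "(\<lambda>x. indicator ?H x *\<^sub>R g0 x) \<in> borel_measurable borel"
      by (rule Lp_loc_measurable[OF is_weak_gradD(2)[OF g0 half_space_borel] open_half_space])
    have mg: "(\<lambda>x. (indicator ?H x *\<^sub>R g0 x) $ d * \<phi> x) \<in> borel_measurable borel"
      "(\<lambda>x. (indicator ?H x *\<^sub>R g x) $ d * \<phi> x) \<in> borel_measurable borel"
      using borel_measurable_vec_component[OF g0H] borel_measurable_vec_component[OF Lp_loc_UNIV_measurable[OF gL]]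
        smooth_borel_measurable[OF test_functions_smooth[OF \<phi>]] by (intro borel_measurable_times; blast)+
    have "(\<integral>x. g0 x $ d * \<phi> x \<partial>?M) = (\<integral>x. indicator ?H x * (g0 x $ d * \<phi> x) \<partial>lborel)" using R(2) by (subst toM) auto
    also have "\<dots> = (\<integral>x. indicator ?H x * g x $ d * \<phi> x \<partial>lborel)"
    proof (rule integral_cong_AE)
      show "AE x in lborel. indicator ?H x * (g0 x $ d * \<phi> x) = indicator ?H x * g x $ d * \<phi> x"
        using is_weak_grad_unique[OF g0 wg open_half_space] by (auto simp: indicator_def elim: eventually_mono)
    qed (use mg in \<open>simp_all add: mult.assoc\<close>)
    finally show ?thesis .
  qed
  moreover have "(\<integral>y. b y * \<phi> y \<partial>?N) = (\<integral>y. b y * \<phi> y \<partial>plane_measure d)"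
    using R(2) by (intro restrict_plane_integral) auto
  ultimately show ?thesis by simp
qed

end

section \<open>Existence\<close>

lemma indicator_Lp_imp_Lp_loc:
  fixes g :: "real ^ 'n::finite \<Rightarrow> 'b::euclidean_space"
  assumes "g \<in> Lp q (lborel_on H)" "H \<in> sets borel" "q \<ge> 1"
  shows "(\<lambda>x. indicator H x *\<^sub>R g x) \<in> Lp_loc 1 UNIV"
  using assms by (intro Lp_imp_Lp_loc_UNIV[of _ q]) (simp_all add: Lp_lborel_on_iff)

text \<open>Integrability up to the boundary, as in the definition of \<open>hat_H1\<close>, is what
  makes the extension by 0 locally integrable across the plane.\<close>

lemma indicator_Lp_loc_closure:
  fixes v :: "real ^ 'n::finite \<Rightarrow> 'b::euclidean_space"
  assumes v: "v \<in> Lp_loc_closure q H" and H: "H \<in> sets borel" and K: "compact K"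
  shows "(\<lambda>x. indicator K x *\<^sub>R (indicator H x *\<^sub>R v x)) \<in> Lp q lborel"
proof -
  have "compact (K \<inter> closure H)" using K by (intro compact_Int_closed) auto
  then have "v \<in> Lp q (lborel_on (K \<inter> closure H \<inter> H))"
    using v unfolding Lp_loc_closure_def by blast
  moreover have "K \<inter> closure H \<inter> H = K \<inter> H" using closure_subset by blast
  ultimately have "(\<lambda>x. indicator (K \<inter> H) x *\<^sub>R v x) \<in> Lp q lborel"
    using H borel_compact[OF K] by (simp add: Lp_lborel_on_iff)
  then show ?thesis by (simp add: indicator_inter_arith)
qed

lemma indicator_Lp_loc_closure_imp_Lp_loc:
  fixes v :: "real ^ 'n::finite \<Rightarrow> 'b::euclidean_space"
  assumes "v \<in> Lp_loc_closure q H" "H \<in> sets borel" "q \<ge> 1"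
  shows "(\<lambda>x. indicator H x *\<^sub>R v x) \<in> Lp_loc 1 UNIV"
proof (rule Lp_loc_1I)
  fix K :: "(real ^ 'n) set" assume K: "compact K"
  have "(\<lambda>x. indicator K x *\<^sub>R (indicator H x *\<^sub>R v x)) \<in> Lp_loc 1 UNIV"
    by (rule Lp_imp_Lp_loc_UNIV[OF indicator_Lp_loc_closure[OF assms(1,2) K] assms(3)])
  from Lp_loc_integrable[OF this K]
  have "integrable lborel (\<lambda>x. indicator K x *\<^sub>R (indicator K x *\<^sub>R (indicator H x *\<^sub>R v x)))" by simp
  also have "(\<lambda>x. indicator K x *\<^sub>R (indicator K x *\<^sub>R (indicator H x *\<^sub>R v x))) = (\<lambda>x. indicator K x *\<^sub>R (indicator H x *\<^sub>R v x))"
    by (intro ext) (auto split: split_indicator)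
  finally show "integrable lborel (\<lambda>x. indicator K x *\<^sub>R (indicator H x *\<^sub>R v x))" .
qed

lemma hat_H1_weak_grad:
  fixes v :: "real ^ 'n::finite \<Rightarrow> real"
  assumes "v \<in> hat_H1 q G" "open G"
  shows "is_weak_grad G v (weak_grad G v)" "weak_grad G v \<in> Lp q (lborel_on G)" "v \<in> Lp_loc_closure q G"
proof -
  obtain g where g: "is_weak_grad G v g" "g \<in> Lp q (lborel_on G)" "v \<in> Lp_loc_closure q G"
    using assms(1) by (auto simp: hat_H1_def)
  show "is_weak_grad G v (weak_grad G v)" "weak_grad G v \<in> Lp q (lborel_on G)" "v \<in> Lp_loc_closure q G"
    using is_weak_grad_weak_grad[OF g(1)] weak_grad_Lp[OF g(1) assms(2) g(2)] g(3) by auto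
qed

text \<open>\<open>hat_H2\<close> speaks of some weak gradient with components in
  \<open>hat_H1\<close>, \<open>weak_hess\<close> of the selected one; both agree almost everywhere,
  so the selected one inherits the regularity.\<close>

lemma hat_H2_weak_hess:
  fixes v :: "real ^ 'n::finite \<Rightarrow> real"
  assumes "v \<in> hat_H2 q G" "open G"
  shows "is_weak_grad G (\<lambda>y. weak_grad G v y $ i) (weak_grad G (\<lambda>y. weak_grad G v y $ i))"
    "weak_grad G (\<lambda>y. weak_grad G v y $ i) \<in> Lp q (lborel_on G)"
proof -
  obtain g where g: "is_weak_grad G v g" "\<And>i. (\<lambda>x. g x $ i) \<in> hat_H1 q G"
    using assms(1) by (auto simp: hat_H2_def)
  obtain h where h: "is_weak_grad G (\<lambda>x. g x $ i) h" "h \<in> Lp q (lborel_on G)"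
    using g(2)[of i] by (auto simp: hat_H1_def)
  have G: "G \<in> sets borel" using assms(2) by simp
  note wg = is_weak_grad_weak_grad[OF g(1)]
  have wh: "is_weak_grad G (\<lambda>y. weak_grad G v y $ i) h"
  proof (rule is_weak_grad_cong[OF h(1) G])
    show "(\<lambda>y. weak_grad G v y $ i) \<in> Lp_loc 1 G" by (intro Lp_loc_component is_weak_gradD(2)[OF wg G]) simp
    show "h \<in> Lp_loc 1 G" by (rule is_weak_gradD(2)[OF h(1) G])
    show "AE x in lborel. x \<in> G \<longrightarrow> weak_grad G v x $ i = g x $ i"
      using weak_grad_AE_eq[OF g(1) assms(2)] by eventually_elim auto
  qed simp
  show "is_weak_grad G (\<lambda>y. weak_grad G v y $ i) (weak_grad G (\<lambda>y. weak_grad G v y $ i))"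
    by (rule is_weak_grad_weak_grad[OF wh])
  show "weak_grad G (\<lambda>y. weak_grad G v y $ i) \<in> Lp q (lborel_on G)"
    by (rule weak_grad_Lp(1)[OF wh assms(2) h(2)])
qed

section \<open>Smooth data for the strong problem\<close>

definition classical_div :: "(real ^ 'n::finite \<Rightarrow> real ^ 'n) \<Rightarrow> real ^ 'n \<Rightarrow> real" where
  "classical_div f x = (\<Sum>i\<in>UNIV. partial_deriv i (\<lambda>x. f x $ i) x)"

lemma is_weak_div_classical:
  fixes f :: "real ^ 'n::finite \<Rightarrow> real ^ 'n"
  assumes f: "\<And>i. (\<lambda>x. f x $ i) \<in> test_functions U" and G: "G \<in> sets borel"
  shows "is_weak_div G f (classical_div f)"
  unfolding is_weak_div_def
proof (intro conjI ballI)
  have f': "(\<lambda>x. f x $ i) \<in> test_functions UNIV" for i using test_functions_mono[OF f] by blast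
  have ft: "f \<in> Lp 1 lborel" by (rule Lp_componentI) (auto intro: test_Lp[OF f'])
  show "f \<in> Lp_loc 1 G" by (rule Lp_loc_subset[OF Lp_imp_Lp_loc_UNIV[OF ft]]) auto
  have "classical_div f \<in> Lp 1 lborel"
    unfolding classical_div_def[abs_def] by (intro Lp_sum test_Lp[OF test_functions_partial_deriv[OF f']]) auto
  then show "classical_div f \<in> Lp_loc 1 G" by (intro Lp_loc_subset[OF Lp_imp_Lp_loc_UNIV]) auto
  fix \<phi> :: "real ^ 'n \<Rightarrow> real" assume \<phi>G: "\<phi> \<in> test_functions G"
  then have \<phi>: "\<phi> \<in> test_functions UNIV" by (rule test_functions_mono) simp
  have z: "\<phi> x = 0" "grad \<phi> x = 0" if "x \<notin> G" for x
    using test_functions_zero_outside[OF \<phi>G that] test_functions_zero_outside[OF test_functions_partial_deriv[OF \<phi>G] that]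
    by (auto simp: vec_eq_iff grad_nth)
  have wg: "is_weak_grad UNIV (\<lambda>x. f x $ i) (grad (\<lambda>x. f x $ i))" for i
    by (rule is_weak_grad_smooth[OF test_functions_smooth[OF f']]) simp
  note D = is_weak_gradD[OF wg, simplified]
  have i1: "integrable lborel (\<lambda>x. f x $ i * partial_deriv i \<phi> x)" for i
    by (rule test_integrable_mult[OF D(1) test_functions_partial_deriv[OF \<phi>]])
  have i2: "integrable lborel (\<lambda>x. partial_deriv i (\<lambda>x. f x $ i) x * \<phi> x)" for i
    by (rule test_integrable_mult[OF smooth_Lp_loc[OF smooth_partial_deriv[OF test_functions_smooth[OF f']]] \<phi>])
  have "(\<integral>x. f x \<bullet> grad \<phi> x \<partial>lborel_on G) = (\<integral>x. f x \<bullet> grad \<phi> x \<partial>lborel)"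
    using z by (intro integral_lborel_on_eq G) auto
  also have "\<dots> = (\<Sum>i\<in>UNIV. \<integral>x. f x $ i * partial_deriv i \<phi> x \<partial>lborel)"
    using i1 by (simp add: inner_vec_def grad_nth)
  also have "\<dots> = - (\<Sum>i\<in>UNIV. \<integral>x. partial_deriv i (\<lambda>x. f x $ i) x * \<phi> x \<partial>lborel)"
    using D(3)[OF \<phi>] by (simp add: grad_nth sum_negf)
  also have "(\<Sum>i\<in>UNIV. \<integral>x. partial_deriv i (\<lambda>x. f x $ i) x * \<phi> x \<partial>lborel) = (\<integral>x. classical_div f x * \<phi> x \<partial>lborel)"
    using i2 by (simp add: classical_div_def sum_distrib_right)
  also have "\<dots> = (\<integral>x. classical_div f x * \<phi> x \<partial>lborel_on G)"
    using z by (intro integral_lborel_on_eq[symmetric] G) auto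
  finally show "(\<integral>x. f x \<bullet> grad \<phi> x \<partial>lborel_on G) = - (\<integral>x. classical_div f x * \<phi> x \<partial>lborel_on G)" .
qed

lemma is_weak_div_unique:
  fixes f :: "real ^ 'n::finite \<Rightarrow> real ^ 'n"
  assumes "is_weak_div G f g" "is_weak_div G f g'" "open G"
  shows "AE x in lborel. x \<in> G \<longrightarrow> g x = g' x"
proof (rule fundamental_lemma_eq[OF _ _ assms(3)])
  fix \<phi> assume \<phi>: "\<phi> \<in> test_functions G"
  have eq: "(\<integral>x. h x * \<phi> x \<partial>lborel_on G) = (\<integral>x. h x * \<phi> x \<partial>lborel)" for h
    using test_functions_zero_outside[OF \<phi>] assms(3) by (intro integral_lborel_on_eq) auto
  show "(\<integral>x. g x * \<phi> x \<partial>lborel) = (\<integral>x. g' x * \<phi> x \<partial>lborel)"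
    using bspec[OF conjunct2[OF conjunct2[OF assms(1)[unfolded is_weak_div_def]]] \<phi>]
      bspec[OF conjunct2[OF conjunct2[OF assms(2)[unfolded is_weak_div_def]]] \<phi>] eq[of g] eq[of g'] by linarith
qed (use assms in \<open>auto simp: is_weak_div_def\<close>)

lemma weak_div_AE_eq:
  fixes f :: "real ^ 'n::finite \<Rightarrow> real ^ 'n"
  assumes "is_weak_div G f g" "open G"
  shows "AE x in lborel. x \<in> G \<longrightarrow> weak_div G f x = g x"
proof -
  have "is_weak_div G f (weak_div G f)" unfolding weak_div_def by (rule someI[of "is_weak_div G f", OF assms(1)])
  from is_weak_div_unique[OF this assms] show ?thesis .
qed

lemma test_F_space:
  fixes f :: "real ^ 'n::finite \<Rightarrow> real ^ 'n"
  assumes f: "\<And>i. (\<lambda>x. f x $ i) \<in> test_functions U" and G: "G \<in> sets borel" and q: "q \<ge> 1"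
  shows "f \<in> F_space q d G"
proof -
  have on: "h \<in> Lp q (lborel_on G)" if "h \<in> Lp q lborel" for h :: "real ^ 'n \<Rightarrow> 'b::euclidean_space"
    by (rule Lp_lborel_on_subset[of _ q UNIV]) (use that G q in \<open>auto simp: Lp_lborel_on_iff\<close>)
  have "f \<in> Lp q lborel" by (rule Lp_componentI) (use q in \<open>auto intro: test_Lp[OF f]\<close>)
  moreover have "classical_div f \<in> Lp q lborel"
    unfolding classical_div_def[abs_def] using q by (intro Lp_sum test_Lp[OF test_functions_partial_deriv[OF f]]) auto
  ultimately have "f \<in> E_space q G"
    unfolding E_space_def using is_weak_div_classical[where f=f, OF f G] by (auto intro: on)
  moreover have "(\<lambda>x. f x $ d) \<in> H1 q G"
    unfolding H1_def mem_Collect_eq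
    by (intro conjI exI[of _ "grad (\<lambda>x. f x $ d)"] on test_Lp[OF f] grad_test_Lp[OF f]
        is_weak_grad_smooth[OF test_functions_smooth[OF f] G]) (use q in auto)
  ultimately show ?thesis by (simp add: F_space_def)
qed

text \<open>The divergence is integrated by parts componentwise; only the normal component produces a
  boundary term.\<close>

lemma Green_half_space:
  fixes V :: "real ^ 'n::finite \<Rightarrow> real ^ 'n" and h :: "'n \<Rightarrow> real ^ 'n \<Rightarrow> real ^ 'n"
  assumes q: "q > 1" and \<sigma>: "\<sigma> = 1 \<or> \<sigma> = - 1"
    and V: "V \<in> Lp q (lborel_on (half_space \<sigma> d))"
    and h: "\<And>i. is_weak_grad (half_space \<sigma> d) (\<lambda>x. V x $ i) (h i)" "\<And>i. h i \<in> Lp q (lborel_on (half_space \<sigma> d))"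
    and tr: "has_trace q d (half_space \<sigma> d) (\<lambda>x. V x $ d) a" and \<phi>: "\<phi> \<in> test_functions UNIV"
  shows "(\<integral>x. indicator (half_space \<sigma> d) x * (V x \<bullet> grad \<phi> x) \<partial>lborel) =
    - (\<integral>x. indicator (half_space \<sigma> d) x * (\<Sum>i\<in>UNIV. h i x $ i) * \<phi> x \<partial>lborel) - \<sigma> * (\<integral>y. a y * \<phi> y \<partial>plane_measure d)"
proof -
  let ?H = "half_space \<sigma> d"
  have q1: "q \<ge> 1" using q by simp
  note hL = indicator_Lp_imp_Lp_loc[OF h(2) half_space_borel q1]
  note VL = indicator_Lp_imp_Lp_loc[OF V half_space_borel q1]
  have VLi: "(\<lambda>x. indicator ?H x *\<^sub>R V x $ i) \<in> Lp_loc 1 UNIV" for i using Lp_loc_component[OF VL, of i] by simp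
  have i1: "integrable lborel (\<lambda>x. indicator ?H x * V x $ i * partial_deriv i \<phi> x)" for i
    using test_integrable_mult[OF VLi test_functions_partial_deriv[OF \<phi>], of i i] by simp
  have i2: "integrable lborel (\<lambda>x. indicator ?H x * h i x $ i * \<phi> x)" for i
    using test_integrable_mult[OF Lp_loc_component[OF hL, of i i] \<phi>] by simp
  let ?b = "\<integral>y. a y * \<phi> y \<partial>plane_measure d"
  have part: "(\<integral>x. indicator ?H x * V x $ i * partial_deriv i \<phi> x \<partial>lborel) =
      - (\<integral>x. indicator ?H x * h i x $ i * \<phi> x \<partial>lborel) - (if i = d then \<sigma> * ?b else 0)" for i
  proof (cases "i = d")
    case True
    then show ?thesis using trace_by_parts[OF tr q \<sigma> h(1) \<phi> hL] by simp
  next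
    case False
    have "\<bar>\<sigma>\<bar> = 1" using \<sigma> by auto
    from half_space_by_parts[OF this h(1) VLi hL \<phi>, of i i] False show ?thesis by simp
  qed
  have "(\<integral>x. indicator ?H x * (V x \<bullet> grad \<phi> x) \<partial>lborel) = (\<integral>x. (\<Sum>i\<in>UNIV. indicator ?H x * V x $ i * partial_deriv i \<phi> x) \<partial>lborel)"
    by (simp only: inner_vec_def grad_nth sum_distrib_left mult.assoc inner_real_def)
  also have "\<dots> = (\<Sum>i\<in>UNIV. \<integral>x. indicator ?H x * V x $ i * partial_deriv i \<phi> x \<partial>lborel)" using i1 by simp
  also have "\<dots> = - (\<Sum>i\<in>UNIV. \<integral>x. indicator ?H x * h i x $ i * \<phi> x \<partial>lborel) - \<sigma> * ?b"
    unfolding part by (simp add: sum_subtractf sum_negf)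
  also have "(\<Sum>i\<in>UNIV. \<integral>x. indicator ?H x * h i x $ i * \<phi> x \<partial>lborel) =
      (\<integral>x. indicator ?H x * (\<Sum>i\<in>UNIV. h i x $ i) * \<phi> x \<partial>lborel)"
    unfolding sum_distrib_left sum_distrib_right by (rule Bochner_Integration.integral_sum[symmetric, OF i2])
  finally show ?thesis .
qed

text \<open>Green's formula is used for the gradient of \<open>v\<close> and for \<open>f\<close>
  with the same test function; by the differential equation the volume terms agree, so only the
  boundary terms can differ.\<close>

lemma one_sided_solution:
  fixes v :: "real ^ 'n::finite \<Rightarrow> real" and f :: "real ^ 'n \<Rightarrow> real ^ 'n"
  assumes q: "q > 1" and \<sigma>: "\<sigma> = 1 \<or> \<sigma> = - 1"
    and v: "v \<in> hat_H1 q (half_space \<sigma> d) \<inter> hat_H2 q (half_space \<sigma> d)"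
    and eq: "AE x in lborel_on (half_space \<sigma> d). weak_laplace (half_space \<sigma> d) v x = weak_div (half_space \<sigma> d) f x"
    and a: "has_trace q d (half_space \<sigma> d) (\<lambda>x. weak_grad (half_space \<sigma> d) v x $ d) a"
    and c: "has_trace q d (half_space \<sigma> d) (\<lambda>x. f x $ d) c"
    and f: "\<And>i. (\<lambda>x. f x $ i) \<in> test_functions U" and \<phi>: "\<phi> \<in> test_functions UNIV"
  shows "(\<integral>x. indicator (half_space \<sigma> d) x * (weak_grad (half_space \<sigma> d) v x \<bullet> grad \<phi> x) \<partial>lborel) + \<sigma> * (\<integral>y. a y * \<phi> y \<partial>plane_measure d) =
    (\<integral>x. indicator (half_space \<sigma> d) x * (f x \<bullet> grad \<phi> x) \<partial>lborel) + \<sigma> * (\<integral>y. c y * \<phi> y \<partial>plane_measure d)"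
proof -
  let ?H = "half_space \<sigma> d"
  have q0: "q \<ge> 0" "q \<ge> 1" using q by auto
  have on: "h \<in> Lp q (lborel_on ?H)" if "h \<in> Lp q lborel" for h :: "real ^ 'n \<Rightarrow> 'b::euclidean_space"
    by (rule Lp_lborel_on_subset[of _ q UNIV]) (use that q0 in \<open>auto simp: Lp_lborel_on_iff\<close>)
  have fL: "f \<in> Lp q lborel" by (rule Lp_componentI) (use q0 in \<open>auto intro: test_Lp[OF f]\<close>)
  let ?h = "\<lambda>i. weak_grad ?H (\<lambda>y. weak_grad ?H v y $ i)"
  have v1: "v \<in> hat_H1 q ?H" "v \<in> hat_H2 q ?H" using v by auto
  note hess = hat_H2_weak_hess[OF v1(2) open_half_space]
  have G1: "(\<integral>x. indicator ?H x * (weak_grad ?H v x \<bullet> grad \<phi> x) \<partial>lborel) =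
      - (\<integral>x. indicator ?H x * (\<Sum>i\<in>UNIV. ?h i x $ i) * \<phi> x \<partial>lborel) - \<sigma> * (\<integral>y. a y * \<phi> y \<partial>plane_measure d)"
    by (rule Green_half_space[OF q \<sigma> hat_H1_weak_grad(2)[OF v1(1) open_half_space] hess a \<phi>])
  have G2: "(\<integral>x. indicator ?H x * (f x \<bullet> grad \<phi> x) \<partial>lborel) =
      - (\<integral>x. indicator ?H x * (\<Sum>i\<in>UNIV. grad (\<lambda>x. f x $ i) x $ i) * \<phi> x \<partial>lborel) - \<sigma> * (\<integral>y. c y * \<phi> y \<partial>plane_measure d)"
    by (rule Green_half_space[OF q \<sigma> on[OF fL] is_weak_grad_smooth[OF test_functions_smooth[OF f] half_space_borel]
          on[OF grad_test_Lp[OF f q0(1)]] c \<phi>])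
  have "(\<integral>x. indicator ?H x * (\<Sum>i\<in>UNIV. ?h i x $ i) * \<phi> x \<partial>lborel) =
      (\<integral>x. indicator ?H x * (\<Sum>i\<in>UNIV. grad (\<lambda>x. f x $ i) x $ i) * \<phi> x \<partial>lborel)"
  proof (rule integral_cong_AE)
    have \<phi>m [measurable]: "\<phi> \<in> borel_measurable borel" by (rule smooth_borel_measurable[OF test_functions_smooth[OF \<phi>]])
    have "(\<lambda>x. (indicator ?H x *\<^sub>R ?h i x) $ i) \<in> borel_measurable borel" for i
      by (intro borel_measurable_vec_component Lp_loc_UNIV_measurable indicator_Lp_imp_Lp_loc[OF hess(2) half_space_borel q0(2)])
    then have "(\<lambda>x. (\<Sum>i\<in>UNIV. (indicator ?H x *\<^sub>R ?h i x) $ i) * \<phi> x) \<in> borel_measurable borel" by measurable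
    then show "(\<lambda>x. indicator ?H x * (\<Sum>i\<in>UNIV. ?h i x $ i) * \<phi> x) \<in> borel_measurable lborel"
      by (simp only: sum_distrib_left vector_scaleR_component real_scaleR_def measurable_lborel2)
    have [measurable]: "partial_deriv i (\<lambda>x. f x $ i) \<in> borel_measurable borel" for i
      by (intro smooth_borel_measurable smooth_partial_deriv test_functions_smooth[OF f])
    show "(\<lambda>x. indicator ?H x * (\<Sum>i\<in>UNIV. grad (\<lambda>x. f x $ i) x $ i) * \<phi> x) \<in> borel_measurable lborel"
      unfolding grad_nth by measurable
    have lap: "AE x in lborel. x \<in> ?H \<longrightarrow> weak_laplace ?H v x = weak_div ?H f x"
      using eq by (subst (asm) AE_lborel_on_iff) auto
    show "AE x in lborel. indicator ?H x * (\<Sum>i\<in>UNIV. ?h i x $ i) * \<phi> x =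
        indicator ?H x * (\<Sum>i\<in>UNIV. grad (\<lambda>x. f x $ i) x $ i) * \<phi> x"
      using lap weak_div_AE_eq[OF is_weak_div_classical[where f=f and G="?H", OF f half_space_borel] open_half_space]
    proof eventually_elim
      case (elim x)
      have "(\<Sum>i\<in>UNIV. ?h i x $ i) = (\<Sum>i\<in>UNIV. grad (\<lambda>x. f x $ i) x $ i)" if "x \<in> ?H"
        using elim that by (simp add: weak_laplace_def weak_hess_def classical_div_def grad_nth)
      then show ?case by (auto simp: indicator_def)
    qed
  qed
  with G1 G2 show ?thesis by simp
qed

text \<open>Gluing multiplies the gradients by \<open>\<rho>p\<close> and \<open>\<rho>m\<close>, at
  a cost of at most \<open>\<rho>p + \<rho>m\<close>; the 2 arises because the strong estimate
  contains the norms of \<open>f\<close> on both half spaces, each at most the full norm.\<close>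

lemma smooth_data_solution:
  fixes d :: "'n::finite" and f :: "real ^ 'n \<Rightarrow> real ^ 'n"
  assumes C: "transmission_constant q d \<rho>p \<rho>m C" and q: "q > 1" and \<rho>: "\<rho>p > 0" "\<rho>m > 0"
    and f: "\<And>i. (\<lambda>x. f x $ i) \<in> test_functions (UNIV - plane d)"
  obtains u G where "u \<in> hat_H1 q UNIV" "is_weak_grad UNIV u G" "G \<in> Lp q lborel"
    "\<And>\<phi>. \<phi> \<in> test_functions UNIV \<Longrightarrow>
      (\<integral>x. (phase_weight d (inverse \<rho>p) (inverse \<rho>m) x *\<^sub>R G x - f x) \<bullet> grad \<phi> x \<partial>lborel) = 0"
    "Lp_norm q lborel G \<le> 2 * C * (\<rho>p + \<rho>m) * Lp_norm q lborel f"
proof -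
  let ?U = "half_space 1 d" and ?L = "half_space (- 1) d"
  have q1: "q \<ge> 1" "q \<ge> 0" "q > 0" using q by auto
  have "f \<in> F_space q d (upper_half d)" "f \<in> F_space q d (lower_half d)"
    unfolding upper_half_eq lower_half_eq using q by (auto intro!: test_F_space[where f=f, OF f])
  then obtain vp vm where sol: "transmission_solution q d \<rho>p \<rho>m f f vp vm"
    and bound: "Lq_norm q ?U (weak_grad ?U vp) + Lq_norm q ?L (weak_grad ?L vm) \<le> C * (Lq_norm q ?U f + Lq_norm q ?L f)"
    using C unfolding transmission_constant_def upper_half_eq lower_half_eq by blast
  have C0: "C > 0" using C by (simp add: transmission_constant_def)
  have vp: "vp \<in> hat_H1 q ?U \<inter> hat_H2 q ?U" and vm: "vm \<in> hat_H1 q ?L \<inter> hat_H2 q ?L"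
    and eqp: "AE x in lborel_on ?U. weak_laplace ?U vp x = weak_div ?U f x"
    and eqm: "AE x in lborel_on ?L. weak_laplace ?L vm x = weak_div ?L f x"
    using sol unfolding transmission_solution_def upper_half_eq lower_half_eq by auto
  obtain bp bm where b: "has_trace q d ?U vp bp" "has_trace q d ?L vm bm" "AE x in plane_measure d. \<rho>p * bp x = \<rho>m * bm x"
    using sol unfolding transmission_solution_def upper_half_eq lower_half_eq by blast
  obtain ap am cp cm where a: "has_trace q d ?U (\<lambda>x. weak_grad ?U vp x $ d) ap" "has_trace q d ?L (\<lambda>x. weak_grad ?L vm x $ d) am"
    and c: "has_trace q d ?U (\<lambda>x. f x $ d) cp" "has_trace q d ?L (\<lambda>x. f x $ d) cm"
    and jump: "AE x in plane_measure d. ap x - am x = cp x - cm x"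
    using sol unfolding transmission_solution_def upper_half_eq lower_half_eq by blast
  let ?gp = "weak_grad ?U vp" and ?gm = "weak_grad ?L vm"
  have vp': "vp \<in> hat_H1 q ?U" and vm': "vm \<in> hat_H1 q ?L" using vp vm by auto
  note Hp = hat_H1_weak_grad[OF vp' open_half_space] and Hm = hat_H1_weak_grad[OF vm' open_half_space]
  have gpL: "(\<lambda>x. indicator ?U x *\<^sub>R ?gp x) \<in> Lp q lborel" and gmL: "(\<lambda>x. indicator ?L x *\<^sub>R ?gm x) \<in> Lp q lborel"
    using Hp(2) Hm(2) by (simp_all add: Lp_lborel_on_iff)
  define G where "G x = \<rho>p *\<^sub>R (indicator ?U x *\<^sub>R ?gp x) + \<rho>m *\<^sub>R (indicator ?L x *\<^sub>R ?gm x)" for x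
  define u where "u x = \<rho>p * (indicator ?U x * vp x) + \<rho>m * (indicator ?L x * vm x)" for x
  have GL: "G \<in> Lp q lborel" unfolding G_def using q1 by (intro Lp_add Lp_scaleR gpL gmL)
  note loc = indicator_Lp_loc_closure_imp_Lp_loc[OF _ half_space_borel q1(1)]
  note vpl = loc[OF Hp(3)] and vml = loc[OF Hm(3)]
  note gpl = indicator_Lp_imp_Lp_loc[OF Hp(2) half_space_borel q1(1)] and gml = indicator_Lp_imp_Lp_loc[OF Hm(2) half_space_borel q1(1)]
  have uK: "(\<lambda>x. indicator K x *\<^sub>R u x) \<in> Lp q lborel" if K: "compact K" for K
  proof -
    have "(\<lambda>x. \<rho>p *\<^sub>R (indicator K x *\<^sub>R (indicator ?U x *\<^sub>R vp x)) + \<rho>m *\<^sub>R (indicator K x *\<^sub>R (indicator ?L x *\<^sub>R vm x))) \<in> Lp q lborel"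
      using q1 by (intro Lp_add Lp_scaleR indicator_Lp_loc_closure[OF Hp(3) half_space_borel K] indicator_Lp_loc_closure[OF Hm(3) half_space_borel K])
    then show ?thesis by (simp add: u_def algebra_simps)
  qed
  have wg: "is_weak_grad UNIV u G"
  proof (subst is_weak_grad_iff, simp, intro conjI ballI allI)
    show "u \<in> Lp_loc 1 UNIV"
      using Lp_loc_add[OF Lp_loc_scaleR[OF vpl, of \<rho>p] Lp_loc_scaleR[OF vml, of \<rho>m]] by (simp add: u_def[abs_def])
    show "G \<in> Lp_loc 1 UNIV" by (rule Lp_imp_Lp_loc_UNIV[OF GL q1(1)])
    fix \<psi> :: "real ^ 'n \<Rightarrow> real" and i assume \<psi>: "\<psi> \<in> test_functions UNIV"
    let ?b = "\<lambda>b. \<integral>y. b y * \<psi> y \<partial>plane_measure d"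
    have j1: "integrable lborel (\<lambda>x. indicator ?U x * vp x * partial_deriv i \<psi> x)" "integrable lborel (\<lambda>x. indicator ?L x * vm x * partial_deriv i \<psi> x)"
      using test_integrable_mult[OF vpl test_functions_partial_deriv[OF \<psi>, of i]] test_integrable_mult[OF vml test_functions_partial_deriv[OF \<psi>, of i]] by simp_all
    have j2: "integrable lborel (\<lambda>x. indicator ?U x * ?gp x $ i * \<psi> x)" "integrable lborel (\<lambda>x. indicator ?L x * ?gm x $ i * \<psi> x)"
      using test_integrable_mult[OF Lp_loc_component[OF gpl, of i] \<psi>] test_integrable_mult[OF Lp_loc_component[OF gml, of i] \<psi>] by simp_all
    \<comment> \<open>Only the normal derivative has boundary terms; the two half spaces have
      opposite outward normals, so these terms cancel by
      \<open>\<rho>p * bp x = \<rho>m * bm x\<close>.\<close>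
    have key: "\<rho>p * (\<integral>x. indicator ?U x * vp x * partial_deriv i \<psi> x \<partial>lborel) + \<rho>m * (\<integral>x. indicator ?L x * vm x * partial_deriv i \<psi> x \<partial>lborel) =
       - (\<rho>p * (\<integral>x. indicator ?U x * ?gp x $ i * \<psi> x \<partial>lborel) + \<rho>m * (\<integral>x. indicator ?L x * ?gm x $ i * \<psi> x \<partial>lborel))"
    proof (cases "i = d")
      case True
      have "(\<integral>y. \<rho>p * (bp y * \<psi> y) \<partial>plane_measure d) = (\<integral>y. \<rho>m * (bm y * \<psi> y) \<partial>plane_measure d)"
      proof (rule integral_cong_AE)
        show "AE y in plane_measure d. \<rho>p * (bp y * \<psi> y) = \<rho>m * (bm y * \<psi> y)"
          using b(3) by eventually_elim (metis mult.assoc)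
        show "(\<lambda>y. \<rho>p * (bp y * \<psi> y)) \<in> borel_measurable (plane_measure d)" "(\<lambda>y. \<rho>m * (bm y * \<psi> y)) \<in> borel_measurable (plane_measure d)"
          using borel_measurable_integrable[OF has_trace_integrable[OF b(1) q \<psi>]] borel_measurable_integrable[OF has_trace_integrable[OF b(2) q \<psi>]]
          by (auto intro: borel_measurable_times)
      qed
      then have beq: "\<rho>p * ?b bp = \<rho>m * ?b bm" by simp
      have tp: "(\<integral>x. indicator ?U x * vp x * partial_deriv d \<psi> x \<partial>lborel) = - (\<integral>x. indicator ?U x * ?gp x $ d * \<psi> x \<partial>lborel) - ?b bp"
        using trace_by_parts[OF b(1) q _ Hp(1) \<psi> gpl] by simp
      have tm: "(\<integral>x. indicator ?L x * vm x * partial_deriv d \<psi> x \<partial>lborel) = - (\<integral>x. indicator ?L x * ?gm x $ d * \<psi> x \<partial>lborel) + ?b bm"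
        using trace_by_parts[OF b(2) q _ Hm(1) \<psi> gml] by simp
      show ?thesis unfolding True tp tm using beq by (simp add: algebra_simps)
    next
      case False
      show ?thesis
        using half_space_by_parts[OF _ Hp(1) vpl gpl \<psi>, of i] half_space_by_parts[OF _ Hm(1) vml gml \<psi>, of i] False by simp
    qed
    have "(\<integral>x. u x * partial_deriv i \<psi> x \<partial>lborel) =
        (\<integral>x. \<rho>p * (indicator ?U x * vp x * partial_deriv i \<psi> x) + \<rho>m * (indicator ?L x * vm x * partial_deriv i \<psi> x) \<partial>lborel)"
      by (simp add: u_def algebra_simps)
    also have "\<dots> = \<rho>p * (\<integral>x. indicator ?U x * vp x * partial_deriv i \<psi> x \<partial>lborel) + \<rho>m * (\<integral>x. indicator ?L x * vm x * partial_deriv i \<psi> x \<partial>lborel)"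
      using j1 by simp
    also note key
    also have "\<rho>p * (\<integral>x. indicator ?U x * ?gp x $ i * \<psi> x \<partial>lborel) + \<rho>m * (\<integral>x. indicator ?L x * ?gm x $ i * \<psi> x \<partial>lborel) =
        (\<integral>x. \<rho>p * (indicator ?U x * ?gp x $ i * \<psi> x) + \<rho>m * (indicator ?L x * ?gm x $ i * \<psi> x) \<partial>lborel)"
      using j2 by simp
    also have "\<dots> = (\<integral>x. G x $ i * \<psi> x \<partial>lborel)" by (simp add: G_def algebra_simps)
    finally show "(\<integral>x. u x * partial_deriv i \<psi> x \<partial>lborel) = - (\<integral>x. G x $ i * \<psi> x \<partial>lborel)" .
  qed
  have uH: "u \<in> hat_H1 q UNIV" unfolding hat_H1_UNIV_iff using uK wg GL by blast
  have fL: "f \<in> Lp q lborel" by (rule Lp_componentI) (use q1 in \<open>auto intro: test_Lp[OF f]\<close>)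
  have fon: "Lp_norm q (lborel_on H) f \<le> Lp_norm q lborel f" if "H \<in> sets borel" for H
    unfolding Lp_norm_lborel_on[OF that]
  proof (rule Lp_norm_mono[OF fL])
    show "(\<lambda>x. indicator H x *\<^sub>R f x) \<in> borel_measurable lborel"
      using that Lp_measurable[OF fL] by (intro borel_measurable_scaleR borel_measurable_indicator) auto
  qed (use q1 in \<open>auto simp: indicator_def\<close>)
  \<comment> \<open>The inverse weight undoes the factors \<open>\<rho>p\<close> and
    \<open>\<rho>m\<close>, so the weak equation is one for the gradients of \<open>vp\<close> and
    \<open>vm\<close> alone.\<close>
  have weight: "phase_weight d (inverse \<rho>p) (inverse \<rho>m) x *\<^sub>R G x = indicator ?U x *\<^sub>R ?gp x + indicator ?L x *\<^sub>R ?gm x" for x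
  proof -
    have "\<not> (x \<in> ?U \<and> x \<in> ?L)" by (auto simp: half_space_def)
    then show ?thesis using \<rho> by (auto simp: phase_weight_def G_def indicator_def)
  qed
  show ?thesis
  proof (rule that[OF uH wg GL])
    fix \<phi> :: "real ^ 'n \<Rightarrow> real" assume \<phi>: "\<phi> \<in> test_functions UNIV"
    note gL = grad_test_Lp[OF \<phi>, of "q / (q - 1)"]
    have p0: "q / (q - 1) \<ge> 0" using q by simp
    have k1: "integrable lborel (\<lambda>x. indicator ?U x * (?gp x \<bullet> grad \<phi> x))" "integrable lborel (\<lambda>x. indicator ?L x * (?gm x \<bullet> grad \<phi> x))"
      using Holder_inner(1)[OF q gpL gL[OF p0]] Holder_inner(1)[OF q gmL gL[OF p0]] by simp_all
    have k2: "integrable lborel (\<lambda>x. f x \<bullet> grad \<phi> x)" by (rule Holder_inner(1)[OF q fL gL[OF p0]])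
    have k3: "integrable lborel (\<lambda>x. indicator H x * (f x \<bullet> grad \<phi> x))" if "H \<in> sets borel" for H
      using integrable_mult_indicator[OF _ k2, of H] that by simp
    let ?b = "\<lambda>b. \<integral>y. b y * \<phi> y \<partial>plane_measure d"
    note T = has_trace_integrable[OF _ q \<phi>]
    have "(\<integral>y. ap y * \<phi> y - am y * \<phi> y \<partial>plane_measure d) = (\<integral>y. cp y * \<phi> y - cm y * \<phi> y \<partial>plane_measure d)"
    proof (rule integral_cong_AE)
      show "AE y in plane_measure d. ap y * \<phi> y - am y * \<phi> y = cp y * \<phi> y - cm y * \<phi> y"
        using jump by eventually_elim (simp flip: left_diff_distrib)
    qed (use T[OF a(1)] T[OF a(2)] T[OF c(1)] T[OF c(2)] in auto)
    \<comment> \<open>When the two one-sided identities are added, the boundary terms enter only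
      through these jumps.\<close>
    then have jmp: "?b ap - ?b am = ?b cp - ?b cm" using T[OF a(1)] T[OF a(2)] T[OF c(1)] T[OF c(2)] by simp
    have Sp: "(\<integral>x. indicator ?U x * (?gp x \<bullet> grad \<phi> x) \<partial>lborel) + ?b ap = (\<integral>x. indicator ?U x * (f x \<bullet> grad \<phi> x) \<partial>lborel) + ?b cp"
      using one_sided_solution[OF q _ vp eqp a(1) c(1) f \<phi>] by simp
    have Sm: "(\<integral>x. indicator ?L x * (?gm x \<bullet> grad \<phi> x) \<partial>lborel) - ?b am = (\<integral>x. indicator ?L x * (f x \<bullet> grad \<phi> x) \<partial>lborel) - ?b cm"
      using one_sided_solution[OF q _ vm eqm a(2) c(2) f \<phi>] by simp
    have "(\<integral>x. f x \<bullet> grad \<phi> x \<partial>lborel) = (\<integral>x. indicator ?U x * (f x \<bullet> grad \<phi> x) + indicator ?L x * (f x \<bullet> grad \<phi> x) \<partial>lborel)"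
    proof (rule integral_cong_AE)
      show "AE x in lborel. f x \<bullet> grad \<phi> x = indicator ?U x * (f x \<bullet> grad \<phi> x) + indicator ?L x * (f x \<bullet> grad \<phi> x)"
        using AE_not_plane[of d] by eventually_elim (auto simp: half_space_def indicator_def)
    qed (use k2 k3[of ?U] k3[of ?L] in auto)
    also have "\<dots> = (\<integral>x. indicator ?U x * (f x \<bullet> grad \<phi> x) \<partial>lborel) + (\<integral>x. indicator ?L x * (f x \<bullet> grad \<phi> x) \<partial>lborel)"
      using k3 by simp
    finally have fs: "(\<integral>x. f x \<bullet> grad \<phi> x \<partial>lborel) = (\<integral>x. indicator ?U x * (?gp x \<bullet> grad \<phi> x) \<partial>lborel) + (\<integral>x. indicator ?L x * (?gm x \<bullet> grad \<phi> x) \<partial>lborel)"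
      using Sp Sm jmp by linarith
    have "(\<integral>x. (phase_weight d (inverse \<rho>p) (inverse \<rho>m) x *\<^sub>R G x - f x) \<bullet> grad \<phi> x \<partial>lborel) =
      (\<integral>x. indicator ?U x * (?gp x \<bullet> grad \<phi> x) + indicator ?L x * (?gm x \<bullet> grad \<phi> x) - f x \<bullet> grad \<phi> x \<partial>lborel)"
      unfolding weight by (simp add: inner_diff_left inner_add_left)
    also have "\<dots> = 0" using k1 k2 fs by simp
    finally show "(\<integral>x. (phase_weight d (inverse \<rho>p) (inverse \<rho>m) x *\<^sub>R G x - f x) \<bullet> grad \<phi> x \<partial>lborel) = 0" .
  next
    let ?np = "Lp_norm q lborel (\<lambda>x. indicator ?U x *\<^sub>R ?gp x)" and ?nm = "Lp_norm q lborel (\<lambda>x. indicator ?L x *\<^sub>R ?gm x)"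
    have n0: "?np \<ge> 0" "?nm \<ge> 0" by (simp_all add: Lp_norm_nonneg)
    have "Lp_norm q lborel G \<le> Lp_norm q lborel (\<lambda>x. \<rho>p *\<^sub>R (indicator ?U x *\<^sub>R ?gp x)) + Lp_norm q lborel (\<lambda>x. \<rho>m *\<^sub>R (indicator ?L x *\<^sub>R ?gm x))"
      unfolding G_def using q1 by (intro Minkowski Lp_scaleR gpL gmL)
    also have "\<dots> = \<rho>p * ?np + \<rho>m * ?nm" using \<rho> q1 by (simp only: Lp_norm_scaleR abs_of_pos)
    also have "\<dots> \<le> (\<rho>p + \<rho>m) * (?np + ?nm)" using \<rho> n0 by (simp add: algebra_simps)
    also have "\<dots> \<le> (\<rho>p + \<rho>m) * (C * (Lp_norm q lborel f + Lp_norm q lborel f))"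
    proof (rule mult_left_mono)
      have "?np + ?nm \<le> C * (Lq_norm q ?U f + Lq_norm q ?L f)"
        using bound by (simp add: Lp_norm_lborel_on[symmetric])
      also have "\<dots> \<le> C * (Lp_norm q lborel f + Lp_norm q lborel f)"
        using C0 by (intro mult_left_mono add_mono fon) auto
      finally show "?np + ?nm \<le> C * (Lp_norm q lborel f + Lp_norm q lborel f)" .
    qed (use \<rho> in simp)
    finally show "Lp_norm q lborel G \<le> 2 * C * (\<rho>p + \<rho>m) * Lp_norm q lborel f" by (simp add: algebra_simps)
  qed
qed

text \<open>By uniqueness, \<open>G2 - G1\<close> is the gradient that the strong problem yields for the datum \<open>f2 - f1\<close>.\<close>

lemma smooth_data_estimate:
  fixes d :: "'n::finite" and f1 f2 :: "real ^ 'n \<Rightarrow> real ^ 'n"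
  assumes C: "transmission_constant q d \<rho>p \<rho>m C" and q: "q > 1" and \<rho>: "\<rho>p > 0" "\<rho>m > 0"
    and f: "\<And>i. (\<lambda>x. f1 x $ i) \<in> test_functions (UNIV - plane d)" "\<And>i. (\<lambda>x. f2 x $ i) \<in> test_functions (UNIV - plane d)"
    and wg: "is_weak_grad UNIV u1 G1" "is_weak_grad UNIV u2 G2" and G: "G1 \<in> Lp q lborel" "G2 \<in> Lp q lborel"
    and sol: "\<And>\<psi>. \<psi> \<in> test_functions UNIV \<Longrightarrow> (\<integral>x. (phase_weight d (inverse \<rho>p) (inverse \<rho>m) x *\<^sub>R G1 x - f1 x) \<bullet> grad \<psi> x \<partial>lborel) = 0"
      "\<And>\<psi>. \<psi> \<in> test_functions UNIV \<Longrightarrow> (\<integral>x. (phase_weight d (inverse \<rho>p) (inverse \<rho>m) x *\<^sub>R G2 x - f2 x) \<bullet> grad \<psi> x \<partial>lborel) = 0"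
  shows "Lp_norm q lborel (\<lambda>x. G2 x - G1 x) \<le> 2 * C * (\<rho>p + \<rho>m) * Lp_norm q lborel (\<lambda>x. f2 x - f1 x)"
proof -
  let ?r = "phase_weight d (inverse \<rho>p) (inverse \<rho>m)"
  have q0: "q \<ge> 0" "q \<ge> 1" "q / (q - 1) \<ge> 0" using q by auto
  have fd: "(\<lambda>x. (f2 x - f1 x) $ i) \<in> test_functions (UNIV - plane d)" for i
    using test_functions_diff[OF f(2) f(1), of i i] by simp
  obtain u G where "u \<in> hat_H1 q UNIV" and wg': "is_weak_grad UNIV u G" and G': "G \<in> Lp q lborel"
    and sol': "\<And>\<phi>. \<phi> \<in> test_functions UNIV \<Longrightarrow> (\<integral>x. (?r x *\<^sub>R G x - (f2 x - f1 x)) \<bullet> grad \<phi> x \<partial>lborel) = 0"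
    and bound: "Lp_norm q lborel G \<le> 2 * C * (\<rho>p + \<rho>m) * Lp_norm q lborel (\<lambda>x. f2 x - f1 x)"
    by (rule smooth_data_solution[where f = "\<lambda>x. f2 x - f1 x", OF C q \<rho> fd]) (rule that; assumption)
  have fL: "f1 \<in> Lp q lborel" "f2 \<in> Lp q lborel"
    using q0 by (auto intro!: Lp_componentI intro: test_Lp[OF f(1)] test_Lp[OF f(2)])
  let ?g = "\<lambda>x. G2 x - G1 x - G x"
  have gL: "?g \<in> Lp q lborel" by (intro Lp_diff G G' q0)
  \<comment> \<open>The difference solves the homogeneous equation for smooth test functions at
    first; uniqueness asks for all of \<open>hat_H1\<close>, which the extension lemma
    provides.\<close>
  have "AE x in lborel. ?g x = 0"
  proof (rule two_phase_unique[OF q \<rho> is_weak_grad_diff[OF is_weak_grad_diff[OF wg(2,1)] wg'] gL])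
    fix \<phi> :: "real ^ 'n \<Rightarrow> real" and W
    assume \<phi>: "\<phi> \<in> hat_H1 (q / (q - 1)) UNIV" "is_weak_grad UNIV \<phi> W" "W \<in> Lp (q / (q - 1)) lborel"
    show "(\<integral>x. (?r x *\<^sub>R ?g x) \<bullet> W x \<partial>lborel) = 0"
    proof (rule weak_solution_extend[OF q phase_weight_Lp[OF gL q0(1)] _ \<phi>])
      fix \<psi> :: "real ^ 'n \<Rightarrow> real" assume \<psi>: "\<psi> \<in> test_functions UNIV"
      have int: "integrable lborel (\<lambda>x. F x \<bullet> grad \<psi> x)" if "F \<in> Lp q lborel" for F
        by (rule Holder_inner(1)[OF q that grad_test_Lp[OF \<psi> q0(3)]])
      have i: "integrable lborel (\<lambda>x. (?r x *\<^sub>R G1 x - f1 x) \<bullet> grad \<psi> x)"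
        "integrable lborel (\<lambda>x. (?r x *\<^sub>R G2 x - f2 x) \<bullet> grad \<psi> x)"
        "integrable lborel (\<lambda>x. (?r x *\<^sub>R G x - (f2 x - f1 x)) \<bullet> grad \<psi> x)"
        by (intro int Lp_diff phase_weight_Lp G G' fL q0)+
      have "(\<integral>x. (?r x *\<^sub>R ?g x) \<bullet> grad \<psi> x \<partial>lborel) =
        (\<integral>x. (?r x *\<^sub>R G2 x - f2 x) \<bullet> grad \<psi> x - (?r x *\<^sub>R G1 x - f1 x) \<bullet> grad \<psi> x -
          (?r x *\<^sub>R G x - (f2 x - f1 x)) \<bullet> grad \<psi> x \<partial>lborel)"
        by (rule Bochner_Integration.integral_cong[OF refl]) (simp add: scaleR_diff_right inner_diff_left)
      also have "\<dots> = 0"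
        unfolding Bochner_Integration.integral_diff[OF Bochner_Integration.integrable_diff[OF i(2,1)] i(3)]
          Bochner_Integration.integral_diff[OF i(2,1)] sol(1)[OF \<psi>] sol(2)[OF \<psi>] sol'[OF \<psi>] by simp
      finally show "(\<integral>x. (?r x *\<^sub>R ?g x) \<bullet> grad \<psi> x \<partial>lborel) = 0" .
    qed
  qed auto
  then have "Lp_norm q lborel (\<lambda>x. G2 x - G1 x) = Lp_norm q lborel G"
    using G G' by (intro Lp_norm_cong_AE Lp_measurable[OF Lp_diff[OF G(2,1) q0(1)]] Lp_measurable[OF G']) (auto elim: eventually_mono)
  with bound show ?thesis by simp
qed

text \<open>Equation and bound are continuous in \<open>Lp\<close> and pass to the limit. The limit
  of the gradients is again a gradient because \<open>hat_H1\<close> is closed under convergence of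
  gradients.\<close>

lemma weak_solution_exists:
  fixes d :: "'n::finite" and f :: "real ^ 'n \<Rightarrow> real ^ 'n"
  assumes C: "transmission_constant q d \<rho>p \<rho>m C" and q: "q > 1" and \<rho>: "\<rho>p > 0" "\<rho>m > 0"
    and f: "f \<in> Lp q lborel" and plane: "\<And>x. x \<in> plane d \<Longrightarrow> f x = 0"
  obtains u G where "u \<in> hat_H1 q UNIV" "is_weak_grad UNIV u G" "G \<in> Lp q lborel"
    "\<And>\<phi> W. \<phi> \<in> hat_H1 (q / (q - 1)) UNIV \<Longrightarrow> is_weak_grad UNIV \<phi> W \<Longrightarrow> W \<in> Lp (q / (q - 1)) lborel \<Longrightarrow>
      (\<integral>x. (phase_weight d (inverse \<rho>p) (inverse \<rho>m) x *\<^sub>R G x - f x) \<bullet> W x \<partial>lborel) = 0"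
    "Lp_norm q lborel G \<le> 2 * C * (\<rho>p + \<rho>m) * Lp_norm q lborel f"
proof -
  let ?r = "phase_weight d (inverse \<rho>p) (inverse \<rho>m)" and ?K = "2 * C * (\<rho>p + \<rho>m)"
  have q0: "q \<ge> 0" "q \<ge> 1" "q > 0" using q by auto
  have K0: "?K \<ge> 0" using C \<rho> by (simp add: transmission_constant_def)
  have op: "open (UNIV - plane d)"
  proof -
    have "UNIV - plane d = {x. x $ d < 0} \<union> {x. 0 < x $ d}" by (auto simp: plane_def)
    moreover have "open {x :: real ^ 'n. x $ d < 0}" "open {x :: real ^ 'n. 0 < x $ d}"
      by (auto intro!: open_Collect_less continuous_intros)
    ultimately show ?thesis by (simp add: open_Un)
  qed
  obtain F where F: "\<And>n i. (\<lambda>x. F n x $ i) \<in> test_functions (UNIV - plane d)"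
    and F0: "(\<lambda>n::nat. Lp_norm q lborel (\<lambda>x. f x - F n x)) \<longlonglongrightarrow> 0"
    using test_functions_dense[OF q0(2) op f] plane by auto
  \<comment> \<open>The geometric rate is handed on to the chosen gradients, as
    \<open>Lp_complete_fast\<close> needs it.\<close>
  have "\<exists>m. Lp_norm q lborel (\<lambda>x. f x - F m x) < (1 / 2) ^ n" for n
    using eventually_happens[OF order_tendstoD(2)[OF F0, of "(1 / 2) ^ n"]] by auto
  then obtain N where N: "\<And>n. Lp_norm q lborel (\<lambda>x. f x - F (N n) x) < (1 / 2) ^ n" by metis
  have FL: "F n \<in> Lp q lborel" for n by (rule Lp_componentI) (use q0 in \<open>auto intro: test_Lp[OF F]\<close>)
  \<comment> \<open>One predicate for all properties, so that a function and its gradient are chosen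
    together for each \<open>n\<close>.\<close>
  define P where "P n u G \<longleftrightarrow> u \<in> hat_H1 q UNIV \<and> is_weak_grad UNIV u G \<and> G \<in> Lp q lborel \<and>
      (\<forall>\<phi>. \<phi> \<in> test_functions UNIV \<longrightarrow> (\<integral>x. (?r x *\<^sub>R G x - F n x) \<bullet> grad \<phi> x \<partial>lborel) = 0) \<and>
      Lp_norm q lborel G \<le> ?K * Lp_norm q lborel (F n)" for n u G
  have "\<exists>u G. P n u G" for n
  proof (rule smooth_data_solution[where f = "F n", OF C q \<rho> F])
    fix u G
    assume *: "u \<in> hat_H1 q UNIV" "is_weak_grad UNIV u G" "G \<in> Lp q lborel"
      "\<And>\<phi>. \<phi> \<in> test_functions UNIV \<Longrightarrow> (\<integral>x. (?r x *\<^sub>R G x - F n x) \<bullet> grad \<phi> x \<partial>lborel) = 0"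
      "Lp_norm q lborel G \<le> ?K * Lp_norm q lborel (F n)"
    show ?thesis unfolding P_def by (intro exI[of _ u] exI[of _ G] conjI allI impI *)
  qed
  then obtain u g where P: "\<And>n. P n (u n) (g n)" by metis
  then have u: "\<And>n. u n \<in> hat_H1 q UNIV" and wg: "\<And>n. is_weak_grad UNIV (u n) (g n)" and g: "\<And>n. g n \<in> Lp q lborel"
    and sol: "\<And>n \<phi>. \<phi> \<in> test_functions UNIV \<Longrightarrow> (\<integral>x. (?r x *\<^sub>R g n x - F n x) \<bullet> grad \<phi> x \<partial>lborel) = 0"
    and bound: "\<And>n. Lp_norm q lborel (g n) \<le> ?K * Lp_norm q lborel (F n)"
    unfolding P_def by simp_all
  have comm: "Lp_norm q lborel (\<lambda>x. a x - b x) = Lp_norm q lborel (\<lambda>x. b x - a x)" for a b :: "real ^ 'n \<Rightarrow> real ^ 'n"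
    by (simp add: Lp_norm_def norm_minus_commute)
  have fast: "Lp_norm q lborel (\<lambda>x. g (N (Suc n)) x - g (N n) x) \<le> (?K * 2) * (1 / 2) ^ n" for n
  proof -
    have "Lp_norm q lborel (\<lambda>x. g (N (Suc n)) x - g (N n) x) \<le> ?K * Lp_norm q lborel (\<lambda>x. F (N (Suc n)) x - F (N n) x)"
      by (rule smooth_data_estimate[OF C q \<rho> F F wg wg g g sol sol])
    also have "\<dots> \<le> ?K * (2 * (1 / 2) ^ n)"
    proof (rule mult_left_mono[OF _ K0])
      have "Lp_norm q lborel (\<lambda>x. F (N (Suc n)) x - F (N n) x) \<le> Lp_norm q lborel (\<lambda>x. F (N (Suc n)) x - f x) + Lp_norm q lborel (\<lambda>x. f x - F (N n) x)"
        by (rule Lp_norm_triangle_diff[OF q0(2) FL f FL])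
      also have "\<dots> \<le> (1 / 2) ^ Suc n + (1 / 2) ^ n" using N[of "Suc n"] N[of n] by (simp add: comm[of "F (N (Suc n))" f])
      also have "\<dots> \<le> 2 * (1 / 2) ^ n" by simp
      finally show "Lp_norm q lborel (\<lambda>x. F (N (Suc n)) x - F (N n) x) \<le> 2 * (1 / 2) ^ n" .
    qed
    finally show ?thesis by (simp only: mult.assoc)
  qed
  obtain G where G: "G \<in> Lp q lborel" and Glim: "(\<lambda>n. Lp_norm q lborel (\<lambda>x. g (N n) x - G x)) \<longlonglongrightarrow> 0"
    using Lp_complete_fast[OF q0(2) g fast] by blast
  have Flim: "(\<lambda>n. Lp_norm q lborel (\<lambda>x. F (N n) x - f x)) \<longlonglongrightarrow> 0"
  proof (rule tendsto_sandwich[of "\<lambda>_. 0" _ _ "\<lambda>n. (1 / 2) ^ n"])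
    show "\<forall>\<^sub>F n in sequentially. Lp_norm q lborel (\<lambda>x. F (N n) x - f x) \<le> (1 / 2) ^ n"
      using N by (simp add: comm[of _ f] less_imp_le)
  qed (auto simp: Lp_norm_nonneg intro!: LIMSEQ_power_zero)
  obtain w where w: "w \<in> hat_H1 q UNIV" "is_weak_grad UNIV w G"
    using hat_H1_closed[OF q u wg g G Glim] by blast
  show ?thesis
  proof (rule that[OF w G])
    have "(\<lambda>n. Lp_norm q lborel (g (N n))) \<longlonglongrightarrow> Lp_norm q lborel G" by (rule Lp_norm_tendsto[OF q0(2) g G Glim])
    moreover have "(\<lambda>n. ?K * Lp_norm q lborel (F (N n))) \<longlonglongrightarrow> ?K * Lp_norm q lborel f"
      by (intro tendsto_intros Lp_norm_tendsto[OF q0(2) FL f Flim])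
    ultimately show "Lp_norm q lborel G \<le> ?K * Lp_norm q lborel f" using bound by (intro LIMSEQ_le) auto
  next
    fix \<phi> :: "real ^ 'n \<Rightarrow> real" and W
    assume \<phi>: "\<phi> \<in> hat_H1 (q / (q - 1)) UNIV" "is_weak_grad UNIV \<phi> W" and W: "W \<in> Lp (q / (q - 1)) lborel"
    have rW: "(\<lambda>x. ?r x *\<^sub>R W x) \<in> Lp (q / (q - 1)) lborel" by (rule phase_weight_Lp[OF W]) (use q in simp)
    \<comment> \<open>The weight is shifted to \<open>W\<close>, so that only plain convergence of
      the gradients and of the data is needed.\<close>
    have split: "(\<integral>x. (?r x *\<^sub>R H x - h x) \<bullet> W x \<partial>lborel) = (\<integral>x. H x \<bullet> (?r x *\<^sub>R W x) \<partial>lborel) - (\<integral>x. h x \<bullet> W x \<partial>lborel)"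
      if "H \<in> Lp q lborel" "h \<in> Lp q lborel" for H h
      using Holder_inner(1)[OF q that(1) rW] Holder_inner(1)[OF q that(2) W] by (simp add: inner_diff_left)
    have 0: "(\<integral>x. g (N n) x \<bullet> (?r x *\<^sub>R W x) \<partial>lborel) - (\<integral>x. F (N n) x \<bullet> W x \<partial>lborel) = 0" for n
      unfolding split[OF g FL, symmetric]
      by (rule weak_solution_extend[OF q Lp_diff[OF phase_weight_Lp[OF g q0(1)] FL q0(1)] sol \<phi> W])
    have "(\<lambda>n. (\<integral>x. g (N n) x \<bullet> (?r x *\<^sub>R W x) \<partial>lborel) - (\<integral>x. F (N n) x \<bullet> W x \<partial>lborel)) \<longlonglongrightarrow>
        (\<integral>x. G x \<bullet> (?r x *\<^sub>R W x) \<partial>lborel) - (\<integral>x. f x \<bullet> W x \<partial>lborel)"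
      by (intro tendsto_diff Lp_inner_tendsto[OF q g G Glim rW] Lp_inner_tendsto[OF q FL f Flim W])
    then show "(\<integral>x. (?r x *\<^sub>R G x - f x) \<bullet> W x \<partial>lborel) = 0"
      unfolding 0 split[OF G f] by (simp add: LIMSEQ_const_iff)
  qed
qed

theorem theorem3p6:
  fixes d :: "'n::finite" and q \<rho>p \<rho>m :: real
  assumes "CARD('n) \<ge> 2" and "1 < q" and "0 < \<rho>p" and "0 < \<rho>m"
  shows
    "(\<forall>C2. transmission_constant q d \<rho>p \<rho>m C2 \<longrightarrow>
       (\<forall>f :: real ^ 'n \<Rightarrow> real ^ 'n. f \<in> Lp q (lborel_on (UNIV - plane d)) \<longrightarrow>
         (\<exists>u \<in> hat_H1 q UNIV.
            (\<forall>\<phi> \<in> hat_H1 (q / (q - 1)) UNIV.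
               (\<integral>x. (inverse (two_phase_density d \<rho>p \<rho>m x) *\<^sub>R weak_grad UNIV u x) \<bullet> weak_grad UNIV \<phi> x
                  \<partial>lborel_on (UNIV - plane d)) =
               (\<integral>x. f x \<bullet> weak_grad UNIV \<phi> x \<partial>lborel_on (UNIV - plane d))) \<and>
            Lq_norm q UNIV (weak_grad UNIV u)
              \<le> 2 * C2 * (\<rho>p + \<rho>m) * Lq_norm q (UNIV - plane d) f))) \<and>
     (\<forall>u \<in> hat_H1 q (UNIV :: (real ^ 'n) set).
        (\<forall>\<phi> \<in> hat_H1 (q / (q - 1)) UNIV.
           (\<integral>x. (inverse (two_phase_density d \<rho>p \<rho>m x) *\<^sub>R weak_grad UNIV u x) \<bullet> weak_grad UNIV \<phi> x
              \<partial>lborel_on (UNIV - plane d)) = 0) \<longrightarrow>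
        (\<exists>c. AE x in lborel. u x = c))"
proof -
  let ?r = "phase_weight d (inverse \<rho>p) (inverse \<rho>m)" and ?S = "UNIV - plane d"
  note q = assms(2) and \<rho> = assms(3,4)
  have q0: "q \<ge> 0" "q / (q - 1) \<ge> 0" using q by auto
  have S: "?S \<in> sets borel"
  proof -
    have "closed (plane d)" unfolding plane_def by (intro closed_Collect_eq continuous_intros)
    then show ?thesis by simp
  qed
  have grad_Lp: "weak_grad UNIV w \<in> Lp p lborel" and grad_wg: "is_weak_grad UNIV w (weak_grad UNIV w)"
    if "w \<in> hat_H1 p UNIV" for w :: "real ^ 'n \<Rightarrow> real" and p
    using hat_H1_weak_grad[OF that] by (simp_all add: Lp_lborel_on_iff)
  \<comment> \<open>On the plane the density is 0 and so is its inverse, so the integral over the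
    complement of the plane equals the one over the whole space.\<close>
  have lhs: "(\<integral>x. (inverse (two_phase_density d \<rho>p \<rho>m x) *\<^sub>R g x) \<bullet> W x \<partial>lborel_on ?S) = (\<integral>x. (?r x *\<^sub>R g x) \<bullet> W x \<partial>lborel)"
    for g W :: "real ^ 'n \<Rightarrow> real ^ 'n"
    unfolding two_phase_density_eq inverse_phase_weight
    by (rule integral_lborel_on_eq[OF S]) (simp add: phase_weight_plane)
  have existence: "\<exists>u \<in> hat_H1 q UNIV.
      (\<forall>\<phi> \<in> hat_H1 (q / (q - 1)) UNIV.
        (\<integral>x. (?r x *\<^sub>R weak_grad UNIV u x) \<bullet> weak_grad UNIV \<phi> x \<partial>lborel) = (\<integral>x. f x \<bullet> weak_grad UNIV \<phi> x \<partial>lborel_on ?S)) \<and>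
      Lq_norm q UNIV (weak_grad UNIV u) \<le> 2 * C2 * (\<rho>p + \<rho>m) * Lq_norm q ?S f"
    if C: "transmission_constant q d \<rho>p \<rho>m C2" and f: "f \<in> Lp q (lborel_on ?S)"
    for C2 and f :: "real ^ 'n \<Rightarrow> real ^ 'n"
  proof -
    \<comment> \<open>The extension by 0 vanishes on the plane, so that test functions supported off
      the plane can approximate it.\<close>
    let ?f = "\<lambda>x. indicator ?S x *\<^sub>R f x"
    have fL: "?f \<in> Lp q lborel" using f S by (simp add: Lp_lborel_on_iff)
    obtain u G where u: "u \<in> hat_H1 q UNIV" "is_weak_grad UNIV u G" and G: "G \<in> Lp q lborel"
      and sol: "\<And>\<phi> W. \<phi> \<in> hat_H1 (q / (q - 1)) UNIV \<Longrightarrow> is_weak_grad UNIV \<phi> W \<Longrightarrow> W \<in> Lp (q / (q - 1)) lborel \<Longrightarrow>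
        (\<integral>x. (?r x *\<^sub>R G x - ?f x) \<bullet> W x \<partial>lborel) = 0"
      and bound: "Lp_norm q lborel G \<le> 2 * C2 * (\<rho>p + \<rho>m) * Lp_norm q lborel ?f"
      by (rule weak_solution_exists[OF C q \<rho> fL]) auto
    let ?g = "weak_grad UNIV u"
    have eq: "AE x in lborel. ?g x = G x" using weak_grad_AE_eq[OF u(2)] by simp
    have [measurable]: "?g \<in> borel_measurable borel" "G \<in> borel_measurable borel"
      using Lp_measurable[OF grad_Lp[OF u(1)]] Lp_measurable[OF G] by simp_all
    show ?thesis
    proof (rule bexI[OF _ u(1)], intro conjI ballI)
      have "Lq_norm q UNIV ?g = Lp_norm q lborel ?g" by (subst Lp_norm_lborel_on) simp_all
      also have "\<dots> = Lp_norm q lborel G" by (rule Lp_norm_cong_AE) (use eq in auto)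
      finally show "Lq_norm q UNIV ?g \<le> 2 * C2 * (\<rho>p + \<rho>m) * Lq_norm q ?S f"
        using bound by (simp only: Lp_norm_lborel_on[OF S])
      fix \<phi> :: "real ^ 'n \<Rightarrow> real" assume \<phi>: "\<phi> \<in> hat_H1 (q / (q - 1)) UNIV"
      let ?W = "weak_grad UNIV \<phi>"
      note W = grad_Lp[OF \<phi>]
      have [measurable]: "?W \<in> borel_measurable borel" using Lp_measurable[OF W] by simp
      have "(\<integral>x. (?r x *\<^sub>R ?g x) \<bullet> ?W x \<partial>lborel) = (\<integral>x. (?r x *\<^sub>R G x) \<bullet> ?W x \<partial>lborel)"
        using eq by (intro integral_cong_AE) (auto elim: eventually_mono)
      also have "\<dots> = (\<integral>x. ?f x \<bullet> ?W x \<partial>lborel)"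
        using sol[OF \<phi> grad_wg[OF \<phi>] W] Holder_inner(1)[OF q phase_weight_Lp[OF G q0(1)] W] Holder_inner(1)[OF q fL W]
        by (simp add: inner_diff_left)
      also have "\<dots> = (\<integral>x. ?f x \<bullet> ?W x \<partial>lborel_on ?S)"
        by (rule integral_lborel_on_eq[OF S, symmetric]) auto
      also have "\<dots> = (\<integral>x. f x \<bullet> ?W x \<partial>lborel_on ?S)"
        by (rule Bochner_Integration.integral_cong[OF refl]) (simp add: space_restrict_space)
      finally show "(\<integral>x. (?r x *\<^sub>R ?g x) \<bullet> ?W x \<partial>lborel) = (\<integral>x. f x \<bullet> ?W x \<partial>lborel_on ?S)" .
    qed
  qed
  have uniqueness: "\<exists>c. AE x in lborel. u x = c"
    if u: "u \<in> hat_H1 q UNIV"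
      and sol: "\<forall>\<phi> \<in> hat_H1 (q / (q - 1)) UNIV. (\<integral>x. (?r x *\<^sub>R weak_grad UNIV u x) \<bullet> weak_grad UNIV \<phi> x \<partial>lborel) = 0"
    for u :: "real ^ 'n \<Rightarrow> real"
  proof (rule weak_grad_0_imp_const[OF u grad_wg[OF u] grad_Lp[OF u] q two_phase_unique[OF q \<rho> grad_wg[OF u] grad_Lp[OF u]]])
    fix \<phi> :: "real ^ 'n \<Rightarrow> real" and W
    assume \<phi>: "\<phi> \<in> hat_H1 (q / (q - 1)) UNIV" and W: "is_weak_grad UNIV \<phi> W" "W \<in> Lp (q / (q - 1)) lborel"
    have [measurable]: "weak_grad UNIV u \<in> borel_measurable borel" "weak_grad UNIV \<phi> \<in> borel_measurable borel" "W \<in> borel_measurable borel"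
      using Lp_measurable[OF grad_Lp[OF u]] Lp_measurable[OF grad_Lp[OF \<phi>]] Lp_measurable[OF W(2)] by simp_all
    have "AE x in lborel. weak_grad UNIV \<phi> x = W x" using weak_grad_AE_eq[OF W(1)] by simp
    then have "(\<integral>x. (?r x *\<^sub>R weak_grad UNIV u x) \<bullet> W x \<partial>lborel) = (\<integral>x. (?r x *\<^sub>R weak_grad UNIV u x) \<bullet> weak_grad UNIV \<phi> x \<partial>lborel)"
      by (intro integral_cong_AE) (auto elim: eventually_mono)
    then show "(\<integral>x. (?r x *\<^sub>R weak_grad UNIV u x) \<bullet> W x \<partial>lborel) = 0" using sol \<phi> by simp
  qed
  show ?thesis unfolding lhs using existence uniqueness by simp
qed

end
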